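(* Let $n\ge 1$, $0<\lambda<n$, $s\ge\frac{\lambda}{2}$, $t_0\in\mathbb{R}$, $T>0$, $\theta\in\mathbb{R}\setminus\{0\}$, and let $u_0\in H^s(\mathbb{R}^n)$. Let $\alpha,\beta:\mathbb{R}\to\mathbb{R}$ be the periodic piecewise constant functions with periods $T_1>0$ and $T_2>0$ respectively, given by $$\alpha(t)=\begin{cases}\alpha^+,&0<t\le t_+,\\-\alpha^-,&t_+-T_1<t\le 0,\end{cases}\qquad \beta(t)=\begin{cases}\beta^+,&0<t\le \tau_+,\\-\beta^-,&\tau_+-T_2<t\le 0,\end{cases}$$ where $\alpha^+,\alpha^-,\beta^+,\beta^->0$ are constants, $t_+\in(0,T_1)$, $\tau_+\in(0,T_2)$, and $\alpha(t+T_1)=\alpha(t)$, $\beta(t+T_2)=\beta(t)$ for all $t\in\mathbb{R}$. Then there exist $T_0=T_0(\|u_0\|_{H^s})$ with $0<T_0\le T$ and a unique solution $u$ of the Cauchy problem $$i\partial_tu+\alpha(t)\Delta u+\beta(t)\Delta^2u+\theta(|x|^{-\lambda}*|u|^2)u=0,\qquad u(x,t_0)=u_0(x),$$ in the class $C([-T_0+t_0,T_0+t_0];H^s(\mathbb{R}^n))$ verifying $$\|u\|_{L^{\infty}([-T_0+t_0,T_0+t_0];H^s(\mathbb{R}^n))}\le C\|u_0\|_{H^s(\mathbb{R}^n)},$$ where $C>0$ is a constant not depending on $u_0$.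
   Context: Solutions are understood in the Duhamel (mild) sense: $$u(t)=U(t,t_0)u_0+i\theta\int_{t_0}^tU(t,\tau)\{(|x|^{-\lambda}*|u(\tau)|^{2})u(\tau)\}\,d\tau,$$ where $U(t,r)f=\left[e^{-i|\xi|^2A(t,r)+i|\xi|^4B(t,r)}\widehat f(\xi)\right]^{\vee}$ with $A(t,r)=\int_r^t\alpha(\tau)\,d\tau$ and $B(t,r)=\int_r^t\beta(\tau)\,d\tau$. The unknown $u$ is complex-valued and $*$ is convolution in $x\in\mathbb{R}^n$. $H^s(\mathbb{R}^n)$ is the $L^2$-based inhomogeneous Sobolev space with norm $\|\langle\xi\rangle^s\widehat f\|_{L^2}$. The notation $T_0=T_0(\|u_0\|_{H^s})$ means that, with the other data ($n,\lambda,s,\theta,t_0,T,\alpha,\beta$) fixed, $T_0$ depends on $u_0$ only through $\|u_0\|_{H^s}$. *)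

theory Defs
  imports "HOL-Analysis.Analysis" "HOL-Probability.Essential_Supremum"
begin

definition square_integrable :: "('a::euclidean_space \<Rightarrow> complex) \<Rightarrow> bool" where
  "square_integrable f \<longleftrightarrow>
     f \<in> borel_measurable lborel \<and> integrable lborel (\<lambda>x. (norm (f x))\<^sup>2)"

definition L2_eq :: "('a::euclidean_space \<Rightarrow> complex) \<Rightarrow> ('a \<Rightarrow> complex) \<Rightarrow> bool" where
  "L2_eq f g \<longleftrightarrow> square_integrable f \<and> square_integrable g \<and> (AE x in lborel. f x = g x)"

lemma square_integrable_0: "square_integrable (\<lambda>x. 0)"
  by (simp add: square_integrable_def)

lemma square_integrable_add:
  assumes "square_integrable f" "square_integrable g"
  shows "square_integrable (\<lambda>x. f x + g x)"
proof -
  have [measurable]: "f \<in> borel_measurable lborel" "g \<in> borel_measurable lborel"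
    using assms by (auto simp: square_integrable_def)
  have "integrable lborel (\<lambda>x. 2 * (norm (f x))\<^sup>2 + 2 * (norm (g x))\<^sup>2)"
    using assms by (auto simp: square_integrable_def)
  then have "integrable lborel (\<lambda>x. (norm (f x + g x))\<^sup>2)"
  proof (rule Bochner_Integration.integrable_bound)
    show "AE x in lborel. norm ((norm (f x + g x))\<^sup>2)
            \<le> norm (2 * (norm (f x))\<^sup>2 + 2 * (norm (g x))\<^sup>2)"
    proof (rule AE_I2)
      fix x
      have "(norm (f x + g x))\<^sup>2 \<le> (norm (f x) + norm (g x))\<^sup>2"
        by (intro power_mono norm_triangle_ineq norm_ge_zero)
      also have "\<dots> \<le> 2 * (norm (f x))\<^sup>2 + 2 * (norm (g x))\<^sup>2"
        using sum_squares_bound[of "norm (f x)" "norm (g x)"] by (simp add: power2_sum)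
      finally show "norm ((norm (f x + g x))\<^sup>2)
            \<le> norm (2 * (norm (f x))\<^sup>2 + 2 * (norm (g x))\<^sup>2)" by simp
    qed
  qed measurable
  then show ?thesis by (simp add: square_integrable_def)
qed

lemma square_integrable_cmult:
  "square_integrable f \<Longrightarrow> square_integrable (\<lambda>x. c * f x)"
  by (auto simp: square_integrable_def norm_mult power_mult_distrib)

lemma square_integrable_scaleR:
  "square_integrable f \<Longrightarrow> square_integrable (\<lambda>x. c *\<^sub>R f x)"
  using square_integrable_cmult[of f "of_real c"] by (simp add: scaleR_conv_of_real)

lemma square_integrable_uminus:
  "square_integrable f \<Longrightarrow> square_integrable (\<lambda>x. - f x)"
  by (auto simp: square_integrable_def)

lemma square_integrable_diff:
  "square_integrable f \<Longrightarrow> square_integrable g \<Longrightarrow> square_integrable (\<lambda>x. f x - g x)"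
  using square_integrable_add[of f "\<lambda>x. - g x"] square_integrable_uminus[of g] by simp

lemma integrable_inner_L2:
  assumes "square_integrable f" "square_integrable g"
  shows "integrable lborel (\<lambda>x. f x \<bullet> g x)"
proof -
  have [measurable]: "f \<in> borel_measurable lborel" "g \<in> borel_measurable lborel"
    using assms by (auto simp: square_integrable_def)
  have "integrable lborel (\<lambda>x. (norm (f x))\<^sup>2 + (norm (g x))\<^sup>2)"
    using assms by (auto simp: square_integrable_def)
  then show ?thesis
  proof (rule Bochner_Integration.integrable_bound)
    show "AE x in lborel. norm (f x \<bullet> g x) \<le> norm ((norm (f x))\<^sup>2 + (norm (g x))\<^sup>2)"
    proof (rule AE_I2)
      fix x
      have "\<bar>f x \<bullet> g x\<bar> \<le> norm (f x) * norm (g x)" by (rule Cauchy_Schwarz_ineq2)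
      also have "\<dots> \<le> 2 * norm (f x) * norm (g x)" by simp
      also have "\<dots> \<le> (norm (f x))\<^sup>2 + (norm (g x))\<^sup>2" by (rule sum_squares_bound)
      finally show "norm (f x \<bullet> g x) \<le> norm ((norm (f x))\<^sup>2 + (norm (g x))\<^sup>2)" by simp
    qed
  qed measurable
qed

quotient_type (overloaded) 'a L2 = "'a::euclidean_space \<Rightarrow> complex" / partial: L2_eq
proof (rule part_equivpI)
  show "\<exists>f::'a \<Rightarrow> complex. L2_eq f f"
    using square_integrable_0 by (auto simp: L2_eq_def)
  show "symp (L2_eq :: ('a \<Rightarrow> complex) \<Rightarrow> _)"
    by (rule sympI) (auto simp: L2_eq_def)
  show "transp (L2_eq :: ('a \<Rightarrow> complex) \<Rightarrow> _)"
    by (rule transpI) (auto simp: L2_eq_def)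
qed

instantiation L2 :: (euclidean_space) real_vector
begin

lift_definition zero_L2 :: "'a L2" is "\<lambda>x. 0"
  by (simp add: L2_eq_def square_integrable_0)

lift_definition plus_L2 :: "'a L2 \<Rightarrow> 'a L2 \<Rightarrow> 'a L2" is "\<lambda>f g x. f x + g x"
  by (auto simp: L2_eq_def intro: square_integrable_add)

lift_definition minus_L2 :: "'a L2 \<Rightarrow> 'a L2 \<Rightarrow> 'a L2" is "\<lambda>f g x. f x - g x"
  by (auto simp: L2_eq_def intro: square_integrable_diff)

lift_definition uminus_L2 :: "'a L2 \<Rightarrow> 'a L2" is "\<lambda>f x. - f x"
  by (auto simp: L2_eq_def intro: square_integrable_uminus)

lift_definition scaleR_L2 :: "real \<Rightarrow> 'a L2 \<Rightarrow> 'a L2" is "\<lambda>c f x. c *\<^sub>R f x"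
  by (auto simp: L2_eq_def intro: square_integrable_scaleR)

instance
proof
  fix f g h :: "'a L2" and a b :: real
  show "(f + g) + h = f + (g + h)" "f + g = g + f" "0 + f = f" "- f + f = 0" "f - g = f + - g"
       "a *\<^sub>R (f + g) = a *\<^sub>R f + a *\<^sub>R g" "(a + b) *\<^sub>R f = a *\<^sub>R f + b *\<^sub>R f"
       "a *\<^sub>R b *\<^sub>R f = (a * b) *\<^sub>R f" "1 *\<^sub>R f = f"
    by (transfer; auto simp: L2_eq_def algebra_simps square_integrable_0
          intro!: square_integrable_add square_integrable_diff square_integrable_scaleR
            square_integrable_uminus)+
qed

end

instantiation L2 :: (euclidean_space) real_inner
begin

lift_definition inner_L2 :: "'a L2 \<Rightarrow> 'a L2 \<Rightarrow> real" is "\<lambda>f g. \<integral>x. f x \<bullet> g x \<partial>lborel"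
  by (rule integral_cong_AE)
     (auto simp: L2_eq_def square_integrable_def intro!: borel_measurable_inner)

lift_definition norm_L2 :: "'a L2 \<Rightarrow> real" is "\<lambda>f. sqrt (\<integral>x. (norm (f x))\<^sup>2 \<partial>lborel)"
  by (rule arg_cong[where f = sqrt], rule integral_cong_AE)
     (auto simp: L2_eq_def square_integrable_def)

definition dist_L2 :: "'a L2 \<Rightarrow> 'a L2 \<Rightarrow> real" where
  "dist_L2 f g = norm (f - g)"

definition sgn_L2 :: "'a L2 \<Rightarrow> 'a L2" where
  "sgn_L2 f = inverse (norm f) *\<^sub>R f"

definition uniformity_L2 :: "('a L2 \<times> 'a L2) filter" where
  "uniformity_L2 = (INF e\<in>{0<..}. principal {(f, g). dist f g < e})"

definition open_L2 :: "'a L2 set \<Rightarrow> bool" where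
  "open_L2 U \<longleftrightarrow> (\<forall>f\<in>U. \<forall>\<^sub>F (f', g) in uniformity. f' = f \<longrightarrow> g \<in> U)"

instance
proof
  fix f g h :: "'a L2" and a :: real
  show "dist f g = norm (f - g)" by (fact dist_L2_def)
  show "sgn f = f /\<^sub>R norm f" by (fact sgn_L2_def)
  show "uniformity = (INF e\<in>{0<..}. principal {(f::'a L2, g). dist f g < e})"
    by (fact uniformity_L2_def)
  show "open U \<longleftrightarrow> (\<forall>f\<in>U. \<forall>\<^sub>F (f', g) in uniformity. f' = f \<longrightarrow> g \<in> U)" for U :: "'a L2 set"
    by (fact open_L2_def)
  show "f \<bullet> g = g \<bullet> f" by transfer (simp add: inner_commute)
  show "(f + g) \<bullet> h = f \<bullet> h + g \<bullet> h"
    by transfer (simp add: L2_eq_def inner_add_left integrable_inner_L2)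
  show "(a *\<^sub>R f) \<bullet> g = a * (f \<bullet> g)" by transfer simp
  show "0 \<le> f \<bullet> f" by transfer (auto intro!: Bochner_Integration.integral_nonneg)
  show "f \<bullet> f = 0 \<longleftrightarrow> f = 0"
  proof (transfer fixing: a)
    fix f :: "'a \<Rightarrow> complex"
    assume "L2_eq f f"
    then have f: "square_integrable f" by (simp add: L2_eq_def)
    then have "(\<integral>x. f x \<bullet> f x \<partial>lborel) = 0 \<longleftrightarrow> (AE x in lborel. f x \<bullet> f x = 0)"
      by (intro integral_nonneg_eq_0_iff_AE integrable_inner_L2) auto
    then show "(\<integral>x. f x \<bullet> f x \<partial>lborel) = 0 \<longleftrightarrow> L2_eq f (\<lambda>x. 0)"
      using f by (simp add: L2_eq_def square_integrable_0)
  qed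
  show "norm f = sqrt (f \<bullet> f)" by transfer (simp add: dot_square_norm)
qed

end

lift_definition scaleC_L2 :: "complex \<Rightarrow> 'a::euclidean_space L2 \<Rightarrow> 'a L2" (infixr "*\<^sub>C" 75)
  is "\<lambda>c f x. c * f x"
  by (auto simp: L2_eq_def intro: square_integrable_cmult)

text \<open>The class of a square-integrable function. Arguments that are not square-integrable are
  sent to \<open>0\<close>.\<close>

definition L2_class :: "('a::euclidean_space \<Rightarrow> complex) \<Rightarrow> 'a L2" where
  "L2_class f = (if square_integrable f then abs_L2 f else 0)"

text \<open>Unitary normalisation with phase \<open>exp (- i x \<bullet> \<xi>)\<close>, so that \<open>\<Delta>\<close> has symbol \<open>-|\<xi>|\<^sup>2\<close> and the
  transform is an isometry of \<open>L\<^sup>2\<close>.\<close>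

definition fourier_integral :: "('a::euclidean_space \<Rightarrow> complex) \<Rightarrow> 'a \<Rightarrow> complex" where
  "fourier_integral f \<xi> =
     of_real ((2 * pi) powr (- real DIM('a) / 2)) * (\<integral>x. cis (- (x \<bullet> \<xi>)) * f x \<partial>lborel)"

definition inv_fourier_integral :: "('a::euclidean_space \<Rightarrow> complex) \<Rightarrow> 'a \<Rightarrow> complex" where
  "inv_fourier_integral g x =
     of_real ((2 * pi) powr (- real DIM('a) / 2)) * (\<integral>\<xi>. cis (x \<bullet> \<xi>) * g \<xi> \<partial>lborel)"

definition cutoff :: "real \<Rightarrow> 'a::euclidean_space L2 \<Rightarrow> 'a \<Rightarrow> complex" where
  "cutoff R f x = (if norm x \<le> R then rep_L2 f x else 0)"

text \<open>On \<open>L\<^sup>2\<close> the transforms are the limits in \<open>L\<^sup>2\<close>, as \<open>R \<rightarrow> \<infinity>\<close>, of the integrals over the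
  balls of radius \<open>R\<close> (Plancherel).\<close>

definition fourier :: "'a::euclidean_space L2 \<Rightarrow> 'a L2" where
  "fourier f = Lim at_top (\<lambda>R. L2_class (fourier_integral (cutoff R f)))"

definition inv_fourier :: "'a::euclidean_space L2 \<Rightarrow> 'a L2" where
  "inv_fourier g = Lim at_top (\<lambda>R. L2_class (inv_fourier_integral (cutoff R g)))"

definition bessel_weight :: "real \<Rightarrow> 'a::euclidean_space L2 \<Rightarrow> 'a \<Rightarrow> complex" where
  "bessel_weight s f \<xi> = of_real (sqrt (1 + (norm \<xi>)\<^sup>2) powr s) * rep_L2 (fourier f) \<xi>"

text \<open>Only \<open>s \<ge> 0\<close> is meant, where \<open>H\<^sup>s\<close> is a subspace of \<open>L\<^sup>2\<close>.\<close>

definition sobolev_space :: "real \<Rightarrow> 'a::euclidean_space L2 set" where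
  "sobolev_space s = {f. square_integrable (bessel_weight s f)}"

definition sobolev_norm :: "real \<Rightarrow> 'a::euclidean_space L2 \<Rightarrow> real" where
  "sobolev_norm s f = norm (L2_class (bessel_weight s f))"

definition C_sobolev :: "real set \<Rightarrow> real \<Rightarrow> (real \<Rightarrow> 'a::euclidean_space L2) set" where
  "C_sobolev I s = {u. \<forall>t\<in>I. u t \<in> sobolev_space s \<and>
     ((\<lambda>r. sobolev_norm s (u r - u t)) \<longlongrightarrow> 0) (at t within I)}"

definition Linf_sobolev_norm :: "real set \<Rightarrow> real \<Rightarrow> (real \<Rightarrow> 'a::euclidean_space L2) \<Rightarrow> ereal" where
  "Linf_sobolev_norm I s u = esssup (lebesgue_on I) (\<lambda>t. ereal (sobolev_norm s (u t)))"

definition multiplier :: "('a::euclidean_space \<Rightarrow> complex) \<Rightarrow> 'a L2 \<Rightarrow> 'a L2" where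
  "multiplier m f = inv_fourier (L2_class (\<lambda>\<xi>. m \<xi> * rep_L2 (fourier f) \<xi>))"

definition propagator ::
  "(real \<Rightarrow> real) \<Rightarrow> (real \<Rightarrow> real) \<Rightarrow> real \<Rightarrow> real \<Rightarrow> 'a::euclidean_space L2 \<Rightarrow> 'a L2" where
  "propagator \<alpha> \<beta> t r =
     (let A = (LBINT \<tau>=r..t. \<alpha> \<tau>); B = (LBINT \<tau>=r..t. \<beta> \<tau>)
      in multiplier (\<lambda>\<xi>. exp (- \<i> * of_real ((norm \<xi>)\<^sup>2 * A) + \<i> * of_real ((norm \<xi>) ^ 4 * B))))"

definition convolution :: "('a::euclidean_space \<Rightarrow> real) \<Rightarrow> ('a \<Rightarrow> real) \<Rightarrow> 'a \<Rightarrow> real" where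
  "convolution f g x = (\<integral>y. f (x - y) * g y \<partial>lborel)"

text \<open>For \<open>u \<in> H\<^sup>s\<close> with \<open>s \<ge> lam / 2\<close> and \<open>0 < lam < n\<close> the convolution integral converges for every
  \<open>x\<close> and is bounded in \<open>x\<close> (Hardy), so neither the integral nor \<open>L2_class\<close> takes a junk value. The
  value of the kernel at \<open>0\<close> is \<open>0\<close>, which affects a null set only.\<close>

definition hartree :: "real \<Rightarrow> 'a::euclidean_space L2 \<Rightarrow> 'a L2" where
  "hartree lam u = L2_class (\<lambda>x.
     of_real (convolution (\<lambda>z. norm z powr (- lam)) (\<lambda>y. (norm (rep_L2 u y))\<^sup>2) x) * rep_L2 u x)"

text \<open>Integral from \<open>a\<close> to \<open>b\<close> with its orientation, for functions with values in \<open>L\<^sup>2\<close>. It is applied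
  to \<open>L\<^sup>2\<close>-valued integrands that are continuous in time, where the gauge integral of the library is
  the Riemann (and Bochner) integral.\<close>

definition has_oriented_integral ::
  "(real \<Rightarrow> 'b::real_normed_vector) \<Rightarrow> 'b \<Rightarrow> real \<Rightarrow> real \<Rightarrow> bool" where
  "has_oriented_integral f J a b \<longleftrightarrow>
     (if a \<le> b then (f has_integral J) {a..b} else (f has_integral - J) {b..a})"

definition mild_solution ::
  "(real \<Rightarrow> real) \<Rightarrow> (real \<Rightarrow> real) \<Rightarrow> real \<Rightarrow> real \<Rightarrow> real \<Rightarrow> 'a::euclidean_space L2 \<Rightarrow>
   real set \<Rightarrow> (real \<Rightarrow> 'a L2) \<Rightarrow> bool" where
  "mild_solution \<alpha> \<beta> lam \<theta> t0 u0 I u \<longleftrightarrow>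
     (\<forall>t\<in>I. \<exists>J. has_oriented_integral (\<lambda>\<tau>. propagator \<alpha> \<beta> t \<tau> (hartree lam (u \<tau>))) J t0 t \<and>
            u t = propagator \<alpha> \<beta> t t0 u0 + (\<i> * of_real \<theta>) *\<^sub>C J)"

end

theory Submission
  imports Defs "HOL-Probability.Characteristic_Functions"
begin

text \<open>On the Fourier side the propagator is multiplication by a unimodular symbol, hence an isometry of
  \<open>H\<^sup>s\<close>, strongly continuous in time; of \<open>\<alpha>\<close> and \<open>\<beta>\<close> only boundedness and measurability matter.
  Everything therefore reduces to the local Lipschitz bound
  \<open>\<parallel>N u - N v\<parallel> \<le> L (\<parallel>u\<parallel>\<^sup>2 + \<parallel>v\<parallel>\<^sup>2) \<parallel>u - v\<parallel>\<close> in \<open>H\<^sup>s\<close> for the Hartree term \<open>N\<close>. Writing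
  \<open>|x|\<^sup>-\<^sup>\<lambda>\<close> as a superposition of Gaussians, \<open>N u\<close> becomes a trilinear convolution of \<open>fourier u\<close> with
  kernel \<open>|c|\<^sup>\<lambda>\<^sup>-\<^sup>n\<close>. The weight \<open>\<langle>\<xi>\<rangle>\<^sup>s\<close> is distributed over the three factors. If it falls on the
  factor outside the potential, the potential is bounded by Hardy's inequality
  \<open>sup \<integral>|x - y|\<^sup>-\<^sup>\<lambda> |u y|\<^sup>2 dy \<le> C \<parallel>u\<parallel>\<^sup>2\<close> with the norm of \<open>H\<^sup>\<lambda>\<^sup>/\<^sup>2\<close>; otherwise duality and the product estimate
  \<open>L\<^sup>2 \<cdot> H\<^sup>\<lambda>\<^sup>/\<^sup>2 \<rightarrow> H\<^sup>-\<^sup>(\<^sup>n\<^sup>-\<^sup>\<lambda>\<^sup>)\<^sup>/\<^sup>2\<close> apply. Picard iteration in the interaction picture then gives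
  a solution on a time interval of length comparable to \<open>1 / \<parallel>u\<^sub>0\<parallel>\<^sup>2\<close> that stays in the ball of radius
  \<open>2 \<parallel>u\<^sub>0\<parallel>\<close>, and Gronwall's inequality gives uniqueness in the whole class \<open>C(I; H\<^sup>s)\<close>.\<close>

text \<open>The Riesz kernel is neither integrable nor square integrable, so its transform lies
  outside the L^2 theory. A Gaussian has an explicit transform, and with it every exchange of
  integrals converges absolutely; the price is one integrability condition on the weighted
  autocorrelation of \<open>fourier u\<close>, which Hardy's inequality supplies. Two kinds of
  estimate are forced by the weight: a factor carrying it is controlled in L^2 only, so a potential
  that contains this factor need not be bounded. The multilinear bounds concern absolute values and
  are proved for \<open>ennreal\<close>-valued functions, where Tonelli and Cauchy--Schwarz ask for
  measurability alone; complex values return only when differences are split into telescoping sums.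
  Since \<open>fourier\<close> is a limit of truncated integrals, its isometry and inversion have to
  be earned: Gaussian damping yields contractivity, and indicators of boxes detect the inverse. The
  evolution is solved in L^2: the isometry \<open>sobolev_lift\<close> identifies L^2 with H^s, so
  that the fixed point and Gronwall arguments concern continuous L^2-valued curves.\<close>

lemma square_integrable_measurable: "square_integrable f \<Longrightarrow> f \<in> borel_measurable borel"
  by (simp add: square_integrable_def)

lemma square_integrable_iff_nn:
  "square_integrable f \<longleftrightarrow> f \<in> borel_measurable borel \<and> (\<integral>\<^sup>+x. ennreal ((norm (f x))\<^sup>2) \<partial>lborel) < \<infinity>"
  by (auto simp: square_integrable_def integrable_iff_bounded)

lemma square_integrable_rep [simp]: "square_integrable (rep_L2 f)"
  using Quotient3_rep_reflp[OF Quotient3_L2, of f] by (simp add: L2_eq_def)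

lemma measurable_rep_L2 [measurable]: "rep_L2 f \<in> borel_measurable borel"
  using square_integrable_measurable[OF square_integrable_rep] .

lemma abs_rep_L2: "abs_L2 (rep_L2 f) = f"
  by (rule Quotient3_abs_rep[OF Quotient3_L2])

lemma L2_class_rep [simp]: "L2_class (rep_L2 f) = f"
  by (simp add: L2_class_def abs_rep_L2)

lemma L2_class_eq_iff:
  assumes "square_integrable f" "square_integrable g"
  shows "L2_class f = L2_class g \<longleftrightarrow> (AE x in lborel. f x = g x)"
  using assms Quotient3_rel[OF Quotient3_L2, of f g] by (simp add: L2_class_def L2_eq_def)

text \<open>Both functions have the same integral of the squared modulus, so either both have a
  genuine class or both fall to the default class 0. Hence measurability is the only side
  condition.\<close>

lemma L2_class_cong_AE:
  assumes [measurable]: "f \<in> borel_measurable borel" "g \<in> borel_measurable borel"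
    and ae: "AE x in lborel. f x = g x"
  shows "L2_class f = L2_class g"
proof -
  have "(\<integral>\<^sup>+x. ennreal ((norm (f x))\<^sup>2) \<partial>lborel) = (\<integral>\<^sup>+x. ennreal ((norm (g x))\<^sup>2) \<partial>lborel)"
    by (rule nn_integral_cong_AE) (use ae in auto)
  then have "square_integrable f \<longleftrightarrow> square_integrable g"
    by (simp add: square_integrable_iff_nn)
  then show ?thesis
    using L2_class_eq_iff[of f g] ae by (cases "square_integrable f") (auto simp: L2_class_def)
qed

lemma rep_L2_class: "square_integrable f \<Longrightarrow> AE x in lborel. rep_L2 (L2_class f) x = f x"
  using L2_class_eq_iff[of "rep_L2 (L2_class f)" f] by simp

lemma L2_eqI: "AE x in lborel. rep_L2 f x = rep_L2 g x \<Longrightarrow> f = g"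
  using L2_class_eq_iff[of "rep_L2 f" "rep_L2 g"] by simp

lemma L2_class_add:
  "square_integrable f \<Longrightarrow> square_integrable g \<Longrightarrow> L2_class f + L2_class g = L2_class (\<lambda>x. f x + g x)"
  by (simp add: L2_class_def plus_L2.abs_eq L2_eq_def square_integrable_add)

lemma L2_class_diff:
  "square_integrable f \<Longrightarrow> square_integrable g \<Longrightarrow> L2_class f - L2_class g = L2_class (\<lambda>x. f x - g x)"
  by (simp add: L2_class_def minus_L2.abs_eq L2_eq_def square_integrable_diff)

lemma L2_class_scaleR:
  "square_integrable f \<Longrightarrow> c *\<^sub>R L2_class f = L2_class (\<lambda>x. c *\<^sub>R f x)"
  by (simp add: L2_class_def scaleR_L2.abs_eq L2_eq_def square_integrable_scaleR)

lemma L2_class_scaleC: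
  "square_integrable f \<Longrightarrow> c *\<^sub>C L2_class f = L2_class (\<lambda>x. c * f x)"
  by (simp add: L2_class_def scaleC_L2.abs_eq L2_eq_def square_integrable_cmult)

lemma L2_class_zero [simp]: "L2_class (\<lambda>x. 0) = 0"
  by (simp add: L2_class_def zero_L2_def)

lemma rep_L2_add: "AE x in lborel. rep_L2 (f + g) x = rep_L2 f x + rep_L2 g x"
  using rep_L2_class[of "\<lambda>x. rep_L2 f x + rep_L2 g x"] L2_class_add[of "rep_L2 f" "rep_L2 g"]
  by (simp add: square_integrable_add)

lemma rep_L2_diff: "AE x in lborel. rep_L2 (f - g) x = rep_L2 f x - rep_L2 g x"
  using rep_L2_class[of "\<lambda>x. rep_L2 f x - rep_L2 g x"] L2_class_diff[of "rep_L2 f" "rep_L2 g"]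
  by (simp add: square_integrable_diff)

lemma rep_L2_scaleR: "AE x in lborel. rep_L2 (c *\<^sub>R f) x = c *\<^sub>R rep_L2 f x"
  using rep_L2_class[of "\<lambda>x. c *\<^sub>R rep_L2 f x"] L2_class_scaleR[of "rep_L2 f" c]
  by (simp add: square_integrable_scaleR)

lemma rep_L2_scaleC: "AE x in lborel. rep_L2 (c *\<^sub>C f) x = c * rep_L2 f x"
  using rep_L2_class[of "\<lambda>x. c * rep_L2 f x"] L2_class_scaleC[of "rep_L2 f" c]
  by (simp add: square_integrable_cmult)

lemma rep_L2_zero: "AE x in lborel. rep_L2 (0::'a::euclidean_space L2) x = 0"
  using rep_L2_class[of "\<lambda>x::'a. 0"] by (simp add: square_integrable_0)

lemma norm_L2_class:
  assumes "square_integrable f"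
  shows "norm (L2_class f) = sqrt (\<integral>x. (norm (f x))\<^sup>2 \<partial>lborel)"
  using assms by (simp add: L2_class_def norm_L2.abs_eq L2_eq_def)

lemma nn_norm_L2_class:
  assumes "square_integrable f"
  shows "(\<integral>\<^sup>+x. ennreal ((norm (f x))\<^sup>2) \<partial>lborel) = ennreal ((norm (L2_class f))\<^sup>2)"
  using assms
  by (subst nn_integral_eq_integral) (auto simp: norm_L2_class square_integrable_def)

lemma nn_norm_L2: "(\<integral>\<^sup>+x. ennreal ((norm (rep_L2 f x))\<^sup>2) \<partial>lborel) = ennreal ((norm f)\<^sup>2)"
  using nn_norm_L2_class[of "rep_L2 f"] by simp

lemma inner_L2_class:
  assumes "square_integrable f" "square_integrable g"
  shows "L2_class f \<bullet> L2_class g = (\<integral>x. f x \<bullet> g x \<partial>lborel)"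
  using assms by (simp add: L2_class_def inner_L2.abs_eq L2_eq_def)

text \<open>Entry point for estimates made with nonnegative integrals: a single bound yields
  membership in L^2 and the norm bound together, so \<open>L2_class\<close> is known not to take its
  default value.\<close>

lemma norm_L2_class_le:
  assumes "f \<in> borel_measurable borel" "(\<integral>\<^sup>+x. ennreal ((norm (f x))\<^sup>2) \<partial>lborel) \<le> ennreal (c\<^sup>2)" "0 \<le> c"
  shows "square_integrable f" "norm (L2_class f) \<le> c"
proof -
  show sq: "square_integrable f"
    using assms by (auto simp: square_integrable_iff_nn intro: le_less_trans)
  have "(norm (L2_class f))\<^sup>2 \<le> c\<^sup>2"
    using assms(2) nn_norm_L2_class[OF sq] by simp
  then show "norm (L2_class f) \<le> c" using assms(3) power2_le_imp_le by blast
qed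

lemma square_integrable_bound:
  assumes "square_integrable f" "g \<in> borel_measurable borel" "AE x in lborel. norm (g x) \<le> B * norm (f x)"
  shows "square_integrable g"
proof -
  have "integrable lborel (\<lambda>x. (norm (of_real B * f x))\<^sup>2)"
    using assms(1) square_integrable_cmult[of f "of_real B"] by (simp add: square_integrable_def)
  moreover have "AE x in lborel. norm ((norm (g x))\<^sup>2) \<le> norm ((norm (of_real B * f x))\<^sup>2)"
    using assms(3)
  proof eventually_elim
    case (elim x)
    then have "norm (g x) \<le> \<bar>B\<bar> * norm (f x)"
      by (meson abs_ge_self mult_right_mono norm_ge_zero order_trans)
    then show ?case by (auto simp: norm_mult intro!: power_mono)
  qed
  ultimately have "integrable lborel (\<lambda>x. (norm (g x))\<^sup>2)"
    using assms(2) by (rule_tac Bochner_Integration.integrable_bound) auto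
  then show ?thesis using assms(2) by (simp add: square_integrable_def)
qed

lemma norm_L2_class_mono:
  assumes "square_integrable f" "square_integrable g" "AE x in lborel. norm (f x) \<le> norm (g x)"
  shows "norm (L2_class f) \<le> norm (L2_class g)"
  unfolding norm_L2_class[OF assms(1)] norm_L2_class[OF assms(2)]
  using assms by (intro real_sqrt_le_mono integral_mono_AE) (auto simp: square_integrable_def power_mono)

lemma integrable_mult_L2:
  assumes "square_integrable f" "square_integrable g"
  shows "integrable lborel (\<lambda>x. f x * g x)"
proof -
  have [measurable]: "f \<in> borel_measurable lborel" "g \<in> borel_measurable lborel"
    using assms by (auto simp: square_integrable_def)
  have "integrable lborel (\<lambda>x. (norm (f x))\<^sup>2 + (norm (g x))\<^sup>2)"
    using assms by (auto simp: square_integrable_def)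
  then show ?thesis
  proof (rule Bochner_Integration.integrable_bound)
    show "AE x in lborel. norm (f x * g x) \<le> norm ((norm (f x))\<^sup>2 + (norm (g x))\<^sup>2)"
    proof (rule AE_I2)
      fix x
      have "norm (f x * g x) \<le> 2 * norm (f x) * norm (g x)" by (simp add: norm_mult)
      also have "\<dots> \<le> (norm (f x))\<^sup>2 + (norm (g x))\<^sup>2" by (rule sum_squares_bound)
      finally show "norm (f x * g x) \<le> norm ((norm (f x))\<^sup>2 + (norm (g x))\<^sup>2)" by simp
    qed
  qed measurable
qed

text \<open>Riesz--Fischer: along a subsequence with \<open>norm (X (r (k+1)) - X (r k)) \<le> 4\<^sup>-\<^sup>k\<close> the series
  \<open>\<Sum>k. 4\<^sup>k |X (r (k+1)) - X (r k)|\<^sup>2\<close> is integrable, which forces convergence almost everywhere.\<close>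

instance L2 :: (euclidean_space) banach
proof
  fix X :: "nat \<Rightarrow> 'a L2" assume "Cauchy X"
  then have C: "\<exists>M. \<forall>m\<ge>M. \<forall>n\<ge>M. norm (X m - X n) < e" if "e > 0" for e
    using that by (simp add: Cauchy_def dist_norm)
  have "\<exists>r. strict_mono r \<and> (\<forall>k. \<forall>n\<ge>r k. norm (X n - X (r k)) < (1/4)^k)"
  proof -
    have ex: "\<exists>M. \<forall>n\<ge>M. norm (X n - X M) < (1/4)^k" for k :: nat
      using C[of "(1/4)^k"] by auto
    define N where "N k = (SOME M. \<forall>m\<ge>M. \<forall>n\<ge>M. norm (X m - X n) < (1/4)^k)" for k :: nat
    have N: "\<forall>m\<ge>N k. \<forall>n\<ge>N k. norm (X m - X n) < (1/4)^k" for k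
      unfolding N_def by (rule someI_ex) (use C[of "(1/4)^k"] in auto)
    \<comment> \<open>The maximum serves two demands: \<open>Suc m\<close> makes the subsequence
      strictly increasing, and \<open>N (Suc k)\<close> keeps it beyond the Cauchy
      threshold.\<close>
    define r where "r = rec_nat (N 0) (\<lambda>k m. max (Suc m) (N (Suc k)))"
    have "strict_mono r"
      by (rule strict_monoI_Suc) (simp add: r_def max_def)
    moreover have "r k \<ge> N k" for k by (cases k) (auto simp: r_def)
    ultimately show ?thesis using N by (meson order_trans le_refl)
  qed
  then obtain r where r: "strict_mono r" and rk: "\<And>k n. n \<ge> r k \<Longrightarrow> norm (X n - X (r k)) < (1/4)^k"
    by blast
  define d where "d k x = rep_L2 (X (r (Suc k))) x - rep_L2 (X (r k)) x" for k x
  have [measurable]: "d k \<in> borel_measurable borel" for k unfolding d_def by measurable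
  have dk: "(\<integral>\<^sup>+x. ennreal ((norm (d k x))\<^sup>2) \<partial>lborel) \<le> ennreal ((1/16)^k)" for k
  proof -
    have "(\<integral>\<^sup>+x. ennreal ((norm (d k x))\<^sup>2) \<partial>lborel) = ennreal ((norm (X (r (Suc k)) - X (r k)))\<^sup>2)"
      unfolding d_def using L2_class_diff[of "rep_L2 (X (r (Suc k)))" "rep_L2 (X (r k))"]
      by (subst nn_norm_L2_class) (auto intro: square_integrable_diff)
    also have "norm (X (r (Suc k)) - X (r k)) \<le> (1/4)^k"
      using rk[of k "r (Suc k)"] r by (simp add: less_imp_le strict_mono_less_eq)
    then have "(norm (X (r (Suc k)) - X (r k)))\<^sup>2 \<le> ((1/4)^k)\<^sup>2" by (intro power_mono) auto
    also have "((1/4::real)^k)\<^sup>2 = (1/16)^k" by (simp add: power2_eq_square flip: power_mult_distrib)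
    finally show ?thesis by (simp add: ennreal_leI)
  qed
  have "(\<integral>\<^sup>+x. (\<Sum>k. ennreal (4^k * (norm (d k x))\<^sup>2)) \<partial>lborel) = (\<Sum>k. \<integral>\<^sup>+x. ennreal (4^k * (norm (d k x))\<^sup>2) \<partial>lborel)"
    by (rule nn_integral_suminf) measurable
  also have "\<dots> \<le> (\<Sum>k. ennreal ((1/4)^k))"
  proof (rule suminf_le)
    fix k
    have "(\<integral>\<^sup>+x. ennreal (4^k * (norm (d k x))\<^sup>2) \<partial>lborel) = ennreal (4^k) * (\<integral>\<^sup>+x. ennreal ((norm (d k x))\<^sup>2) \<partial>lborel)"
      by (subst nn_integral_cmult[symmetric]) (auto simp: ennreal_mult)
    also have "\<dots> \<le> ennreal (4^k) * ennreal ((1/16)^k)" by (intro mult_left_mono dk) auto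
    also have "\<dots> = ennreal ((1/4)^k)"
      by (subst ennreal_mult[symmetric]) (auto simp flip: power_mult_distrib)
    finally show "(\<integral>\<^sup>+x. ennreal (4^k * (norm (d k x))\<^sup>2) \<partial>lborel) \<le> ennreal ((1/4)^k)" .
  qed auto
  also have "\<dots> < \<infinity>" by (simp add: suminf_ennreal2 summable_geometric less_top[symmetric])
  finally have "AE x in lborel. (\<Sum>k. ennreal (4^k * (norm (d k x))\<^sup>2)) \<noteq> \<infinity>"
    by (intro nn_integral_PInf_AE) auto
  then have conv: "AE x in lborel. convergent (\<lambda>k. rep_L2 (X (r k)) x)"
  proof eventually_elim
    case (elim x)
    define g where "g k = ennreal (4^k * (norm (d k x))\<^sup>2)" for k
    define S where "S = enn2real (\<Sum>k. g k)"
    have "S \<ge> 0" by (simp add: S_def)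
    \<comment> \<open>A single term is at most the whole sum \<open>S\<close>, so the weight
      \<open>4^k\<close> turns finiteness of the series into geometric decay of the
      increments.\<close>
    have "norm (d k x) \<le> sqrt S * (1/2)^k" for k
    proof -
      have "sum g {k} \<le> suminf g" by (rule sum_le_suminf) auto
      moreover have "suminf g = ennreal S"
        using elim unfolding S_def g_def[symmetric] by (metis ennreal_enn2real less_top infinity_ennreal_def)
      ultimately have "ennreal (4^k * (norm (d k x))\<^sup>2) \<le> ennreal S" by (simp add: g_def)
      then have "4^k * (norm (d k x))\<^sup>2 \<le> S" using \<open>S \<ge> 0\<close> by (subst (asm) ennreal_le_iff)
      moreover have "(4::real)^k = (2^k)\<^sup>2" by (simp add: power2_eq_square flip: power_mult_distrib)
      ultimately have "(2^k * norm (d k x))\<^sup>2 \<le> S" by (simp add: power_mult_distrib)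
      then have "sqrt ((2^k * norm (d k x))\<^sup>2) \<le> sqrt S" by (rule real_sqrt_le_mono)
      then have "2^k * norm (d k x) \<le> sqrt S" by simp
      then show ?thesis by (simp add: power_divide field_simps)
    qed
    then have "summable (\<lambda>k. norm (d k x))"
      by (intro summable_comparison_test[OF _ summable_mult[OF summable_geometric[of "1/2::real"], of "sqrt S"]]) auto
    then have "summable (\<lambda>k. d k x)" by (rule summable_norm_cancel)
    then have "convergent (\<lambda>n. rep_L2 (X (r n)) x - rep_L2 (X (r 0)) x)"
      using sum_lessThan_telescope[of "\<lambda>n. rep_L2 (X (r n)) x"]
      by (simp add: d_def summable_iff_convergent)
    then show ?case by (simp add: convergent_diff_const_right_iff)
  qed
  define f where "f x = lim (\<lambda>k. rep_L2 (X (r k)) x)" for x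
  have [measurable]: "f \<in> borel_measurable borel" unfolding f_def by measurable
  have f: "AE x in lborel. (\<lambda>k. rep_L2 (X (r k)) x) \<longlonglongrightarrow> f x"
    using conv by eventually_elim (simp add: f_def convergent_LIMSEQ_iff)
  \<comment> \<open>Fatou's lemma along the subsequence sends m to infinity in the Cauchy estimate.
    The resulting bound both places \<open>f\<close> in L^2 and gives convergence of the full
    sequence.\<close>
  have fatou: "(\<integral>\<^sup>+x. ennreal ((norm (f x - rep_L2 (X n) x))\<^sup>2) \<partial>lborel) \<le> ennreal (e\<^sup>2)"
    if e: "e > 0" "\<And>m. m \<ge> M \<Longrightarrow> norm (X m - X n) \<le> e" for e n M
  proof -
    have "(\<integral>\<^sup>+x. ennreal ((norm (f x - rep_L2 (X n) x))\<^sup>2) \<partial>lborel)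
      = (\<integral>\<^sup>+x. liminf (\<lambda>k. ennreal ((norm (rep_L2 (X (r k)) x - rep_L2 (X n) x))\<^sup>2)) \<partial>lborel)"
    proof (rule nn_integral_cong_AE, use f in eventually_elim)
      case (elim x)
      then have "(\<lambda>k. ennreal ((norm (rep_L2 (X (r k)) x - rep_L2 (X n) x))\<^sup>2)) \<longlonglongrightarrow> ennreal ((norm (f x - rep_L2 (X n) x))\<^sup>2)"
        by (intro tendsto_intros)
      from lim_imp_Liminf[OF _ this] show ?case by (simp only: trivial_limit_sequentially not_False_eq_True)
    qed
    also have "\<dots> \<le> liminf (\<lambda>k. \<integral>\<^sup>+x. ennreal ((norm (rep_L2 (X (r k)) x - rep_L2 (X n) x))\<^sup>2) \<partial>lborel)"
      by (rule nn_integral_liminf) measurable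
    also have "\<dots> \<le> ennreal (e\<^sup>2)"
    proof (rule Liminf_le)
      show "sequentially \<noteq> bot" by simp
      have "\<forall>\<^sub>F k in sequentially. r k \<ge> M"
        using filterlim_subseq[OF r] by (simp add: filterlim_at_top)
      then show "\<forall>\<^sub>F k in sequentially. (\<integral>\<^sup>+x. ennreal ((norm (rep_L2 (X (r k)) x - rep_L2 (X n) x))\<^sup>2) \<partial>lborel) \<le> ennreal (e\<^sup>2)"
      proof eventually_elim
        case (elim k)
        have "(\<integral>\<^sup>+x. ennreal ((norm (rep_L2 (X (r k)) x - rep_L2 (X n) x))\<^sup>2) \<partial>lborel) = ennreal ((norm (X (r k) - X n))\<^sup>2)"
          using L2_class_diff[of "rep_L2 (X (r k))" "rep_L2 (X n)"]
          by (subst nn_norm_L2_class) (auto intro: square_integrable_diff)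
        also have "\<dots> \<le> ennreal (e\<^sup>2)" using e(2)[OF elim] by (intro ennreal_leI power_mono) auto
        finally show ?case .
      qed
    qed
    finally show ?thesis .
  qed
  have sqd: "square_integrable (\<lambda>x. f x - rep_L2 (X n) x)" and nd: "norm (L2_class (\<lambda>x. f x - rep_L2 (X n) x)) \<le> e"
    if e: "e > 0" "\<And>m. m \<ge> M \<Longrightarrow> norm (X m - X n) \<le> e" for e n M
    using norm_L2_class_le[OF _ fatou[OF that]] e(1) by auto
  have sqf: "square_integrable f"
  proof -
    obtain M where "\<forall>m\<ge>M. \<forall>n\<ge>M. norm (X m - X n) < 1" using C[of 1] by auto
    then have "square_integrable (\<lambda>x. f x - rep_L2 (X M) x)"
      by (intro sqd[of 1 M M]) (auto intro: less_imp_le)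
    from square_integrable_add[OF this, of "rep_L2 (X M)"] show ?thesis by simp
  qed
  have "X \<longlonglongrightarrow> L2_class f"
  proof (rule LIMSEQ_I)
    fix e :: real assume "e > 0"
    then obtain M where M: "\<forall>m\<ge>M. \<forall>n\<ge>M. norm (X m - X n) < e / 2" using C[of "e/2"] by auto
    show "\<exists>no. \<forall>n\<ge>no. norm (X n - L2_class f) < e"
    proof (intro exI allI impI)
      fix n assume "n \<ge> M"
      then have "norm (L2_class (\<lambda>x. f x - rep_L2 (X n) x)) \<le> e/2"
        using M \<open>e > 0\<close> by (intro nd[of _ M]) (auto intro: less_imp_le)
      then show "norm (X n - L2_class f) < e"
        using L2_class_diff[OF sqf, of "rep_L2 (X n)"] \<open>e > 0\<close> by (simp add: norm_minus_commute)
    qed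
  qed
  then show "convergent X" by (rule convergentI)
qed

section \<open>Multiplication operators on L^2\<close>

definition mult_op :: "('a::euclidean_space \<Rightarrow> complex) \<Rightarrow> 'a L2 \<Rightarrow> 'a L2" where
  "mult_op m f = L2_class (\<lambda>\<xi>. m \<xi> * rep_L2 f \<xi>)"

lemma square_integrable_mult:
  assumes "m \<in> borel_measurable borel" "\<And>\<xi>. norm (m \<xi>) \<le> B" "square_integrable f"
  shows "square_integrable (\<lambda>\<xi>. m \<xi> * f \<xi>)"
  using assms square_integrable_measurable[OF assms(3)]
  by (intro square_integrable_bound[OF assms(3), of _ B]) (auto simp: norm_mult intro!: mult_right_mono)

lemma rep_mult_op:
  assumes "m \<in> borel_measurable borel" "\<And>\<xi>. norm (m \<xi>) \<le> B"
  shows "AE \<xi> in lborel. rep_L2 (mult_op m f) \<xi> = m \<xi> * rep_L2 f \<xi>"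
  unfolding mult_op_def by (rule rep_L2_class) (rule square_integrable_mult[OF assms], simp)

lemma mult_op_L2_class:
  assumes [measurable]: "m \<in> borel_measurable borel" and "square_integrable f"
  shows "mult_op m (L2_class f) = L2_class (\<lambda>\<xi>. m \<xi> * f \<xi>)"
proof -
  have [measurable]: "f \<in> borel_measurable borel" using assms square_integrable_measurable by blast
  show ?thesis unfolding mult_op_def
    by (rule L2_class_cong_AE) (use rep_L2_class[OF assms(2)] in auto)
qed

text \<open>The bound on the inner symbol makes the inner product a genuine L^2 function, whose
  representative may then be replaced by the product itself.\<close>

lemma mult_op_mult_op:
  assumes [measurable]: "m \<in> borel_measurable borel" "m' \<in> borel_measurable borel" and B: "\<And>\<xi>. norm (m' \<xi>) \<le> B"
  shows "mult_op m (mult_op m' f) = mult_op (\<lambda>\<xi>. m \<xi> * m' \<xi>) f"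
  using mult_op_L2_class[of m "\<lambda>\<xi>. m' \<xi> * rep_L2 f \<xi>"] square_integrable_mult[OF assms(2) B, of "rep_L2 f"]
  by (simp add: mult_op_def mult.assoc)

lemma mult_op_1 [simp]: "mult_op (\<lambda>_. 1) f = f"
  by (simp add: mult_op_def)

lemma scaleC_eq_mult_op: "c *\<^sub>C f = mult_op (\<lambda>_. c) f"
  using L2_class_scaleC[of "rep_L2 f" c] by (simp add: mult_op_def)

lemma norm_mult_op_le:
  assumes "m \<in> borel_measurable borel" "\<And>\<xi>. norm (m \<xi>) \<le> B"
  shows "norm (mult_op m f) \<le> B * norm f"
proof -
  have B: "B \<ge> 0" using assms(2)[of 0] norm_ge_zero order_trans by blast
  have "norm (mult_op m f) \<le> norm (B *\<^sub>R f)"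
    using L2_class_scaleR[of "rep_L2 f" B] B assms(2) unfolding mult_op_def
    by (simp only: L2_class_rep)
       (auto intro!: norm_L2_class_mono square_integrable_mult[OF assms] square_integrable_scaleR mult_right_mono
          AE_I2 simp: norm_mult)
  then show ?thesis using B by simp
qed

lemma bounded_linear_mult_op:
  assumes "m \<in> borel_measurable borel" "\<And>\<xi>. norm (m \<xi>) \<le> B"
  shows "bounded_linear (mult_op m)"
proof (rule bounded_linear_intro)
  note [measurable] = assms(1)
  note sq = square_integrable_mult[OF assms]
  show "mult_op m (f + g) = mult_op m f + mult_op m g" for f g
    unfolding mult_op_def L2_class_add[OF sq[OF square_integrable_rep] sq[OF square_integrable_rep]]
    by (rule L2_class_cong_AE) (use rep_L2_add[of f g] in \<open>auto simp: algebra_simps\<close>)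
  show "mult_op m (r *\<^sub>R f) = r *\<^sub>R mult_op m f" for r f
    unfolding mult_op_def L2_class_scaleR[OF sq[OF square_integrable_rep]]
    by (rule L2_class_cong_AE) (use rep_L2_scaleR[of r f] in \<open>auto simp: algebra_simps\<close>)
  show "norm (mult_op m f) \<le> norm f * B" for f
    using norm_mult_op_le[OF assms, of f] by (simp add: mult.commute)
qed

lemma norm_mult_op_unimodular:
  assumes "m \<in> borel_measurable borel" "\<And>\<xi>. norm (m \<xi>) = 1"
  shows "norm (mult_op m f) = norm f"
proof -
  have "square_integrable (\<lambda>\<xi>. m \<xi> * rep_L2 f \<xi>)"
    by (rule square_integrable_mult[of _ 1]) (use assms in auto)
  then have "norm (mult_op m f) = sqrt (\<integral>x. (norm (m x * rep_L2 f x))\<^sup>2 \<partial>lborel)"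
    unfolding mult_op_def by (rule norm_L2_class)
  also have "\<dots> = norm f" using norm_L2_class[of "rep_L2 f"] by (simp add: norm_mult assms)
  finally show ?thesis .
qed

lemma bounded_linear_scaleC: "bounded_linear (\<lambda>f::'a::euclidean_space L2. c *\<^sub>C f)"
  unfolding scaleC_eq_mult_op by (rule bounded_linear_mult_op[of _ "norm c"]) auto

subsection \<open>Plancherel's theorem\<close>

text \<open>Up to scaling this is the characteristic function of the standard normal
  distribution.\<close>

lemma gaussian_integral_real:
  fixes \<epsilon> t :: real
  assumes "\<epsilon> > 0"
  shows "has_bochner_integral lborel (\<lambda>x. cis (t * x) * of_real (exp (- \<epsilon> * x\<^sup>2 / 2)))
    (of_real (sqrt (2 * pi / \<epsilon>) * exp (- t\<^sup>2 / (2 * \<epsilon>))) :: complex)"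
proof -
  have 1: "has_bochner_integral lborel (\<lambda>x. cis (t * x) * of_real (exp (- x\<^sup>2 / 2)))
    (of_real (sqrt (2 * pi) * exp (- t\<^sup>2 / 2)))" for t :: real
  proof -
    have "integrable std_normal_distribution (\<lambda>x. iexp (t * x))"
      using prob_space.finite_measure[OF real_distribution.axioms(1)[OF real_dist_normal_dist]]
      by (intro finite_measure.integrable_const_bound[where B = 1]) auto
    then have i: "integrable lborel (\<lambda>x. std_normal_density x *\<^sub>R iexp (t * x))"
      by (subst (asm) integrable_density) auto
    have "(CLINT x|std_normal_distribution. iexp (t * x)) = (\<integral>x. std_normal_density x *\<^sub>R iexp (t * x) \<partial>lborel)"
      by (subst integral_density) auto
    then have "has_bochner_integral lborel (\<lambda>x. std_normal_density x *\<^sub>R iexp (t * x)) (of_real (exp (- (t\<^sup>2) / 2)))"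
      using i char_std_normal_distribution by (simp add: has_bochner_integral_iff char_def fun_eq_iff)
    then have "has_bochner_integral lborel (\<lambda>x. of_real (sqrt (2 * pi)) * (std_normal_density x *\<^sub>R iexp (t * x)))
       (of_real (sqrt (2 * pi)) * of_real (exp (- (t\<^sup>2) / 2)))"
      by (rule has_bochner_integral_mult_right)
    then show ?thesis
      by (simp add: std_normal_density_def scaleR_conv_of_real cis_conv_exp mult.commute mult.left_commute field_simps)
  qed
  \<comment> \<open>Substituting \<open>sqrt \<epsilon> * x\<close> at frequency
    \<open>t / sqrt \<epsilon>\<close> restores the phase \<open>t * x\<close> and moves \<epsilon>
    into the exponent.\<close>
  have "has_bochner_integral lborel (\<lambda>x. cis (t / sqrt \<epsilon> * (0 + sqrt \<epsilon> * x)) * of_real (exp (- (0 + sqrt \<epsilon> * x)\<^sup>2 / 2)))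
    (of_real (sqrt (2 * pi) * exp (- (t / sqrt \<epsilon>)\<^sup>2 / 2)) /\<^sub>R \<bar>sqrt \<epsilon>\<bar>)"
    by (rule iffD1[OF lborel_has_bochner_integral_real_affine_iff[of "sqrt \<epsilon>"] 1]) (use assms in simp)
  then show ?thesis using assms
    by (simp add: power_mult_distrib power_divide real_sqrt_divide scaleR_conv_of_real field_simps)
qed

text \<open>Lebesgue measure is the image of a product measure over the basis, and both the phase
  and the Gaussian factor along it, so the integral is a product of one-dimensional ones.\<close>

lemma gaussian_integral:
  fixes \<xi> :: "'a::euclidean_space"
  assumes "\<epsilon> > 0"
  shows "has_bochner_integral lborel (\<lambda>x. cis (x \<bullet> \<xi>) * of_real (exp (- \<epsilon> * (norm x)\<^sup>2 / 2)))
    (of_real ((2 * pi / \<epsilon>) powr (real DIM('a) / 2) * exp (- (norm \<xi>)\<^sup>2 / (2 * \<epsilon>))))"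
proof -
  interpret product_sigma_finite "\<lambda>b::'a. lborel :: real measure" ..
  let ?F = "\<lambda>b x. cis ((\<xi> \<bullet> b) * x) * complex_of_real (exp (- \<epsilon> * x\<^sup>2 / 2))"
  let ?s = "\<lambda>f::'a \<Rightarrow> real. \<Sum>b\<in>Basis. f b *\<^sub>R b"
  note F = gaussian_integral_real[OF assms]
  have cis_sum: "cis (sum g A) = (\<Prod>b\<in>A. cis (g b))" if "finite A" for g :: "'a \<Rightarrow> real" and A
    using that by (induction A) (auto simp: cis_mult[symmetric])
  have eq: "cis (?s f \<bullet> \<xi>) * of_real (exp (- \<epsilon> * (norm (?s f))\<^sup>2 / 2)) = (\<Prod>b\<in>Basis. ?F b (f b))" for f
  proof -
    have "?s f \<bullet> \<xi> = (\<Sum>b\<in>Basis. (\<xi> \<bullet> b) * f b)"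
      by (simp add: inner_sum_left inner_commute[of \<xi>] mult.commute)
    moreover have "(norm (?s f))\<^sup>2 = (\<Sum>b\<in>Basis. (f b)\<^sup>2)"
      unfolding power2_norm_eq_inner
      by (subst euclidean_inner) (simp add: inner_sum_left inner_Basis power2_eq_square if_distrib sum.delta cong: if_cong)
    ultimately show ?thesis
      by (simp add: cis_sum prod.distrib exp_sum[symmetric] sum_distrib_left sum_negf sum_divide_distrib flip: of_real_prod)
  qed
  have int: "integrable (Pi\<^sub>M Basis (\<lambda>b. lborel)) (\<lambda>f. \<Prod>b\<in>Basis. ?F b (f b))"
    by (rule product_integrable_prod) (use F in \<open>auto simp: has_bochner_integral_iff\<close>)
  have val: "(\<integral>f. (\<Prod>b\<in>Basis. ?F b (f b)) \<partial>Pi\<^sub>M Basis (\<lambda>b. lborel)) = (\<Prod>b\<in>Basis. \<integral>x. ?F b x \<partial>lborel)"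
    by (rule product_integral_prod) (use F in \<open>auto simp: has_bochner_integral_iff\<close>)
  have "(\<Prod>b\<in>Basis. \<integral>x. ?F b x \<partial>lborel) = (\<Prod>b\<in>Basis. of_real (sqrt (2 * pi / \<epsilon>) * exp (- (\<xi> \<bullet> b)\<^sup>2 / (2 * \<epsilon>))))"
    using F by (simp add: has_bochner_integral_iff)
  also have "\<dots> = of_real (sqrt (2 * pi / \<epsilon>) ^ DIM('a) * exp (- (norm \<xi>)\<^sup>2 / (2 * \<epsilon>)))"
  proof -
    have "(norm \<xi>)\<^sup>2 = (\<Sum>b\<in>Basis. (\<xi> \<bullet> b)\<^sup>2)"
      unfolding power2_norm_eq_inner by (subst euclidean_inner) (simp add: power2_eq_square)
    then show ?thesis
      by (simp add: prod.distrib exp_sum[symmetric] sum_negf sum_divide_distrib[symmetric] flip: of_real_prod)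
  qed
  also have "sqrt (2 * pi / \<epsilon>) ^ DIM('a) = (2 * pi / \<epsilon>) powr (real DIM('a) / 2)"
    using assms by (simp add: powr_half_sqrt[symmetric] powr_realpow[symmetric] powr_powr)
  finally have val2: "(\<Prod>b\<in>Basis. \<integral>x. ?F b x \<partial>lborel) =
     of_real ((2 * pi / \<epsilon>) powr (real DIM('a) / 2) * exp (- (norm \<xi>)\<^sup>2 / (2 * \<epsilon>)))" .
  have [measurable]: "?s \<in> Pi\<^sub>M Basis (\<lambda>b. lborel) \<rightarrow>\<^sub>M borel" by measurable
  have m: "(\<lambda>x. cis (x \<bullet> \<xi>) * of_real (exp (- \<epsilon> * (norm x)\<^sup>2 / 2))) \<in> borel_measurable borel"
    by (intro borel_measurable_continuous_onI continuous_intros) auto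
  show ?thesis
    unfolding has_bochner_integral_iff lborel_eq[where 'a='a]
    by (subst integral_distr[OF _ m], measurable, subst integrable_distr_eq[OF _ m], measurable)
       (simp only: eq int val val2 simp_thms)
qed

section \<open>Fourier integrals of integrable functions, both signs \<sigma> at once\<close>

definition fourier_int :: "real \<Rightarrow> ('a::euclidean_space \<Rightarrow> complex) \<Rightarrow> 'a \<Rightarrow> complex" where
  "fourier_int \<sigma> f \<xi> = of_real ((2 * pi) powr (- real DIM('a) / 2)) * (\<integral>x. cis (\<sigma> * (x \<bullet> \<xi>)) * f x \<partial>lborel)"

lemma fourier_integral_eq: "fourier_integral = fourier_int (-1)"
  by (simp add: fourier_int_def fourier_integral_def fun_eq_iff)

lemma inv_fourier_integral_eq: "inv_fourier_integral = fourier_int 1"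
  by (simp add: fourier_int_def inv_fourier_integral_def fun_eq_iff inner_commute)

lemma measurable_cis_inner [measurable]: "(\<lambda>(x::'a::euclidean_space, y). cis (c * (x \<bullet> y))) \<in> borel_measurable (borel \<Otimes>\<^sub>M borel)"
  unfolding case_prod_beta borel_prod by (intro borel_measurable_continuous_onI continuous_intros)

lemma measurable_cis' [measurable (raw)]:
  "f \<in> borel_measurable M \<Longrightarrow> (\<lambda>x. cis (f x)) \<in> borel_measurable M"
  by (rule measurable_compose[of f M borel cis]) (auto intro!: borel_measurable_continuous_onI continuous_intros)

lemma measurable_cnj [measurable (raw)]:
  "f \<in> borel_measurable M \<Longrightarrow> (\<lambda>x. cnj (f x)) \<in> borel_measurable M"
  by (rule measurable_compose[of f M borel cnj]) (auto intro!: borel_measurable_continuous_onI continuous_intros)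

lemma integrable_cis_mult:
  assumes "integrable M f" "g \<in> borel_measurable M"
  shows "integrable M (\<lambda>x. cis (g x) * f x)"
  by (rule Bochner_Integration.integrable_bound[OF assms(1)]) (use assms in \<open>auto simp: norm_mult\<close>)

lemma measurable_fourier_int [measurable]:
  assumes [measurable]: "f \<in> borel_measurable borel"
  shows "fourier_int \<sigma> f \<in> borel_measurable borel"
proof -
  have "(\<lambda>\<xi>. \<integral>x. cis (\<sigma> * (x \<bullet> \<xi>)) * f x \<partial>lborel) \<in> borel_measurable borel"
    by (rule lborel.borel_measurable_lebesgue_integral) measurable
  then show ?thesis unfolding fourier_int_def by measurable
qed

lemma norm_fourier_int_le:
  fixes f :: "'a::euclidean_space \<Rightarrow> complex"
  shows "norm (fourier_int \<sigma> f \<xi>) \<le> (2 * pi) powr (- real DIM('a) / 2) * (\<integral>x. norm (f x) \<partial>lborel)"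
proof -
  have "norm (\<integral>x. cis (\<sigma> * (x \<bullet> \<xi>)) * f x \<partial>lborel) \<le> (\<integral>x. norm (cis (\<sigma> * (x \<bullet> \<xi>)) * f x) \<partial>lborel)"
    by (rule integral_norm_bound)
  then show ?thesis unfolding fourier_int_def by (simp add: norm_mult mult_left_mono)
qed

lemma fourier_int_add:
  assumes "integrable lborel f" "integrable lborel g"
  shows "fourier_int \<sigma> (\<lambda>x. f x + g x) \<xi> = fourier_int \<sigma> f \<xi> + fourier_int \<sigma> g \<xi>"
  unfolding fourier_int_def distrib_left
  by (subst Bochner_Integration.integral_add) (auto intro!: integrable_cis_mult assms simp: distrib_left right_diff_distrib)

lemma fourier_int_diff:
  assumes "integrable lborel f" "integrable lborel g"
  shows "fourier_int \<sigma> (\<lambda>x. f x - g x) \<xi> = fourier_int \<sigma> f \<xi> - fourier_int \<sigma> g \<xi>"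
  unfolding fourier_int_def right_diff_distrib
  by (subst Bochner_Integration.integral_diff) (auto intro!: integrable_cis_mult assms simp: distrib_left right_diff_distrib)

lemma fourier_int_cmult: "fourier_int \<sigma> (\<lambda>x. c * f x) \<xi> = c * fourier_int \<sigma> f \<xi>"
  unfolding fourier_int_def by (subst mult.left_commute) (simp add: mult.left_commute)

lemma cnj_fourier_int: "cnj (fourier_int \<sigma> f \<xi>) = fourier_int (- \<sigma>) (\<lambda>x. cnj (f x)) \<xi>"
proof -
  have "cnj (\<integral>x. cis (\<sigma> * (x \<bullet> \<xi>)) * f x \<partial>lborel) = (\<integral>x. cnj (cis (\<sigma> * (x \<bullet> \<xi>)) * f x) \<partial>lborel)"
    by (rule Bochner_Integration.integral_cnj[symmetric])
  then show ?thesis unfolding fourier_int_def by (simp add: cis_cnj)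
qed

text \<open>Justifies the exchange of integrals for a product of integrable functions against a
  bounded oscillating kernel.\<close>

lemma integrable_tensor:
  fixes f :: "'a::euclidean_space \<Rightarrow> complex" and h :: "'b::euclidean_space \<Rightarrow> complex"
  assumes "integrable lborel f" "integrable lborel h"
    and [measurable]: "(\<lambda>(x, y). k x y) \<in> borel_measurable (borel \<Otimes>\<^sub>M borel)"
    and B: "\<And>x y. norm (k x y) \<le> B"
  shows "integrable (lborel \<Otimes>\<^sub>M lborel) (\<lambda>(x, y). k x y * (f x * h y) :: complex)"
proof -
  note [measurable] = borel_measurable_integrable[OF assms(1)] borel_measurable_integrable[OF assms(2)]
  have "integrable (lborel \<Otimes>\<^sub>M lborel) (\<lambda>(x, y). of_real B * (f x * h y))"
    unfolding case_prod_beta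
    by (intro integrable_mult_right lborel_pair.Fubini_integrable) (auto simp: norm_mult assms integrable_norm)
  then show ?thesis
    by (rule Bochner_Integration.integrable_bound)
       (auto simp: norm_mult case_prod_beta split_beta' intro!: mult_right_mono AE_I2 order_trans[OF B])
qed

text \<open>The kernel \<open>cis (\<sigma> * (x \<bullet> \<xi>))\<close> is symmetric in its two
  variables, so Fubini moves the transform from one factor to the other.\<close>

lemma fourier_int_mult_formula:
  assumes "integrable lborel f" "integrable lborel h"
  shows "(\<integral>\<xi>. fourier_int \<sigma> f \<xi> * h \<xi> \<partial>lborel) = (\<integral>x. f x * fourier_int \<sigma> h x \<partial>lborel)"
proof -
  have i: "integrable (lborel \<Otimes>\<^sub>M lborel) (\<lambda>(x, \<xi>). cis (\<sigma> * (x \<bullet> \<xi>)) * (f x * h \<xi>))"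
    by (rule integrable_tensor[OF assms, of _ 1]) auto
  have "(\<integral>\<xi>. (\<integral>x. cis (\<sigma> * (x \<bullet> \<xi>)) * (f x * h \<xi>) \<partial>lborel) \<partial>lborel) = (\<integral>x. (\<integral>\<xi>. cis (\<sigma> * (x \<bullet> \<xi>)) * (f x * h \<xi>) \<partial>lborel) \<partial>lborel)"
    by (rule lborel_pair.Fubini_integral[OF i])
  moreover have "(\<integral>x. cis (\<sigma> * (x \<bullet> \<xi>)) * (f x * h \<xi>) \<partial>lborel) = (\<integral>x. cis (\<sigma> * (x \<bullet> \<xi>)) * f x \<partial>lborel) * h \<xi>" for \<xi>
    by (subst integral_mult_left_zero[symmetric]) (simp add: mult.assoc)
  moreover have "(\<integral>\<xi>. cis (\<sigma> * (x \<bullet> \<xi>)) * (f x * h \<xi>) \<partial>lborel) = f x * (\<integral>\<xi>. cis (\<sigma> * (\<xi> \<bullet> x)) * h \<xi> \<partial>lborel)" for x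
    by (subst integral_mult_right_zero[symmetric]) (simp add: mult.left_commute inner_commute)
  ultimately show ?thesis
    unfolding fourier_int_def by (simp add: mult.assoc mult.left_commute[of _ "complex_of_real _"])
qed

text \<open>The density of the centred normal law with covariance \<epsilon> times the identity,
  that is, the heat kernel at time \<epsilon>/2. Its transform is, up to normalisation, the damping
  factor \<open>exp (- \<epsilon> * (norm \<xi>)\<^sup>2 / 2)\<close>.\<close>

definition heat_kernel :: "real \<Rightarrow> 'a::euclidean_space \<Rightarrow> real" where
  "heat_kernel \<epsilon> z = (2 * pi * \<epsilon>) powr (- real DIM('a) / 2) * exp (- (norm z)\<^sup>2 / (2 * \<epsilon>))"

lemma heat_kernel_nonneg [simp]: "heat_kernel \<epsilon> z \<ge> 0"
  by (simp add: heat_kernel_def)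

lemma measurable_heat_kernel [measurable]: "heat_kernel \<epsilon> \<in> borel_measurable borel"
  unfolding heat_kernel_def by measurable

lemma heat_kernel_integral:
  assumes "\<epsilon> > 0"
  shows "has_bochner_integral lborel (heat_kernel \<epsilon> :: 'a::euclidean_space \<Rightarrow> real) 1"
proof -
  have "has_bochner_integral lborel (\<lambda>x::'a. complex_of_real (exp (- (1/\<epsilon>) * (norm x)\<^sup>2 / 2)))
    (of_real ((2 * pi / (1/\<epsilon>)) powr (real DIM('a) / 2)))"
    using gaussian_integral[of "1/\<epsilon>" "0::'a"] assms by simp
  then have "has_bochner_integral lborel (\<lambda>x::'a. exp (- (1/\<epsilon>) * (norm x)\<^sup>2 / 2)) ((2 * pi * \<epsilon>) powr (real DIM('a) / 2))"
    by (subst (asm) has_bochner_integral_iff)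
       (simp add: has_bochner_integral_iff complex_of_real_integrable_eq del: of_real_exp)
  from has_bochner_integral_mult_right[OF this, of "(2 * pi * \<epsilon>) powr (- real DIM('a) / 2)"]
  show ?thesis using assms
    by (simp add: heat_kernel_def[abs_def] powr_add[symmetric] mult.commute)
qed

text \<open>For merely integrable functions the product of the transforms is only known to be
  bounded; the Gaussian factor makes its integral converge. In position space this factor becomes a
  mollification of \<open>g\<close> by the heat kernel, so sending \<epsilon> to 0 leads to
  Plancherel's theorem. The hypothesis \<open>\<sigma> * \<sigma> = 1\<close> says that \<sigma> is
  1 or -1.\<close>

lemma fourier_int_parseval_gaussian:
  fixes f g :: "'a::euclidean_space \<Rightarrow> complex"
  assumes f: "integrable lborel f" and g: "integrable lborel g" and \<epsilon>: "\<epsilon> > 0" and \<sigma>: "\<sigma> * \<sigma> = 1"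
  shows "(\<integral>\<xi>. fourier_int \<sigma> f \<xi> * cnj (fourier_int \<sigma> g \<xi>) * of_real (exp (- \<epsilon> * (norm \<xi>)\<^sup>2 / 2)) \<partial>lborel)
    = (\<integral>x. f x * (\<integral>y. cnj (g y) * of_real (heat_kernel \<epsilon> (x - y)) \<partial>lborel) \<partial>lborel)"
proof -
  note [measurable] = borel_measurable_integrable[OF f] borel_measurable_integrable[OF g]
  let ?c = "(2 * pi) powr (- real DIM('a) / 2)"
  let ?e = "\<lambda>\<xi>::'a. complex_of_real (exp (- \<epsilon> * (norm \<xi>)\<^sup>2 / 2))"
  have e: "integrable lborel ?e"
    using gaussian_integral[of \<epsilon> "0::'a"] \<epsilon> by (simp add: has_bochner_integral_iff)
  have ce: "integrable lborel (\<lambda>\<xi>. cis (\<sigma> * (x \<bullet> \<xi>)) * ?e \<xi>)" for x :: 'a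
    by (intro integrable_cis_mult e) measurable
  have h: "integrable lborel (\<lambda>\<xi>. cnj (fourier_int \<sigma> g \<xi>) * ?e \<xi>)"
  proof (rule Bochner_Integration.integrable_bound)
    show "integrable lborel (\<lambda>\<xi>. (?c * (\<integral>x. norm (g x) \<partial>lborel)) *\<^sub>R ?e \<xi>)"
      using e by simp
    show "AE x in lborel. norm (cnj (fourier_int \<sigma> g x) * ?e x) \<le> norm ((?c * (\<integral>x. norm (g x) \<partial>lborel)) *\<^sub>R ?e x)"
      using norm_fourier_int_le[of \<sigma> g]
      by (intro AE_I2) (auto simp: norm_mult intro!: mult_right_mono)
  qed measurable
  \<comment> \<open>Conjugating the transform of \<open>g\<close> flips its sign, hence the sign
    \<open>-\<sigma>\<close> here; the two phases combine to one that depends on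
    \<open>x - y\<close> alone.\<close>
  have gauss: "fourier_int (-\<sigma>) (\<lambda>\<xi>. cis (\<sigma> * (x \<bullet> \<xi>)) * ?e \<xi>) y = of_real ((2 * pi / \<epsilon>) powr (real DIM('a) / 2) * ?c * exp (- (norm (x - y))\<^sup>2 / (2 * \<epsilon>)))" for x y :: 'a
  proof -
    have "(norm (\<sigma> *\<^sub>R (x - y)))\<^sup>2 = (norm (x - y))\<^sup>2"
      using \<sigma> by (simp add: power_mult_distrib power2_eq_square)
    moreover have "(\<integral>\<xi>. cis (-\<sigma> * (\<xi> \<bullet> y)) * (cis (\<sigma> * (x \<bullet> \<xi>)) * ?e \<xi>) \<partial>lborel) = (\<integral>\<xi>. cis (\<xi> \<bullet> (\<sigma> *\<^sub>R (x - y))) * ?e \<xi> \<partial>lborel)"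
      by (intro Bochner_Integration.integral_cong) (auto simp: cis_mult inner_commute inner_diff_right algebra_simps simp flip: mult.assoc)
    ultimately show ?thesis
      using gaussian_integral[OF \<epsilon>, of "\<sigma> *\<^sub>R (x - y)"]
      by (simp add: fourier_int_def has_bochner_integral_iff mult_ac)
  qed
  have "fourier_int \<sigma> (\<lambda>\<xi>. cnj (fourier_int \<sigma> g \<xi>) * ?e \<xi>) x = (\<integral>y. cnj (g y) * of_real (heat_kernel \<epsilon> (x - y)) \<partial>lborel)" for x
  proof -
    have "fourier_int \<sigma> (\<lambda>\<xi>. cnj (fourier_int \<sigma> g \<xi>) * ?e \<xi>) x = of_real ?c * (\<integral>\<xi>. fourier_int (-\<sigma>) (\<lambda>x. cnj (g x)) \<xi> * (cis (\<sigma> * (x \<bullet> \<xi>)) * ?e \<xi>) \<partial>lborel)"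
      unfolding cnj_fourier_int by (simp add: fourier_int_def inner_commute mult_ac)
    also have "\<dots> = of_real ?c * (\<integral>y. cnj (g y) * fourier_int (-\<sigma>) (\<lambda>\<xi>. cis (\<sigma> * (x \<bullet> \<xi>)) * ?e \<xi>) y \<partial>lborel)"
      using g by (subst fourier_int_mult_formula[OF _ ce]) auto
    also have "\<dots> = (\<integral>y. cnj (g y) * of_real (heat_kernel \<epsilon> (x - y)) \<partial>lborel)"
    proof -
      \<comment> \<open>Two normalisation factors and the Gaussian integral combine to the
        normalisation of the heat kernel: \<open>(2 pi)^(-n) (2 pi / \<epsilon>)^(n/2) = (2 pi
        \<epsilon>)^(-n/2)\<close>.\<close>
      have "?c * ((2 * pi / \<epsilon>) powr (real DIM('a) / 2) * ?c) = (2 * pi * \<epsilon>) powr (- real DIM('a) / 2)"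
      proof -
        have "(2 * pi / \<epsilon>) powr (real DIM('a) / 2) = (2 * pi) powr (real DIM('a) / 2) * \<epsilon> powr (- real DIM('a) / 2)"
          using \<epsilon> by (simp add: powr_divide powr_minus field_simps)
        then show ?thesis using \<epsilon> by (simp add: powr_mult mult_ac flip: powr_add)
      qed
      then have "?c * ((2 * pi / \<epsilon>) powr (real DIM('a) / 2) * ?c * E) = (2 * pi * \<epsilon>) powr (- real DIM('a) / 2) * E" for E
        by (metis mult.assoc)
      then have *: "of_real ?c * (cnj (g y) * of_real ((2 * pi / \<epsilon>) powr (real DIM('a) / 2) * ?c * exp (- (norm (x - y))\<^sup>2 / (2 * \<epsilon>)))) = cnj (g y) * of_real (heat_kernel \<epsilon> (x - y))" for y
        unfolding heat_kernel_def by (simp only: mult.left_commute[of "of_real ?c"] of_real_mult[symmetric])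
      then show ?thesis
        unfolding gauss integral_mult_right_zero[symmetric] by (simp only: *)
    qed
    finally show ?thesis .
  qed
  then show ?thesis
    using fourier_int_mult_formula[OF f h] by (simp add: mult.assoc)
qed

text \<open>The Bochner integral of a non-integrable function is 0, so the bound holds in every case
  and estimates can start without side conditions.\<close>

lemma ennreal_norm_integral_le:
  fixes f :: "'a \<Rightarrow> 'b::{banach, second_countable_topology}"
  shows "ennreal (norm (integral\<^sup>L M f)) \<le> (\<integral>\<^sup>+x. ennreal (norm (f x)) \<partial>M)"
  by (cases "integrable M f") (auto simp: integral_norm_bound_ennreal not_integrable_integral_eq)

lemma lborel_distr_minus: "distr lborel borel (\<lambda>x. a - x) = (lborel :: 'a::euclidean_space measure)"
  by (subst (2) lborel_affine[of "-1" a]) (auto simp: density_1)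

lemma lborel_distr_translate: "distr lborel borel (\<lambda>x. x + a) = (lborel :: 'a::euclidean_space measure)"
proof -
  have "(\<lambda>x. x + a) = (+) a" by (simp add: fun_eq_iff add.commute)
  then show ?thesis by (simp add: lborel_distr_plus)
qed

lemma nn_integral_lborel_minus:
  "f \<in> borel_measurable borel \<Longrightarrow> (\<integral>\<^sup>+x. f (a - x) \<partial>lborel) = (\<integral>\<^sup>+x. f x \<partial>(lborel :: 'a::euclidean_space measure))"
  using nn_integral_distr[of "\<lambda>x. a - x" lborel borel f] by (simp add: lborel_distr_minus)

lemma nn_integral_lborel_translate:
  "f \<in> borel_measurable borel \<Longrightarrow> (\<integral>\<^sup>+x. f (x + a) \<partial>lborel) = (\<integral>\<^sup>+x. f x \<partial>(lborel :: 'a::euclidean_space measure))"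
  using nn_integral_distr[of "\<lambda>x. x + a" lborel borel f] by (simp add: lborel_distr_translate)

lemma AE_lborel_translate:
  assumes "AE x in (lborel :: 'a::euclidean_space measure). P x"
  shows "AE x in lborel. P (x + a)"
proof -
  obtain N where N: "N \<in> null_sets lborel" "{x. \<not> P x} \<subseteq> N"
    using assms by (auto simp: eventually_ae_filter)
  then have "AE x in distr lborel borel (\<lambda>x. x + a). x \<notin> N"
    unfolding lborel_distr_translate by (intro AE_not_in) auto
  then have "AE x in lborel. x + a \<notin> N"
    using N by (subst (asm) AE_distr_iff) (auto simp: null_sets_def)
  then show ?thesis using N(2) by (auto elim!: eventually_mono)
qed

lemma integral_lborel_affine:
  fixes f :: "'a::euclidean_space \<Rightarrow> 'b::{banach, second_countable_topology}"
  assumes [measurable]: "f \<in> borel_measurable borel" and c: "c \<noteq> 0"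
  shows "(\<integral>x. f x \<partial>lborel) = \<bar>c\<bar> ^ DIM('a) *\<^sub>R (\<integral>x. f (t + c *\<^sub>R x) \<partial>lborel)"
  by (subst lborel_affine[OF c, of t]) (simp add: integral_density integral_distr)

lemma nn_integral_lborel_affine:
  fixes f :: "'a::euclidean_space \<Rightarrow> ennreal"
  assumes [measurable]: "f \<in> borel_measurable borel" and c: "c \<noteq> 0"
  shows "(\<integral>\<^sup>+x. f x \<partial>lborel) = ennreal (\<bar>c\<bar> ^ DIM('a)) * (\<integral>\<^sup>+x. f (t + c *\<^sub>R x) \<partial>lborel)"
  by (subst lborel_affine[OF c, of t]) (simp add: nn_integral_density nn_integral_distr nn_integral_cmult)

text \<open>In the damped Parseval identity with \<open>g = f\<close> the product of
  \<open>norm (f x)\<close> and \<open>norm (f y)\<close> is at most half the sum of squares. The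
  heat kernel has mass 1 in each variable, so both halves contribute half of the squared L^2 norm,
  uniformly in \<epsilon>. The inequality is enough to extend the transform; that it is an isometry
  follows later from inversion.\<close>

lemma fourier_int_contraction:
  fixes f :: "'a::euclidean_space \<Rightarrow> complex"
  assumes f: "integrable lborel f" and sq: "square_integrable f" and \<sigma>: "\<sigma> * \<sigma> = 1"
  shows "square_integrable (fourier_int \<sigma> f)" "norm (L2_class (fourier_int \<sigma> f)) \<le> norm (L2_class f)"
proof -
  note [measurable] = borel_measurable_integrable[OF f]
  let ?F = "fourier_int \<sigma> f"
  let ?c = "(2 * pi) powr (- real DIM('a) / 2)"
  let ?e = "\<lambda>\<epsilon> \<xi>::'a. exp (- \<epsilon> * (norm \<xi>)\<^sup>2 / 2)"
  have heat1: "(\<integral>\<^sup>+y. ennreal (heat_kernel \<epsilon> y) \<partial>(lborel::'a measure)) = 1" if "\<epsilon> > 0" for \<epsilon>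
    using heat_kernel_integral[OF that, where 'a='a] by (subst nn_integral_eq_integral) (auto simp: has_bochner_integral_iff)
  have le: "(\<integral>\<^sup>+\<xi>. ennreal ((norm (?F \<xi>))\<^sup>2 * ?e \<epsilon> \<xi>) \<partial>lborel) \<le> ennreal ((norm (L2_class f))\<^sup>2)" if \<epsilon>: "\<epsilon> > 0" for \<epsilon>
  proof -
    have e: "integrable lborel (?e \<epsilon>)"
      using gaussian_integral[of \<epsilon> "0::'a"] \<epsilon> by (simp add: has_bochner_integral_iff complex_of_real_integrable_eq del: of_real_exp)
    have int: "integrable lborel (\<lambda>\<xi>. (norm (?F \<xi>))\<^sup>2 * ?e \<epsilon> \<xi>)"
    proof (rule Bochner_Integration.integrable_bound)
      show "integrable lborel (\<lambda>\<xi>. (?c * (\<integral>x. norm (f x) \<partial>lborel))\<^sup>2 * ?e \<epsilon> \<xi>)"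
        using e by simp
      show "AE x in lborel. norm ((norm (?F x))\<^sup>2 * ?e \<epsilon> x) \<le> norm ((?c * (\<integral>x. norm (f x) \<partial>lborel))\<^sup>2 * ?e \<epsilon> x)"
        using norm_fourier_int_le[of \<sigma> f]
        by (intro AE_I2) (auto simp: norm_mult intro!: mult_right_mono power_mono)
    qed measurable
    have "(\<integral>\<^sup>+\<xi>. ennreal ((norm (?F \<xi>))\<^sup>2 * ?e \<epsilon> \<xi>) \<partial>lborel) = ennreal (\<integral>\<xi>. (norm (?F \<xi>))\<^sup>2 * ?e \<epsilon> \<xi> \<partial>lborel)"
      by (rule nn_integral_eq_integral[OF int]) auto
    also have "\<dots> = ennreal (norm (complex_of_real (\<integral>\<xi>. (norm (?F \<xi>))\<^sup>2 * ?e \<epsilon> \<xi> \<partial>lborel)))"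
      by (simp add: Bochner_Integration.integral_nonneg)
    also have "complex_of_real (\<integral>\<xi>. (norm (?F \<xi>))\<^sup>2 * ?e \<epsilon> \<xi> \<partial>lborel) = (\<integral>\<xi>. ?F \<xi> * cnj (?F \<xi>) * of_real (?e \<epsilon> \<xi>) \<partial>lborel)"
      by (simp only: complex_norm_square[symmetric] of_real_mult[symmetric] integral_complex_of_real)
    also have "\<dots> = (\<integral>x. f x * (\<integral>y. cnj (f y) * of_real (heat_kernel \<epsilon> (x - y)) \<partial>lborel) \<partial>lborel)"
      by (rule fourier_int_parseval_gaussian[OF f f \<epsilon> \<sigma>])
    also have "ennreal (norm \<dots>) \<le> (\<integral>\<^sup>+x. ennreal (norm (f x * (\<integral>y. cnj (f y) * of_real (heat_kernel \<epsilon> (x - y)) \<partial>lborel))) \<partial>lborel)"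
      by (rule ennreal_norm_integral_le)
    also have "\<dots> \<le> (\<integral>\<^sup>+x. (\<integral>\<^sup>+y. ennreal (norm (f x) * (norm (f y) * heat_kernel \<epsilon> (x - y))) \<partial>lborel) \<partial>lborel)"
    proof (rule nn_integral_mono)
      fix x :: 'a
      have "ennreal (norm (f x)) * ennreal (norm (\<integral>y. cnj (f y) * of_real (heat_kernel \<epsilon> (x - y)) \<partial>lborel))
        \<le> ennreal (norm (f x)) * (\<integral>\<^sup>+y. ennreal (norm (cnj (f y) * of_real (heat_kernel \<epsilon> (x - y)))) \<partial>lborel)"
        by (intro mult_left_mono ennreal_norm_integral_le) auto
      also have "\<dots> = (\<integral>\<^sup>+y. ennreal (norm (f x) * (norm (f y) * heat_kernel \<epsilon> (x - y))) \<partial>lborel)"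
        by (subst nn_integral_cmult[symmetric]) (auto simp: norm_mult ennreal_mult)
      finally show "ennreal (norm (f x * (\<integral>y. cnj (f y) * of_real (heat_kernel \<epsilon> (x - y)) \<partial>lborel)))
        \<le> (\<integral>\<^sup>+y. ennreal (norm (f x) * (norm (f y) * heat_kernel \<epsilon> (x - y))) \<partial>lborel)"
        by (simp add: norm_mult ennreal_mult)
    qed
    also have "\<dots> \<le> (\<integral>\<^sup>+x. (\<integral>\<^sup>+y. (ennreal ((norm (f x))\<^sup>2 / 2) * ennreal (heat_kernel \<epsilon> (x - y))
        + ennreal ((norm (f y))\<^sup>2 / 2) * ennreal (heat_kernel \<epsilon> (x - y))) \<partial>lborel) \<partial>lborel)"
    proof (intro nn_integral_mono)
      fix x y :: 'a
      have "norm (f x) * norm (f y) \<le> ((norm (f x))\<^sup>2 + (norm (f y))\<^sup>2) / 2"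
        using sum_squares_bound[of "norm (f x)" "norm (f y)"] by simp
      then have "norm (f x) * norm (f y) * heat_kernel \<epsilon> (x - y) \<le> ((norm (f x))\<^sup>2 + (norm (f y))\<^sup>2) / 2 * heat_kernel \<epsilon> (x - y)"
        by (rule mult_right_mono) simp
      then show "ennreal (norm (f x) * (norm (f y) * heat_kernel \<epsilon> (x - y))) \<le> ennreal ((norm (f x))\<^sup>2 / 2) * ennreal (heat_kernel \<epsilon> (x - y))
        + ennreal ((norm (f y))\<^sup>2 / 2) * ennreal (heat_kernel \<epsilon> (x - y))"
        by (simp add: ennreal_mult[symmetric] ennreal_plus[symmetric] mult.assoc add_divide_distrib distrib_right ennreal_leI del: ennreal_plus)
    qed
    also have "\<dots> = (\<integral>\<^sup>+x. (\<integral>\<^sup>+y. ennreal ((norm (f x))\<^sup>2 / 2) * ennreal (heat_kernel \<epsilon> (x - y)) \<partial>lborel) \<partial>lborel)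
        + (\<integral>\<^sup>+y. (\<integral>\<^sup>+x. ennreal ((norm (f y))\<^sup>2 / 2) * ennreal (heat_kernel \<epsilon> (x - y)) \<partial>lborel) \<partial>lborel)"
      by (subst (3) lborel_pair.Fubini') (simp_all add: nn_integral_add)
    also have "\<dots> = (\<integral>\<^sup>+x. ennreal ((norm (f x))\<^sup>2 / 2) \<partial>lborel) + (\<integral>\<^sup>+x. ennreal ((norm (f x))\<^sup>2 / 2) \<partial>lborel)"
      using nn_integral_lborel_minus[of "\<lambda>z::'a. ennreal (heat_kernel \<epsilon> z)"] nn_integral_lborel_translate[of "\<lambda>z::'a. ennreal (heat_kernel \<epsilon> z)" "- _"]
      by (simp add: nn_integral_cmult heat1[OF \<epsilon>])
    also have "\<dots> = (\<integral>\<^sup>+x. ennreal ((norm (f x))\<^sup>2) \<partial>lborel)"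
      by (subst nn_integral_add[symmetric]) (auto simp: ennreal_plus[symmetric] simp del: ennreal_plus)
    also have "\<dots> = ennreal ((norm (L2_class f))\<^sup>2)" by (rule nn_norm_L2_class[OF sq])
    finally show ?thesis .
  qed
  \<comment> \<open>The damping is removed by Fatou's lemma along the values \<epsilon> =
    1/(k+1).\<close>
  have "(\<integral>\<^sup>+\<xi>. ennreal ((norm (?F \<xi>))\<^sup>2) \<partial>lborel) = (\<integral>\<^sup>+\<xi>. liminf (\<lambda>k. ennreal ((norm (?F \<xi>))\<^sup>2 * ?e (1 / real (Suc k)) \<xi>)) \<partial>lborel)"
  proof (rule nn_integral_cong)
    fix \<xi> :: 'a
    have "(\<lambda>k. ?e (1 / real (Suc k)) \<xi>) \<longlonglongrightarrow> exp (- 0 * (norm \<xi>)\<^sup>2 / 2)"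
      by (intro tendsto_intros LIMSEQ_inverse_real_of_nat[unfolded inverse_eq_divide]) auto
    then have "(\<lambda>k. ennreal ((norm (?F \<xi>))\<^sup>2 * ?e (1 / real (Suc k)) \<xi>)) \<longlonglongrightarrow> ennreal ((norm (?F \<xi>))\<^sup>2 * 1)"
      by (intro tendsto_intros) simp
    from lim_imp_Liminf[OF _ this]
    show "ennreal ((norm (?F \<xi>))\<^sup>2) = liminf (\<lambda>k. ennreal ((norm (?F \<xi>))\<^sup>2 * ?e (1 / real (Suc k)) \<xi>))"
      by (simp only: trivial_limit_sequentially not_False_eq_True mult_1_right)
  qed
  also have "\<dots> \<le> liminf (\<lambda>k. \<integral>\<^sup>+\<xi>. ennreal ((norm (?F \<xi>))\<^sup>2 * ?e (1 / real (Suc k)) \<xi>) \<partial>lborel)"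
    by (rule nn_integral_liminf) measurable
  also have "\<dots> \<le> ennreal ((norm (L2_class f))\<^sup>2)"
    by (rule Liminf_le[OF trivial_limit_sequentially always_eventually], rule allI, rule le) simp
  finally show "square_integrable (fourier_int \<sigma> f)" "norm (L2_class (fourier_int \<sigma> f)) \<le> norm (L2_class f)"
    by (auto intro!: norm_L2_class_le[of ?F])
qed

section \<open>Extension of the transform from truncated functions to L^2\<close>

lemma measurable_cutoff [measurable]: "cutoff R f \<in> borel_measurable borel"
  unfolding cutoff_def by measurable

lemma square_integrable_cutoff [simp]: "square_integrable (cutoff R f)"
  by (rule square_integrable_bound[of "rep_L2 f" _ 1]) (auto simp: cutoff_def)

lemma integrable_cutoff [simp]: "integrable lborel (cutoff R (f :: 'a::euclidean_space L2))"
proof -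
  have "square_integrable (\<lambda>x::'a. indicator (cball 0 R) x :: complex)"
  proof -
    have "(\<lambda>x::'a. (norm (indicator (cball 0 R) x :: complex))\<^sup>2) = indicator (cball 0 R)"
      by (auto simp: indicator_def fun_eq_iff)
    moreover have "integrable lborel (indicator (cball (0::'a) R) :: 'a \<Rightarrow> real)"
      by (rule integrable_real_indicator) (use emeasure_lborel_cball_finite[of "0::'a" R] in auto)
    moreover have [measurable]: "cball (0::'a) R \<in> sets borel" by simp
    moreover have "(\<lambda>x. indicator (cball (0::'a) R) x :: complex) \<in> borel_measurable borel"
      unfolding indicator_def of_bool_def by measurable
    ultimately show ?thesis by (simp add: square_integrable_def)
  qed
  from integrable_mult_L2[OF this square_integrable_rep, of f]
  show ?thesis
    by (rule Bochner_Integration.integrable_cong[THEN iffD1, rotated -1]) (auto simp: cutoff_def indicator_def)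
qed

lemma L2_class_cutoff_tendsto:
  fixes f :: "'a::euclidean_space L2"
  shows "((\<lambda>R. L2_class (cutoff R f)) \<longlongrightarrow> f) at_top"
proof -
  have "((\<lambda>R. (\<integral>x. (norm (cutoff R f x - rep_L2 f x))\<^sup>2 \<partial>lborel)) \<longlongrightarrow> (\<integral>x. 0 \<partial>(lborel :: 'a measure))) at_top"
  proof (rule integral_dominated_convergence_at_top)
    show "integrable lborel (\<lambda>x. (norm (rep_L2 f x))\<^sup>2)"
      using square_integrable_rep[of f] by (simp add: square_integrable_def)
    show "\<forall>\<^sub>F R in at_top. AE x in lborel. norm ((norm (cutoff R f x - rep_L2 f x))\<^sup>2) \<le> (norm (rep_L2 f x))\<^sup>2"
      by (intro always_eventually allI AE_I2) (auto simp: cutoff_def)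
    show "AE x in lborel. ((\<lambda>R. (norm (cutoff R f x - rep_L2 f x))\<^sup>2) \<longlongrightarrow> 0) at_top"
    proof (rule AE_I2)
      fix x
      have "\<forall>\<^sub>F R in at_top. (norm (cutoff R f x - rep_L2 f x))\<^sup>2 = 0"
        using eventually_ge_at_top[of "norm x"] by eventually_elim (auto simp: cutoff_def)
      then show "((\<lambda>R. (norm (cutoff R f x - rep_L2 f x))\<^sup>2) \<longlongrightarrow> 0) at_top"
        by (rule tendsto_eventually)
    qed
  qed measurable
  then have "((\<lambda>R. sqrt (\<integral>x. (norm (cutoff R f x - rep_L2 f x))\<^sup>2 \<partial>lborel)) \<longlongrightarrow> sqrt 0) at_top"
    by (intro tendsto_real_sqrt) simp
  moreover have "norm (L2_class (cutoff R f) - f) = sqrt (\<integral>x. (norm (cutoff R f x - rep_L2 f x))\<^sup>2 \<partial>lborel)" for R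
    using L2_class_diff[of "cutoff R f" "rep_L2 f"] norm_L2_class[of "\<lambda>x. cutoff R f x - rep_L2 f x"]
    by (simp add: square_integrable_diff)
  ultimately have "((\<lambda>R. norm (L2_class (cutoff R f) - f)) \<longlongrightarrow> 0) at_top" by simp
  then show ?thesis by (simp add: tendsto_norm_zero_iff LIM_zero_iff)
qed

definition fourier_L2 :: "real \<Rightarrow> 'a::euclidean_space L2 \<Rightarrow> 'a L2" where
  "fourier_L2 \<sigma> f = Lim at_top (\<lambda>R. L2_class (fourier_int \<sigma> (cutoff R f)))"

lemma fourier_eq: "fourier = fourier_L2 (-1)" and inv_fourier_eq: "inv_fourier = fourier_L2 1"
  by (simp_all add: fun_eq_iff fourier_def inv_fourier_def fourier_L2_def fourier_integral_eq inv_fourier_integral_eq)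

lemma fourier_int_L2_diff_le:
  assumes "integrable lborel f" "square_integrable f" "integrable lborel g" "square_integrable g" "\<sigma> * \<sigma> = 1"
  shows "norm (L2_class (fourier_int \<sigma> f) - L2_class (fourier_int \<sigma> g)) \<le> norm (L2_class f - L2_class g)"
proof -
  have "fourier_int \<sigma> (\<lambda>x. f x - g x) = (\<lambda>\<xi>. fourier_int \<sigma> f \<xi> - fourier_int \<sigma> g \<xi>)"
    using assms by (simp add: fun_eq_iff fourier_int_diff)
  then have "L2_class (fourier_int \<sigma> f) - L2_class (fourier_int \<sigma> g) = L2_class (fourier_int \<sigma> (\<lambda>x. f x - g x))"
    using assms by (subst L2_class_diff) (auto intro: fourier_int_contraction)
  then show ?thesis
    using assms by (simp add: L2_class_diff fourier_int_contraction square_integrable_diff)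
qed

text \<open>\<open>Lim\<close> carries information only once the limit exists. Completeness is
  sequential, so a limit \<open>L\<close> is found along integer radii; the truncation error
  \<open>d R\<close> then bounds the distance to \<open>L\<close> at every real radius.\<close>

lemma fourier_L2_tendsto:
  fixes f :: "'a::euclidean_space L2"
  assumes \<sigma>: "\<sigma> * \<sigma> = 1"
  shows "((\<lambda>R. L2_class (fourier_int \<sigma> (cutoff R f))) \<longlongrightarrow> fourier_L2 \<sigma> f) at_top"
proof -
  define Y where "Y R = L2_class (fourier_int \<sigma> (cutoff R f))" for R
  define d where "d R = norm (L2_class (cutoff R f) - f)" for R
  have Yd: "norm (Y R - Y S) \<le> d R + d S" for R S
  proof -
    have "norm (Y R - Y S) \<le> norm ((L2_class (cutoff R f) - f) - (L2_class (cutoff S f) - f))"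
      using fourier_int_L2_diff_le[OF _ _ _ _ \<sigma>, of "cutoff R f" "cutoff S f"] by (simp add: Y_def)
    also have "\<dots> \<le> d R + d S" unfolding d_def by (rule norm_triangle_ineq4)
    finally show ?thesis .
  qed
  have d0: "(d \<longlongrightarrow> 0) at_top"
    using L2_class_cutoff_tendsto[of f] unfolding d_def by (simp add: tendsto_norm_zero_iff LIM_zero_iff)
  have dn: "(\<lambda>n. d (real n)) \<longlonglongrightarrow> 0"
    by (rule filterlim_compose[OF d0 filterlim_real_sequentially])
  have "Cauchy (\<lambda>n. Y (real n))"
  proof (rule metric_CauchyI)
    fix e :: real assume "e > 0"
    then have "\<forall>\<^sub>F n in sequentially. d (real n) < e / 2"
      using dn by (auto simp: tendsto_iff d_def dist_real_def elim!: allE[of _ "e/2"])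
    then obtain N where N: "\<And>n. n \<ge> N \<Longrightarrow> d (real n) < e/2" by (auto simp: eventually_sequentially)
    show "\<exists>M. \<forall>m\<ge>M. \<forall>n\<ge>M. dist (Y (real m)) (Y (real n)) < e"
      using Yd N by (intro exI[of _ N]) (auto simp: dist_norm intro!: order.strict_trans1[OF Yd] , smt (verit) N field_sum_of_halves)
  qed
  then obtain L where L: "(\<lambda>n. Y (real n)) \<longlonglongrightarrow> L" using Cauchy_convergent_iff convergent_def by blast
  have "norm (Y R - L) \<le> d R" for R
  proof (rule tendsto_le[OF trivial_limit_sequentially])
    show "(\<lambda>n. d R + d (real n)) \<longlonglongrightarrow> d R" using tendsto_add[OF tendsto_const dn, of "d R"] by simp
    show "(\<lambda>n. norm (Y R - Y (real n))) \<longlonglongrightarrow> norm (Y R - L)" by (intro tendsto_intros L)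
  qed (use Yd in auto)
  then have "((\<lambda>R. Y R - L) \<longlongrightarrow> 0) at_top"
    by (intro Lim_null_comparison[OF _ d0] always_eventually) auto
  then have "(Y \<longlongrightarrow> L) at_top" by (simp add: LIM_zero_iff)
  moreover from tendsto_Lim[OF _ this] have "fourier_L2 \<sigma> f = L"
    by (simp add: fourier_L2_def Y_def[abs_def])
  ultimately show ?thesis by (simp add: Y_def[abs_def])
qed

text \<open>On integrable L^2 functions the limit is the integral itself, since the truncations
  converge in L^2 and the transform is a contraction.\<close>

lemma fourier_L2_class:
  assumes \<sigma>: "\<sigma> * \<sigma> = 1" and g: "integrable lborel g" "square_integrable g"
  shows "fourier_L2 \<sigma> (L2_class g) = L2_class (fourier_int \<sigma> g)"
proof (rule tendsto_unique[OF _ fourier_L2_tendsto[OF \<sigma>]])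
  have "((\<lambda>R. norm (L2_class (cutoff R (L2_class g)) - L2_class g)) \<longlongrightarrow> 0) at_top"
    using L2_class_cutoff_tendsto[of "L2_class g"] by (simp add: tendsto_norm_zero_iff LIM_zero_iff)
  then have "((\<lambda>R. L2_class (fourier_int \<sigma> (cutoff R (L2_class g))) - L2_class (fourier_int \<sigma> g)) \<longlongrightarrow> 0) at_top"
    by (rule Lim_null_comparison[rotated]) (auto intro!: always_eventually fourier_int_L2_diff_le \<sigma> g)
  then show "((\<lambda>R. L2_class (fourier_int \<sigma> (cutoff R (L2_class g)))) \<longlongrightarrow> L2_class (fourier_int \<sigma> g)) at_top"
    by (simp add: LIM_zero_iff)
qed simp

lemma fourier_int_cong_AE:
  assumes [measurable]: "f \<in> borel_measurable borel" "g \<in> borel_measurable borel"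
    and "AE x in lborel. f x = g x"
  shows "fourier_int \<sigma> f = fourier_int \<sigma> g"
proof -
  have "(\<integral>x. cis (\<sigma> * (x \<bullet> \<xi>)) * f x \<partial>lborel) = (\<integral>x. cis (\<sigma> * (x \<bullet> \<xi>)) * g x \<partial>lborel)" for \<xi>
    by (rule integral_cong_AE) (use assms(3) in auto)
  then show ?thesis by (simp add: fourier_int_def fun_eq_iff)
qed

lemma scaleR_eq_scaleC: "c *\<^sub>R (f :: 'a::euclidean_space L2) = of_real c *\<^sub>C f"
  using L2_class_scaleC[of "rep_L2 f" "of_real c"] L2_class_scaleR[of "rep_L2 f" c]
  by (simp add: scaleR_conv_of_real)

context
  fixes \<sigma> :: real
  assumes \<sigma>: "\<sigma> * \<sigma> = 1"
begin

lemma fourier_L2_add: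
  fixes f g :: "'a::euclidean_space L2"
  shows "fourier_L2 \<sigma> (f + g) = fourier_L2 \<sigma> f + fourier_L2 \<sigma> g"
proof (rule tendsto_unique[OF _ fourier_L2_tendsto[OF \<sigma>]])
  have "L2_class (fourier_int \<sigma> (cutoff R (f + g))) = L2_class (fourier_int \<sigma> (cutoff R f)) + L2_class (fourier_int \<sigma> (cutoff R g))" for R
  proof -
    have "fourier_int \<sigma> (cutoff R (f + g)) = fourier_int \<sigma> (\<lambda>x. cutoff R f x + cutoff R g x)"
      by (rule fourier_int_cong_AE) (use rep_L2_add[of f g] in \<open>auto simp: cutoff_def elim!: eventually_mono\<close>)
    also have "\<dots> = (\<lambda>\<xi>. fourier_int \<sigma> (cutoff R f) \<xi> + fourier_int \<sigma> (cutoff R g) \<xi>)"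
      by (simp add: fourier_int_add fun_eq_iff)
    finally show ?thesis by (simp add: L2_class_add fourier_int_contraction \<sigma>)
  qed
  then show "((\<lambda>R. L2_class (fourier_int \<sigma> (cutoff R (f + g)))) \<longlongrightarrow> fourier_L2 \<sigma> f + fourier_L2 \<sigma> g) at_top"
    by (simp add: tendsto_add fourier_L2_tendsto[OF \<sigma>])
qed simp

lemma fourier_L2_scaleC:
  fixes f :: "'a::euclidean_space L2"
  shows "fourier_L2 \<sigma> (c *\<^sub>C f) = c *\<^sub>C fourier_L2 \<sigma> f"
proof (rule tendsto_unique[OF _ fourier_L2_tendsto[OF \<sigma>]])
  have "L2_class (fourier_int \<sigma> (cutoff R (c *\<^sub>C f))) = c *\<^sub>C L2_class (fourier_int \<sigma> (cutoff R f))" for R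
  proof -
    have "fourier_int \<sigma> (cutoff R (c *\<^sub>C f)) = fourier_int \<sigma> (\<lambda>x. c * cutoff R f x)"
      by (rule fourier_int_cong_AE) (use rep_L2_scaleC[of c f] in \<open>auto simp: cutoff_def elim!: eventually_mono\<close>)
    also have "\<dots> = (\<lambda>\<xi>. c * fourier_int \<sigma> (cutoff R f) \<xi>)"
      by (simp add: fourier_int_cmult fun_eq_iff)
    finally show ?thesis by (simp add: L2_class_scaleC fourier_int_contraction \<sigma>)
  qed
  then show "((\<lambda>R. L2_class (fourier_int \<sigma> (cutoff R (c *\<^sub>C f)))) \<longlongrightarrow> c *\<^sub>C fourier_L2 \<sigma> f) at_top"
    by (simp add: bounded_linear.tendsto[OF bounded_linear_scaleC] fourier_L2_tendsto[OF \<sigma>])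
qed simp

lemma norm_fourier_L2_le: "norm (fourier_L2 \<sigma> f) \<le> norm (f :: 'a::euclidean_space L2)"
proof (rule tendsto_le)
  show "((\<lambda>R. norm (L2_class (cutoff R f))) \<longlongrightarrow> norm f) at_top"
    by (intro tendsto_norm L2_class_cutoff_tendsto)
  show "((\<lambda>R. norm (L2_class (fourier_int \<sigma> (cutoff R f)))) \<longlongrightarrow> norm (fourier_L2 \<sigma> f)) at_top"
    by (intro tendsto_norm fourier_L2_tendsto \<sigma>)
qed (auto intro!: always_eventually fourier_int_contraction \<sigma>)

lemma bounded_linear_fourier_L2: "bounded_linear (fourier_L2 \<sigma> :: 'a::euclidean_space L2 \<Rightarrow> 'a L2)"
  by (rule bounded_linear_intro[of _ 1])
     (auto simp: fourier_L2_add scaleR_eq_scaleC fourier_L2_scaleC norm_fourier_L2_le)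

end

section \<open>Adjoint, Parseval identity and inversion\<close>

lemma inner_L2_class_Re:
  assumes "square_integrable f" "square_integrable g"
  shows "L2_class f \<bullet> L2_class g = Re (\<integral>x. f x * cnj (g x) \<partial>lborel)"
proof -
  have "square_integrable (\<lambda>x. cnj (g x))" using assms(2) by (auto simp: square_integrable_def)
  then have "integrable lborel (\<lambda>x. f x * cnj (g x))"
    by (rule integrable_mult_L2[OF assms(1)])
  from integral_Re[OF this] show ?thesis
    by (simp add: inner_L2_class[OF assms] inner_complex_def)
qed

lemma fourier_int_adjoint:
  assumes \<sigma>: "\<sigma> * \<sigma> = 1"
    and f: "integrable lborel f" "square_integrable f" and g: "integrable lborel g" "square_integrable g"
  shows "L2_class (fourier_int \<sigma> f) \<bullet> L2_class g = L2_class f \<bullet> L2_class (fourier_int (- \<sigma>) g)"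
proof -
  have "(\<integral>\<xi>. fourier_int \<sigma> f \<xi> * cnj (g \<xi>) \<partial>lborel) = (\<integral>x. f x * fourier_int \<sigma> (\<lambda>\<xi>. cnj (g \<xi>)) x \<partial>lborel)"
    by (rule fourier_int_mult_formula) (use f g in auto)
  then show ?thesis
    using f g \<sigma> by (simp add: inner_L2_class_Re fourier_int_contraction cnj_fourier_int)
qed

lemma fourier_L2_adjoint:
  fixes f g :: "'a::euclidean_space L2"
  assumes \<sigma>: "\<sigma> * \<sigma> = 1"
  shows "fourier_L2 \<sigma> f \<bullet> g = f \<bullet> fourier_L2 (- \<sigma>) g"
proof (rule tendsto_unique[OF trivial_limit_at_top_linorder])
  have \<sigma>': "(- \<sigma>) * (- \<sigma>) = 1" using \<sigma> by simp
  show "((\<lambda>R. L2_class (fourier_int \<sigma> (cutoff R f)) \<bullet> L2_class (cutoff R g)) \<longlongrightarrow> fourier_L2 \<sigma> f \<bullet> g) at_top"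
    by (intro tendsto_inner fourier_L2_tendsto L2_class_cutoff_tendsto \<sigma>)
  have "((\<lambda>R. L2_class (cutoff R f) \<bullet> L2_class (fourier_int (-\<sigma>) (cutoff R g))) \<longlongrightarrow> f \<bullet> fourier_L2 (-\<sigma>) g) at_top"
    by (intro tendsto_inner fourier_L2_tendsto L2_class_cutoff_tendsto \<sigma>')
  moreover have "L2_class (fourier_int \<sigma> (cutoff R f)) \<bullet> L2_class (cutoff R g) = L2_class (cutoff R f) \<bullet> L2_class (fourier_int (-\<sigma>) (cutoff R g))" for R
    by (rule fourier_int_adjoint[OF \<sigma>]) simp_all
  ultimately show "((\<lambda>R. L2_class (fourier_int \<sigma> (cutoff R f)) \<bullet> L2_class (cutoff R g)) \<longlongrightarrow> f \<bullet> fourier_L2 (-\<sigma>) g) at_top"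
    by (simp only:)
qed

text \<open>Boxes are stable under intersection and generate the Borel sets, so a Dynkin-system
  argument extends the hypothesis to all Borel sets. Intersecting with the growing boxes
  \<open>Q k\<close> makes \<open>h\<close> integrable, as the complement and union steps
  require.\<close>

lemma L2_zero_if_boxes:
  fixes h :: "'a::euclidean_space \<Rightarrow> complex"
  assumes h: "square_integrable h"
    and 0: "\<And>a b. (\<integral>x. indicator (box a b) x *\<^sub>R h x \<partial>lborel) = 0"
  shows "AE x in lborel. h x = 0"
proof -
  have [measurable]: "h \<in> borel_measurable borel" using h by (rule square_integrable_measurable)
  define Q where "Q k = box (- real k *\<^sub>R One) (real k *\<^sub>R (One :: 'a))" for k :: nat
  have [measurable]: "Q k \<in> sets borel" for k by (simp add: Q_def)
  have intQ: "integrable lborel (\<lambda>x. indicator (Q k) x *\<^sub>R h x)" for k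
  proof -
    have "square_integrable (\<lambda>x. indicator (Q k) x :: complex)"
    proof -
      have "(\<lambda>x::'a. (norm (indicator (Q k) x :: complex))\<^sup>2) = indicator (Q k)"
        by (auto simp: indicator_def fun_eq_iff)
      moreover have "integrable lborel (indicator (Q k) :: 'a \<Rightarrow> real)"
        by (rule integrable_real_indicator) (auto simp: Q_def emeasure_lborel_box_finite[unfolded infinity_ennreal_def])
      moreover have "(\<lambda>x. indicator (Q k) x :: complex) \<in> borel_measurable borel"
        unfolding indicator_def of_bool_def by measurable
      ultimately show ?thesis by (simp add: square_integrable_def)
    qed
    from integrable_mult_L2[OF this h] show ?thesis
      by (rule Bochner_Integration.integrable_cong[THEN iffD1, rotated -1]) (auto simp: indicator_def)
  qed
  have "AE x in lborel. indicator (Q k) x *\<^sub>R h x = 0" for k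
  proof (rule sigma_finite_measure.density_zero[OF sigma_finite_lborel intQ])
    fix A :: "'a set" assume "A \<in> sets lborel"
    then have A: "A \<in> sigma_sets UNIV (range (\<lambda>(a, b). box a b))"
      by (simp add: borel_eq_box)
    have meas: "sigma_sets UNIV (range (\<lambda>(a, b). box a b)) = sets (borel :: 'a measure)"
      by (simp add: borel_eq_box)
    have Iint: "integrable lborel (\<lambda>x. indicator A x *\<^sub>R (indicator (Q k) x *\<^sub>R h x))" if "A \<in> sets borel" for A
      by (rule integrable_mult_indicator[OF _ intQ]) (use that in simp)
    have "Int_stable (range (\<lambda>(a, b). box a b :: 'a set))"
      by (auto simp: Int_stable_def box_Int_box)
    moreover have "range (\<lambda>(a, b). box a b :: 'a set) \<subseteq> Pow UNIV" by simp
    ultimately have "(\<integral>x. indicator A x *\<^sub>R (indicator (Q k) x *\<^sub>R h x) \<partial>lborel) = 0"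
      using A
    proof (induction A rule: sigma_sets_induct_disjoint)
      case (basic A)
      then obtain a b where "A = box a b" by auto
      then obtain c d where cd: "A \<inter> Q k = box c d" unfolding Q_def using box_Int_box by blast
      have "(\<lambda>x. indicator A x *\<^sub>R (indicator (Q k) x *\<^sub>R h x)) = (\<lambda>x. indicator (box c d) x *\<^sub>R h x)"
        by (auto simp: cd[symmetric] indicator_def fun_eq_iff)
      then show ?case using 0 by simp
    next
      case empty
      show ?case by simp
    next
      case (compl A)
      then have "A \<in> sets borel" by (simp add: meas)
      have "(\<lambda>x. indicator (UNIV - A) x *\<^sub>R (indicator (Q k) x *\<^sub>R h x)) = (\<lambda>x. indicator (Q k) x *\<^sub>R h x - indicator A x *\<^sub>R (indicator (Q k) x *\<^sub>R h x))"
        by (auto simp: indicator_def fun_eq_iff)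
      then show ?case
        using compl 0 Iint[OF \<open>A \<in> sets borel\<close>] intQ by (simp add: Q_def)
    next
      case (union A)
      then have A: "A i \<in> sets borel" for i by (auto simp: meas)
      have "(\<integral>x\<in>(\<Union>i. A i). (indicator (Q k) x *\<^sub>R h x) \<partial>lborel) = (\<Sum>i. \<integral>x\<in>A i. (indicator (Q k) x *\<^sub>R h x) \<partial>lborel)"
      proof (rule lebesgue_integral_countable_add)
        show "A i \<inter> A j = {}" if "i \<noteq> j" for i j
          using union(1) that by (auto simp: disjoint_family_on_def)
        show "set_integrable lborel (\<Union>i. A i) (\<lambda>x. indicator (Q k) x *\<^sub>R h x)"
          unfolding set_integrable_def by (rule Iint) (use A in auto)
      qed (use A in auto)
      then show ?case using union by (simp add: set_lebesgue_integral_def)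
    qed
    then show "(\<integral>x\<in>A. (indicator (Q k) x *\<^sub>R h x) \<partial>lborel) = 0"
      by (simp add: set_lebesgue_integral_def)
  qed
  then have "AE x in lborel. \<forall>k. indicator (Q k) x *\<^sub>R h x = 0" by (subst AE_all_countable) blast
  then show ?thesis
  proof eventually_elim
    case (elim x)
    obtain k :: nat where k: "real k > norm x" using reals_Archimedean2 by blast
    have "x \<in> Q k" unfolding Q_def mem_box
    proof
      fix i :: 'a assume i: "i \<in> Basis"
      then have "\<bar>x \<bullet> i\<bar> < real k" using Basis_le_norm[OF i, of x] k by linarith
      then show "(- real k *\<^sub>R One) \<bullet> i < x \<bullet> i \<and> x \<bullet> i < (real k *\<^sub>R One) \<bullet> i"
        using i by (auto simp: abs_less_iff)
    qed
    then show ?case using elim[rule_format, of k] by simp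
  qed
qed

text \<open>The substitution \<open>y = x - sqrt \<epsilon> w\<close> fixes the kernel and moves the
  shrinking scale into the indicator, which is locally constant off the frontier; dominated
  convergence concludes.\<close>

lemma heat_kernel_box_tendsto:
  fixes x :: "'a::euclidean_space"
  assumes "x \<notin> frontier (box a b)"
  shows "(\<lambda>k. \<integral>y. c * of_bool (y \<in> box a b) * of_real (heat_kernel (1 / real (Suc k)) (x - y)) \<partial>lborel)
    \<longlonglongrightarrow> (c :: complex) * of_bool (x \<in> box a b)"
proof -
  define G :: "'a \<Rightarrow> complex" where "G y = c * of_bool (y \<in> box a b)" for y
  have [measurable]: "G \<in> borel_measurable borel" unfolding G_def of_bool_def by measurable
  define r where "r k = - sqrt (1 / real (Suc k))" for k
  have r0: "r k \<noteq> 0" for k by (simp add: r_def)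
  have hk1: "integrable lborel (heat_kernel 1 :: 'a \<Rightarrow> real)" "(\<integral>w. heat_kernel 1 w \<partial>(lborel :: 'a measure)) = 1"
    using heat_kernel_integral[of 1, where 'a='a] by (auto simp: has_bochner_integral_iff)
  \<comment> \<open>The Jacobian \<open>\<epsilon>^(n/2)\<close> of the substitution cancels the
    normalisation of the kernel.\<close>
  have scale: "\<bar>r k\<bar> ^ DIM('a) * heat_kernel (1 / real (Suc k)) (r k *\<^sub>R w) = heat_kernel 1 (w :: 'a)" for k w
  proof -
    define e where "e = 1 / real (Suc k)"
    have e: "e > 0" by (simp add: e_def)
    have r: "r k = - sqrt e" by (simp only: r_def e_def)
    have "\<bar>r k\<bar> ^ DIM('a) = e powr (real DIM('a) / 2)"
      using e by (simp add: r powr_half_sqrt[symmetric] powr_realpow[symmetric] powr_powr)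
    moreover have "(norm (r k *\<^sub>R w))\<^sup>2 = e * (norm w)\<^sup>2"
      using e by (simp add: r power_mult_distrib)
    moreover have "(2 * pi * e) powr (- real DIM('a) / 2) = (2 * pi) powr (- real DIM('a) / 2) * e powr (- real DIM('a) / 2)"
      using e by (subst powr_mult) auto
    moreover have "e powr (real DIM('a) / 2) * e powr (- real DIM('a) / 2) = 1"
      using e by (simp flip: powr_add)
    ultimately show ?thesis using e
      unfolding heat_kernel_def e_def[symmetric] by (simp add: mult.assoc mult.left_commute[of _ "(2 * pi) powr _"])
  qed
  have sub: "(\<integral>y. G y * of_real (heat_kernel (1 / real (Suc k)) (x - y)) \<partial>lborel) = (\<integral>w. G (x + r k *\<^sub>R w) * of_real (heat_kernel 1 w) \<partial>lborel)" for k
  proof -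
    have "(\<integral>y. G y * of_real (heat_kernel (1 / real (Suc k)) (x - y)) \<partial>lborel)
      = \<bar>r k\<bar> ^ DIM('a) *\<^sub>R (\<integral>w. G (x + r k *\<^sub>R w) * of_real (heat_kernel (1 / real (Suc k)) (x - (x + r k *\<^sub>R w))) \<partial>lborel)"
      by (rule integral_lborel_affine[OF _ r0]) measurable
    also have "\<dots> = (\<integral>w. \<bar>r k\<bar> ^ DIM('a) *\<^sub>R (G (x + r k *\<^sub>R w) * of_real (heat_kernel (1 / real (Suc k)) (x - (x + r k *\<^sub>R w)))) \<partial>lborel)"
      by (simp only: integral_scaleR_right)
    also have "\<dots> = (\<integral>w. G (x + r k *\<^sub>R w) * of_real (heat_kernel 1 w) \<partial>lborel)"
    proof (rule Bochner_Integration.integral_cong)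
      fix w :: 'a
      have "heat_kernel (1 / real (Suc k)) (x - (x + r k *\<^sub>R w)) = heat_kernel (1 / real (Suc k)) (r k *\<^sub>R w)"
        by (simp add: heat_kernel_def)
      then show "\<bar>r k\<bar> ^ DIM('a) *\<^sub>R (G (x + r k *\<^sub>R w) * of_real (heat_kernel (1 / real (Suc k)) (x - (x + r k *\<^sub>R w)))) = G (x + r k *\<^sub>R w) * of_real (heat_kernel 1 w)"
        unfolding scale[symmetric, of w k] by (simp add: scaleR_conv_of_real mult_ac)
    qed simp
    finally show ?thesis .
  qed
  have "(\<lambda>k. \<integral>w. G (x + r k *\<^sub>R w) * of_real (heat_kernel 1 w) \<partial>lborel) \<longlonglongrightarrow> (\<integral>w. G x * of_real (heat_kernel 1 w) \<partial>(lborel :: 'a measure))"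
  proof (rule integral_dominated_convergence)
    show "integrable lborel (\<lambda>w::'a. norm c * heat_kernel 1 w)" using hk1 by simp
    show "AE w in lborel. norm (G (x + r k *\<^sub>R w) * of_real (heat_kernel 1 w)) \<le> norm c * heat_kernel 1 w" for k
      by (auto simp: G_def norm_mult of_bool_def intro!: AE_I2)
    show "AE w in lborel. (\<lambda>k. G (x + r k *\<^sub>R w) * of_real (heat_kernel 1 w)) \<longlonglongrightarrow> G x * of_real (heat_kernel 1 w)"
    proof (intro AE_I2 tendsto_mult tendsto_const)
      fix w :: 'a
      have "r \<longlonglongrightarrow> - sqrt 0" unfolding r_def
        by (intro tendsto_intros LIMSEQ_inverse_real_of_nat[unfolded inverse_eq_divide])
      then have lim: "(\<lambda>k. x + r k *\<^sub>R w) \<longlonglongrightarrow> x"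
        using tendsto_add[OF tendsto_const tendsto_scaleR[OF _ tendsto_const], of r 0 sequentially x w] by simp
      have "\<forall>\<^sub>F k in sequentially. G (x + r k *\<^sub>R w) = G x"
      proof (cases "x \<in> box a b")
        case True
        from topological_tendstoD[OF lim open_box True] show ?thesis
          by eventually_elim (simp add: G_def True)
      next
        case False
        then have "x \<in> - closure (box a b)" using assms by (simp add: frontier_def interior_open[OF open_box])
        from topological_tendstoD[OF lim _ this] have "\<forall>\<^sub>F k in sequentially. x + r k *\<^sub>R w \<in> - closure (box a b)"
          by auto
        then show ?thesis
          by eventually_elim (use False closure_subset[of "box a b"] in \<open>auto simp: G_def\<close>)
      qed
      then show "(\<lambda>k. G (x + r k *\<^sub>R w)) \<longlonglongrightarrow> G x" by (rule tendsto_eventually)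
    qed
  qed measurable
  also have "(\<integral>w. G x * of_real (heat_kernel 1 w) \<partial>(lborel :: 'a measure)) = G x"
    using hk1 by (simp add: integral_complex_of_real)
  finally show ?thesis unfolding sub[symmetric] unfolding G_def .
qed

lemma frontier_box_null: "AE x in lborel. x \<notin> frontier (box a (b :: 'a::euclidean_space))"
proof -
  have "frontier (box a b) \<in> null_sets lborel"
    using null_sets_completion_iff[of "frontier (box a b)" lborel] negligible_convex_frontier[of "box a b"]
    by (simp add: negligible_iff_null_sets)
  then show ?thesis by (rule AE_not_in)
qed

text \<open>For a multiple of the indicator of a box the mollified function stays bounded by
  \<open>norm c\<close> and converges off a null set, so the damped identity passes to the limit
  with majorant \<open>norm (f x) * norm c\<close>. Boxes are enough, because they detect when an
  L^2 function vanishes.\<close>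

lemma fourier_int_parseval_box:
  fixes f :: "'a::euclidean_space \<Rightarrow> complex" and c :: complex and a b :: 'a
  assumes \<sigma>: "\<sigma> * \<sigma> = 1" and f: "integrable lborel f" "square_integrable f"
  defines "g \<equiv> \<lambda>x. c * of_bool (x \<in> box a b)"
  shows "integrable lborel g" "square_integrable g"
    "L2_class (fourier_int \<sigma> f) \<bullet> L2_class (fourier_int \<sigma> g) = L2_class f \<bullet> L2_class g"
proof -
  note [measurable] = borel_measurable_integrable[OF f(1)]
  have [measurable]: "g \<in> borel_measurable borel" unfolding g_def of_bool_def by measurable
  have fin: "integrable lborel (indicator (box a b) :: 'a \<Rightarrow> real)"
    by (rule integrable_real_indicator) (use emeasure_lborel_box_finite[of a b] in auto)
  show g1: "integrable lborel g"
    by (rule Bochner_Integration.integrable_bound[OF integrable_mult_right[OF fin, of "norm c"]])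
       (auto simp: g_def indicator_def norm_mult)
  have "integrable lborel (\<lambda>x. (norm c)\<^sup>2 * indicator (box a b) x)" using fin by simp
  then have "integrable lborel (\<lambda>x. (norm (g x))\<^sup>2)"
    by (rule Bochner_Integration.integrable_cong[THEN iffD1, rotated -1]) (auto simp: g_def indicator_def norm_mult)
  then show g2: "square_integrable g" by (simp add: square_integrable_def)
  let ?e = "\<lambda>k \<xi>::'a. complex_of_real (exp (- (1 / real (Suc k)) * (norm \<xi>)\<^sup>2 / 2))"
  have F: "square_integrable (fourier_int \<sigma> f)" "square_integrable (fourier_int \<sigma> g)"
    using fourier_int_contraction f g1 g2 \<sigma> by auto
  then have cF: "square_integrable (\<lambda>x. cnj (fourier_int \<sigma> g x))" by (auto simp: square_integrable_def)
  have L: "(\<lambda>k. \<integral>\<xi>. fourier_int \<sigma> f \<xi> * cnj (fourier_int \<sigma> g \<xi>) * ?e k \<xi> \<partial>lborel)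
    \<longlonglongrightarrow> (\<integral>\<xi>. fourier_int \<sigma> f \<xi> * cnj (fourier_int \<sigma> g \<xi>) \<partial>lborel)"
  proof (rule integral_dominated_convergence)
    show "integrable lborel (\<lambda>\<xi>. norm (fourier_int \<sigma> f \<xi> * cnj (fourier_int \<sigma> g \<xi>)))"
      by (intro integrable_norm integrable_mult_L2 F cF)
    show "AE x in lborel. (\<lambda>k. fourier_int \<sigma> f x * cnj (fourier_int \<sigma> g x) * ?e k x) \<longlonglongrightarrow> fourier_int \<sigma> f x * cnj (fourier_int \<sigma> g x)"
    proof (rule AE_I2)
      fix x :: 'a
      have "(\<lambda>k. ?e k x) \<longlonglongrightarrow> complex_of_real (exp (- 0 * (norm x)\<^sup>2 / 2))"
        by (intro tendsto_intros LIMSEQ_inverse_real_of_nat[unfolded inverse_eq_divide]) auto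
      from tendsto_mult[OF tendsto_const this]
      show "(\<lambda>k. fourier_int \<sigma> f x * cnj (fourier_int \<sigma> g x) * ?e k x) \<longlonglongrightarrow> fourier_int \<sigma> f x * cnj (fourier_int \<sigma> g x)"
        by simp
    qed
    show "AE x in lborel. norm (fourier_int \<sigma> f x * cnj (fourier_int \<sigma> g x) * ?e k x) \<le> norm (fourier_int \<sigma> f x * cnj (fourier_int \<sigma> g x))" for k
      by (intro AE_I2) (auto simp: norm_mult mult_left_le)
  qed measurable
  have cg: "cnj (g y) = cnj c * of_bool (y \<in> box a b)" for y by (auto simp: g_def)
  have R: "(\<lambda>k. \<integral>x. f x * (\<integral>y. cnj (g y) * of_real (heat_kernel (1 / real (Suc k)) (x - y)) \<partial>lborel) \<partial>lborel)
    \<longlonglongrightarrow> (\<integral>x. f x * cnj (g x) \<partial>lborel)"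
  proof (rule integral_dominated_convergence)
    show "integrable lborel (\<lambda>x. norm (f x) * norm c)" using f(1) by (simp add: integrable_norm)
    show "AE x in lborel. (\<lambda>k. f x * (\<integral>y. cnj (g y) * of_real (heat_kernel (1 / real (Suc k)) (x - y)) \<partial>lborel)) \<longlonglongrightarrow> f x * cnj (g x)"
      using frontier_box_null[of a b]
    proof eventually_elim
      case (elim x)
      show ?case unfolding cg by (intro tendsto_mult tendsto_const heat_kernel_box_tendsto elim)
    qed
    show "AE x in lborel. norm (f x * (\<integral>y. cnj (g y) * of_real (heat_kernel (1 / real (Suc k)) (x - y)) \<partial>lborel)) \<le> norm (f x) * norm c" for k
    proof (rule AE_I2)
      fix x :: 'a
      define \<epsilon> where "\<epsilon> = 1 / real (Suc k)"
      have \<epsilon>: "\<epsilon> > 0" by (simp add: \<epsilon>_def)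
      have "ennreal (norm (\<integral>y. cnj (g y) * of_real (heat_kernel \<epsilon> (x - y)) \<partial>lborel)) \<le> (\<integral>\<^sup>+y. ennreal (norm (cnj (g y) * of_real (heat_kernel \<epsilon> (x - y)))) \<partial>lborel)"
        by (rule ennreal_norm_integral_le)
      also have "\<dots> \<le> (\<integral>\<^sup>+y. ennreal (norm c) * ennreal (heat_kernel \<epsilon> (x - y)) \<partial>lborel)"
        by (intro nn_integral_mono) (auto simp: norm_mult g_def ennreal_mult[symmetric] of_bool_def)
      also have "\<dots> = ennreal (norm c) * (\<integral>\<^sup>+y. ennreal (heat_kernel \<epsilon> y) \<partial>(lborel :: 'a measure))"
        using nn_integral_lborel_minus[of "\<lambda>z::'a. ennreal (heat_kernel \<epsilon> z)" x] by (simp add: nn_integral_cmult)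
      also have "(\<integral>\<^sup>+y. ennreal (heat_kernel \<epsilon> y) \<partial>(lborel :: 'a measure)) = 1"
        using heat_kernel_integral[OF \<epsilon>, where 'a='a] by (subst nn_integral_eq_integral) (auto simp: has_bochner_integral_iff)
      finally show "norm (f x * (\<integral>y. cnj (g y) * of_real (heat_kernel (1 / real (Suc k)) (x - y)) \<partial>lborel)) \<le> norm (f x) * norm c"
        by (simp add: norm_mult mult_left_mono \<epsilon>_def)
    qed
  qed measurable
  have "(\<integral>\<xi>. fourier_int \<sigma> f \<xi> * cnj (fourier_int \<sigma> g \<xi>) \<partial>lborel) = (\<integral>x. f x * cnj (g x) \<partial>lborel)"
  proof (rule LIMSEQ_unique[OF L])
    show "(\<lambda>k. \<integral>\<xi>. fourier_int \<sigma> f \<xi> * cnj (fourier_int \<sigma> g \<xi>) * ?e k \<xi> \<partial>lborel) \<longlonglongrightarrow> (\<integral>x. f x * cnj (g x) \<partial>lborel)"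
      using R by (subst fourier_int_parseval_gaussian[OF f(1) g1 _ \<sigma>]) auto
  qed
  then show "L2_class (fourier_int \<sigma> f) \<bullet> L2_class (fourier_int \<sigma> g) = L2_class f \<bullet> L2_class g"
    by (simp add: inner_L2_class_Re F f g2)
qed

text \<open>The defect \<open>h\<close> is orthogonal to all multiples of indicators of boxes: the
  adjoint moves one transform to the test function, where Parseval for boxes applies.\<close>

lemma fourier_L2_inverse:
  fixes f :: "'a::euclidean_space L2"
  assumes \<sigma>: "\<sigma> * \<sigma> = 1"
  shows "fourier_L2 (- \<sigma>) (fourier_L2 \<sigma> f) = f"
proof -
  define h where "h = fourier_L2 (- \<sigma>) (fourier_L2 \<sigma> f) - f"
  have test: "h \<bullet> L2_class (\<lambda>x. c * of_bool (x \<in> box a b)) = 0" for c a b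
  proof -
    let ?g = "\<lambda>x. c * of_bool (x \<in> box a b)"
    note box = fourier_int_parseval_box[OF \<sigma> integrable_cutoff square_integrable_cutoff, where c = c and a = a and b = b]
    have "fourier_L2 \<sigma> f \<bullet> L2_class (fourier_int \<sigma> ?g) = f \<bullet> L2_class ?g"
    proof (rule tendsto_unique[OF trivial_limit_at_top_linorder])
      show "((\<lambda>R. L2_class (fourier_int \<sigma> (cutoff R f)) \<bullet> L2_class (fourier_int \<sigma> ?g)) \<longlongrightarrow> fourier_L2 \<sigma> f \<bullet> L2_class (fourier_int \<sigma> ?g)) at_top"
        by (intro tendsto_inner fourier_L2_tendsto \<sigma> tendsto_const)
      show "((\<lambda>R. L2_class (fourier_int \<sigma> (cutoff R f)) \<bullet> L2_class (fourier_int \<sigma> ?g)) \<longlongrightarrow> f \<bullet> L2_class ?g) at_top"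
        unfolding box(3) by (intro tendsto_inner L2_class_cutoff_tendsto tendsto_const)
    qed
    moreover have "fourier_L2 (- \<sigma>) (fourier_L2 \<sigma> f) \<bullet> L2_class ?g = fourier_L2 \<sigma> f \<bullet> fourier_L2 \<sigma> (L2_class ?g)"
      using fourier_L2_adjoint[of "- \<sigma>" "fourier_L2 \<sigma> f"] \<sigma> by simp
    ultimately show ?thesis
      by (simp add: h_def inner_diff_left fourier_L2_class[OF \<sigma> box(1,2)])
  qed
  have "AE x in lborel. rep_L2 h x = 0"
  proof (rule L2_zero_if_boxes)
    fix a b :: 'a
    have sq: "square_integrable (\<lambda>x. c * of_bool (x \<in> box a b))" for c
      using fourier_int_parseval_box(2)[OF \<sigma> integrable_cutoff square_integrable_cutoff] .
    have "Re (\<integral>x. rep_L2 h x * cnj (c * of_bool (x \<in> box a b)) \<partial>lborel) = 0" for c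
      using test[of c a b] inner_L2_class_Re[OF square_integrable_rep sq, of h c] by simp
    moreover have "(\<integral>x. rep_L2 h x * cnj (c * of_bool (x \<in> box a b)) \<partial>lborel) = cnj c * (\<integral>x. indicator (box a b) x *\<^sub>R rep_L2 h x \<partial>lborel)" for c
      by (subst integral_mult_right_zero[symmetric], rule Bochner_Integration.integral_cong) (auto simp: indicator_def)
    ultimately have "Re (cnj c * (\<integral>x. indicator (box a b) x *\<^sub>R rep_L2 h x \<partial>lborel)) = 0" for c by metis
    \<comment> \<open>The inner product is real-valued, so \<open>c = 1\<close> recovers the real
      part of the integral and \<open>c = \<i>\<close> its imaginary part.\<close>
    from this[of 1] this[of \<i>] show "(\<integral>x. indicator (box a b) x *\<^sub>R rep_L2 h x \<partial>lborel) = 0"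
      by (simp add: complex_eq_iff)
  qed simp
  then have "h = 0" using rep_L2_zero[where 'a='a] by (intro L2_eqI) auto
  then show ?thesis by (simp add: h_def)
qed

lemma inner_fourier_L2:
  assumes "\<sigma> * \<sigma> = 1"
  shows "fourier_L2 \<sigma> f \<bullet> fourier_L2 \<sigma> g = f \<bullet> g"
  using fourier_L2_adjoint[OF assms, of f "fourier_L2 \<sigma> g"] fourier_L2_inverse[OF assms, of g] by simp

lemma fourier_inv_fourier [simp]: "fourier (inv_fourier f) = f"
  and inv_fourier_fourier [simp]: "inv_fourier (fourier f) = f"
  using fourier_L2_inverse[of 1 f] fourier_L2_inverse[of "-1" f] by (simp_all add: fourier_eq inv_fourier_eq)

section \<open>Translations, modulations and the transform of a density\<close>

lemma integrable_pairI:
  fixes h :: "'a::euclidean_space \<Rightarrow> 'b::euclidean_space \<Rightarrow> 'c::{banach, second_countable_topology}"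
  assumes [measurable]: "(\<lambda>(x, y). h x y) \<in> borel_measurable (borel \<Otimes>\<^sub>M borel)"
    and "(\<integral>\<^sup>+x. (\<integral>\<^sup>+y. ennreal (norm (h x y)) \<partial>lborel) \<partial>lborel) < \<infinity>"
  shows "integrable (lborel \<Otimes>\<^sub>M lborel) (\<lambda>(x, y). h x y)"
proof (rule integrableI_bounded)
  have "(\<integral>\<^sup>+p. ennreal (norm (case p of (x, y) \<Rightarrow> h x y)) \<partial>(lborel \<Otimes>\<^sub>M lborel)) = (\<integral>\<^sup>+x. (\<integral>\<^sup>+y. ennreal (norm (h x y)) \<partial>lborel) \<partial>lborel)"
    by (subst lborel.nn_integral_fst[symmetric]) auto
  then show "(\<integral>\<^sup>+p. ennreal (norm (case p of (x, y) \<Rightarrow> h x y)) \<partial>(lborel \<Otimes>\<^sub>M lborel)) < \<infinity>"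
    using assms(2) by simp
qed simp

definition translate_L2 :: "'a::euclidean_space \<Rightarrow> 'a L2 \<Rightarrow> 'a L2" where
  "translate_L2 a f = L2_class (\<lambda>x. rep_L2 f (x + a))"

lemma nn_norm_translate:
  fixes f :: "'a::euclidean_space \<Rightarrow> complex"
  assumes [measurable]: "f \<in> borel_measurable borel"
  shows "(\<integral>\<^sup>+x. ennreal ((norm (f (x + a)))\<^sup>2) \<partial>lborel) = (\<integral>\<^sup>+x. ennreal ((norm (f x))\<^sup>2) \<partial>lborel)"
  by (rule nn_integral_lborel_translate[of "\<lambda>x. ennreal ((norm (f x))\<^sup>2)"]) measurable

lemma square_integrable_translate:
  assumes "square_integrable (f :: 'a::euclidean_space \<Rightarrow> complex)"
  shows "square_integrable (\<lambda>x. f (x + a))"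
proof -
  have [measurable]: "f \<in> borel_measurable borel" using assms by (rule square_integrable_measurable)
  show ?thesis using assms nn_norm_translate[of f a] unfolding square_integrable_iff_nn by simp
qed

lemma translate_L2_class:
  assumes "square_integrable f"
  shows "translate_L2 a (L2_class f) = L2_class (\<lambda>x. f (x + a))"
proof -
  have [measurable]: "f \<in> borel_measurable borel" using assms by (rule square_integrable_measurable)
  show ?thesis unfolding translate_L2_def
    by (rule L2_class_cong_AE) (use AE_lborel_translate[OF rep_L2_class[OF assms], of a] in auto)
qed

lemma rep_translate_L2: "AE x in lborel. rep_L2 (translate_L2 a f) x = rep_L2 f (x + a)"
  unfolding translate_L2_def by (intro rep_L2_class square_integrable_translate) simp

lemma norm_translate_L2_diff: "norm (translate_L2 a f - translate_L2 a g) = norm (f - g)"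
proof -
  have *: "norm (translate_L2 a h) = norm h" for h :: "'a L2"
  proof -
    have "ennreal ((norm (translate_L2 a h))\<^sup>2) = ennreal ((norm h)\<^sup>2)"
      unfolding translate_L2_def nn_norm_L2[symmetric]
      by (subst nn_norm_translate[symmetric, of _ a], simp, subst nn_norm_L2)
         (rule nn_norm_L2_class[symmetric], rule square_integrable_translate, simp)
    then show ?thesis by simp
  qed
  have "translate_L2 a f - translate_L2 a g = translate_L2 a (L2_class (\<lambda>x. rep_L2 f x - rep_L2 g x))"
    by (subst translate_L2_class) (auto simp: translate_L2_def L2_class_diff square_integrable_translate square_integrable_diff)
  then show ?thesis using L2_class_diff[of "rep_L2 f" "rep_L2 g"] by (simp add: *)
qed

text \<open>Truncation commutes with modulation, so the identity for Fourier integrals survives the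
  limit; translation, being isometric, is continuous on L^2.\<close>

lemma fourier_modulation:
  fixes u :: "'a::euclidean_space L2"
  shows "fourier (mult_op (\<lambda>x. cis (x \<bullet> \<eta>)) u) = translate_L2 (- \<eta>) (fourier u)"
  unfolding fourier_eq
proof (rule tendsto_unique[OF _ fourier_L2_tendsto])
  let ?e = "\<lambda>x::'a. cis (x \<bullet> \<eta>)"
  have "L2_class (fourier_int (-1) (cutoff R (mult_op ?e u))) = translate_L2 (-\<eta>) (L2_class (fourier_int (-1) (cutoff R u)))" for R
  proof -
    have "fourier_int (-1) (cutoff R (mult_op ?e u)) = fourier_int (-1) (\<lambda>x. ?e x * cutoff R u x)"
    proof (rule fourier_int_cong_AE)
      have "AE x in lborel. rep_L2 (mult_op ?e u) x = ?e x * rep_L2 u x"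
        by (rule rep_mult_op[of _ 1]) auto
      then show "AE x in lborel. cutoff R (mult_op ?e u) x = ?e x * cutoff R u x"
        by eventually_elim (simp add: cutoff_def)
    qed measurable
    also have "\<dots> = (\<lambda>\<xi>. fourier_int (-1) (cutoff R u) (\<xi> + (-\<eta>)))"
      by (simp add: fun_eq_iff fourier_int_def mult.assoc[symmetric] cis_mult inner_diff_right)
    finally show ?thesis by (simp add: translate_L2_class fourier_int_contraction)
  qed
  moreover have "((\<lambda>R. translate_L2 (-\<eta>) (L2_class (fourier_int (-1) (cutoff R u)))) \<longlongrightarrow> translate_L2 (-\<eta>) (fourier_L2 (-1) u)) at_top"
    using fourier_L2_tendsto[of "-1" u]
    by (subst LIM_zero_iff[symmetric], subst tendsto_norm_zero_iff[symmetric])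
       (simp add: norm_translate_L2_diff tendsto_norm_zero_iff LIM_zero_iff)
  ultimately show "((\<lambda>R. L2_class (fourier_int (-1) (cutoff R (mult_op ?e u)))) \<longlongrightarrow> translate_L2 (-\<eta>) (fourier_L2 (-1) u)) at_top"
    by simp
qed simp_all

lemma square_integrable_cnj: "square_integrable f \<Longrightarrow> square_integrable (\<lambda>x. cnj (f x))"
  by (auto simp: square_integrable_def)

text \<open>The transform preserves the real inner product; applying this to complex multiples of
  \<open>v\<close> gives the real and the imaginary part of the complex one.\<close>

lemma parseval_complex:
  fixes v w :: "'a::euclidean_space L2"
  shows "(\<integral>\<xi>. rep_L2 (fourier v) \<xi> * cnj (rep_L2 (fourier w) \<xi>) \<partial>lborel) = (\<integral>x. rep_L2 v x * cnj (rep_L2 w x) \<partial>lborel)"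
proof -
  have *: "(c *\<^sub>C v) \<bullet> w = Re (c * (\<integral>x. rep_L2 v x * cnj (rep_L2 w x) \<partial>lborel))" for v w :: "'a L2" and c
    using inner_L2_class_Re[OF square_integrable_cmult[OF square_integrable_rep[of v], of c] square_integrable_rep[of w]]
      L2_class_scaleC[of "rep_L2 v" c]
    by (simp add: mult.assoc)
  have "Re (c * (\<integral>\<xi>. rep_L2 (fourier v) \<xi> * cnj (rep_L2 (fourier w) \<xi>) \<partial>lborel)) = Re (c * (\<integral>x. rep_L2 v x * cnj (rep_L2 w x) \<partial>lborel))" for c
    unfolding *[symmetric] fourier_eq using inner_fourier_L2[of "-1" "c *\<^sub>C v" w] by (simp add: fourier_L2_scaleC)
  from this[of 1] this[of \<i>] show ?thesis by (simp add: complex_eq_iff)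
qed

text \<open>A correlation rather than a convolution, so that the transform of the complex conjugate
  of u never appears. At \<open>f = fourier u\<close> it is the transform of the density
  \<open>|u|^2\<close>, without a normalising factor.\<close>

definition autocorrelation :: "('a::euclidean_space \<Rightarrow> complex) \<Rightarrow> 'a \<Rightarrow> complex" where
  "autocorrelation f \<eta> = (\<integral>\<zeta>. f (\<zeta> + \<eta>) * cnj (f \<zeta>) \<partial>lborel)"

lemma measurable_autocorrelation [measurable]:
  assumes [measurable]: "f \<in> borel_measurable borel"
  shows "autocorrelation f \<in> borel_measurable borel"
  unfolding autocorrelation_def by measurable

text \<open>Attaching the modulation to one factor of \<open>|u|^2\<close> makes the integral an L^2
  inner product, to which Parseval applies.\<close>

lemma fourier_density:
  fixes u :: "'a::euclidean_space L2"
  shows "(\<integral>y. cis (- (y \<bullet> \<eta>)) * of_real ((norm (rep_L2 u y))\<^sup>2) \<partial>lborel) = autocorrelation (rep_L2 (fourier u)) \<eta>"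
proof -
  let ?e = "\<lambda>x::'a. cis (x \<bullet> (- \<eta>))"
  have "AE y in lborel. rep_L2 (mult_op ?e u) y = ?e y * rep_L2 u y"
    by (rule rep_mult_op[of _ 1]) auto
  then have "(\<integral>y. cis (- (y \<bullet> \<eta>)) * of_real ((norm (rep_L2 u y))\<^sup>2) \<partial>lborel) = (\<integral>y. rep_L2 (mult_op ?e u) y * cnj (rep_L2 u y) \<partial>lborel)"
    by (intro integral_cong_AE, measurable, elim eventually_mono) (simp only: complex_norm_square inner_minus_right mult.assoc)
  also have "\<dots> = (\<integral>\<xi>. rep_L2 (translate_L2 \<eta> (fourier u)) \<xi> * cnj (rep_L2 (fourier u) \<xi>) \<partial>lborel)"
    using parseval_complex[of "mult_op ?e u" u] fourier_modulation[of "-\<eta>" u] by simp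
  also have "\<dots> = autocorrelation (rep_L2 (fourier u)) \<eta>"
    unfolding autocorrelation_def
    by (rule integral_cong_AE, measurable, use rep_translate_L2[of \<eta> "fourier u"] in eventually_elim) simp
  finally show ?thesis .
qed

lemma gaussian_eq_heat_transform:
  fixes z :: "'a::euclidean_space"
  assumes "\<epsilon> > 0"
  shows "has_bochner_integral lborel (\<lambda>\<eta>. cis (z \<bullet> \<eta>) * of_real (heat_kernel \<epsilon> \<eta>)) (of_real (exp (- \<epsilon> * (norm z)\<^sup>2 / 2)))"
proof -
  have a: "has_bochner_integral lborel (\<lambda>\<eta>. of_real ((2 * pi * \<epsilon>) powr (- real DIM('a) / 2)) * (cis (\<eta> \<bullet> z) * of_real (exp (- (1/\<epsilon>) * (norm \<eta>)\<^sup>2 / 2))))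
     (of_real ((2 * pi * \<epsilon>) powr (- real DIM('a) / 2)) * complex_of_real ((2 * pi / (1/\<epsilon>)) powr (real DIM('a) / 2) * exp (- (norm z)\<^sup>2 / (2 * (1/\<epsilon>)))))"
    by (intro has_bochner_integral_mult_right gaussian_integral) (use assms in simp)
  have b: "(2 * pi * \<epsilon>) powr (- real DIM('a) / 2) * ((2 * pi / (1/\<epsilon>)) powr (real DIM('a) / 2) * exp (- (norm z)\<^sup>2 / (2 * (1/\<epsilon>)))) = exp (- \<epsilon> * (norm z)\<^sup>2 / 2)"
  proof -
    have "(2 * pi * \<epsilon>) powr (- real DIM('a) / 2) * (2 * pi * \<epsilon>) powr (real DIM('a) / 2) = 1"
      using assms by (simp flip: powr_add)
    moreover have "2 * pi / (1 / \<epsilon>) = 2 * pi * \<epsilon>" "- (norm z)\<^sup>2 / (2 * (1/\<epsilon>)) = - \<epsilon> * (norm z)\<^sup>2 / 2"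
      using assms by simp_all
    ultimately show ?thesis by (simp only: mult.assoc[symmetric] mult_1_left)
  qed
  have c: "of_real ((2 * pi * \<epsilon>) powr (- real DIM('a) / 2)) * (cis (\<eta> \<bullet> z) * of_real (exp (- (1/\<epsilon>) * (norm \<eta>)\<^sup>2 / 2))) = cis (z \<bullet> \<eta>) * of_real (heat_kernel \<epsilon> \<eta>)" for \<eta>
    using assms by (simp add: heat_kernel_def inner_commute mult_ac)
  from a show ?thesis unfolding c of_real_mult[symmetric] b .
qed

text \<open>The Gaussian is written as the transform of the heat kernel. Heat kernel and density are
  both integrable, so Fubini applies, and the inner integral becomes the transform of the
  density.\<close>

lemma gaussian_convolution_density:
  fixes u :: "'a::euclidean_space L2"
  assumes \<epsilon>: "\<epsilon> > 0"
  shows "complex_of_real (\<integral>y. exp (- \<epsilon> * (norm (x - y))\<^sup>2 / 2) * (norm (rep_L2 u y))\<^sup>2 \<partial>lborel)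
    = (\<integral>\<eta>. of_real (heat_kernel \<epsilon> \<eta>) * (cis (x \<bullet> \<eta>) * autocorrelation (rep_L2 (fourier u)) \<eta>) \<partial>lborel)"
proof -
  let ?p = "\<lambda>y. complex_of_real ((norm (rep_L2 u y))\<^sup>2)"
  have p: "integrable lborel ?p" using square_integrable_rep[of u]
    unfolding complex_of_real_integrable_eq by (simp add: square_integrable_def)
  have k: "integrable lborel (\<lambda>\<eta>::'a. complex_of_real (heat_kernel \<epsilon> \<eta>))"
    using heat_kernel_integral[OF \<epsilon>, where 'a='a] by (simp add: has_bochner_integral_iff)
  have i: "integrable (lborel \<Otimes>\<^sub>M lborel) (\<lambda>(y, \<eta>). cis ((x - y) \<bullet> \<eta>) * (?p y * of_real (heat_kernel \<epsilon> \<eta>)))"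
  proof (rule integrable_tensor[OF p k, of _ 1])
    show "(\<lambda>(y::'a, \<eta>). cis ((x - y) \<bullet> \<eta>)) \<in> borel_measurable (borel \<Otimes>\<^sub>M borel)"
      unfolding case_prod_beta borel_prod by (intro borel_measurable_continuous_onI continuous_intros)
  qed simp
  have "complex_of_real (\<integral>y. exp (- \<epsilon> * (norm (x - y))\<^sup>2 / 2) * (norm (rep_L2 u y))\<^sup>2 \<partial>lborel)
    = (\<integral>y. complex_of_real (exp (- \<epsilon> * (norm (x - y))\<^sup>2 / 2)) * ?p y \<partial>lborel)"
    by (simp only: integral_complex_of_real[symmetric] of_real_mult)
  also have "\<dots> = (\<integral>y. (\<integral>\<eta>. cis ((x - y) \<bullet> \<eta>) * (?p y * of_real (heat_kernel \<epsilon> \<eta>)) \<partial>lborel) \<partial>lborel)"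
  proof (rule Bochner_Integration.integral_cong)
    fix y
    have "(\<integral>\<eta>. cis ((x - y) \<bullet> \<eta>) * (?p y * of_real (heat_kernel \<epsilon> \<eta>)) \<partial>lborel) = (\<integral>\<eta>. ?p y * (cis ((x - y) \<bullet> \<eta>) * of_real (heat_kernel \<epsilon> \<eta>)) \<partial>lborel)"
      by (simp only: mult.left_commute)
    also have "\<dots> = ?p y * (\<integral>\<eta>. cis ((x - y) \<bullet> \<eta>) * of_real (heat_kernel \<epsilon> \<eta>) \<partial>lborel)"
      by (rule integral_mult_right_zero)
    also have "\<dots> = complex_of_real (exp (- \<epsilon> * (norm (x - y))\<^sup>2 / 2)) * ?p y"
      using gaussian_eq_heat_transform[OF \<epsilon>, of "x - y"] by (simp add: has_bochner_integral_iff mult.commute)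
    finally show "complex_of_real (exp (- \<epsilon> * (norm (x - y))\<^sup>2 / 2)) * ?p y = (\<integral>\<eta>. cis ((x - y) \<bullet> \<eta>) * (?p y * of_real (heat_kernel \<epsilon> \<eta>)) \<partial>lborel)" ..
  qed simp
  also have "\<dots> = (\<integral>\<eta>. (\<integral>y. cis ((x - y) \<bullet> \<eta>) * (?p y * of_real (heat_kernel \<epsilon> \<eta>)) \<partial>lborel) \<partial>lborel)"
    by (rule lborel_pair.Fubini_integral[OF i, symmetric])
  also have "\<dots> = (\<integral>\<eta>. of_real (heat_kernel \<epsilon> \<eta>) * (cis (x \<bullet> \<eta>) * autocorrelation (rep_L2 (fourier u)) \<eta>) \<partial>lborel)"
  proof (rule Bochner_Integration.integral_cong)
    fix \<eta> :: 'a
    have "cis ((x - y) \<bullet> \<eta>) * (?p y * of_real (heat_kernel \<epsilon> \<eta>)) = (of_real (heat_kernel \<epsilon> \<eta>) * cis (x \<bullet> \<eta>)) * (cis (- (y \<bullet> \<eta>)) * ?p y)" for y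
    proof -
      have "cis ((x - y) \<bullet> \<eta>) = cis (x \<bullet> \<eta>) * cis (- (y \<bullet> \<eta>))" by (simp add: cis_mult inner_diff_left)
      then show ?thesis by (simp only: mult_ac)
    qed
    then have "(\<integral>y. cis ((x - y) \<bullet> \<eta>) * (?p y * of_real (heat_kernel \<epsilon> \<eta>)) \<partial>lborel) = (of_real (heat_kernel \<epsilon> \<eta>) * cis (x \<bullet> \<eta>)) * (\<integral>y. cis (- (y \<bullet> \<eta>)) * ?p y \<partial>lborel)"
      by (simp only: integral_mult_right_zero)
    then show "(\<integral>y. cis ((x - y) \<bullet> \<eta>) * (?p y * of_real (heat_kernel \<epsilon> \<eta>)) \<partial>lborel) = of_real (heat_kernel \<epsilon> \<eta>) * (cis (x \<bullet> \<eta>) * autocorrelation (rep_L2 (fourier u)) \<eta>)"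
      by (simp only: fourier_density mult.assoc)
  qed simp
  finally show ?thesis .
qed

subsection \<open>The Hartree term in Fourier variables\<close>

text \<open>Riesz potentials as superpositions of Gaussians. In the logarithmic scale \<open>t\<close> the homogeneity
  is a translation.\<close>

lemma nn_integral_exp_halfline_finite:
  assumes "a > 0"
  shows "(\<integral>\<^sup>+t. ennreal (indicator {0..} t * exp (- a * t)) \<partial>lborel) < \<infinity>"
proof -
  obtain I where "((\<lambda>t. exp (- a * t)) has_integral I) {0..}"
    using integrable_on_exp_minus_to_infinity[OF assms, of 0] by blast
  then have "((\<lambda>t. if t \<in> {0..} then exp (- a * t) else 0) has_integral I) UNIV"
    by (simp only: has_integral_restrict_UNIV)
  moreover have "(\<lambda>t. if t \<in> {0..} then exp (- a * t) else 0) = (\<lambda>t. indicator {0..} t * exp (- a * t))"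
    by (auto simp: indicator_def)
  ultimately have "((\<lambda>t. indicator {0..} t * exp (- a * t)) has_integral I) UNIV" by (simp only:)
  from nn_integral_has_integral_lborel[OF _ _ this]
  have "(\<integral>\<^sup>+t. ennreal (indicator {0..} t * exp (- a * t)) \<partial>lborel) = ennreal I" by simp
  then show ?thesis by simp
qed

text \<open>A Gamma integral in logarithmic scale. For t to minus infinity
  \<open>exp (t * p)\<close> decays; for t to plus infinity a single term \<open>x^k / k!\<close> of
  the exponential series at \<open>x = exp t / 2\<close>, with \<open>k > p\<close>, beats
  it.\<close>

lemma nn_integral_exp_scale_finite:
  assumes "p > 0"
  shows "(\<integral>\<^sup>+t. ennreal (exp (t * p) * exp (- exp t / 2)) \<partial>lborel) < \<infinity>"
proof -
  obtain k :: nat where k: "real k > p" using reals_Archimedean2 by blast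
  let ?K = "fact k * 2 ^ k :: real"
  have le: "exp (t * p) * exp (- exp t / 2) \<le> indicator {..0} t * exp (t * p) + ?K * (indicator {0..} t * exp (- (real k - p) * t))" for t :: real
  proof (cases "t \<le> 0")
    case True
    have "exp (t * p) * exp (- exp t / 2) + 0 \<le> exp (t * p) * 1 + ?K * (indicator {0..} t * exp (- (real k - p) * t))"
      by (intro add_mono mult_left_mono) auto
    moreover have "indicator {..0} t = (1::real)" using True by simp
    ultimately show ?thesis by (simp only: mult_1_left mult_1_right add_0_right)
  next
    case False
    have "(\<Sum>n\<in>{k}. (exp t / 2) ^ n /\<^sub>R fact n) \<le> (\<Sum>n. (exp t / 2) ^ n /\<^sub>R fact n)"
      by (rule sum_le_suminf[OF summable_exp_generic]) auto
    then have "inverse (fact k) * (exp t / 2) ^ k \<le> exp (exp t / 2)" by (simp add: exp_def)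
    then have "inverse (exp (exp t / 2)) \<le> inverse (inverse (fact k) * (exp t / 2) ^ k)"
      by (rule le_imp_inverse_le) simp
    also have "\<dots> = ?K * exp (- real k * t)"
    proof -
      have "(exp t / 2) ^ k = exp (real k * t) / 2 ^ k" by (simp add: power_divide exp_of_nat_mult)
      moreover have "exp (- real k * t) = inverse (exp (real k * t))" by (simp add: exp_minus)
      ultimately show ?thesis by (simp only: inverse_mult_distrib inverse_inverse_eq inverse_divide divide_inverse mult.assoc) (simp only: mult.commute)
    qed
    finally have "exp (- exp t / 2) \<le> ?K * exp (- real k * t)" by (simp add: exp_minus)
    then have "exp (t * p) * exp (- exp t / 2) \<le> exp (t * p) * (?K * exp (- real k * t))" by (intro mult_left_mono) auto
    also have "\<dots> = ?K * exp (- (real k - p) * t)"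
    proof -
      have "t * p + - real k * t = - (real k - p) * t" by (simp add: algebra_simps)
      then show ?thesis unfolding mult.left_commute[of "exp (t * p)"] mult_exp_exp by (simp only:)
    qed
    finally show ?thesis using False by (auto simp: indicator_def)
  qed
  have i2: "(\<integral>\<^sup>+t. ennreal (indicator {..0} t * exp (t * p)) \<partial>lborel) < \<infinity>"
  proof -
    have "(\<integral>\<^sup>+t. ennreal (indicator {..0} t * exp (t * p)) \<partial>lborel) = (\<integral>\<^sup>+t. ennreal (indicator {0..} t * exp (- p * t)) \<partial>lborel)"
      by (subst nn_integral_real_affine[of _ "-1" 0]) (auto intro!: nn_integral_cong simp: indicator_def mult.commute)
    then show ?thesis using nn_integral_exp_halfline_finite[OF assms] by simp
  qed
  have "(\<integral>\<^sup>+t. ennreal (exp (t * p) * exp (- exp t / 2)) \<partial>lborel)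
    \<le> (\<integral>\<^sup>+t. (ennreal (indicator {..0} t * exp (t * p)) + ennreal ?K * ennreal (indicator {0..} t * exp (- (real k - p) * t))) \<partial>lborel)"
  proof (rule nn_integral_mono)
    fix t :: real
    show "ennreal (exp (t * p) * exp (- exp t / 2)) \<le> ennreal (indicator {..0} t * exp (t * p)) + ennreal ?K * ennreal (indicator {0..} t * exp (- (real k - p) * t))"
      using ennreal_leI[OF le[of t]] by (subst (asm) ennreal_plus) (auto simp: ennreal_mult'[symmetric])
  qed
  also have "\<dots> = (\<integral>\<^sup>+t. ennreal (indicator {..0} t * exp (t * p)) \<partial>lborel) + ennreal ?K * (\<integral>\<^sup>+t. ennreal (indicator {0..} t * exp (- (real k - p) * t)) \<partial>lborel)"
    by (simp add: nn_integral_add nn_integral_cmult)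
  also have "\<dots> < \<infinity>"
    using i2 nn_integral_exp_halfline_finite[of "real k - p"] k by (simp add: ennreal_mult_less_top)
  finally show ?thesis .
qed

text \<open>For \<open>p > 0\<close> the substitution \<open>r = exp t\<close> identifies this
  number as \<open>2 powr p\<close> times Gamma of p.\<close>

definition riesz_const :: "real \<Rightarrow> real" where
  "riesz_const p = enn2real (\<integral>\<^sup>+t. ennreal (exp (t * p) * exp (- exp t / 2)) \<partial>lborel)"

lemma riesz_const_ennreal:
  "p > 0 \<Longrightarrow> ennreal (riesz_const p) = (\<integral>\<^sup>+t. ennreal (exp (t * p) * exp (- exp t / 2)) \<partial>lborel)"
  unfolding riesz_const_def using nn_integral_exp_scale_finite[of p] by simp

lemma riesz_const_pos:
  assumes "p > 0"
  shows "riesz_const p > 0"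
proof -
  have "(\<integral>\<^sup>+t. ennreal (exp (t * p) * exp (- exp t / 2)) \<partial>lborel) \<noteq> 0"
    by (subst nn_integral_0_iff_AE) (auto simp: ennreal_eq_0_iff mult_le_0_iff ae_filter_eq_bot_iff eventually_False)
  then have "ennreal (riesz_const p) \<noteq> 0" using riesz_const_ennreal[OF assms] by simp
  then show ?thesis by (auto simp: ennreal_eq_0_iff not_le)
qed

lemma riesz_superposition:
  assumes "r > 0" "p > 0"
  shows "(\<integral>\<^sup>+t. ennreal (exp (t * p) * exp (- exp t * r / 2)) \<partial>lborel) = ennreal (riesz_const p * r powr - p)"
proof -
  have "(\<integral>\<^sup>+t. ennreal (exp (t * p) * exp (- exp t * r / 2)) \<partial>lborel)
    = (\<integral>\<^sup>+t. ennreal (exp ((- ln r + 1 * t) * p) * exp (- exp (- ln r + 1 * t) * r / 2)) \<partial>lborel)"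
    by (subst nn_integral_real_affine[of _ 1 "- ln r"]) auto
  also have "\<dots> = (\<integral>\<^sup>+t. ennreal (r powr - p) * ennreal (exp (t * p) * exp (- exp t / 2)) \<partial>lborel)"
  proof (rule nn_integral_cong)
    fix t :: real
    have "exp (- ln r + 1 * t) * r = exp t" using assms by (simp add: exp_diff)
    moreover have "exp ((- ln r + 1 * t) * p) = r powr - p * exp (t * p)"
      using assms by (simp add: powr_def exp_add[symmetric] algebra_simps)
    ultimately show "ennreal (exp ((- ln r + 1 * t) * p) * exp (- exp (- ln r + 1 * t) * r / 2)) = ennreal (r powr - p) * ennreal (exp (t * p) * exp (- exp t / 2))"
      by (simp add: ennreal_mult[symmetric] mult.assoc)
  qed
  also have "\<dots> = ennreal (riesz_const p * r powr - p)"
    using riesz_const_pos[OF assms(2)]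
    by (subst nn_integral_cmult) (auto simp only: riesz_const_ennreal[OF assms(2), symmetric] ennreal_mult'[symmetric] powr_ge_zero mult.commute[of "riesz_const p"], measurable)
  finally show ?thesis .
qed

lemma riesz_superposition_norm:
  assumes "z \<noteq> 0" "p > 0"
  shows "(\<integral>\<^sup>+t. ennreal (exp (t * (p / 2)) * exp (- exp t * (norm z)\<^sup>2 / 2)) \<partial>lborel) = ennreal (riesz_const (p / 2) * norm z powr - p)"
proof -
  have "(norm z)\<^sup>2 powr - (p / 2) = norm z powr - p"
  proof -
    have "(norm z)\<^sup>2 = norm z powr 2" using assms by simp
    then show ?thesis by (simp only: powr_powr) simp
  qed
  then show ?thesis using riesz_superposition[of "(norm z)\<^sup>2" "p / 2"] assms by simp
qed

text \<open>Reflecting t turns the heat kernel of variance \<open>exp t\<close> into the Gaussian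
  treated before, and its normalisation contributes \<open>exp (t * (n / 2))\<close>. The exponent
  lam/2 thereby becomes (n - lam)/2, that of the transformed Riesz kernel.\<close>

lemma riesz_superposition_heat:
  fixes \<eta> :: "'a::euclidean_space"
  assumes "\<eta> \<noteq> 0" "0 < lam" "lam < real DIM('a)"
  shows "(\<integral>\<^sup>+t. ennreal (exp (t * (lam / 2)) * heat_kernel (exp t) \<eta>) \<partial>lborel)
    = ennreal ((2 * pi) powr (- real DIM('a) / 2) * riesz_const ((real DIM('a) - lam) / 2) * norm \<eta> powr (lam - real DIM('a)))"
proof -
  let ?c = "(2 * pi) powr (- real DIM('a) / 2)"
  let ?q = "real DIM('a) - lam"
  have "(\<integral>\<^sup>+t. ennreal (exp (t * (lam / 2)) * heat_kernel (exp t) \<eta>) \<partial>lborel)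
     = (\<integral>\<^sup>+t. ennreal (exp ((0 + -1 * t) * (lam / 2)) * heat_kernel (exp (0 + -1 * t)) \<eta>) \<partial>lborel)"
    by (subst nn_integral_real_affine[of _ "-1" 0]) (auto simp: heat_kernel_def)
  also have "\<dots> = (\<integral>\<^sup>+t. ennreal ?c * ennreal (exp (t * (?q / 2)) * exp (- exp t * (norm \<eta>)\<^sup>2 / 2)) \<partial>lborel)"
  proof (rule nn_integral_cong)
    fix t :: real
    have "(2 * pi * exp (- t)) powr (- real DIM('a) / 2) = ?c * exp (t * (real DIM('a) / 2))"
      by (subst powr_mult) (auto simp: powr_def)
    moreover have "exp (t * (real DIM('a) / 2)) * exp (- t * (lam / 2)) = exp (t * (?q / 2))"
      by (simp add: exp_add[symmetric] field_simps)
    moreover have "- (norm \<eta>)\<^sup>2 / (2 * exp (- t)) = - exp t * (norm \<eta>)\<^sup>2 / 2"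
      by (simp add: exp_minus field_simps)
    moreover have "exp (- t * (lam / 2)) * (?c * b * e) = ?c * (b * exp (- t * (lam / 2)) * e)" for b e
      by simp
    ultimately have "exp (- t * (lam / 2)) * heat_kernel (exp (- t)) \<eta> = ?c * (exp (t * (?q / 2)) * exp (- exp t * (norm \<eta>)\<^sup>2 / 2))"
      unfolding heat_kernel_def by (simp only:)
    then show "ennreal (exp ((0 + -1 * t) * (lam / 2)) * heat_kernel (exp (0 + -1 * t)) \<eta>) = ennreal ?c * ennreal (exp (t * (?q / 2)) * exp (- exp t * (norm \<eta>)\<^sup>2 / 2))"
      by (simp add: ennreal_mult[symmetric])
  qed
  also have "\<dots> = ennreal ?c * ennreal (riesz_const (?q / 2) * norm \<eta> powr - ?q)"
    using riesz_superposition_norm[of \<eta> ?q] assms by (subst nn_integral_cmult) auto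
  finally show ?thesis by (simp add: ennreal_mult'[symmetric] mult.assoc)
qed

text \<open>The Fourier side of the Hartree potential: the Gaussian superposition of the Riesz kernel is
  exchanged with the Fourier representation of each Gaussian.\<close>

lemma riesz_potential_fourier:
  fixes u :: "'a::euclidean_space L2" and x :: 'a
  assumes lam: "0 < lam" "lam < real DIM('a)"
    and fin: "(\<integral>\<^sup>+\<eta>. ennreal (norm \<eta> powr (lam - real DIM('a)) * norm (autocorrelation (rep_L2 (fourier u)) \<eta>)) \<partial>lborel) < \<infinity>"
  shows "complex_of_real (Defs.convolution (\<lambda>z. norm z powr (- lam)) (\<lambda>y. (norm (rep_L2 u y))\<^sup>2) x)
    = of_real ((2 * pi) powr (- real DIM('a) / 2) * riesz_const ((real DIM('a) - lam) / 2) / riesz_const (lam / 2))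
      * (\<integral>\<eta>. cis (x \<bullet> \<eta>) * (of_real (norm \<eta> powr (lam - real DIM('a))) * autocorrelation (rep_L2 (fourier u)) \<eta>) \<partial>lborel)"
proof -
  define A where "A = autocorrelation (rep_L2 (fourier u))"
  have [measurable]: "A \<in> borel_measurable borel" unfolding A_def by measurable
  define D where "D = (2 * pi) powr (- real DIM('a) / 2) * riesz_const ((real DIM('a) - lam) / 2)"
  define C where "C = riesz_const (lam / 2)"
  have C: "C > 0" and D: "D \<ge> 0" using lam riesz_const_pos[of "lam/2"] riesz_const_pos[of "(real DIM('a) - lam)/2"] by (auto simp: C_def D_def)
  define G where "G t = (\<integral>y. exp (- exp t * (norm (x - y))\<^sup>2 / 2) * (norm (rep_L2 u y))\<^sup>2 \<partial>lborel)" for t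
  have G0: "G t \<ge> 0" for t unfolding G_def by (intro Bochner_Integration.integral_nonneg) simp
  define k where "k t \<eta> = exp (t * (lam / 2)) * heat_kernel (exp t) \<eta>" for t and \<eta> :: 'a
  have k0: "k t \<eta> \<ge> 0" for t \<eta> by (simp add: k_def)
  have kmeas [measurable]: "(\<lambda>(t, \<eta>). k t \<eta>) \<in> borel_measurable (borel \<Otimes>\<^sub>M borel)"
    unfolding k_def heat_kernel_def by measurable
  have kint: "(\<integral>\<^sup>+t. ennreal (k t \<eta>) \<partial>lborel) = ennreal (D * norm \<eta> powr (lam - real DIM('a)))" if "\<eta> \<noteq> 0" for \<eta>
    unfolding k_def D_def by (rule riesz_superposition_heat[OF that lam])
  have ae0: "AE \<eta> in lborel. \<eta> \<noteq> (0::'a)" by (simp add: AE_lborel_singleton)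
  \<comment> \<open>Hypothesis \<open>fin\<close> amounts to absolute integrability in t and \<eta>:
    integrating the heat kernels over t first produces the weight
    \<open>norm \<eta> powr (lam - n)\<close>.\<close>
  have int: "integrable (lborel \<Otimes>\<^sub>M lborel) (\<lambda>(t, \<eta>). of_real (k t \<eta>) * (cis (x \<bullet> \<eta>) * A \<eta>))"
  proof (rule integrable_pairI)
    have "(\<integral>\<^sup>+t. (\<integral>\<^sup>+\<eta>. ennreal (norm (of_real (k t \<eta>) * (cis (x \<bullet> \<eta>) * A \<eta>))) \<partial>lborel) \<partial>lborel)
      = (\<integral>\<^sup>+\<eta>. (\<integral>\<^sup>+t. ennreal (norm (of_real (k t \<eta>) * (cis (x \<bullet> \<eta>) * A \<eta>))) \<partial>lborel) \<partial>lborel)"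
      by (rule lborel_pair.Fubini'[symmetric]) measurable
    also have "\<dots> = (\<integral>\<^sup>+\<eta>. ennreal D * ennreal (norm \<eta> powr (lam - real DIM('a)) * norm (A \<eta>)) \<partial>lborel)"
    proof (intro nn_integral_cong_AE, use ae0 in eventually_elim)
      case (elim \<eta>)
      have "(\<integral>\<^sup>+t. ennreal (norm (of_real (k t \<eta>) * (cis (x \<bullet> \<eta>) * A \<eta>))) \<partial>lborel) = (\<integral>\<^sup>+t. ennreal (k t \<eta>) * ennreal (norm (A \<eta>)) \<partial>lborel)"
        by (intro nn_integral_cong) (simp add: norm_mult k0 ennreal_mult)
      also have "\<dots> = (\<integral>\<^sup>+t. ennreal (k t \<eta>) \<partial>lborel) * ennreal (norm (A \<eta>))"
        by (rule nn_integral_multc) measurable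
      finally show ?case unfolding kint[OF elim] using D by (simp add: ennreal_mult[symmetric] mult.assoc)
    qed
    also have "\<dots> = ennreal D * (\<integral>\<^sup>+\<eta>. ennreal (norm \<eta> powr (lam - real DIM('a)) * norm (A \<eta>)) \<partial>lborel)"
      by (rule nn_integral_cmult) measurable
    also have "\<dots> < \<infinity>" using fin by (simp add: A_def ennreal_mult_less_top)
    finally show "(\<integral>\<^sup>+t. (\<integral>\<^sup>+\<eta>. ennreal (norm (of_real (k t \<eta>) * (cis (x \<bullet> \<eta>) * A \<eta>))) \<partial>lborel) \<partial>lborel) < \<infinity>" .
  qed measurable
  have G: "complex_of_real (exp (t * (lam / 2)) * G t) = (\<integral>\<eta>. of_real (k t \<eta>) * (cis (x \<bullet> \<eta>) * A \<eta>) \<partial>lborel)" for t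
  proof -
    have "complex_of_real (exp (t * (lam / 2)) * G t) = of_real (exp (t * (lam / 2))) * (\<integral>\<eta>. of_real (heat_kernel (exp t) \<eta>) * (cis (x \<bullet> \<eta>) * A \<eta>) \<partial>lborel)"
      unfolding G_def A_def of_real_mult by (subst gaussian_convolution_density) auto
    also have "\<dots> = (\<integral>\<eta>. of_real (exp (t * (lam / 2))) * (of_real (heat_kernel (exp t) \<eta>) * (cis (x \<bullet> \<eta>) * A \<eta>)) \<partial>lborel)"
      by (rule integral_mult_right_zero[symmetric])
    finally show ?thesis unfolding k_def of_real_mult by (simp only: mult.assoc)
  qed
  have intG: "integrable lborel (\<lambda>t. complex_of_real (exp (t * (lam / 2)) * G t))"
    unfolding G using lborel_pair.integrable_fst[OF int] by simp
  then have intG': "integrable lborel (\<lambda>t. exp (t * (lam / 2)) * G t)"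
    unfolding complex_of_real_integrable_eq .
  have "complex_of_real (\<integral>t. exp (t * (lam / 2)) * G t \<partial>lborel) = (\<integral>t. (\<integral>\<eta>. of_real (k t \<eta>) * (cis (x \<bullet> \<eta>) * A \<eta>) \<partial>lborel) \<partial>lborel)"
    unfolding G[symmetric] by (rule integral_complex_of_real[symmetric])
  also have "\<dots> = (\<integral>\<eta>. (\<integral>t. of_real (k t \<eta>) * (cis (x \<bullet> \<eta>) * A \<eta>) \<partial>lborel) \<partial>lborel)"
    by (rule lborel_pair.Fubini_integral[OF int, symmetric])
  also have "\<dots> = (\<integral>\<eta>. of_real D * (cis (x \<bullet> \<eta>) * (of_real (norm \<eta> powr (lam - real DIM('a))) * A \<eta>)) \<partial>lborel)"
  proof (rule integral_cong_AE)
    show "AE \<eta> in lborel. (\<integral>t. of_real (k t \<eta>) * (cis (x \<bullet> \<eta>) * A \<eta>) \<partial>lborel) = of_real D * (cis (x \<bullet> \<eta>) * (of_real (norm \<eta> powr (lam - real DIM('a))) * A \<eta>))"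
      using ae0
    proof eventually_elim
      case (elim \<eta>)
      have "(\<integral>t. k t \<eta> \<partial>lborel) = D * norm \<eta> powr (lam - real DIM('a))"
        using D k0 by (subst integral_eq_nn_integral) (auto simp: kint[OF elim])
      then have "(\<integral>t. complex_of_real (k t \<eta>) \<partial>lborel) = of_real (D * norm \<eta> powr (lam - real DIM('a)))"
        by (simp only: integral_complex_of_real)
      then show ?case by (simp only: integral_mult_left_zero of_real_mult) (simp only: mult_ac)
    qed
  qed measurable
  also have "\<dots> = of_real D * (\<integral>\<eta>. cis (x \<bullet> \<eta>) * (of_real (norm \<eta> powr (lam - real DIM('a))) * A \<eta>) \<partial>lborel)"
    by (rule integral_mult_right_zero)
  finally have main: "complex_of_real (\<integral>t. exp (t * (lam / 2)) * G t \<partial>lborel) = of_real D * (\<integral>\<eta>. cis (x \<bullet> \<eta>) * (of_real (norm \<eta> powr (lam - real DIM('a))) * A \<eta>) \<partial>lborel)" .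
  let ?p = "\<lambda>y. (norm (rep_L2 u y))\<^sup>2"
  have aex: "AE y in lborel. y \<noteq> x" by (simp add: AE_lborel_singleton)
  \<comment> \<open>In position space everything is nonnegative, so Tonelli sums the Gaussians to
    the Riesz kernel; finiteness is inherited from the frequency side.\<close>
  have "ennreal C * (\<integral>\<^sup>+y. ennreal (norm (x - y) powr (- lam) * ?p y) \<partial>lborel)
     = (\<integral>\<^sup>+y. ennreal C * ennreal (norm (x - y) powr (- lam) * ?p y) \<partial>lborel)"
    by (rule nn_integral_cmult[symmetric]) measurable
  also have "\<dots> = (\<integral>\<^sup>+y. (\<integral>\<^sup>+t. ennreal (exp (t * (lam / 2)) * (exp (- exp t * (norm (x - y))\<^sup>2 / 2) * ?p y)) \<partial>lborel) \<partial>lborel)"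
  proof (intro nn_integral_cong_AE, use aex in eventually_elim)
    case (elim y)
    have "(\<integral>\<^sup>+t. ennreal (exp (t * (lam / 2)) * (exp (- exp t * (norm (x - y))\<^sup>2 / 2) * ?p y)) \<partial>lborel)
      = (\<integral>\<^sup>+t. ennreal (exp (t * (lam / 2)) * exp (- exp t * (norm (x - y))\<^sup>2 / 2)) * ennreal (?p y) \<partial>lborel)"
      by (intro nn_integral_cong) (simp add: ennreal_mult[symmetric] mult.assoc)
    also have "\<dots> = (\<integral>\<^sup>+t. ennreal (exp (t * (lam / 2)) * exp (- exp t * (norm (x - y))\<^sup>2 / 2)) \<partial>lborel) * ennreal (?p y)"
      by (rule nn_integral_multc) measurable
    also have "\<dots> = ennreal (C * norm (x - y) powr - lam) * ennreal (?p y)"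
      using riesz_superposition_norm[of "x - y" lam] elim lam by (simp add: C_def)
    finally show ?case using C by (simp add: ennreal_mult[symmetric] mult.assoc)
  qed
  also have "\<dots> = (\<integral>\<^sup>+t. (\<integral>\<^sup>+y. ennreal (exp (t * (lam / 2)) * (exp (- exp t * (norm (x - y))\<^sup>2 / 2) * ?p y)) \<partial>lborel) \<partial>lborel)"
    by (rule lborel_pair.Fubini'[symmetric]) measurable
  also have "\<dots> = (\<integral>\<^sup>+t. ennreal (exp (t * (lam / 2)) * G t) \<partial>lborel)"
  proof (rule nn_integral_cong)
    fix t :: real
    have i: "integrable lborel (\<lambda>y. exp (- exp t * (norm (x - y))\<^sup>2 / 2) * ?p y)"
      by (rule Bochner_Integration.integrable_bound[of _ ?p])
         (use square_integrable_rep[of u] in \<open>auto simp: square_integrable_def mult_left_le_one_le\<close>)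
    have "(\<integral>\<^sup>+y. ennreal (exp (t * (lam / 2)) * (exp (- exp t * (norm (x - y))\<^sup>2 / 2) * ?p y)) \<partial>lborel)
      = ennreal (\<integral>y. exp (t * (lam / 2)) * (exp (- exp t * (norm (x - y))\<^sup>2 / 2) * ?p y) \<partial>lborel)"
      by (rule nn_integral_eq_integral[OF integrable_mult_right[OF i]]) simp
    also have "(\<integral>y. exp (t * (lam / 2)) * (exp (- exp t * (norm (x - y))\<^sup>2 / 2) * ?p y) \<partial>lborel) = exp (t * (lam / 2)) * G t"
      unfolding G_def by (rule integral_mult_right_zero)
    finally show "(\<integral>\<^sup>+y. ennreal (exp (t * (lam / 2)) * (exp (- exp t * (norm (x - y))\<^sup>2 / 2) * ?p y)) \<partial>lborel) = ennreal (exp (t * (lam / 2)) * G t)" .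
  qed
  also have "\<dots> = ennreal (\<integral>t. exp (t * (lam / 2)) * G t \<partial>lborel)"
    by (rule nn_integral_eq_integral[OF intG']) (simp add: G0)
  finally have eq: "ennreal C * (\<integral>\<^sup>+y. ennreal (norm (x - y) powr (- lam) * ?p y) \<partial>lborel) = ennreal (\<integral>t. exp (t * (lam / 2)) * G t \<partial>lborel)" .
  \<comment> \<open>The Bochner integral of a nonnegative function is \<open>enn2real\<close> of its
    nonnegative integral, and \<open>enn2real\<close> respects the factor \<open>C\<close>, so
    \<open>eq\<close> can be read off in the reals.\<close>
  have "C * Defs.convolution (\<lambda>z. norm z powr (- lam)) ?p x = (\<integral>t. exp (t * (lam / 2)) * G t \<partial>lborel)"
  proof -
    have "Defs.convolution (\<lambda>z. norm z powr (- lam)) ?p x = enn2real (\<integral>\<^sup>+y. ennreal (norm (x - y) powr (- lam) * ?p y) \<partial>lborel)"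
      unfolding Defs.convolution_def by (subst integral_eq_nn_integral) auto
    then have "C * Defs.convolution (\<lambda>z. norm z powr (- lam)) ?p x = enn2real (ennreal C * (\<integral>\<^sup>+y. ennreal (norm (x - y) powr (- lam) * ?p y) \<partial>lborel))"
      using C by (simp add: enn2real_mult)
    also have "\<dots> = (\<integral>t. exp (t * (lam / 2)) * G t \<partial>lborel)"
      unfolding eq by (intro enn2real_ennreal Bochner_Integration.integral_nonneg) (simp add: G0)
    finally show ?thesis .
  qed
  then have "Defs.convolution (\<lambda>z. norm z powr (- lam)) ?p x = (\<integral>t. exp (t * (lam / 2)) * G t \<partial>lborel) / C"
    using C by (simp add: field_simps)
  then show ?thesis
    unfolding A_def[symmetric] D_def[symmetric] C_def[symmetric] using main by (simp add: of_real_divide)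
qed

section \<open>Products with a potential as convolutions in frequency\<close>

lemma ennreal_le_if_power2_le:
  assumes "x\<^sup>2 \<le> ennreal (c\<^sup>2)" "0 \<le> c"
  shows "x \<le> ennreal c"
proof (cases x)
  case (real r)
  then have "r\<^sup>2 \<le> c\<^sup>2" using assms by (simp add: ennreal_power)
  then have "r \<le> c" using assms(2) by (rule power2_le_imp_le)
  then show ?thesis unfolding real(2) by (rule ennreal_leI)
next
  case top
  then show ?thesis using assms by (simp add: top_unique)
qed

lemma nn_cauchy_schwarz_L2:
  fixes f g :: "'a::euclidean_space \<Rightarrow> complex"
  assumes "square_integrable f" "square_integrable g"
  shows "(\<integral>\<^sup>+x. ennreal (norm (f x) * norm (g x)) \<partial>lborel) \<le> ennreal (norm (L2_class f) * norm (L2_class g))"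
proof (rule ennreal_le_if_power2_le)
  note [measurable] = square_integrable_measurable[OF assms(1)] square_integrable_measurable[OF assms(2)]
  have "(\<integral>\<^sup>+x. ennreal (norm (f x)) * ennreal (norm (g x)) \<partial>lborel)\<^sup>2
     \<le> (\<integral>\<^sup>+x. (ennreal (norm (f x)))\<^sup>2 \<partial>lborel) * (\<integral>\<^sup>+x. (ennreal (norm (g x)))\<^sup>2 \<partial>lborel)"
    by (rule Cauchy_Schwarz_nn_integral) measurable
  then show "(\<integral>\<^sup>+x. ennreal (norm (f x) * norm (g x)) \<partial>lborel)\<^sup>2 \<le> ennreal ((norm (L2_class f) * norm (L2_class g))\<^sup>2)"
    by (simp add: ennreal_power nn_norm_L2_class assms ennreal_mult power_mult_distrib)
qed simp

text \<open>Cauchy--Schwarz with respect to the measure of density \<Phi>, followed by Tonelli and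
  translation invariance.\<close>

lemma nn_young:
  fixes \<Phi> H :: "'a::euclidean_space \<Rightarrow> ennreal"
  assumes [measurable]: "\<Phi> \<in> borel_measurable borel" "H \<in> borel_measurable borel"
  shows "(\<integral>\<^sup>+\<xi>. (\<integral>\<^sup>+\<eta>. \<Phi> \<eta> * H (\<xi> - \<eta>) \<partial>lborel)\<^sup>2 \<partial>lborel) \<le> (\<integral>\<^sup>+\<eta>. \<Phi> \<eta> \<partial>lborel)\<^sup>2 * (\<integral>\<^sup>+\<xi>. (H \<xi>)\<^sup>2 \<partial>lborel)"
proof -
  let ?M = "density lborel \<Phi>"
  have "(\<integral>\<^sup>+\<eta>. \<Phi> \<eta> * H (\<xi> - \<eta>) \<partial>lborel)\<^sup>2 \<le> (\<integral>\<^sup>+\<eta>. \<Phi> \<eta> \<partial>lborel) * (\<integral>\<^sup>+\<eta>. \<Phi> \<eta> * (H (\<xi> - \<eta>))\<^sup>2 \<partial>lborel)" for \<xi>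
    using Cauchy_Schwarz_nn_integral[of "\<lambda>_. 1" ?M "\<lambda>\<eta>. H (\<xi> - \<eta>)"]
    by (simp add: nn_integral_density emeasure_density)
  then have "(\<integral>\<^sup>+\<xi>. (\<integral>\<^sup>+\<eta>. \<Phi> \<eta> * H (\<xi> - \<eta>) \<partial>lborel)\<^sup>2 \<partial>lborel)
     \<le> (\<integral>\<^sup>+\<xi>. (\<integral>\<^sup>+\<eta>. \<Phi> \<eta> \<partial>lborel) * (\<integral>\<^sup>+\<eta>. \<Phi> \<eta> * (H (\<xi> - \<eta>))\<^sup>2 \<partial>lborel) \<partial>lborel)"
    by (rule nn_integral_mono)
  also have "\<dots> = (\<integral>\<^sup>+\<eta>. \<Phi> \<eta> \<partial>lborel) * (\<integral>\<^sup>+\<xi>. (\<integral>\<^sup>+\<eta>. \<Phi> \<eta> * (H (\<xi> - \<eta>))\<^sup>2 \<partial>lborel) \<partial>lborel)"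
    by (rule nn_integral_cmult) measurable
  also have "(\<integral>\<^sup>+\<xi>. (\<integral>\<^sup>+\<eta>. \<Phi> \<eta> * (H (\<xi> - \<eta>))\<^sup>2 \<partial>lborel) \<partial>lborel) = (\<integral>\<^sup>+\<eta>. (\<integral>\<^sup>+\<xi>. \<Phi> \<eta> * (H (\<xi> - \<eta>))\<^sup>2 \<partial>lborel) \<partial>lborel)"
    by (rule lborel_pair.Fubini'[symmetric]) measurable
  also have "\<dots> = (\<integral>\<^sup>+\<eta>. \<Phi> \<eta> * (\<integral>\<^sup>+\<xi>. (H \<xi>)\<^sup>2 \<partial>lborel) \<partial>lborel)"
  proof (rule nn_integral_cong)
    fix \<eta> :: 'a
    have "(\<integral>\<^sup>+\<xi>. \<Phi> \<eta> * (H (\<xi> - \<eta>))\<^sup>2 \<partial>lborel) = \<Phi> \<eta> * (\<integral>\<^sup>+\<xi>. (H (\<xi> + (- \<eta>)))\<^sup>2 \<partial>lborel)"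
      by (subst nn_integral_cmult) auto
    also have "(\<integral>\<^sup>+\<xi>. (H (\<xi> + (- \<eta>)))\<^sup>2 \<partial>lborel) = (\<integral>\<^sup>+\<xi>. (H \<xi>)\<^sup>2 \<partial>lborel)"
      by (rule nn_integral_lborel_translate[of "\<lambda>x. (H x)\<^sup>2"]) measurable
    finally show "(\<integral>\<^sup>+\<xi>. \<Phi> \<eta> * (H (\<xi> - \<eta>))\<^sup>2 \<partial>lborel) = \<Phi> \<eta> * (\<integral>\<^sup>+\<xi>. (H \<xi>)\<^sup>2 \<partial>lborel)" .
  qed
  also have "\<dots> = (\<integral>\<^sup>+\<eta>. \<Phi> \<eta> \<partial>lborel) * (\<integral>\<^sup>+\<xi>. (H \<xi>)\<^sup>2 \<partial>lborel)"
    by (rule nn_integral_multc) measurable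
  finally show ?thesis by (simp add: power2_eq_square mult.assoc)
qed

lemma square_integrable_convolution:
  fixes \<phi> f :: "'a::euclidean_space \<Rightarrow> complex"
  assumes \<phi>: "integrable lborel \<phi>" and f: "square_integrable f"
  shows "square_integrable (\<lambda>\<xi>. \<integral>\<eta>. \<phi> \<eta> * f (\<xi> - \<eta>) \<partial>lborel)"
proof -
  note [measurable] = borel_measurable_integrable[OF \<phi>] square_integrable_measurable[OF f]
  have "(\<integral>\<^sup>+\<xi>. ennreal ((norm (\<integral>\<eta>. \<phi> \<eta> * f (\<xi> - \<eta>) \<partial>lborel))\<^sup>2) \<partial>lborel)
     \<le> (\<integral>\<^sup>+\<xi>. (\<integral>\<^sup>+\<eta>. ennreal (norm (\<phi> \<eta>)) * ennreal (norm (f (\<xi> - \<eta>))) \<partial>lborel)\<^sup>2 \<partial>lborel)"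
  proof (rule nn_integral_mono)
    fix \<xi> :: 'a
    have "ennreal (norm (\<integral>\<eta>. \<phi> \<eta> * f (\<xi> - \<eta>) \<partial>lborel)) \<le> (\<integral>\<^sup>+\<eta>. ennreal (norm (\<phi> \<eta>)) * ennreal (norm (f (\<xi> - \<eta>))) \<partial>lborel)"
      using ennreal_norm_integral_le[of lborel "\<lambda>\<eta>. \<phi> \<eta> * f (\<xi> - \<eta>)"] by (simp add: norm_mult ennreal_mult)
    then show "ennreal ((norm (\<integral>\<eta>. \<phi> \<eta> * f (\<xi> - \<eta>) \<partial>lborel))\<^sup>2) \<le> (\<integral>\<^sup>+\<eta>. ennreal (norm (\<phi> \<eta>)) * ennreal (norm (f (\<xi> - \<eta>))) \<partial>lborel)\<^sup>2"
      by (subst ennreal_power[symmetric]) (auto intro: power_mono)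
  qed
  also have "\<dots> \<le> (\<integral>\<^sup>+\<eta>. ennreal (norm (\<phi> \<eta>)) \<partial>lborel)\<^sup>2 * (\<integral>\<^sup>+\<xi>. (ennreal (norm (f \<xi>)))\<^sup>2 \<partial>lborel)"
    by (rule nn_young) measurable
  also have "\<dots> < \<infinity>"
    using \<phi> f by (simp add: ennreal_power square_integrable_iff_nn integrable_iff_bounded ennreal_mult_less_top power_less_top_ennreal)
  finally show ?thesis by (simp add: square_integrable_iff_nn)
qed

lemma fourier_adjoint: "fourier f \<bullet> g = f \<bullet> inv_fourier g"
  using fourier_L2_adjoint[of "-1" f g] by (simp add: fourier_eq inv_fourier_eq)

text \<open>Proved weakly: after pairing with an arbitrary \<open>g\<close> all exchanges of
  integrals converge absolutely, whereas the convolution itself is only guaranteed to converge at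
  almost every frequency.\<close>

lemma fourier_mult_inverse_transform:
  fixes u :: "'a::euclidean_space L2"
  assumes \<phi>: "integrable lborel \<phi>"
  shows "fourier (mult_op (\<lambda>x. \<integral>\<eta>. cis (x \<bullet> \<eta>) * \<phi> \<eta> \<partial>lborel) u) = L2_class (\<lambda>\<xi>. \<integral>\<eta>. \<phi> \<eta> * rep_L2 (fourier u) (\<xi> - \<eta>) \<partial>lborel)"
    (is "fourier (mult_op ?V u) = L2_class ?C")
proof -
  define f where "f = rep_L2 (fourier u)"
  note [measurable] = borel_measurable_integrable[OF \<phi>]
  have f: "square_integrable f" and [measurable]: "f \<in> borel_measurable borel" by (simp_all add: f_def)
  have Vmeas [measurable]: "?V \<in> borel_measurable borel" by measurable
  have Vb: "norm (?V x) \<le> (\<integral>\<eta>. norm (\<phi> \<eta>) \<partial>lborel)" for x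
    using integral_norm_bound[of lborel "\<lambda>\<eta>. cis (x \<bullet> \<eta>) * \<phi> \<eta>"] by (simp add: norm_mult)
  have C: "square_integrable ?C" using square_integrable_convolution[OF \<phi> f] by (simp add: f_def)
  have "fourier (mult_op ?V u) \<bullet> g = L2_class ?C \<bullet> g" for g
  proof -
    define w where "w = inv_fourier g"
    have gw: "g = fourier w" by (simp add: w_def)
    let ?p = "\<lambda>x. rep_L2 u x * cnj (rep_L2 w x)"
    have p: "integrable lborel ?p" by (intro integrable_mult_L2 square_integrable_cnj square_integrable_rep)
    have par: "(\<integral>x. cis (x \<bullet> \<eta>) * ?p x \<partial>lborel) = (\<integral>\<xi>. f (\<xi> - \<eta>) * cnj (rep_L2 g \<xi>) \<partial>lborel)" for \<eta>
    proof -
      let ?e = "\<lambda>x::'a. cis (x \<bullet> \<eta>)"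
      have "AE y in lborel. rep_L2 (mult_op ?e u) y = ?e y * rep_L2 u y"
        by (rule rep_mult_op[of _ 1]) auto
      then have "(\<integral>x. cis (x \<bullet> \<eta>) * ?p x \<partial>lborel) = (\<integral>x. rep_L2 (mult_op ?e u) x * cnj (rep_L2 w x) \<partial>lborel)"
        by (intro integral_cong_AE, measurable, elim eventually_mono) (simp only: mult.assoc)
      also have "\<dots> = (\<integral>\<xi>. rep_L2 (translate_L2 (-\<eta>) (fourier u)) \<xi> * cnj (rep_L2 g \<xi>) \<partial>lborel)"
        unfolding gw fourier_modulation[symmetric] by (rule parseval_complex[symmetric])
      also have "\<dots> = (\<integral>\<xi>. f (\<xi> - \<eta>) * cnj (rep_L2 g \<xi>) \<partial>lborel)"
        by (rule integral_cong_AE, measurable, use rep_translate_L2[of "-\<eta>" "fourier u"] in eventually_elim) (simp add: f_def)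
      finally show ?thesis .
    qed
    have i1: "integrable (lborel \<Otimes>\<^sub>M lborel) (\<lambda>(x, \<eta>). cis (x \<bullet> \<eta>) * (?p x * \<phi> \<eta>))"
    proof (rule integrable_tensor[OF p \<phi>, of _ 1])
      show "(\<lambda>(x::'a, \<eta>). cis (x \<bullet> \<eta>)) \<in> borel_measurable (borel \<Otimes>\<^sub>M borel)"
        using measurable_cis_inner[of 1, where 'a='a] by simp
    qed simp
    have i2: "integrable (lborel \<Otimes>\<^sub>M lborel) (\<lambda>(\<eta>, \<xi>). \<phi> \<eta> * (f (\<xi> - \<eta>) * cnj (rep_L2 g \<xi>)))"
    proof (rule integrable_pairI)
      have "(\<integral>\<^sup>+\<eta>. (\<integral>\<^sup>+\<xi>. ennreal (norm (\<phi> \<eta> * (f (\<xi> - \<eta>) * cnj (rep_L2 g \<xi>)))) \<partial>lborel) \<partial>lborel)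
         \<le> (\<integral>\<^sup>+\<eta>. ennreal (norm (\<phi> \<eta>)) * ennreal (norm (L2_class f) * norm g) \<partial>lborel)"
      proof (rule nn_integral_mono)
        fix \<eta> :: 'a
        have ft: "square_integrable (\<lambda>\<xi>. f (\<xi> - \<eta>))" using square_integrable_translate[OF f, of "-\<eta>"] by simp
        have nf: "norm (L2_class (\<lambda>\<xi>. f (\<xi> - \<eta>))) = norm (L2_class f)"
          using nn_norm_translate[of f "-\<eta>"] nn_norm_L2_class[OF f] nn_norm_L2_class[OF ft] by simp
        have "(\<integral>\<^sup>+\<xi>. ennreal (norm (\<phi> \<eta> * (f (\<xi> - \<eta>) * cnj (rep_L2 g \<xi>)))) \<partial>lborel) = ennreal (norm (\<phi> \<eta>)) * (\<integral>\<^sup>+\<xi>. ennreal (norm (f (\<xi> - \<eta>)) * norm (rep_L2 g \<xi>)) \<partial>lborel)"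
          by (subst nn_integral_cmult[symmetric]) (auto simp: norm_mult ennreal_mult)
        also have "\<dots> \<le> ennreal (norm (\<phi> \<eta>)) * ennreal (norm (L2_class f) * norm g)"
          using nn_cauchy_schwarz_L2[OF ft square_integrable_rep[of g]] by (intro mult_left_mono) (simp_all add: nf)
        finally show "(\<integral>\<^sup>+\<xi>. ennreal (norm (\<phi> \<eta> * (f (\<xi> - \<eta>) * cnj (rep_L2 g \<xi>)))) \<partial>lborel) \<le> ennreal (norm (\<phi> \<eta>)) * ennreal (norm (L2_class f) * norm g)" .
      qed
      also have "\<dots> < \<infinity>"
        using \<phi> by (subst nn_integral_multc) (auto simp: integrable_iff_bounded ennreal_mult_less_top)
      finally show "(\<integral>\<^sup>+\<eta>. (\<integral>\<^sup>+\<xi>. ennreal (norm (\<phi> \<eta> * (f (\<xi> - \<eta>) * cnj (rep_L2 g \<xi>)))) \<partial>lborel) \<partial>lborel) < \<infinity>" .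
    qed measurable
    have "(\<integral>x. (?V x * rep_L2 u x) * cnj (rep_L2 w x) \<partial>lborel) = (\<integral>x. (\<integral>\<eta>. cis (x \<bullet> \<eta>) * (?p x * \<phi> \<eta>) \<partial>lborel) \<partial>lborel)"
    proof (rule Bochner_Integration.integral_cong)
      fix x :: 'a
      have "(\<integral>\<eta>. cis (x \<bullet> \<eta>) * (?p x * \<phi> \<eta>) \<partial>lborel) = (\<integral>\<eta>. (cis (x \<bullet> \<eta>) * \<phi> \<eta>) * ?p x \<partial>lborel)"
        by (simp only: mult_ac)
      also have "\<dots> = ?V x * ?p x" by (rule integral_mult_left_zero)
      finally show "(?V x * rep_L2 u x) * cnj (rep_L2 w x) = (\<integral>\<eta>. cis (x \<bullet> \<eta>) * (?p x * \<phi> \<eta>) \<partial>lborel)"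
        by (simp only: mult.assoc)
    qed simp
    also have "\<dots> = (\<integral>\<eta>. (\<integral>x. cis (x \<bullet> \<eta>) * (?p x * \<phi> \<eta>) \<partial>lborel) \<partial>lborel)"
      by (rule lborel_pair.Fubini_integral[OF i1, symmetric])
    also have "\<dots> = (\<integral>\<eta>. (\<integral>\<xi>. \<phi> \<eta> * (f (\<xi> - \<eta>) * cnj (rep_L2 g \<xi>)) \<partial>lborel) \<partial>lborel)"
    proof (rule Bochner_Integration.integral_cong)
      fix \<eta> :: 'a
      have "(\<integral>x. cis (x \<bullet> \<eta>) * (?p x * \<phi> \<eta>) \<partial>lborel) = (\<integral>x. (cis (x \<bullet> \<eta>) * ?p x) * \<phi> \<eta> \<partial>lborel)"
        by (simp only: mult.assoc)
      also have "\<dots> = (\<integral>\<xi>. f (\<xi> - \<eta>) * cnj (rep_L2 g \<xi>) \<partial>lborel) * \<phi> \<eta>"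
        by (simp only: integral_mult_left_zero par)
      also have "\<dots> = \<phi> \<eta> * (\<integral>\<xi>. f (\<xi> - \<eta>) * cnj (rep_L2 g \<xi>) \<partial>lborel)" by (rule mult.commute)
      also have "\<dots> = (\<integral>\<xi>. \<phi> \<eta> * (f (\<xi> - \<eta>) * cnj (rep_L2 g \<xi>)) \<partial>lborel)"
        by (rule integral_mult_right_zero[symmetric])
      finally show "(\<integral>x. cis (x \<bullet> \<eta>) * (?p x * \<phi> \<eta>) \<partial>lborel) = (\<integral>\<xi>. \<phi> \<eta> * (f (\<xi> - \<eta>) * cnj (rep_L2 g \<xi>)) \<partial>lborel)" .
    qed simp
    also have "\<dots> = (\<integral>\<xi>. (\<integral>\<eta>. \<phi> \<eta> * (f (\<xi> - \<eta>) * cnj (rep_L2 g \<xi>)) \<partial>lborel) \<partial>lborel)"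
      by (rule lborel_pair.Fubini_integral[OF i2, symmetric])
    also have "\<dots> = (\<integral>\<xi>. ?C \<xi> * cnj (rep_L2 g \<xi>) \<partial>lborel)"
      unfolding f_def[symmetric] mult.assoc[symmetric] integral_mult_left_zero ..
    finally have eq: "(\<integral>x. (?V x * rep_L2 u x) * cnj (rep_L2 w x) \<partial>lborel) = (\<integral>\<xi>. ?C \<xi> * cnj (rep_L2 g \<xi>) \<partial>lborel)" .
    have "fourier (mult_op ?V u) \<bullet> g = mult_op ?V u \<bullet> w" by (simp add: fourier_adjoint w_def)
    also have "\<dots> = Re (\<integral>x. (?V x * rep_L2 u x) * cnj (rep_L2 w x) \<partial>lborel)"
      using inner_L2_class_Re[OF square_integrable_mult[OF Vmeas Vb square_integrable_rep] square_integrable_rep, of u w]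
      by (simp add: mult_op_def)
    also have "\<dots> = L2_class ?C \<bullet> g"
      unfolding eq using inner_L2_class_Re[OF C square_integrable_rep[of g]] by simp
    finally show ?thesis .
  qed
  then show ?thesis using vector_eq_rdot by blast
qed

text \<open>Contains all normalising constants, so that the Hartree potential at x is just the
  integral of \<open>cis (x \<bullet> \<eta>)\<close> against this function, taken at
  \<open>f = fourier u\<close>.\<close>

definition hartree_density :: "real \<Rightarrow> ('a::euclidean_space \<Rightarrow> complex) \<Rightarrow> 'a \<Rightarrow> complex" where
  "hartree_density lam f \<eta> =
    of_real ((2 * pi) powr (- real DIM('a) / 2) * riesz_const ((real DIM('a) - lam) / 2) / riesz_const (lam / 2))
      * (of_real (norm \<eta> powr (lam - real DIM('a))) * autocorrelation f \<eta>)"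

text \<open>Under \<open>fin\<close> the density is integrable, so the potential is a bounded
  function given by an absolutely convergent Fourier integral, and the Hartree term is a
  multiplication operator applied to u.\<close>

lemma fourier_hartree:
  fixes u :: "'a::euclidean_space L2"
  assumes lam: "0 < lam" "lam < real DIM('a)"
    and fin: "(\<integral>\<^sup>+\<eta>. ennreal (norm \<eta> powr (lam - real DIM('a)) * norm (autocorrelation (rep_L2 (fourier u)) \<eta>)) \<partial>lborel) < \<infinity>"
  shows "integrable lborel (hartree_density lam (rep_L2 (fourier u)))"
    and "fourier (hartree lam u) = L2_class (\<lambda>\<xi>. \<integral>\<eta>. hartree_density lam (rep_L2 (fourier u)) \<eta> * rep_L2 (fourier u) (\<xi> - \<eta>) \<partial>lborel)"
proof -
  let ?f = "rep_L2 (fourier u)"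
  let ?K = "(2 * pi) powr (- real DIM('a) / 2) * riesz_const ((real DIM('a) - lam) / 2) / riesz_const (lam / 2)"
  show int: "integrable lborel (hartree_density lam ?f)"
    unfolding hartree_density_def
    by (intro integrable_mult_right integrableI_bounded) (use fin in \<open>auto simp: norm_mult\<close>)
  have "of_real (Defs.convolution (\<lambda>z. norm z powr (- lam)) (\<lambda>y. (norm (rep_L2 u y))\<^sup>2) x) = (\<integral>\<eta>. cis (x \<bullet> \<eta>) * hartree_density lam ?f \<eta> \<partial>lborel)" for x
    unfolding riesz_potential_fourier[OF lam fin] hartree_density_def integral_mult_right_zero[symmetric]
    by (simp only: mult.left_commute)
  then have "hartree lam u = mult_op (\<lambda>x. \<integral>\<eta>. cis (x \<bullet> \<eta>) * hartree_density lam ?f \<eta> \<partial>lborel) u"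
    by (simp add: hartree_def mult_op_def)
  then show "fourier (hartree lam u) = L2_class (\<lambda>\<xi>. \<integral>\<eta>. hartree_density lam ?f \<eta> * ?f (\<xi> - \<eta>) \<partial>lborel)"
    by (simp only: fourier_mult_inverse_transform[OF int])
qed

subsection \<open>The trilinear Sobolev estimate\<close>

lemma nn_integral_gaussian:
  assumes "\<epsilon> > 0"
  shows "(\<integral>\<^sup>+b. ennreal (exp (- \<epsilon> * (norm b)\<^sup>2 / 2)) \<partial>(lborel :: 'a::euclidean_space measure)) = ennreal ((2 * pi / \<epsilon>) powr (real DIM('a) / 2))"
proof -
  have "has_bochner_integral lborel (\<lambda>b::'a. complex_of_real (exp (- \<epsilon> * (norm b)\<^sup>2 / 2))) (of_real ((2 * pi / \<epsilon>) powr (real DIM('a) / 2)))"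
    using gaussian_integral[OF assms, of "0::'a"] by simp
  then have "has_bochner_integral lborel (\<lambda>b::'a. exp (- \<epsilon> * (norm b)\<^sup>2 / 2)) ((2 * pi / \<epsilon>) powr (real DIM('a) / 2))"
    unfolding has_bochner_integral_iff complex_of_real_integrable_eq integral_complex_of_real by (simp only: of_real_eq_iff)
  then show ?thesis
    by (subst nn_integral_eq_integral) (auto simp: has_bochner_integral_iff)
qed

lemma nn_integral_exp_twosided_finite:
  assumes "a > 0" "b > 0"
  shows "(\<integral>\<^sup>+t. ennreal (if t \<le> 0 then exp (t * a) else exp (- (t * b))) \<partial>lborel) < \<infinity>"
proof -
  have "(\<integral>\<^sup>+t. ennreal (if t \<le> 0 then exp (t * a) else exp (- (t * b))) \<partial>lborel)
    \<le> (\<integral>\<^sup>+t. (ennreal (indicator {0..} (0 + -1 * t) * exp (- a * (0 + -1 * t))) + ennreal (indicator {0..} t * exp (- b * t))) \<partial>lborel)"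
    by (rule nn_integral_mono) (auto simp: indicator_def mult.commute)
  also have "\<dots> = (\<integral>\<^sup>+t. ennreal (indicator {0..} (0 + -1 * t) * exp (- a * (0 + -1 * t))) \<partial>lborel) + (\<integral>\<^sup>+t. ennreal (indicator {0..} t * exp (- b * t)) \<partial>lborel)"
    by (rule nn_integral_add) measurable
  also have "(\<integral>\<^sup>+t. ennreal (indicator {0..} (0 + -1 * t) * exp (- a * (0 + -1 * t))) \<partial>lborel) = (\<integral>\<^sup>+t. ennreal (indicator {0..} t * exp (- a * t)) \<partial>lborel)"
    by (subst (2) nn_integral_real_affine[of _ "-1" 0]) auto
  finally show ?thesis
    using nn_integral_exp_halfline_finite[OF assms(1)] nn_integral_exp_halfline_finite[OF assms(2)]
    by (auto intro: le_less_trans)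
qed

text \<open>Instead of polar coordinates the power is written as a superposition of Gaussians. For
  \<open>t \<le> 0\<close> the Gaussian is at most 1 and the ball has finite volume; for
  \<open>t > 0\<close> the Gaussian integral over the whole space supplies
  \<open>exp (- (t * (n / 2)))\<close>, which wins because \<open>p < n\<close>.\<close>

lemma radial_unit_ball_finite:
  assumes "0 < p" "p < real DIM('a::euclidean_space)"
  shows "(\<integral>\<^sup>+b. ennreal (norm b powr - p) * indicator (cball 0 1) b \<partial>(lborel :: 'a measure)) < \<infinity>"
proof -
  let ?n = "real DIM('a)"
  define V where "V = emeasure lborel (cball (0::'a) 1)"
  have [measurable]: "cball (0::'a) 1 \<in> sets borel" by simp
  have V: "V < \<infinity>" unfolding V_def by (rule emeasure_lborel_cball_finite)
  define C where "C = riesz_const (p / 2)"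
  have C: "C > 0" using assms riesz_const_pos[of "p/2"] by (simp add: C_def)
  have "ennreal C * (\<integral>\<^sup>+b. ennreal (norm b powr - p) * indicator (cball 0 1) b \<partial>(lborel :: 'a measure))
    = (\<integral>\<^sup>+b. ennreal C * (ennreal (norm b powr - p) * indicator (cball 0 1) b) \<partial>(lborel :: 'a measure))"
    by (rule nn_integral_cmult[symmetric]) measurable
  also have "\<dots> = (\<integral>\<^sup>+b. (\<integral>\<^sup>+t. ennreal (exp (t * (p / 2)) * exp (- exp t * (norm b)\<^sup>2 / 2)) * indicator (cball 0 1) b \<partial>lborel) \<partial>(lborel :: 'a measure))"
  proof (rule nn_integral_cong_AE, use AE_lborel_singleton[of "0::'a"] in eventually_elim)
    case (elim b)
    have "(\<integral>\<^sup>+t. ennreal (exp (t * (p / 2)) * exp (- exp t * (norm b)\<^sup>2 / 2)) * indicator (cball 0 1) b \<partial>lborel)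
      = ennreal (C * norm b powr - p) * indicator (cball 0 1) b"
      using riesz_superposition_norm[OF elim assms(1)] by (subst nn_integral_multc) (auto simp: C_def)
    then show ?case using C by (simp add: ennreal_mult mult.assoc)
  qed
  also have "\<dots> = (\<integral>\<^sup>+t. (\<integral>\<^sup>+b. ennreal (exp (t * (p / 2)) * exp (- exp t * (norm b)\<^sup>2 / 2)) * indicator (cball 0 1) b \<partial>(lborel :: 'a measure)) \<partial>lborel)"
    by (rule lborel_pair.Fubini'[symmetric]) measurable
  also have "\<dots> \<le> (\<integral>\<^sup>+t. ennreal (if t \<le> 0 then exp (t * (p / 2)) else exp (- (t * ((?n - p) / 2)))) * (V + ennreal ((2 * pi) powr (?n / 2))) \<partial>lborel)"
  proof (rule nn_integral_mono)
    fix t :: real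
    show "(\<integral>\<^sup>+b. ennreal (exp (t * (p / 2)) * exp (- exp t * (norm b)\<^sup>2 / 2)) * indicator (cball 0 1) b \<partial>(lborel :: 'a measure))
      \<le> ennreal (if t \<le> 0 then exp (t * (p / 2)) else exp (- (t * ((?n - p) / 2)))) * (V + ennreal ((2 * pi) powr (?n / 2)))"
    proof (cases "t \<le> 0")
      case True
      have "(\<integral>\<^sup>+b. ennreal (exp (t * (p / 2)) * exp (- exp t * (norm b)\<^sup>2 / 2)) * indicator (cball 0 1) b \<partial>(lborel :: 'a measure))
        \<le> (\<integral>\<^sup>+b. ennreal (exp (t * (p / 2))) * indicator (cball 0 1) b \<partial>(lborel :: 'a measure))"
        by (intro nn_integral_mono mult_right_mono ennreal_leI) (auto simp: mult_left_le)
      also have "\<dots> = ennreal (exp (t * (p / 2))) * V"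
        by (simp add: nn_integral_cmult V_def)
      also have "\<dots> \<le> ennreal (exp (t * (p / 2))) * (V + ennreal ((2 * pi) powr (?n / 2)))"
        by (intro mult_left_mono) auto
      finally show ?thesis using True by simp
    next
      case False
      have "(\<integral>\<^sup>+b. ennreal (exp (t * (p / 2)) * exp (- exp t * (norm b)\<^sup>2 / 2)) * indicator (cball 0 1) b \<partial>(lborel :: 'a measure))
        \<le> (\<integral>\<^sup>+b. ennreal (exp (t * (p / 2))) * ennreal (exp (- exp t * (norm b)\<^sup>2 / 2)) \<partial>(lborel :: 'a measure))"
        by (intro nn_integral_mono) (auto simp: indicator_def ennreal_mult)
      also have "\<dots> = ennreal (exp (t * (p / 2))) * ennreal ((2 * pi / exp t) powr (?n / 2))"
        by (subst nn_integral_cmult, measurable, subst nn_integral_gaussian) simp_all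
      also have "\<dots> = ennreal (exp (- (t * ((?n - p) / 2)))) * ennreal ((2 * pi) powr (?n / 2))"
      proof -
        have h1: "(2 * pi / exp t) powr (?n / 2) = (2 * pi) powr (?n / 2) * exp (- (t * (?n / 2)))"
        proof -
          have "exp t powr (?n / 2) = exp (t * (?n / 2))" by (simp add: powr_def mult.commute)
          moreover have "(2 * pi / exp t) powr (?n / 2) = (2 * pi) powr (?n / 2) / exp t powr (?n / 2)"
            by (simp add: powr_divide)
          ultimately show ?thesis by (simp only: exp_minus divide_inverse)
        qed
        have h2: "exp (t * (p / 2)) * exp (- (t * (?n / 2))) = exp (- (t * ((?n - p) / 2)))"
        proof -
          have "t * (p / 2) + - (t * (?n / 2)) = - (t * ((?n - p) / 2))" by (simp add: field_simps)
          then show ?thesis by (simp only: mult_exp_exp)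
        qed
        have "exp (t * (p / 2)) * (2 * pi / exp t) powr (?n / 2) = exp (- (t * ((?n - p) / 2))) * (2 * pi) powr (?n / 2)"
          unfolding h1 h2[symmetric] by (simp only: mult_ac)
        then show ?thesis by (simp add: ennreal_mult[symmetric])
      qed
      also have "\<dots> \<le> ennreal (exp (- (t * ((?n - p) / 2)))) * (V + ennreal ((2 * pi) powr (?n / 2)))"
        by (intro mult_left_mono) auto
      finally show ?thesis using False by simp
    qed
  qed
  also have "\<dots> = (\<integral>\<^sup>+t. ennreal (if t \<le> 0 then exp (t * (p / 2)) else exp (- (t * ((?n - p) / 2)))) \<partial>lborel) * (V + ennreal ((2 * pi) powr (?n / 2)))"
    by (rule nn_integral_multc) measurable
  also have "\<dots> < \<infinity>"
    using nn_integral_exp_twosided_finite[of "p/2" "(?n - p)/2"] assms V by (simp add: ennreal_mult_less_top)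
  finally show ?thesis using C by (auto simp: ennreal_mult_less_top)
qed

text \<open>Where \<open>norm b\<close> is at least 1, half of the Gaussian exponent is spent on the
  factor \<open>exp (- exp t / 4)\<close> and the other half is integrated over the whole space.
  What remains is a superposition with exponent (q - n)/2, positive by assumption.\<close>

lemma radial_exterior_finite:
  assumes "q > real DIM('a::euclidean_space)"
  shows "(\<integral>\<^sup>+b. ennreal (norm b powr - q) * indicator {b. 1 \<le> norm b} b \<partial>(lborel :: 'a measure)) < \<infinity>"
proof -
  let ?n = "real DIM('a)"
  have q: "q > 0" using assms by (meson le_less_trans of_nat_0_le_iff)
  define C where "C = riesz_const (q / 2)"
  have C: "C > 0" using q riesz_const_pos[of "q/2"] by (simp add: C_def)
  have [measurable]: "{b::'a. 1 \<le> norm b} \<in> sets borel" by measurable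
  have "ennreal C * (\<integral>\<^sup>+b. ennreal (norm b powr - q) * indicator {b. 1 \<le> norm b} b \<partial>(lborel :: 'a measure))
    = (\<integral>\<^sup>+b. ennreal C * (ennreal (norm b powr - q) * indicator {b. 1 \<le> norm b} b) \<partial>(lborel :: 'a measure))"
    by (rule nn_integral_cmult[symmetric]) measurable
  also have "\<dots> = (\<integral>\<^sup>+b. (\<integral>\<^sup>+t. ennreal (exp (t * (q / 2)) * exp (- exp t * (norm b)\<^sup>2 / 2)) * indicator {b. 1 \<le> norm b} b \<partial>lborel) \<partial>(lborel :: 'a measure))"
  proof (rule nn_integral_cong_AE, use AE_lborel_singleton[of "0::'a"] in eventually_elim)
    case (elim b)
    have "(\<integral>\<^sup>+t. ennreal (exp (t * (q / 2)) * exp (- exp t * (norm b)\<^sup>2 / 2)) * indicator {b. 1 \<le> norm b} b \<partial>lborel)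
      = ennreal (C * norm b powr - q) * indicator {b. 1 \<le> norm b} b"
      using riesz_superposition_norm[OF elim q] by (subst nn_integral_multc) (auto simp: C_def)
    then show ?case using C by (simp add: ennreal_mult mult.assoc)
  qed
  also have "\<dots> = (\<integral>\<^sup>+t. (\<integral>\<^sup>+b. ennreal (exp (t * (q / 2)) * exp (- exp t * (norm b)\<^sup>2 / 2)) * indicator {b. 1 \<le> norm b} b \<partial>(lborel :: 'a measure)) \<partial>lborel)"
    by (rule lborel_pair.Fubini'[symmetric]) measurable
  also have "\<dots> \<le> (\<integral>\<^sup>+t. ennreal ((4 * pi) powr (?n / 2)) * ennreal (exp (t * ((q - ?n) / 2)) * exp (- exp t * (1 / 2) / 2)) \<partial>lborel)"
  proof (rule nn_integral_mono)
    fix t :: real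
    have "(\<integral>\<^sup>+b. ennreal (exp (t * (q / 2)) * exp (- exp t * (norm b)\<^sup>2 / 2)) * indicator {b. 1 \<le> norm b} b \<partial>(lborel :: 'a measure))
      \<le> (\<integral>\<^sup>+b. ennreal (exp (t * (q / 2)) * exp (- exp t * (1 / 2) / 2)) * ennreal (exp (- (exp t / 2) * (norm b)\<^sup>2 / 2)) \<partial>(lborel :: 'a measure))"
    proof (rule nn_integral_mono)
      fix b :: 'a
      have "exp (t * (q / 2)) * exp (- exp t * (norm b)\<^sup>2 / 2) \<le> exp (t * (q / 2)) * exp (- exp t * (1 / 2) / 2) * exp (- (exp t / 2) * (norm b)\<^sup>2 / 2)" if "1 \<le> norm b"
      proof -
        have "exp t * 1 \<le> exp t * (norm b)\<^sup>2" using that by (intro mult_left_mono one_le_power) auto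
        then have "- exp t * (norm b)\<^sup>2 / 2 \<le> - exp t * (1 / 2) / 2 + - (exp t / 2) * (norm b)\<^sup>2 / 2" by (simp add: field_simps)
        then show ?thesis by (simp only: mult_exp_exp exp_le_cancel_iff)
      qed
      then show "ennreal (exp (t * (q / 2)) * exp (- exp t * (norm b)\<^sup>2 / 2)) * indicator {b. 1 \<le> norm b} b
        \<le> ennreal (exp (t * (q / 2)) * exp (- exp t * (1 / 2) / 2)) * ennreal (exp (- (exp t / 2) * (norm b)\<^sup>2 / 2))"
        by (auto simp: indicator_def ennreal_mult[symmetric] intro!: ennreal_leI)
    qed
    also have "\<dots> = ennreal (exp (t * (q / 2)) * exp (- exp t * (1 / 2) / 2)) * ennreal ((2 * pi / (exp t / 2)) powr (?n / 2))"
      using nn_integral_gaussian[of "exp t / 2", where 'a='a] by (subst nn_integral_cmult) auto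
    also have "\<dots> = ennreal ((4 * pi) powr (?n / 2)) * ennreal (exp (t * ((q - ?n) / 2)) * exp (- exp t * (1 / 2) / 2))"
    proof -
      have h1: "(2 * pi / (exp t / 2)) powr (?n / 2) = (4 * pi) powr (?n / 2) * exp (- (t * (?n / 2)))"
      proof -
        have "exp t powr (?n / 2) = exp (t * (?n / 2))" by (simp add: powr_def mult.commute)
        moreover have "(4 * pi / exp t) powr (?n / 2) = (4 * pi) powr (?n / 2) / exp t powr (?n / 2)"
          by (simp add: powr_divide)
        moreover have "2 * pi / (exp t / 2) = 4 * pi / exp t" by simp
        ultimately show ?thesis by (simp only: exp_minus divide_inverse)
      qed
      have h2: "exp (t * (q / 2)) * exp (- (t * (?n / 2))) = exp (t * ((q - ?n) / 2))"
      proof -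
        have "t * (q / 2) + - (t * (?n / 2)) = t * ((q - ?n) / 2)" by (simp add: field_simps)
        then show ?thesis by (simp only: mult_exp_exp)
      qed
      have "exp (t * (q / 2)) * exp (- exp t * (1 / 2) / 2) * (2 * pi / (exp t / 2)) powr (?n / 2) = (4 * pi) powr (?n / 2) * (exp (t * ((q - ?n) / 2)) * exp (- exp t * (1 / 2) / 2))"
        unfolding h1 h2[symmetric] by (simp only: mult_ac)
      then show ?thesis by (simp add: ennreal_mult[symmetric])
    qed
    finally show "(\<integral>\<^sup>+b. ennreal (exp (t * (q / 2)) * exp (- exp t * (norm b)\<^sup>2 / 2)) * indicator {b. 1 \<le> norm b} b \<partial>(lborel :: 'a measure))
      \<le> ennreal ((4 * pi) powr (?n / 2)) * ennreal (exp (t * ((q - ?n) / 2)) * exp (- exp t * (1 / 2) / 2))" .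
  qed
  also have "\<dots> = ennreal ((4 * pi) powr (?n / 2)) * ennreal (riesz_const ((q - ?n) / 2) * (1/2) powr - ((q - ?n) / 2))"
    using riesz_superposition[of "1/2" "(q - ?n)/2"] assms by (subst nn_integral_cmult) auto
  also have "\<dots> < \<infinity>" by (simp add: ennreal_mult_less_top)
  finally show ?thesis using C by (auto simp: ennreal_mult_less_top)
qed

lemma radial_ball_bound:
  assumes "0 < p" "p < real DIM('a::euclidean_space)"
  obtains C where "C > 0" "\<And>R. R > 0 \<Longrightarrow> (\<integral>\<^sup>+b. ennreal (norm b powr - p) * indicator {b. norm b \<le> R} b \<partial>(lborel :: 'a measure)) \<le> ennreal (C * R powr (real DIM('a) - p))"
proof -
  let ?I = "\<integral>\<^sup>+b. ennreal (norm b powr - p) * indicator (cball 0 1) b \<partial>(lborel :: 'a measure)"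
  \<comment> \<open>The summand 1 makes the constant positive without a lower bound for the
    integral; all other radii follow by scaling.\<close>
  define C where "C = enn2real ?I + 1"
  have C: "?I \<le> ennreal C" "C > 0"
  proof -
    have "?I = ennreal (enn2real ?I)" using radial_unit_ball_finite[OF assms] by (intro ennreal_enn2real[symmetric]) (simp add: less_top)
    also have "\<dots> \<le> ennreal C" unfolding C_def by (intro ennreal_leI) simp
    finally show "?I \<le> ennreal C" .
    show "C > 0" unfolding C_def using enn2real_nonneg[of ?I] by linarith
  qed
  have [measurable]: "{b::'a. norm b \<le> R} \<in> sets borel" for R by measurable
  have [measurable]: "cball (0::'a) 1 \<in> sets borel" by simp
  show thesis
  proof (rule that[OF C(2)])
    fix R :: real assume R: "R > 0"
    have "(\<integral>\<^sup>+b. ennreal (norm b powr - p) * indicator {b. norm b \<le> R} b \<partial>(lborel :: 'a measure))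
      = ennreal (\<bar>R\<bar> ^ DIM('a)) * (\<integral>\<^sup>+b. ennreal (norm (0 + R *\<^sub>R b) powr - p) * indicator {b. norm b \<le> R} (0 + R *\<^sub>R b) \<partial>(lborel :: 'a measure))"
      by (rule nn_integral_lborel_affine) (measurable, use R in simp)
    also have "(\<integral>\<^sup>+b. ennreal (norm (0 + R *\<^sub>R b) powr - p) * indicator {b. norm b \<le> R} (0 + R *\<^sub>R b) \<partial>(lborel :: 'a measure))
      = (\<integral>\<^sup>+b. ennreal (R powr - p) * (ennreal (norm b powr - p) * indicator (cball 0 1) b) \<partial>(lborel :: 'a measure))"
      using R by (intro nn_integral_cong) (auto simp: indicator_def powr_mult ennreal_mult[symmetric] mult_le_cancel_left1 field_simps)
    also have "\<dots> = ennreal (R powr - p) * ?I" by (rule nn_integral_cmult) measurable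
    also have "ennreal (\<bar>R\<bar> ^ DIM('a)) * (ennreal (R powr - p) * ?I) \<le> ennreal (\<bar>R\<bar> ^ DIM('a)) * (ennreal (R powr - p) * ennreal C)"
      by (intro mult_left_mono C) auto
    also have "\<dots> = ennreal (C * R powr (real DIM('a) - p))"
      using R C(2) by (simp add: ennreal_mult[symmetric] powr_realpow[symmetric] powr_diff powr_minus divide_inverse mult_ac)
    finally show "(\<integral>\<^sup>+b. ennreal (norm b powr - p) * indicator {b. norm b \<le> R} b \<partial>(lborel :: 'a measure)) \<le> ennreal (C * R powr (real DIM('a) - p))" .
  qed
qed

lemma radial_exterior_bound:
  assumes "q > real DIM('a::euclidean_space)"
  obtains C where "C > 0" "\<And>R. R > 0 \<Longrightarrow> (\<integral>\<^sup>+b. ennreal (norm b powr - q) * indicator {b. R \<le> norm b} b \<partial>(lborel :: 'a measure)) \<le> ennreal (C * R powr (real DIM('a) - q))"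
proof -
  let ?I = "\<integral>\<^sup>+b. ennreal (norm b powr - q) * indicator {b. 1 \<le> norm b} b \<partial>(lborel :: 'a measure)"
  define C where "C = enn2real ?I + 1"
  have C: "?I \<le> ennreal C" "C > 0"
  proof -
    have "?I = ennreal (enn2real ?I)" using radial_exterior_finite[OF assms] by (intro ennreal_enn2real[symmetric]) (simp add: less_top)
    also have "\<dots> \<le> ennreal C" unfolding C_def by (intro ennreal_leI) simp
    finally show "?I \<le> ennreal C" .
    show "C > 0" unfolding C_def using enn2real_nonneg[of ?I] by linarith
  qed
  have [measurable]: "{b::'a. R \<le> norm b} \<in> sets borel" for R by measurable
  show thesis
  proof (rule that[OF C(2)])
    fix R :: real assume R: "R > 0"
    have "(\<integral>\<^sup>+b. ennreal (norm b powr - q) * indicator {b. R \<le> norm b} b \<partial>(lborel :: 'a measure))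
      = ennreal (\<bar>R\<bar> ^ DIM('a)) * (\<integral>\<^sup>+b. ennreal (norm (0 + R *\<^sub>R b) powr - q) * indicator {b. R \<le> norm b} (0 + R *\<^sub>R b) \<partial>(lborel :: 'a measure))"
      by (rule nn_integral_lborel_affine) (measurable, use R in simp)
    also have "(\<integral>\<^sup>+b. ennreal (norm (0 + R *\<^sub>R b) powr - q) * indicator {b. R \<le> norm b} (0 + R *\<^sub>R b) \<partial>(lborel :: 'a measure))
      = (\<integral>\<^sup>+b. ennreal (R powr - q) * (ennreal (norm b powr - q) * indicator {b. 1 \<le> norm b} b) \<partial>(lborel :: 'a measure))"
      using R by (intro nn_integral_cong) (auto simp: indicator_def powr_mult ennreal_mult[symmetric] field_simps)
    also have "\<dots> = ennreal (R powr - q) * ?I" by (rule nn_integral_cmult) measurable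
    also have "ennreal (\<bar>R\<bar> ^ DIM('a)) * (ennreal (R powr - q) * ?I) \<le> ennreal (\<bar>R\<bar> ^ DIM('a)) * (ennreal (R powr - q) * ennreal C)"
      by (intro mult_left_mono C) auto
    also have "\<dots> = ennreal (C * R powr (real DIM('a) - q))"
      using R C(2) by (simp add: ennreal_mult[symmetric] powr_realpow[symmetric] powr_diff powr_minus divide_inverse mult_ac)
    finally show "(\<integral>\<^sup>+b. ennreal (norm b powr - q) * indicator {b. R \<le> norm b} b \<partial>(lborel :: 'a measure)) \<le> ennreal (C * R powr (real DIM('a) - q))" .
  qed
qed

section \<open>Bilinear estimates with homogeneous weights\<close>

definition npow :: "real \<Rightarrow> 'a::euclidean_space \<Rightarrow> ennreal" where
  "npow r x = ennreal (norm x powr r)"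

lemma measurable_npow [measurable]: "npow r \<in> borel_measurable borel"
  unfolding npow_def by measurable

lemma npow_mult: "npow r x * npow q x = npow (r + q) x"
  by (simp add: npow_def ennreal_mult[symmetric] powr_add)

lemma npow_power2: "(npow r x)\<^sup>2 = npow (2 * r) x"
  by (simp add: power2_eq_square npow_mult)

text \<open>At the origin \<open>npow\<close> is 0 for every exponent, 0 included, since
  \<open>0 powr r = 0\<close>. Powers are therefore cancelled only off the origin, that is, up to a
  null set.\<close>

lemma npow_zero: "x \<noteq> 0 \<Longrightarrow> npow 0 x = 1"
  by (simp add: npow_def)

lemma npow_minus_commute: "npow r (x - y) = npow r (y - x)"
  by (simp add: npow_def norm_minus_commute)

lemma npow_uminus [simp]: "npow r (- x) = npow r x"
  by (simp add: npow_def)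

lemma ennreal_sum_power2_le: "(x + y :: ennreal)\<^sup>2 \<le> 2 * x\<^sup>2 + 2 * y\<^sup>2"
proof (cases "x = top \<or> y = top")
  case True
  then show ?thesis by (auto simp: power2_eq_square ennreal_top_mult)
next
  case False
  then obtain a b where ab: "x = ennreal a" "y = ennreal b" "0 \<le> a" "0 \<le> b" by (cases x; cases y) auto
  have "(a + b)\<^sup>2 \<le> 2 * a\<^sup>2 + 2 * b\<^sup>2" using sum_squares_bound[of a b] by (simp add: power2_sum)
  then have "ennreal ((a + b)\<^sup>2) \<le> ennreal (2 * a\<^sup>2 + 2 * b\<^sup>2)" by (rule ennreal_leI)
  moreover have "ennreal (2 * a\<^sup>2 + 2 * b\<^sup>2) = 2 * (ennreal a)\<^sup>2 + 2 * (ennreal b)\<^sup>2"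
    using ab by (simp add: ennreal_power ennreal_mult)
  moreover have "(x + y)\<^sup>2 = ennreal ((a + b)\<^sup>2)" using ab by (simp add: ennreal_power flip: ennreal_plus)
  ultimately show ?thesis using ab by simp
qed

lemma npow_ball_bound:
  assumes "0 < p" "p < real DIM('a::euclidean_space)"
  obtains C where "C > 0" "\<And>x::'a. x \<noteq> 0 \<Longrightarrow> (\<integral>\<^sup>+b. npow (- p) b * indicator {b. norm b \<le> norm x} b \<partial>(lborel :: 'a measure)) \<le> ennreal C * npow (real DIM('a) - p) x"
proof -
  obtain C where "C > 0" and C: "\<And>R. R > 0 \<Longrightarrow> (\<integral>\<^sup>+b. ennreal (norm b powr - p) * indicator {b. norm b \<le> R} b \<partial>(lborel :: 'a measure)) \<le> ennreal (C * R powr (real DIM('a) - p))"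
    using radial_ball_bound[OF assms] by blast
  then show thesis
    using that[of C] C[of "norm _"] by (simp add: npow_def ennreal_mult)
qed

text \<open>The product estimate \<open>L\<^sup>2 \<cdot> H\<^sup>\<lambda>\<^sup>/\<^sup>2 \<rightarrow> H\<^sup>-\<^sup>(\<^sup>n\<^sup>-\<^sup>\<lambda>\<^sup>)\<^sup>/\<^sup>2\<close> on the Fourier side; the inner
  integral is split at \<open>|a| = |c|\<close> and each part is estimated by Cauchy--Schwarz.\<close>

lemma bilinear_estimate:
  assumes lam: "0 < lam" "lam < real DIM('a::euclidean_space)"
  obtains C where "C > 0" "\<And>F G :: 'a \<Rightarrow> ennreal. F \<in> borel_measurable borel \<Longrightarrow> G \<in> borel_measurable borel \<Longrightarrow>
    (\<integral>\<^sup>+c. npow (lam - real DIM('a)) c * (\<integral>\<^sup>+a. F (a + c) * G a \<partial>lborel)\<^sup>2 \<partial>lborel)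
      \<le> ennreal C * ((\<integral>\<^sup>+a. (F a)\<^sup>2 \<partial>lborel) * (\<integral>\<^sup>+a. npow lam a * (G a)\<^sup>2 \<partial>lborel))"
proof -
  let ?n = "real DIM('a)"
  obtain C1 where C1: "C1 > 0" "\<And>x::'a. x \<noteq> 0 \<Longrightarrow> (\<integral>\<^sup>+b. npow (- lam) b * indicator {b. norm b \<le> norm x} b \<partial>(lborel :: 'a measure)) \<le> ennreal C1 * npow (?n - lam) x"
    by (rule npow_ball_bound[of lam, where 'a='a]) (use lam in auto)
  have e: "- (?n - lam) = lam - ?n" "?n - (?n - lam) = lam" by simp_all
  obtain C2 where C2: "C2 > 0" "\<And>x::'a. x \<noteq> 0 \<Longrightarrow> (\<integral>\<^sup>+b. npow (lam - ?n) b * indicator {b. norm b \<le> norm x} b \<partial>(lborel :: 'a measure)) \<le> ennreal C2 * npow lam x"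
    by (rule npow_ball_bound[of "?n - lam", where 'a='a, unfolded e]) (use lam in auto)
  have [measurable]: "{b::'a. norm b \<le> R} \<in> sets borel" for R by measurable
  have [measurable]: "{b::'a. R \<le> norm b} \<in> sets borel" for R by measurable
  show thesis
  proof (rule that)
    show "2 * C1 + 2 * C2 > 0" using C1 C2 by simp
    fix F G :: "'a \<Rightarrow> ennreal"
    assume [measurable]: "F \<in> borel_measurable borel" "G \<in> borel_measurable borel"
    define NF where "NF = (\<integral>\<^sup>+a. (F a)\<^sup>2 \<partial>lborel)"
    define NG where "NG = (\<integral>\<^sup>+a. npow lam a * (G a)\<^sup>2 \<partial>lborel)"
    have NFt: "(\<integral>\<^sup>+a. (F (a + c))\<^sup>2 \<partial>lborel) = NF" for c
      unfolding NF_def by (rule nn_integral_lborel_translate[of "\<lambda>x. (F x)\<^sup>2"]) measurable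
    \<comment> \<open>Part |a| \<le> |c|: the integral of \<open>|a|^(-lam)\<close> over the ball is
      of order \<open>|c|^(n - lam)\<close> and cancels the outer weight exactly, leaving
      \<open>S\<close>, whose integral is the product of the two norms.\<close>
    define S where "S c = (\<integral>\<^sup>+a. (F (a + c))\<^sup>2 * (npow lam a * (G a)\<^sup>2) \<partial>lborel)" for c
    \<comment> \<open>Part |c| \<le> |a|: \<open>F\<close> contributes its full norm, and
      integrating the outer weight \<open>|c|^(lam - n)\<close> over |c| \<le> |a| restores
      \<open>|a|^lam\<close> on \<open>G\<close>.\<close>
    define R where "R c = (\<integral>\<^sup>+a. indicator {a. norm c \<le> norm a} a * (G a)\<^sup>2 \<partial>lborel)" for c :: 'a
    have meas2 [measurable]: "(\<lambda>(c, a). indicator {a. norm c \<le> norm a} a :: ennreal) \<in> borel_measurable (borel \<Otimes>\<^sub>M borel)"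
      unfolding indicator_def of_bool_def by measurable
    have [measurable]: "S \<in> borel_measurable borel" "R \<in> borel_measurable borel" unfolding S_def R_def by measurable
    have split: "npow (lam - ?n) c * (\<integral>\<^sup>+a. F (a + c) * G a \<partial>lborel)\<^sup>2 \<le> ennreal (2 * C1) * S c + 2 * NF * (npow (lam - ?n) c * R c)" if c: "c \<noteq> 0" for c
    proof -
      define I1 where "I1 = (\<integral>\<^sup>+a. (npow (- lam / 2) a * indicator {a. norm a \<le> norm c} a) * (F (a + c) * (npow (lam / 2) a * G a)) \<partial>lborel)"
      define I2 where "I2 = (\<integral>\<^sup>+a. F (a + c) * (indicator {a. norm c \<le> norm a} a * G a) \<partial>lborel)"
      have "(\<integral>\<^sup>+a. F (a + c) * G a \<partial>lborel) \<le> (\<integral>\<^sup>+a. (npow (- lam / 2) a * indicator {a. norm a \<le> norm c} a) * (F (a + c) * (npow (lam / 2) a * G a)) + F (a + c) * (indicator {a. norm c \<le> norm a} a * G a) \<partial>lborel)"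
      proof (rule nn_integral_mono_AE, use AE_lborel_singleton[of "0::'a"] in eventually_elim)
        case (elim a)
        have "npow (- lam / 2) a * (F (a + c) * (npow (lam / 2) a * G a)) = (npow (- lam / 2) a * npow (lam / 2) a) * (F (a + c) * G a)"
          by (simp only: mult_ac)
        also have "npow (- lam / 2) a * npow (lam / 2) a = 1" using elim by (simp add: npow_mult npow_zero)
        finally show ?case by (auto simp: indicator_def)
      qed
      also have "\<dots> = I1 + I2" unfolding I1_def I2_def by (rule nn_integral_add) measurable
      finally have "(\<integral>\<^sup>+a. F (a + c) * G a \<partial>lborel)\<^sup>2 \<le> (I1 + I2)\<^sup>2" by (rule power_mono) simp
      also have "\<dots> \<le> 2 * I1\<^sup>2 + 2 * I2\<^sup>2" by (rule ennreal_sum_power2_le)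
      finally have le0: "(\<integral>\<^sup>+a. F (a + c) * G a \<partial>lborel)\<^sup>2 \<le> 2 * I1\<^sup>2 + 2 * I2\<^sup>2" .
      have "I1\<^sup>2 \<le> (\<integral>\<^sup>+a. (npow (- lam / 2) a * indicator {a. norm a \<le> norm c} a)\<^sup>2 \<partial>(lborel :: 'a measure)) * (\<integral>\<^sup>+a. (F (a + c) * (npow (lam / 2) a * G a))\<^sup>2 \<partial>lborel)"
        unfolding I1_def by (rule Cauchy_Schwarz_nn_integral) measurable
      also have "\<dots> = (\<integral>\<^sup>+a. npow (- lam) a * indicator {a. norm a \<le> norm c} a \<partial>(lborel :: 'a measure)) * S c"
        unfolding S_def by (intro arg_cong2[where f = times] nn_integral_cong) (auto simp: power_mult_distrib npow_power2 indicator_def)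
      also have "\<dots> \<le> (ennreal C1 * npow (?n - lam) c) * S c"
        by (intro mult_right_mono C1(2) c) simp
      finally have I1le: "I1\<^sup>2 \<le> ennreal C1 * npow (?n - lam) c * S c" .
      have "I2\<^sup>2 \<le> (\<integral>\<^sup>+a. (F (a + c))\<^sup>2 \<partial>lborel) * (\<integral>\<^sup>+a. (indicator {a. norm c \<le> norm a} a * G a)\<^sup>2 \<partial>lborel)"
        unfolding I2_def by (rule Cauchy_Schwarz_nn_integral) measurable
      also have "\<dots> = NF * R c"
        unfolding NFt R_def by (intro arg_cong2[where f = times] nn_integral_cong refl) (auto simp: indicator_def)
      finally have I2le: "I2\<^sup>2 \<le> NF * R c" .
      have le: "(\<integral>\<^sup>+a. F (a + c) * G a \<partial>lborel)\<^sup>2 \<le> 2 * (ennreal C1 * npow (?n - lam) c * S c) + 2 * (NF * R c)"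
        by (rule order_trans[OF le0]) (intro add_mono mult_left_mono I1le I2le; simp)
      have one: "npow (lam - ?n) c * npow (?n - lam) c = 1" using c by (simp add: npow_mult npow_zero)
      have "npow (lam - ?n) c * (\<integral>\<^sup>+a. F (a + c) * G a \<partial>lborel)\<^sup>2 \<le> npow (lam - ?n) c * (2 * (ennreal C1 * npow (?n - lam) c * S c) + 2 * (NF * R c))"
        by (rule mult_left_mono[OF le]) simp
      also have "\<dots> = (npow (lam - ?n) c * npow (?n - lam) c) * (2 * ennreal C1 * S c) + 2 * NF * (npow (lam - ?n) c * R c)"
        by (simp only: distrib_left mult_ac)
      also have "2 * ennreal C1 = ennreal (2 * C1)" using C1(1) by (simp add: ennreal_mult)
      finally show ?thesis by (simp only: one mult_1)
    qed
    have "(\<integral>\<^sup>+c. npow (lam - ?n) c * (\<integral>\<^sup>+a. F (a + c) * G a \<partial>lborel)\<^sup>2 \<partial>lborel) \<le> (\<integral>\<^sup>+c. ennreal (2 * C1) * S c + 2 * NF * (npow (lam - ?n) c * R c) \<partial>lborel)"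
      by (rule nn_integral_mono_AE, use AE_lborel_singleton[of "0::'a"] in eventually_elim) (rule split)
    also have "\<dots> = ennreal (2 * C1) * (\<integral>\<^sup>+c. S c \<partial>lborel) + 2 * NF * (\<integral>\<^sup>+c. npow (lam - ?n) c * R c \<partial>lborel)"
      by (simp add: nn_integral_add nn_integral_cmult)
    finally have main: "(\<integral>\<^sup>+c. npow (lam - ?n) c * (\<integral>\<^sup>+a. F (a + c) * G a \<partial>lborel)\<^sup>2 \<partial>lborel) \<le> ennreal (2 * C1) * (\<integral>\<^sup>+c. S c \<partial>lborel) + 2 * NF * (\<integral>\<^sup>+c. npow (lam - ?n) c * R c \<partial>lborel)" .
    have Sint: "(\<integral>\<^sup>+c. S c \<partial>lborel) = NF * NG"
    proof -
      have "(\<integral>\<^sup>+c. S c \<partial>lborel) = (\<integral>\<^sup>+a. (\<integral>\<^sup>+c. (F (c + a))\<^sup>2 * (npow lam a * (G a)\<^sup>2) \<partial>lborel) \<partial>lborel)"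
        unfolding S_def by (subst lborel_pair.Fubini'[symmetric]) (simp_all add: add.commute)
      also have "\<dots> = (\<integral>\<^sup>+a. NF * (npow lam a * (G a)\<^sup>2) \<partial>lborel)"
        by (intro nn_integral_cong) (subst nn_integral_multc, simp_all add: NFt)
      also have "\<dots> = NF * NG" unfolding NG_def by (rule nn_integral_cmult) measurable
      finally show ?thesis .
    qed
    have Rint: "(\<integral>\<^sup>+c. npow (lam - ?n) c * R c \<partial>lborel) \<le> ennreal C2 * NG"
    proof -
      have "(\<integral>\<^sup>+c. npow (lam - ?n) c * R c \<partial>lborel) = (\<integral>\<^sup>+c. (\<integral>\<^sup>+a. npow (lam - ?n) c * (indicator {a. norm c \<le> norm a} a * (G a)\<^sup>2) \<partial>lborel) \<partial>(lborel :: 'a measure))"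
        unfolding R_def by (intro nn_integral_cong nn_integral_cmult[symmetric]) measurable
      also have "\<dots> = (\<integral>\<^sup>+a. (\<integral>\<^sup>+c. npow (lam - ?n) c * (indicator {a. norm c \<le> norm a} a * (G a)\<^sup>2) \<partial>(lborel :: 'a measure)) \<partial>lborel)"
        by (rule lborel_pair.Fubini'[symmetric]) measurable
      also have "\<dots> \<le> (\<integral>\<^sup>+a. ennreal C2 * (npow lam a * (G a)\<^sup>2) \<partial>lborel)"
      proof (rule nn_integral_mono_AE, use AE_lborel_singleton[of "0::'a"] in eventually_elim)
        case (elim a)
        have "(\<integral>\<^sup>+c. npow (lam - ?n) c * (indicator {a. norm c \<le> norm a} a * (G a)\<^sup>2) \<partial>(lborel :: 'a measure)) = (\<integral>\<^sup>+c. npow (lam - ?n) c * indicator {c. norm c \<le> norm a} c * (G a)\<^sup>2 \<partial>(lborel :: 'a measure))"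
          by (intro nn_integral_cong) (auto simp: indicator_def)
        also have "\<dots> = (\<integral>\<^sup>+c. npow (lam - ?n) c * indicator {c. norm c \<le> norm a} c \<partial>(lborel :: 'a measure)) * (G a)\<^sup>2"
          by (rule nn_integral_multc) measurable
        also have "\<dots> \<le> (ennreal C2 * npow lam a) * (G a)\<^sup>2" by (intro mult_right_mono C2(2) elim) simp
        finally show ?case by (simp only: mult.assoc)
      qed
      also have "\<dots> = ennreal C2 * NG" unfolding NG_def by (rule nn_integral_cmult) measurable
      finally show ?thesis .
    qed
    have const: "ennreal (2 * C1) * (NF * NG) + 2 * NF * (ennreal C2 * NG) = ennreal (2 * C1 + 2 * C2) * (NF * NG)"
    proof -
      have "2 * NF * (ennreal C2 * NG) = ennreal (2 * C2) * (NF * NG)"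
        using C2(1) by (simp add: ennreal_mult mult_ac)
      then show ?thesis using C1(1) C2(1) by (simp add: distrib_right)
    qed
    have "ennreal (2 * C1) * (\<integral>\<^sup>+c. S c \<partial>lborel) + 2 * NF * (\<integral>\<^sup>+c. npow (lam - ?n) c * R c \<partial>lborel) \<le> ennreal (2 * C1) * (NF * NG) + 2 * NF * (ennreal C2 * NG)"
      unfolding Sint by (intro add_mono mult_left_mono Rint) auto
    with main show "(\<integral>\<^sup>+c. npow (lam - ?n) c * (\<integral>\<^sup>+a. F (a + c) * G a \<partial>lborel)\<^sup>2 \<partial>lborel)
      \<le> ennreal (2 * C1 + 2 * C2) * ((\<integral>\<^sup>+a. (F a)\<^sup>2 \<partial>lborel) * (\<integral>\<^sup>+a. npow lam a * (G a)\<^sup>2 \<partial>lborel))"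
      unfolding const NF_def[symmetric] NG_def[symmetric] by (rule order_trans)
  qed
qed

text \<open>Both singularities are integrable, since (lam + n)/2 and n - lam are below n; at
  infinity the exponents add up to (3n - lam)/2, which exceeds n. Homogeneity fixes the resulting
  power of |b|.\<close>

lemma riesz_kernel_bound:
  assumes lam: "0 < lam" "lam < real DIM('a::euclidean_space)"
  obtains C where "C > 0" "\<And>b::'a. b \<noteq> 0 \<Longrightarrow>
    (\<integral>\<^sup>+a. npow (- ((lam + real DIM('a)) / 2)) a * npow (lam - real DIM('a)) (b - a) \<partial>lborel) \<le> ennreal C * npow ((lam - real DIM('a)) / 2) b"
proof -
  let ?n = "real DIM('a)"
  let ?p = "(lam + ?n) / 2"
  let ?q = "(3 * ?n - lam) / 2"
  obtain C3 where C3: "C3 > 0" "\<And>R. R > 0 \<Longrightarrow> (\<integral>\<^sup>+b. ennreal (norm b powr - ?p) * indicator {b. norm b \<le> R} b \<partial>(lborel :: 'a measure)) \<le> ennreal (C3 * R powr (?n - ?p))"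
    by (rule radial_ball_bound[of ?p, where 'a='a]) (use lam in auto)
  obtain C4 where C4: "C4 > 0" "\<And>R. R > 0 \<Longrightarrow> (\<integral>\<^sup>+b. ennreal (norm b powr - ?q) * indicator {b. R \<le> norm b} b \<partial>(lborel :: 'a measure)) \<le> ennreal (C4 * R powr (?n - ?q))"
    by (rule radial_exterior_bound[of ?q, where 'a='a]) (use lam in auto)
  obtain C5 where C5: "C5 > 0" "\<And>R. R > 0 \<Longrightarrow> (\<integral>\<^sup>+b. ennreal (norm b powr - (?n - lam)) * indicator {b. norm b \<le> R} b \<partial>(lborel :: 'a measure)) \<le> ennreal (C5 * R powr (?n - (?n - lam)))"
    by (rule radial_ball_bound[of "?n - lam", where 'a='a]) (use lam in auto)
  have [measurable]: "{b::'a. norm b \<le> R} \<in> sets borel" for R by measurable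
  have [measurable]: "{b::'a. R \<le> norm b} \<in> sets borel" for R by measurable
  let ?e = "(lam - ?n) / 2"
  define D3 where "D3 = (1/2) powr (lam - ?n) * C3 * (1/2) powr (?n - ?p)"
  define D4 where "D4 = (1/2) powr (lam - ?n) * C4 * 2 powr (?n - ?q)"
  define D5 where "D5 = (1/2) powr (- ?p) * C5 * 3 powr lam"
  have D: "D3 > 0" "D4 > 0" "D5 > 0" using C3 C4 C5 by (auto simp: D3_def D4_def D5_def)
  show thesis
  proof (rule that)
    show "D3 + D4 + D5 > 0" using D by simp
    fix b :: 'a assume "b \<noteq> 0"
    define R where "R = norm b"
    have R: "R > 0" using \<open>b \<noteq> 0\<close> by (simp add: R_def)
    define x1 where "x1 = (R * (1/2)) powr (lam - ?n)"
    define x2 where "x2 = (1/2) powr (lam - ?n)"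
    define x3 where "x3 = (R * (1/2)) powr (- ?p)"
    have ptw: "npow (- ?p) a * npow (lam - ?n) (b - a)
      \<le> ennreal x1 * (ennreal (norm a powr - ?p) * indicator {a. norm a \<le> R * (1/2)} a)
        + ennreal x2 * (ennreal (norm a powr - ?q) * indicator {a. R * 2 \<le> norm a} a)
        + ennreal x3 * (ennreal (norm (b - a) powr - (?n - lam)) * indicator {a. norm a \<le> R * 3} (b - a))"
      if a: "a \<noteq> 0" for a
    proof -
      \<comment> \<open>Near the origin b - a has length at least |b|/2, far away its length is at
        least |a|/2, and in between |a| is of order |b| while b - a stays in the ball of radius
        3|b|.\<close>
      consider "norm a \<le> R * (1/2)" | "R * 2 \<le> norm a" | "R * (1/2) \<le> norm a" "norm a \<le> R * 2" by linarith
      then show ?thesis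
      proof cases
        case 1
        have "R * (1/2) \<le> norm (b - a)" using 1 norm_triangle_ineq2[of b a] by (simp add: R_def)
        then have "norm (b - a) powr (lam - ?n) \<le> x1" unfolding x1_def using R lam by (intro powr_mono2') auto
        then have "npow (- ?p) a * npow (lam - ?n) (b - a) \<le> ennreal (norm a powr - ?p) * ennreal x1"
          unfolding npow_def by (intro mult_left_mono ennreal_leI) auto
        also have "\<dots> = ennreal x1 * (ennreal (norm a powr - ?p) * indicator {a. norm a \<le> R * (1/2)} a)"
          using 1 by (simp add: mult.commute)
        finally show ?thesis by (meson add_increasing2 order_trans le_add_same_cancel1 zero_le)
      next
        case 2
        have "norm a * (1/2) \<le> norm (b - a)" using 2 norm_triangle_ineq3[of a b] by (simp add: R_def norm_minus_commute)
        then have "norm (b - a) powr (lam - ?n) \<le> (norm a * (1/2)) powr (lam - ?n)" using a lam by (intro powr_mono2') auto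
        also have "\<dots> = norm a powr (lam - ?n) * x2" unfolding x2_def by (rule powr_mult)
        finally have "norm a powr - ?p * norm (b - a) powr (lam - ?n) \<le> norm a powr - ?p * (norm a powr (lam - ?n) * x2)" by (intro mult_left_mono) auto
        also have "\<dots> = x2 * norm a powr - ?q"
        proof -
          have "- ?p + (lam - ?n) = - ?q" by (simp add: field_simps)
          then show ?thesis using powr_add[of "norm a" "- ?p" "lam - ?n"] by (simp only: mult_ac)
        qed
        finally have "npow (- ?p) a * npow (lam - ?n) (b - a) \<le> ennreal (x2 * norm a powr - ?q)"
          unfolding npow_def by (subst ennreal_mult[symmetric]) (auto intro: ennreal_leI)
        also have "\<dots> = ennreal x2 * (ennreal (norm a powr - ?q) * indicator {a. R * 2 \<le> norm a} a)"
          using 2 by (simp add: ennreal_mult x2_def)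
        finally show ?thesis by (meson add_increasing2 add_increasing order_trans le_add_same_cancel1 zero_le)
      next
        case 3
        have "norm (b - a) \<le> R * 3" using 3 norm_triangle_ineq4[of b a] by (simp add: R_def)
        moreover have "norm a powr - ?p \<le> x3" unfolding x3_def using R lam 3 by (intro powr_mono2') auto
        then have "npow (- ?p) a * npow (lam - ?n) (b - a) \<le> ennreal x3 * ennreal (norm (b - a) powr (lam - ?n))"
          unfolding npow_def by (intro mult_right_mono ennreal_leI) auto
        ultimately have "npow (- ?p) a * npow (lam - ?n) (b - a) \<le> ennreal x3 * (ennreal (norm (b - a) powr - (?n - lam)) * indicator {a. norm a \<le> R * 3} (b - a))"
          by simp
        then show ?thesis by (meson add_increasing zero_le)
      qed
    qed
    have "(\<integral>\<^sup>+a. npow (- ?p) a * npow (lam - ?n) (b - a) \<partial>lborel)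
      \<le> (\<integral>\<^sup>+a. ennreal x1 * (ennreal (norm a powr - ?p) * indicator {a. norm a \<le> R * (1/2)} a)
        + ennreal x2 * (ennreal (norm a powr - ?q) * indicator {a. R * 2 \<le> norm a} a)
        + ennreal x3 * (ennreal (norm (b - a) powr - (?n - lam)) * indicator {a. norm a \<le> R * 3} (b - a)) \<partial>lborel)"
      by (rule nn_integral_mono_AE, use AE_lborel_singleton[of "0::'a"] in eventually_elim) (rule ptw)
    also have "\<dots> = ennreal x1 * (\<integral>\<^sup>+a. ennreal (norm a powr - ?p) * indicator {a. norm a \<le> R * (1/2)} a \<partial>(lborel :: 'a measure))
        + ennreal x2 * (\<integral>\<^sup>+a. ennreal (norm a powr - ?q) * indicator {a. R * 2 \<le> norm a} a \<partial>(lborel :: 'a measure))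
        + ennreal x3 * (\<integral>\<^sup>+a. ennreal (norm (b - a) powr - (?n - lam)) * indicator {a. norm a \<le> R * 3} (b - a) \<partial>lborel)"
      by (simp add: nn_integral_add nn_integral_cmult)
    also have "(\<integral>\<^sup>+a. ennreal (norm (b - a) powr - (?n - lam)) * indicator {a. norm a \<le> R * 3} (b - a) \<partial>lborel)
       = (\<integral>\<^sup>+a. ennreal (norm a powr - (?n - lam)) * indicator {a. norm a \<le> R * 3} a \<partial>(lborel :: 'a measure))"
      by (rule nn_integral_lborel_minus[of "\<lambda>a. ennreal (norm a powr - (?n - lam)) * indicator {a. norm a \<le> R * 3} a"]) measurable
    also have "ennreal x1 * (\<integral>\<^sup>+a. ennreal (norm a powr - ?p) * indicator {a. norm a \<le> R * (1/2)} a \<partial>(lborel :: 'a measure))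
        + ennreal x2 * (\<integral>\<^sup>+a. ennreal (norm a powr - ?q) * indicator {a. R * 2 \<le> norm a} a \<partial>(lborel :: 'a measure))
        + ennreal x3 * (\<integral>\<^sup>+a. ennreal (norm a powr - (?n - lam)) * indicator {a. norm a \<le> R * 3} a \<partial>(lborel :: 'a measure))
      \<le> ennreal x1 * ennreal (C3 * (R * (1/2)) powr (?n - ?p)) + ennreal x2 * ennreal (C4 * (R * 2) powr (?n - ?q)) + ennreal x3 * ennreal (C5 * (R * 3) powr (?n - (?n - lam)))"
      using R by (intro add_mono mult_left_mono C3 C4 C5) auto
    also have "\<dots> = ennreal (D3 * R powr ?e) + ennreal (D4 * R powr ?e) + ennreal (D5 * R powr ?e)"
    proof -
      have "x1 * (C3 * (R * (1/2)) powr (?n - ?p)) = D3 * R powr ?e"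
      proof -
        have "R powr (lam - ?n) * R powr (?n - ?p) = R powr ?e"
          unfolding powr_add[symmetric] by (rule arg_cong[of _ _ "\<lambda>z. R powr z"]) (simp add: field_simps)
        then show ?thesis unfolding x1_def D3_def using R powr_mult[of R "1/2"] by (simp add: mult_ac)
      qed
      moreover have "x2 * (C4 * (R * 2) powr (?n - ?q)) = D4 * R powr ?e"
      proof -
        have "R powr (?n - ?q) = R powr ?e" by (rule arg_cong[of _ _ "\<lambda>z. R powr z"]) (simp add: field_simps)
        then show ?thesis unfolding x2_def D4_def using R powr_mult[of R 2] by (simp add: mult_ac)
      qed
      moreover have "x3 * (C5 * (R * 3) powr (?n - (?n - lam))) = D5 * R powr ?e"
      proof -
        have "R powr (- ?p) * R powr lam = R powr ?e"
          unfolding powr_add[symmetric] by (rule arg_cong[of _ _ "\<lambda>z. R powr z"]) (simp add: field_simps)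
        then show ?thesis unfolding x3_def D5_def using R powr_mult[of R "1/2"] powr_mult[of R 3] by (simp add: mult_ac)
      qed
      ultimately show ?thesis using C3(1) C4(1) C5(1)
        by (simp only: ennreal_mult'[symmetric] x1_def x2_def x3_def powr_ge_zero)
    qed
    also have "\<dots> = ennreal (D3 + D4 + D5) * npow ?e b"
      using D by (simp add: npow_def R_def distrib_right ennreal_mult)
    finally show "(\<integral>\<^sup>+a. npow (- ?p) a * npow (lam - ?n) (b - a) \<partial>lborel) \<le> ennreal (D3 + D4 + D5) * npow ?e b" .
  qed
qed

text \<open>Schur's test with the weight \<open>|a|\<^sup>-\<^sup>n\<^sup>/\<^sup>2\<close>, carried out as a Cauchy--Schwarz inequality on the product space.\<close>

lemma hardy_fourier:
  assumes lam: "0 < lam" "lam < real DIM('a::euclidean_space)"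
  obtains C where "C > 0" "\<And>F G :: 'a \<Rightarrow> ennreal. F \<in> borel_measurable borel \<Longrightarrow> G \<in> borel_measurable borel \<Longrightarrow>
    (\<integral>\<^sup>+c. npow (lam - real DIM('a)) c * (\<integral>\<^sup>+a. F (a + c) * G a \<partial>lborel) \<partial>lborel)\<^sup>2
      \<le> ennreal C * ((\<integral>\<^sup>+b. npow lam b * (F b)\<^sup>2 \<partial>lborel) * (\<integral>\<^sup>+a. npow lam a * (G a)\<^sup>2 \<partial>lborel))"
proof -
  let ?n = "real DIM('a)"
  \<comment> \<open>Half of (lam + n)/2: the Schur weight \<open>|a|^(-n/2)\<close> is merged with
    the factor \<open>|a|^(-lam/2)\<close> that comes from the weighted norms.\<close>
  let ?e = "(lam + ?n) / 4"
  obtain C where C: "C > 0" "\<And>b::'a. b \<noteq> 0 \<Longrightarrow>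
    (\<integral>\<^sup>+a. npow (- ((lam + ?n) / 2)) a * npow (lam - ?n) (b - a) \<partial>lborel) \<le> ennreal C * npow ((lam - ?n) / 2) b"
    using riesz_kernel_bound[OF lam] by blast
  \<comment> \<open>The kernel bound produces \<open>|b|^((lam - n)/2)\<close>; together with
    \<open>|b|^((lam + n)/2)\<close> this is exactly \<open>|b|^lam\<close>.\<close>
  have half: "(\<integral>\<^sup>+b. (\<integral>\<^sup>+a. npow (lam - ?n) (b - a) * (npow (2 * ?e) b * (npow (- (2 * ?e)) a * (F b)\<^sup>2)) \<partial>lborel) \<partial>lborel)
    \<le> ennreal C * (\<integral>\<^sup>+b. npow lam b * (F b)\<^sup>2 \<partial>lborel)"
    if [measurable]: "F \<in> borel_measurable borel" for F :: "'a \<Rightarrow> ennreal"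
  proof -
    have "(\<integral>\<^sup>+b. (\<integral>\<^sup>+a. npow (lam - ?n) (b - a) * (npow (2 * ?e) b * (npow (- (2 * ?e)) a * (F b)\<^sup>2)) \<partial>lborel) \<partial>lborel)
      \<le> (\<integral>\<^sup>+b. ennreal C * (npow lam b * (F b)\<^sup>2) \<partial>lborel)"
    proof (rule nn_integral_mono_AE, use AE_lborel_singleton[of "0::'a"] in eventually_elim)
      case (elim b)
      have "(\<integral>\<^sup>+a. npow (lam - ?n) (b - a) * (npow (2 * ?e) b * (npow (- (2 * ?e)) a * (F b)\<^sup>2)) \<partial>lborel)
        = (\<integral>\<^sup>+a. (npow (- ((lam + ?n) / 2)) a * npow (lam - ?n) (b - a)) * (npow (2 * ?e) b * (F b)\<^sup>2) \<partial>lborel)"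
      proof (intro nn_integral_cong)
        fix a :: 'a
        have "- (2 * ?e) = - ((lam + ?n) / 2)" by (simp add: field_simps)
        then show "npow (lam - ?n) (b - a) * (npow (2 * ?e) b * (npow (- (2 * ?e)) a * (F b)\<^sup>2)) = (npow (- ((lam + ?n) / 2)) a * npow (lam - ?n) (b - a)) * (npow (2 * ?e) b * (F b)\<^sup>2)"
          by (simp only: mult_ac)
      qed
      also have "\<dots> = (\<integral>\<^sup>+a. npow (- ((lam + ?n) / 2)) a * npow (lam - ?n) (b - a) \<partial>lborel) * (npow (2 * ?e) b * (F b)\<^sup>2)"
        by (rule nn_integral_multc) measurable
      also have "\<dots> \<le> (ennreal C * npow ((lam - ?n) / 2) b) * (npow (2 * ?e) b * (F b)\<^sup>2)"
        by (intro mult_right_mono C(2) elim) simp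
      also have "\<dots> = ennreal C * ((npow ((lam - ?n) / 2) b * npow (2 * ?e) b) * (F b)\<^sup>2)" by (simp only: mult_ac)
      also have "npow ((lam - ?n) / 2) b * npow (2 * ?e) b = npow lam b"
        unfolding npow_mult by (rule arg_cong[of _ _ "\<lambda>r. npow r b"]) (simp add: field_simps)
      finally show ?case .
    qed
    also have "\<dots> = ennreal C * (\<integral>\<^sup>+b. npow lam b * (F b)\<^sup>2 \<partial>lborel)" by (rule nn_integral_cmult) measurable
    finally show ?thesis .
  qed
  show thesis
  proof (rule that)
    show "C * C > 0" using C by simp
    fix F G :: "'a \<Rightarrow> ennreal"
    assume [measurable]: "F \<in> borel_measurable borel" "G \<in> borel_measurable borel"
    let ?\<phi> = "\<lambda>(b, a). npow ((lam - ?n) / 2) (b - a) * (npow ?e b * (npow (- ?e) a * F b))"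
    let ?\<psi> = "\<lambda>(b, a). npow ((lam - ?n) / 2) (b - a) * (npow ?e a * (npow (- ?e) b * G a))"
    have x2: "2 * ((lam - ?n) / 2) = lam - ?n" "2 * - ?e = - (2 * ?e)" by simp_all
    have [measurable]: "?\<phi> \<in> borel_measurable (lborel \<Otimes>\<^sub>M lborel)" "?\<psi> \<in> borel_measurable (lborel \<Otimes>\<^sub>M lborel)" by measurable
    have "(\<integral>\<^sup>+c. npow (lam - ?n) c * (\<integral>\<^sup>+a. F (a + c) * G a \<partial>lborel) \<partial>lborel)
      = (\<integral>\<^sup>+c. (\<integral>\<^sup>+a. npow (lam - ?n) c * (F (a + c) * G a) \<partial>lborel) \<partial>lborel)"
      by (intro nn_integral_cong nn_integral_cmult[symmetric]) measurable
    also have "\<dots> = (\<integral>\<^sup>+a. (\<integral>\<^sup>+c. npow (lam - ?n) c * (F (a + c) * G a) \<partial>lborel) \<partial>lborel)"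
      by (rule lborel_pair.Fubini'[symmetric]) measurable
    also have "\<dots> = (\<integral>\<^sup>+a. (\<integral>\<^sup>+b. npow (lam - ?n) (b - a) * (F b * G a) \<partial>lborel) \<partial>lborel)"
    proof (rule nn_integral_cong)
      fix a :: 'a
      have "(\<integral>\<^sup>+b. npow (lam - ?n) (b - a) * (F b * G a) \<partial>lborel) = (\<integral>\<^sup>+b. npow (lam - ?n) ((b + a) - a) * (F (b + a) * G a) \<partial>lborel)"
        by (rule nn_integral_lborel_translate[of "\<lambda>b. npow (lam - ?n) (b - a) * (F b * G a)", symmetric]) measurable
      then show "(\<integral>\<^sup>+c. npow (lam - ?n) c * (F (a + c) * G a) \<partial>lborel) = (\<integral>\<^sup>+b. npow (lam - ?n) (b - a) * (F b * G a) \<partial>lborel)"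
        by (simp add: add.commute)
    qed
    also have "\<dots> = (\<integral>\<^sup>+p. (case p of (b, a) \<Rightarrow> npow (lam - ?n) (b - a) * (F b * G a)) \<partial>(lborel \<Otimes>\<^sub>M lborel))"
      by (subst lborel_pair.nn_integral_snd[symmetric]) simp_all
    also have "\<dots> = (\<integral>\<^sup>+p. ?\<phi> p * ?\<psi> p \<partial>(lborel \<Otimes>\<^sub>M lborel))"
    proof (rule nn_integral_cong_AE)
      \<comment> \<open>Off the two axes the powers inserted into the two factors cancel in their
        product.\<close>
      have "AE p in lborel \<Otimes>\<^sub>M lborel. fst p \<noteq> (0::'a) \<and> snd p \<noteq> (0::'a)"
      proof (rule lborel_pair.AE_pair_measure)
        show "{p \<in> space (lborel \<Otimes>\<^sub>M lborel). fst p \<noteq> (0::'a) \<and> snd p \<noteq> (0::'a)} \<in> sets (lborel \<Otimes>\<^sub>M lborel)"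
          by measurable
        show "AE x in lborel. AE y in lborel. fst (x, y) \<noteq> (0::'a) \<and> snd (x, y) \<noteq> (0::'a)"
          by (rule eventually_mono[OF AE_lborel_singleton[of "0::'a"]])
             (use AE_lborel_singleton[of "0::'a"] in \<open>auto elim!: eventually_mono\<close>)
      qed
      then show "AE p in lborel \<Otimes>\<^sub>M lborel. (case p of (b, a) \<Rightarrow> npow (lam - ?n) (b - a) * (F b * G a)) = ?\<phi> p * ?\<psi> p"
      proof eventually_elim
        case (elim p)
        obtain b a where p: "p = (b, a)" by (cases p)
        have "?\<phi> p * ?\<psi> p = (npow ((lam - ?n) / 2) (b - a) * npow ((lam - ?n) / 2) (b - a)) * ((npow ?e b * npow (- ?e) b) * ((npow ?e a * npow (- ?e) a) * (F b * G a)))"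
          unfolding p by (simp only: prod.case mult_ac)
        also have "npow ?e b * npow (- ?e) b = 1" using elim p by (simp add: npow_mult npow_zero)
        also have "npow ?e a * npow (- ?e) a = 1" using elim p by (simp add: npow_mult npow_zero)
        also have "npow ((lam - ?n) / 2) (b - a) * npow ((lam - ?n) / 2) (b - a) = npow (lam - ?n) (b - a)"
          unfolding npow_mult by (rule arg_cong[of _ _ "\<lambda>r. npow r (b - a)"]) (simp add: field_simps)
        finally show ?case unfolding p by simp
      qed
    qed
    finally have "(\<integral>\<^sup>+c. npow (lam - ?n) c * (\<integral>\<^sup>+a. F (a + c) * G a \<partial>lborel) \<partial>lborel)\<^sup>2 = (\<integral>\<^sup>+p. ?\<phi> p * ?\<psi> p \<partial>(lborel \<Otimes>\<^sub>M lborel))\<^sup>2" by simp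
    also have "\<dots> \<le> (\<integral>\<^sup>+p. (?\<phi> p)\<^sup>2 \<partial>(lborel \<Otimes>\<^sub>M lborel)) * (\<integral>\<^sup>+p. (?\<psi> p)\<^sup>2 \<partial>(lborel \<Otimes>\<^sub>M lborel))"
      by (rule Cauchy_Schwarz_nn_integral) measurable
    also have "(\<integral>\<^sup>+p. (?\<phi> p)\<^sup>2 \<partial>(lborel \<Otimes>\<^sub>M lborel)) = (\<integral>\<^sup>+b. (\<integral>\<^sup>+a. npow (lam - ?n) (b - a) * (npow (2 * ?e) b * (npow (- (2 * ?e)) a * (F b)\<^sup>2)) \<partial>lborel) \<partial>lborel)"
      by (subst lborel.nn_integral_fst[symmetric], measurable) (simp only: prod.case power_mult_distrib npow_power2 x2)
    also have "(\<integral>\<^sup>+p. (?\<psi> p)\<^sup>2 \<partial>(lborel \<Otimes>\<^sub>M lborel)) = (\<integral>\<^sup>+a. (\<integral>\<^sup>+b. npow (lam - ?n) (a - b) * (npow (2 * ?e) a * (npow (- (2 * ?e)) b * (G a)\<^sup>2)) \<partial>lborel) \<partial>lborel)"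
      by (subst lborel_pair.nn_integral_snd[symmetric], measurable) (simp only: prod.case power_mult_distrib npow_power2 x2, simp only: npow_minus_commute)
    finally have "(\<integral>\<^sup>+c. npow (lam - ?n) c * (\<integral>\<^sup>+a. F (a + c) * G a \<partial>lborel) \<partial>lborel)\<^sup>2
       \<le> (\<integral>\<^sup>+b. (\<integral>\<^sup>+a. npow (lam - ?n) (b - a) * (npow (2 * ?e) b * (npow (- (2 * ?e)) a * (F b)\<^sup>2)) \<partial>lborel) \<partial>lborel)
         * (\<integral>\<^sup>+a. (\<integral>\<^sup>+b. npow (lam - ?n) (a - b) * (npow (2 * ?e) a * (npow (- (2 * ?e)) b * (G a)\<^sup>2)) \<partial>lborel) \<partial>lborel)" .
    also have "\<dots> \<le> (ennreal C * (\<integral>\<^sup>+b. npow lam b * (F b)\<^sup>2 \<partial>lborel)) * (ennreal C * (\<integral>\<^sup>+a. npow lam a * (G a)\<^sup>2 \<partial>lborel))"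
      by (intro mult_mono half) auto
    also have "\<dots> = ennreal (C * C) * ((\<integral>\<^sup>+b. npow lam b * (F b)\<^sup>2 \<partial>lborel) * (\<integral>\<^sup>+a. npow lam a * (G a)\<^sup>2 \<partial>lborel))"
      using C(1) by (simp add: ennreal_mult mult_ac)
    finally show "(\<integral>\<^sup>+c. npow (lam - ?n) c * (\<integral>\<^sup>+a. F (a + c) * G a \<partial>lborel) \<partial>lborel)\<^sup>2
      \<le> ennreal (C * C) * ((\<integral>\<^sup>+b. npow lam b * (F b)\<^sup>2 \<partial>lborel) * (\<integral>\<^sup>+a. npow lam a * (G a)\<^sup>2 \<partial>lborel))" .
  qed
qed

section \<open>Duality and the trilinear kernel\<close>

lemma nn_L2_duality:
  fixes T :: "'a::euclidean_space \<Rightarrow> ennreal"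
  assumes [measurable]: "T \<in> borel_measurable borel"
    and dual: "\<And>K. K \<in> borel_measurable borel \<Longrightarrow> (\<integral>\<^sup>+x. T x * K x \<partial>lborel)\<^sup>2 \<le> M * (\<integral>\<^sup>+x. (K x)\<^sup>2 \<partial>lborel)"
  shows "(\<integral>\<^sup>+x. (T x)\<^sup>2 \<partial>lborel) \<le> M"
proof -
  \<comment> \<open>\<open>T\<close> is truncated in height and in support, so that the integral
    \<open>X\<close> below is finite and can be cancelled from \<open>X\<^sup>2 \<le> M * X\<close>;
    monotone convergence then removes the truncation.\<close>
  define K where "K k x = min (T x) (of_nat k) * indicator (cball 0 (real k)) x" for k :: nat and x :: 'a
  have [measurable]: "cball (0::'a) r \<in> sets borel" for r by simp
  have [measurable]: "K k \<in> borel_measurable borel" for k unfolding K_def by measurable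
  have KM: "(\<integral>\<^sup>+x. (K k x)\<^sup>2 \<partial>lborel) \<le> M" for k
  proof -
    define X where "X = (\<integral>\<^sup>+x. (K k x)\<^sup>2 \<partial>lborel)"
    have "X \<le> (\<integral>\<^sup>+x. (of_nat k)\<^sup>2 * indicator (cball 0 (real k)) x \<partial>(lborel :: 'a measure))"
      unfolding X_def by (intro nn_integral_mono) (auto simp: K_def indicator_def intro!: power_mono)
    also have "\<dots> = (of_nat k)\<^sup>2 * emeasure lborel (cball (0::'a) (real k))" by (subst nn_integral_cmult) auto
    also have "\<dots> < \<infinity>"
      using emeasure_lborel_cball_finite[of "0::'a" "real k"]
      by (auto simp: ennreal_mult_less_top power_less_top_ennreal of_nat_less_top)
    finally have fin: "X \<noteq> \<infinity>" by simp
    have "X \<le> (\<integral>\<^sup>+x. T x * K k x \<partial>lborel)"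
      unfolding X_def by (intro nn_integral_mono) (auto simp: K_def indicator_def power2_eq_square intro!: mult_right_mono)
    then have "X\<^sup>2 \<le> (\<integral>\<^sup>+x. T x * K k x \<partial>lborel)\<^sup>2" by (rule power_mono) simp
    also have "\<dots> \<le> M * X" unfolding X_def by (rule dual) measurable
    finally have "X * X \<le> M * X" by (simp add: power2_eq_square)
    then have "X \<le> M"
    proof (cases "X = 0")
      case False
      have "X * X / X \<le> M * X / X" by (rule divide_right_mono_ennreal) fact
      then show ?thesis using False fin by (simp add: ennreal_mult_divide_eq)
    qed simp
    then show ?thesis by (simp add: X_def)
  qed
  have "incseq (\<lambda>k x. (K k x)\<^sup>2)"
  proof (intro incseq_SucI le_funI power_mono)
    fix k and x :: 'a
    have "(of_nat k :: ennreal) \<le> of_nat (Suc k)" by (rule of_nat_mono) simp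
    moreover have "(indicator (cball 0 (real k)) x :: ennreal) \<le> indicator (cball 0 (real (Suc k))) x"
      by (auto simp: indicator_def)
    ultimately show "K k x \<le> K (Suc k) x"
      unfolding K_def by (intro mult_mono min.mono) auto
  qed simp
  then have "(\<integral>\<^sup>+x. (SUP k. (K k x)\<^sup>2) \<partial>lborel) = (SUP k. \<integral>\<^sup>+x. (K k x)\<^sup>2 \<partial>lborel)"
    by (rule nn_integral_monotone_convergence_SUP) measurable
  also have "\<dots> \<le> M" using KM by (simp add: SUP_le_iff)
  finally have "(\<integral>\<^sup>+x. (SUP k. (K k x)\<^sup>2) \<partial>lborel) \<le> M" .
  moreover have "(T x)\<^sup>2 \<le> (SUP k. (K k x)\<^sup>2)" for x
  proof (cases "T x = top")
    case False
    then obtain r where r: "T x = ennreal r" "0 \<le> r" by (cases "T x") auto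
    obtain k :: nat where k: "real k \<ge> max r (norm x)" using real_arch_simple by blast
    then have "ennreal r \<le> ennreal (real k)" by (intro ennreal_leI) simp
    then have "K k x = T x" using k r by (simp add: K_def ennreal_of_nat_eq_real_of_nat min_def)
    then show ?thesis by (metis SUP_upper UNIV_I)
  next
    case True
    \<comment> \<open>Where \<open>T\<close> is infinite the truncations take the value k, so the
      supremum of their squares is infinite as well.\<close>
    obtain k0 :: nat where k0: "real k0 \<ge> norm x" using real_arch_simple by blast
    have "of_nat m \<le> (SUP k. (K k x)\<^sup>2)" for m
    proof -
      define k where "k = Suc (max m k0)"
      have "K k x = of_nat k" using k0 True by (simp add: K_def k_def)
      moreover have "(of_nat m :: ennreal) \<le> (of_nat k)\<^sup>2"
      proof -
        have "m \<le> k * 1" by (simp add: k_def)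
        also have "\<dots> \<le> k * k" by (rule mult_left_mono) (auto simp: k_def)
        finally have "(of_nat m :: ennreal) \<le> of_nat (k * k)" by (rule of_nat_mono)
        then show ?thesis by (simp add: power2_eq_square)
      qed
      ultimately have "of_nat m \<le> (K k x)\<^sup>2" by simp
      then show ?thesis by (meson SUP_upper UNIV_I order_trans)
    qed
    then have "(SUP m. of_nat m :: ennreal) \<le> (SUP k. (K k x)\<^sup>2)" by (simp add: SUP_le_iff)
    then have "top \<le> (SUP k. (K k x)\<^sup>2)" by (simp only: ennreal_SUP_of_nat_eq_top)
    then show ?thesis by (rule order_trans[OF top_greatest])
  qed
  ultimately show ?thesis by (meson nn_integral_mono order_trans)
qed

text \<open>Majorant of the trilinear convolution with complex values replaced by moduli. Three
  independent slots are provided, because both the weight and a difference of two solutions may sit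
  in any one of them.\<close>

definition hartree_kernel :: "real \<Rightarrow> ('a::euclidean_space \<Rightarrow> ennreal) \<Rightarrow> ('a \<Rightarrow> ennreal) \<Rightarrow> ('a \<Rightarrow> ennreal) \<Rightarrow> 'a \<Rightarrow> ennreal" where
  "hartree_kernel lam F G H \<xi> = (\<integral>\<^sup>+\<eta>. (npow (lam - real DIM('a)) \<eta> * (\<integral>\<^sup>+\<zeta>. F (\<zeta> + \<eta>) * G \<zeta> \<partial>lborel)) * H (\<xi> - \<eta>) \<partial>lborel)"

lemma measurable_hartree_kernel [measurable]:
  assumes [measurable]: "F \<in> borel_measurable borel" "G \<in> borel_measurable borel" "H \<in> borel_measurable borel"
  shows "hartree_kernel lam F G H \<in> borel_measurable borel"
  unfolding hartree_kernel_def by measurable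

context
  fixes lam :: real and C :: real and type_a :: "'a::euclidean_space itself"
  assumes C0: "C > 0"
    and hardy: "\<And>F G :: 'a \<Rightarrow> ennreal. F \<in> borel_measurable borel \<Longrightarrow> G \<in> borel_measurable borel \<Longrightarrow>
    (\<integral>\<^sup>+c. npow (lam - real DIM('a)) c * (\<integral>\<^sup>+a. F (a + c) * G a \<partial>lborel) \<partial>lborel)\<^sup>2
      \<le> ennreal C * ((\<integral>\<^sup>+b. npow lam b * (F b)\<^sup>2 \<partial>lborel) * (\<integral>\<^sup>+a. npow lam a * (G a)\<^sup>2 \<partial>lborel))"
    and bil: "\<And>F G :: 'a \<Rightarrow> ennreal. F \<in> borel_measurable borel \<Longrightarrow> G \<in> borel_measurable borel \<Longrightarrow>
    (\<integral>\<^sup>+c. npow (lam - real DIM('a)) c * (\<integral>\<^sup>+a. F (a + c) * G a \<partial>lborel)\<^sup>2 \<partial>lborel)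
      \<le> ennreal C * ((\<integral>\<^sup>+a. (F a)\<^sup>2 \<partial>lborel) * (\<integral>\<^sup>+a. npow lam a * (G a)\<^sup>2 \<partial>lborel))"
begin

text \<open>For the weight outside the potential: Hardy puts the transform of the potential in L^1,
  and Young's inequality lets it act on \<open>H\<close> in L^2.\<close>

lemma hartree_kernel_est3:
  fixes F G H :: "'a \<Rightarrow> ennreal"
  assumes [measurable]: "F \<in> borel_measurable borel" "G \<in> borel_measurable borel" "H \<in> borel_measurable borel"
  shows "(\<integral>\<^sup>+\<xi>. (hartree_kernel lam F G H \<xi>)\<^sup>2 \<partial>lborel) \<le> ennreal C * ((\<integral>\<^sup>+b. npow lam b * (F b)\<^sup>2 \<partial>lborel) * (\<integral>\<^sup>+a. npow lam a * (G a)\<^sup>2 \<partial>lborel)) * (\<integral>\<^sup>+a. (H a)\<^sup>2 \<partial>lborel)"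
proof -
  have "(\<integral>\<^sup>+\<xi>. (hartree_kernel lam F G H \<xi>)\<^sup>2 \<partial>lborel) \<le> (\<integral>\<^sup>+\<eta>. npow (lam - real DIM('a)) \<eta> * (\<integral>\<^sup>+\<zeta>. F (\<zeta> + \<eta>) * G \<zeta> \<partial>lborel) \<partial>lborel)\<^sup>2 * (\<integral>\<^sup>+a. (H a)\<^sup>2 \<partial>lborel)"
    unfolding hartree_kernel_def by (rule nn_young) measurable
  also have "\<dots> \<le> ennreal C * ((\<integral>\<^sup>+b. npow lam b * (F b)\<^sup>2 \<partial>lborel) * (\<integral>\<^sup>+a. npow lam a * (G a)\<^sup>2 \<partial>lborel)) * (\<integral>\<^sup>+a. (H a)\<^sup>2 \<partial>lborel)"
    by (intro mult_right_mono hardy) auto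
  finally show ?thesis .
qed

text \<open>Pairing with a test function \<open>K\<close> puts \<open>H\<close> into a correlation
  with \<open>K\<close>. Cauchy--Schwarz with weight \<open>|\<eta>|^(lam - n)\<close> separates it
  from the correlation of \<open>F\<close> and \<open>G\<close>, and the product estimate bounds it
  with \<open>K\<close> measured in L^2 only.\<close>

lemma hartree_kernel_dual_est:
  fixes F G H :: "'a \<Rightarrow> ennreal"
  assumes [measurable]: "F \<in> borel_measurable borel" "G \<in> borel_measurable borel" "H \<in> borel_measurable borel"
    and B: "(\<integral>\<^sup>+c. npow (lam - real DIM('a)) c * (\<integral>\<^sup>+a. F (a + c) * G a \<partial>lborel)\<^sup>2 \<partial>lborel) \<le> B"
  shows "(\<integral>\<^sup>+\<xi>. (hartree_kernel lam F G H \<xi>)\<^sup>2 \<partial>lborel) \<le> B * (ennreal C * (\<integral>\<^sup>+a. npow lam a * (H a)\<^sup>2 \<partial>lborel))"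
proof (rule nn_L2_duality)
  let ?n = "real DIM('a)"
  fix K :: "'a \<Rightarrow> ennreal"
  assume [measurable]: "K \<in> borel_measurable borel"
  define Q where "Q \<eta> = (\<integral>\<^sup>+\<zeta>. F (\<zeta> + \<eta>) * G \<zeta> \<partial>lborel)" for \<eta>
  define P where "P \<eta> = (\<integral>\<^sup>+\<zeta>. K (\<zeta> + \<eta>) * H \<zeta> \<partial>lborel)" for \<eta>
  have [measurable]: "Q \<in> borel_measurable borel" "P \<in> borel_measurable borel" unfolding Q_def P_def by measurable
  have sq: "npow (lam - ?n) x * (y :: ennreal)\<^sup>2 = (npow ((lam - ?n) / 2) x * y)\<^sup>2" for x :: 'a and y
  proof -
    have "2 * ((lam - ?n) / 2) = lam - ?n" by simp
    then show ?thesis by (simp only: power_mult_distrib npow_power2)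
  qed
  have "(\<integral>\<^sup>+\<xi>. hartree_kernel lam F G H \<xi> * K \<xi> \<partial>lborel) = (\<integral>\<^sup>+\<xi>. (\<integral>\<^sup>+\<eta>. (npow (lam - ?n) \<eta> * Q \<eta>) * H (\<xi> - \<eta>) * K \<xi> \<partial>lborel) \<partial>lborel)"
    unfolding hartree_kernel_def Q_def[symmetric] by (intro nn_integral_cong nn_integral_multc[symmetric]) measurable
  also have "\<dots> = (\<integral>\<^sup>+\<eta>. (\<integral>\<^sup>+\<xi>. (npow (lam - ?n) \<eta> * Q \<eta>) * H (\<xi> - \<eta>) * K \<xi> \<partial>lborel) \<partial>lborel)"
    by (rule lborel_pair.Fubini'[symmetric]) measurable
  also have "\<dots> = (\<integral>\<^sup>+\<eta>. (npow ((lam - ?n) / 2) \<eta> * Q \<eta>) * (npow ((lam - ?n) / 2) \<eta> * P \<eta>) \<partial>lborel)"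
  proof (rule nn_integral_cong)
    fix \<eta> :: 'a
    have "(\<integral>\<^sup>+\<xi>. (npow (lam - ?n) \<eta> * Q \<eta>) * H (\<xi> - \<eta>) * K \<xi> \<partial>lborel) = (npow (lam - ?n) \<eta> * Q \<eta>) * (\<integral>\<^sup>+\<xi>. K \<xi> * H (\<xi> - \<eta>) \<partial>lborel)"
      by (subst nn_integral_cmult[symmetric], measurable) (simp only: mult_ac)
    also have "(\<integral>\<^sup>+\<xi>. K \<xi> * H (\<xi> - \<eta>) \<partial>lborel) = (\<integral>\<^sup>+\<xi>. K (\<xi> + \<eta>) * H ((\<xi> + \<eta>) - \<eta>) \<partial>lborel)"
      by (rule nn_integral_lborel_translate[of "\<lambda>\<xi>. K \<xi> * H (\<xi> - \<eta>)", symmetric]) measurable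
    also have "\<dots> = P \<eta>" by (simp add: P_def)
    finally have eq: "(\<integral>\<^sup>+\<xi>. (npow (lam - ?n) \<eta> * Q \<eta>) * H (\<xi> - \<eta>) * K \<xi> \<partial>lborel) = (npow (lam - ?n) \<eta> * Q \<eta>) * P \<eta>" .
    have "npow (lam - ?n) \<eta> = npow ((lam - ?n) / 2) \<eta> * npow ((lam - ?n) / 2) \<eta>"
      unfolding npow_mult by (rule arg_cong[of _ _ "\<lambda>r. npow r \<eta>"]) (simp add: field_simps)
    then show "(\<integral>\<^sup>+\<xi>. (npow (lam - ?n) \<eta> * Q \<eta>) * H (\<xi> - \<eta>) * K \<xi> \<partial>lborel) = (npow ((lam - ?n) / 2) \<eta> * Q \<eta>) * (npow ((lam - ?n) / 2) \<eta> * P \<eta>)"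
      unfolding eq by (simp only: mult_ac)
  qed
  finally have "(\<integral>\<^sup>+\<xi>. hartree_kernel lam F G H \<xi> * K \<xi> \<partial>lborel)\<^sup>2 = (\<integral>\<^sup>+\<eta>. (npow ((lam - ?n) / 2) \<eta> * Q \<eta>) * (npow ((lam - ?n) / 2) \<eta> * P \<eta>) \<partial>lborel)\<^sup>2"
    by simp
  also have "\<dots> \<le> (\<integral>\<^sup>+\<eta>. (npow ((lam - ?n) / 2) \<eta> * Q \<eta>)\<^sup>2 \<partial>lborel) * (\<integral>\<^sup>+\<eta>. (npow ((lam - ?n) / 2) \<eta> * P \<eta>)\<^sup>2 \<partial>lborel)"
    by (rule Cauchy_Schwarz_nn_integral) measurable
  also have "\<dots> \<le> B * (ennreal C * ((\<integral>\<^sup>+a. (K a)\<^sup>2 \<partial>lborel) * (\<integral>\<^sup>+a. npow lam a * (H a)\<^sup>2 \<partial>lborel)))"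
    unfolding sq[symmetric] using B bil[of K H] unfolding Q_def P_def by (intro mult_mono) auto
  finally show "(\<integral>\<^sup>+\<xi>. hartree_kernel lam F G H \<xi> * K \<xi> \<partial>lborel)\<^sup>2 \<le> B * (ennreal C * (\<integral>\<^sup>+a. npow lam a * (H a)\<^sup>2 \<partial>lborel)) * (\<integral>\<^sup>+x. (K x)\<^sup>2 \<partial>lborel)"
    by (simp only: mult_ac)
qed measurable

lemma hartree_kernel_est1:
  fixes F G H :: "'a \<Rightarrow> ennreal"
  assumes [measurable]: "F \<in> borel_measurable borel" "G \<in> borel_measurable borel" "H \<in> borel_measurable borel"
  shows "(\<integral>\<^sup>+\<xi>. (hartree_kernel lam F G H \<xi>)\<^sup>2 \<partial>lborel) \<le> ennreal C * ((\<integral>\<^sup>+b. (F b)\<^sup>2 \<partial>lborel) * (\<integral>\<^sup>+a. npow lam a * (G a)\<^sup>2 \<partial>lborel)) * (ennreal C * (\<integral>\<^sup>+a. npow lam a * (H a)\<^sup>2 \<partial>lborel))"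
  by (rule hartree_kernel_dual_est[OF assms bil[OF assms(1,2)]])

text \<open>Reflecting \<eta> exchanges the roles of \<open>F\<close> and \<open>G\<close> in the
  correlation, and the weight is even.\<close>

lemma hartree_kernel_est2:
  fixes F G H :: "'a \<Rightarrow> ennreal"
  assumes [measurable]: "F \<in> borel_measurable borel" "G \<in> borel_measurable borel" "H \<in> borel_measurable borel"
  shows "(\<integral>\<^sup>+\<xi>. (hartree_kernel lam F G H \<xi>)\<^sup>2 \<partial>lborel) \<le> ennreal C * ((\<integral>\<^sup>+b. (G b)\<^sup>2 \<partial>lborel) * (\<integral>\<^sup>+a. npow lam a * (F a)\<^sup>2 \<partial>lborel)) * (ennreal C * (\<integral>\<^sup>+a. npow lam a * (H a)\<^sup>2 \<partial>lborel))"
proof (rule hartree_kernel_dual_est[OF assms])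
  have swap: "(\<integral>\<^sup>+a. F (a + c) * G a \<partial>lborel) = (\<integral>\<^sup>+a. G (a + - c) * F a \<partial>lborel)" for c
  proof -
    have "(\<integral>\<^sup>+a. F (a + c) * G (a + c + - c) \<partial>lborel) = (\<integral>\<^sup>+a. F a * G (a + - c) \<partial>lborel)"
      by (rule nn_integral_lborel_translate[of "\<lambda>a. F a * G (a + - c)"]) measurable
    then show ?thesis by (simp add: mult.commute)
  qed
  have "(\<integral>\<^sup>+c. npow (lam - real DIM('a)) c * (\<integral>\<^sup>+a. F (a + c) * G a \<partial>lborel)\<^sup>2 \<partial>lborel)
    = (\<integral>\<^sup>+c. npow (lam - real DIM('a)) (0 - c) * (\<integral>\<^sup>+a. G (a + (0 - c)) * F a \<partial>lborel)\<^sup>2 \<partial>lborel)"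
    unfolding swap by simp
  also have "\<dots> = (\<integral>\<^sup>+c. npow (lam - real DIM('a)) c * (\<integral>\<^sup>+a. G (a + c) * F a \<partial>lborel)\<^sup>2 \<partial>lborel)"
    by (rule nn_integral_lborel_minus[of "\<lambda>c. npow (lam - real DIM('a)) c * (\<integral>\<^sup>+a. G (a + c) * F a \<partial>lborel)\<^sup>2"]) measurable
  also have "\<dots> \<le> ennreal C * ((\<integral>\<^sup>+b. (G b)\<^sup>2 \<partial>lborel) * (\<integral>\<^sup>+a. npow lam a * (F a)\<^sup>2 \<partial>lborel))"
    by (rule bil) measurable
  finally show "(\<integral>\<^sup>+c. npow (lam - real DIM('a)) c * (\<integral>\<^sup>+a. F (a + c) * G a \<partial>lborel)\<^sup>2 \<partial>lborel) \<le> ennreal C * ((\<integral>\<^sup>+b. (G b)\<^sup>2 \<partial>lborel) * (\<integral>\<^sup>+a. npow lam a * (F a)\<^sup>2 \<partial>lborel))" .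
qed

end

section \<open>Inhomogeneous weights and their distribution over three factors\<close>

definition japanese :: "real \<Rightarrow> 'a::euclidean_space \<Rightarrow> real" where
  "japanese s \<xi> = sqrt (1 + (norm \<xi>)\<^sup>2) powr s"

lemma measurable_japanese [measurable]: "japanese s \<in> borel_measurable borel"
  unfolding japanese_def by measurable

lemma japanese_base_ge_1: "1 \<le> sqrt (1 + (norm \<xi>)\<^sup>2)"
  by simp

lemma japanese_ge_1: "0 \<le> s \<Longrightarrow> 1 \<le> japanese s \<xi>"
  unfolding japanese_def by (rule ge_one_powr_ge_zero) auto

lemma japanese_pos [simp]: "0 < japanese s \<xi>"
  using japanese_base_ge_1[of \<xi>] unfolding japanese_def by (metis less_le_trans powr_gt_zero zero_less_one less_irrefl)

lemma japanese_uminus [simp]: "japanese s (- \<xi>) = japanese s \<xi>"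
  by (simp add: japanese_def)

lemma powr_le_japanese:
  assumes "0 \<le> r" "r \<le> s"
  shows "norm \<xi> powr r \<le> japanese s \<xi>"
proof -
  have "norm \<xi> \<le> sqrt (1 + (norm \<xi>)\<^sup>2)" by (rule real_le_rsqrt) simp
  then have "norm \<xi> powr r \<le> sqrt (1 + (norm \<xi>)\<^sup>2) powr r" using assms by (intro powr_mono2) auto
  also have "\<dots> \<le> japanese s \<xi>" unfolding japanese_def by (rule powr_mono) (use assms in auto)
  finally show ?thesis .
qed

text \<open>The longest of the three vectors dominates: the sum is at most three times as long,
  which costs the factor \<open>3 powr s\<close>.\<close>

lemma japanese_add_le:
  assumes s: "0 \<le> s"
  shows "japanese s (x + y + z) \<le> 3 powr s * (japanese s x + japanese s y + japanese s z)"
proof -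
  have *: "japanese s (x + y + z) \<le> 3 powr s * japanese s v" if v: "norm x \<le> norm v" "norm y \<le> norm v" "norm z \<le> norm v" for v
  proof -
    have "norm (x + y + z) \<le> norm x + norm y + norm z"
      using norm_triangle_ineq[of "x + y" z] norm_triangle_ineq[of x y] by linarith
    then have "norm (x + y + z) \<le> 3 * norm v" using v by linarith
    then have "(norm (x + y + z))\<^sup>2 \<le> (3 * norm v)\<^sup>2" by (rule power_mono) simp
    then have "sqrt (1 + (norm (x + y + z))\<^sup>2) \<le> sqrt (9 * (1 + (norm v)\<^sup>2))"
      by (intro real_sqrt_le_mono) (simp add: power_mult_distrib)
    also have "\<dots> = 3 * sqrt (1 + (norm v)\<^sup>2)" unfolding real_sqrt_mult by simp
    finally have "sqrt (1 + (norm (x + y + z))\<^sup>2) powr s \<le> (3 * sqrt (1 + (norm v)\<^sup>2)) powr s" using s by (intro powr_mono2) auto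
    then show ?thesis unfolding japanese_def by (simp add: powr_mult)
  qed
  have pos: "0 < japanese s x" "0 < japanese s y" "0 < japanese s z" by simp_all
  have "\<exists>v\<in>{x, y, z}. norm x \<le> norm v \<and> norm y \<le> norm v \<and> norm z \<le> norm v"
    by (cases "norm x \<le> norm y"; cases "norm y \<le> norm z"; cases "norm x \<le> norm z") auto
  then obtain v where v: "v \<in> {x, y, z}" "norm x \<le> norm v" "norm y \<le> norm v" "norm z \<le> norm v" by blast
  have le: "japanese s v \<le> japanese s x + japanese s y + japanese s z" using v(1) pos by (auto intro!: less_imp_le add_pos_pos)
  have "japanese s (x + y + z) \<le> 3 powr s * japanese s v" using v(2-4) by (rule *)
  also have "3 powr s * japanese s v \<le> 3 powr s * (japanese s x + japanese s y + japanese s z)" by (intro mult_left_mono le) simp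
  finally show ?thesis .
qed

text \<open>The squared H^s norm seen from the frequency side. It stays squared and
  \<open>ennreal\<close>-valued, so neither roots nor finiteness conditions intrude.\<close>

definition wnorm2 :: "real \<Rightarrow> ('a::euclidean_space \<Rightarrow> ennreal) \<Rightarrow> ennreal" where
  "wnorm2 s F = (\<integral>\<^sup>+x. (ennreal (japanese s x) * F x)\<^sup>2 \<partial>lborel)"

text \<open>Here the regularity threshold enters: at \<open>s \<ge> lam / 2\<close> the homogeneous
  norm of order lam/2, which the bilinear estimates require, is dominated by the H^s norm.\<close>

lemma npow_le_wnorm2:
  fixes F :: "'a::euclidean_space \<Rightarrow> ennreal"
  assumes "0 \<le> lam" "lam / 2 \<le> s"
  shows "(\<integral>\<^sup>+x. npow lam x * (F x)\<^sup>2 \<partial>lborel) \<le> wnorm2 s F"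
  unfolding wnorm2_def
proof (rule nn_integral_mono)
  fix x :: 'a
  have "npow (lam / 2) x \<le> ennreal (japanese s x)"
    unfolding npow_def using assms by (intro ennreal_leI powr_le_japanese) auto
  then have "(npow (lam / 2) x * F x)\<^sup>2 \<le> (ennreal (japanese s x) * F x)\<^sup>2" by (intro power_mono mult_right_mono) auto
  then show "npow lam x * (F x)\<^sup>2 \<le> (ennreal (japanese s x) * F x)\<^sup>2" by (simp add: power_mult_distrib npow_power2)
qed

lemma ennreal_sum3_power2_le: "(x + y + z :: ennreal)\<^sup>2 \<le> 4 * (x\<^sup>2 + y\<^sup>2 + z\<^sup>2)"
proof -
  have "(x + y + z)\<^sup>2 \<le> 2 * (x + y)\<^sup>2 + 2 * z\<^sup>2" by (rule ennreal_sum_power2_le)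
  also have "\<dots> \<le> 2 * (2 * x\<^sup>2 + 2 * y\<^sup>2) + 4 * z\<^sup>2"
    by (intro add_mono mult_left_mono mult_right_mono ennreal_sum_power2_le) auto
  also have "\<dots> = 4 * (x\<^sup>2 + y\<^sup>2 + z\<^sup>2)" by (simp add: distrib_left mult.assoc[symmetric])
  finally show ?thesis .
qed

text \<open>The frequencies in the three slots satisfy
  \<open>\<xi> = (\<zeta> + \<eta>) - \<zeta> + (\<xi> - \<eta>)\<close>, and the weight is even and
  subadditive up to a factor, so it can be handed to one slot at a time.\<close>

lemma weight_hartree_kernel_le:
  fixes F G H :: "'a::euclidean_space \<Rightarrow> ennreal"
  assumes s: "0 \<le> s" and [measurable]: "F \<in> borel_measurable borel" "G \<in> borel_measurable borel" "H \<in> borel_measurable borel"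
  defines "W \<equiv> \<lambda>x::'a. ennreal (japanese s x)"
  shows "W \<xi> * hartree_kernel lam F G H \<xi> \<le> ennreal (3 powr s) *
    (hartree_kernel lam (\<lambda>x. W x * F x) G H \<xi> + hartree_kernel lam F (\<lambda>x. W x * G x) H \<xi> + hartree_kernel lam F G (\<lambda>x. W x * H x) \<xi>)"
proof -
  let ?n = "real DIM('a)"
  have [measurable]: "W \<in> borel_measurable borel" unfolding W_def by measurable
  have expand: "hartree_kernel lam F G H \<xi> = (\<integral>\<^sup>+\<eta>. (\<integral>\<^sup>+\<zeta>. npow (lam - ?n) \<eta> * (F (\<zeta> + \<eta>) * G \<zeta>) * H (\<xi> - \<eta>) \<partial>lborel) \<partial>lborel)"
    if [measurable]: "F \<in> borel_measurable borel" "G \<in> borel_measurable borel" for F G H :: "'a \<Rightarrow> ennreal"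
    unfolding hartree_kernel_def by (simp add: nn_integral_cmult nn_integral_multc)
  have Wle: "W \<xi> \<le> ennreal (3 powr s) * (W (\<zeta> + \<eta>) + W \<zeta> + W (\<xi> - \<eta>))" for \<zeta> \<eta>
  proof -
    have "japanese s \<xi> \<le> 3 powr s * (japanese s (\<zeta> + \<eta>) + japanese s \<zeta> + japanese s (\<xi> - \<eta>))"
      using japanese_add_le[OF s, of "\<zeta> + \<eta>" "- \<zeta>" "\<xi> - \<eta>"] by simp
    from ennreal_leI[OF this] show ?thesis
      unfolding W_def by (simp add: ennreal_mult less_imp_le)
  qed
  have "W \<xi> * hartree_kernel lam F G H \<xi> = (\<integral>\<^sup>+\<eta>. (\<integral>\<^sup>+\<zeta>. W \<xi> * (npow (lam - ?n) \<eta> * (F (\<zeta> + \<eta>) * G \<zeta>) * H (\<xi> - \<eta>)) \<partial>lborel) \<partial>lborel)"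
    by (simp add: expand nn_integral_cmult)
  also have "\<dots> \<le> (\<integral>\<^sup>+\<eta>. (\<integral>\<^sup>+\<zeta>. ennreal (3 powr s) * (npow (lam - ?n) \<eta> * ((W (\<zeta> + \<eta>) * F (\<zeta> + \<eta>)) * G \<zeta>) * H (\<xi> - \<eta>)
     + npow (lam - ?n) \<eta> * (F (\<zeta> + \<eta>) * (W \<zeta> * G \<zeta>)) * H (\<xi> - \<eta>)
     + npow (lam - ?n) \<eta> * (F (\<zeta> + \<eta>) * G \<zeta>) * (W (\<xi> - \<eta>) * H (\<xi> - \<eta>))) \<partial>lborel) \<partial>lborel)"
  proof (intro nn_integral_mono)
    fix \<eta> \<zeta> :: 'a
    have "W \<xi> * (npow (lam - ?n) \<eta> * (F (\<zeta> + \<eta>) * G \<zeta>) * H (\<xi> - \<eta>)) \<le> (ennreal (3 powr s) * (W (\<zeta> + \<eta>) + W \<zeta> + W (\<xi> - \<eta>))) * (npow (lam - ?n) \<eta> * (F (\<zeta> + \<eta>) * G \<zeta>) * H (\<xi> - \<eta>))"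
      by (intro mult_right_mono Wle) simp
    also have "\<dots> = ennreal (3 powr s) * (npow (lam - ?n) \<eta> * ((W (\<zeta> + \<eta>) * F (\<zeta> + \<eta>)) * G \<zeta>) * H (\<xi> - \<eta>)
     + npow (lam - ?n) \<eta> * (F (\<zeta> + \<eta>) * (W \<zeta> * G \<zeta>)) * H (\<xi> - \<eta>)
     + npow (lam - ?n) \<eta> * (F (\<zeta> + \<eta>) * G \<zeta>) * (W (\<xi> - \<eta>) * H (\<xi> - \<eta>)))"
      by (simp only: distrib_left distrib_right mult_ac)
    finally show "W \<xi> * (npow (lam - ?n) \<eta> * (F (\<zeta> + \<eta>) * G \<zeta>) * H (\<xi> - \<eta>)) \<le> \<dots>" .
  qed
  also have "\<dots> = ennreal (3 powr s) *
    (hartree_kernel lam (\<lambda>x. W x * F x) G H \<xi> + hartree_kernel lam F (\<lambda>x. W x * G x) H \<xi> + hartree_kernel lam F G (\<lambda>x. W x * H x) \<xi>)"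
    by (simp add: expand nn_integral_cmult nn_integral_add)
  finally show ?thesis .
qed

text \<open>Each of the three placements of the weight has its own bound, after which every norm
  that remains is dominated by \<open>wnorm2 s\<close>. The second conclusion accompanies the first
  because it secures the absolute convergence needed to pass to frequency variables.\<close>

lemma weighted_trilinear:
  assumes lam: "0 < lam" "lam < real DIM('a::euclidean_space)" and s: "lam / 2 \<le> s"
  obtains M where "M > 0" "\<And>F G H :: 'a \<Rightarrow> ennreal. F \<in> borel_measurable borel \<Longrightarrow> G \<in> borel_measurable borel \<Longrightarrow> H \<in> borel_measurable borel \<Longrightarrow>
    wnorm2 s (hartree_kernel lam F G H) \<le> ennreal M * (wnorm2 s F * wnorm2 s G * wnorm2 s H)"
   and "\<And>F G :: 'a \<Rightarrow> ennreal. F \<in> borel_measurable borel \<Longrightarrow> G \<in> borel_measurable borel \<Longrightarrow>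
    (\<integral>\<^sup>+c. npow (lam - real DIM('a)) c * (\<integral>\<^sup>+a. F (a + c) * G a \<partial>lborel) \<partial>lborel)\<^sup>2 \<le> ennreal M * (wnorm2 s F * wnorm2 s G)"
proof -
  let ?n = "real DIM('a)"
  obtain C1 where C1: "C1 > 0" "\<And>F G :: 'a \<Rightarrow> ennreal. F \<in> borel_measurable borel \<Longrightarrow> G \<in> borel_measurable borel \<Longrightarrow>
    (\<integral>\<^sup>+c. npow (lam - ?n) c * (\<integral>\<^sup>+a. F (a + c) * G a \<partial>lborel) \<partial>lborel)\<^sup>2
      \<le> ennreal C1 * ((\<integral>\<^sup>+b. npow lam b * (F b)\<^sup>2 \<partial>lborel) * (\<integral>\<^sup>+a. npow lam a * (G a)\<^sup>2 \<partial>lborel))"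
    using hardy_fourier[OF lam] by blast
  obtain C2 where C2: "C2 > 0" "\<And>F G :: 'a \<Rightarrow> ennreal. F \<in> borel_measurable borel \<Longrightarrow> G \<in> borel_measurable borel \<Longrightarrow>
    (\<integral>\<^sup>+c. npow (lam - ?n) c * (\<integral>\<^sup>+a. F (a + c) * G a \<partial>lborel)\<^sup>2 \<partial>lborel)
      \<le> ennreal C2 * ((\<integral>\<^sup>+a. (F a)\<^sup>2 \<partial>lborel) * (\<integral>\<^sup>+a. npow lam a * (G a)\<^sup>2 \<partial>lborel))"
    using bilinear_estimate[OF lam] by blast
  \<comment> \<open>One constant for both estimates, at least 1 so that it is bounded by its own
    square and hence by \<open>M\<close>.\<close>
  define C where "C = max C1 C2 + 1"
  have C: "C > 0" "C1 \<le> C" "C2 \<le> C" "C \<ge> 1" using C1(1) C2(1) by (auto simp: C_def)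
  have hardy: "(\<integral>\<^sup>+c. npow (lam - ?n) c * (\<integral>\<^sup>+a. F (a + c) * G a \<partial>lborel) \<partial>lborel)\<^sup>2
      \<le> ennreal C * ((\<integral>\<^sup>+b. npow lam b * (F b)\<^sup>2 \<partial>lborel) * (\<integral>\<^sup>+a. npow lam a * (G a)\<^sup>2 \<partial>lborel))"
    if "F \<in> borel_measurable borel" "G \<in> borel_measurable borel" for F G :: "'a \<Rightarrow> ennreal"
    using C1(2)[OF that] by (rule order_trans) (intro mult_right_mono ennreal_leI C; simp)
  have bil: "(\<integral>\<^sup>+c. npow (lam - ?n) c * (\<integral>\<^sup>+a. F (a + c) * G a \<partial>lborel)\<^sup>2 \<partial>lborel)
      \<le> ennreal C * ((\<integral>\<^sup>+a. (F a)\<^sup>2 \<partial>lborel) * (\<integral>\<^sup>+a. npow lam a * (G a)\<^sup>2 \<partial>lborel))"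
    if "F \<in> borel_measurable borel" "G \<in> borel_measurable borel" for F G :: "'a \<Rightarrow> ennreal"
    using C2(2)[OF that] by (rule order_trans) (intro mult_right_mono ennreal_leI C; simp)
  have s0: "0 \<le> s" using lam s by simp
  note np = npow_le_wnorm2[OF less_imp_le[OF lam(1)] s]
  define B where "B = (3::real) powr s"
  have B: "B > 0" by (simp add: B_def)
  \<comment> \<open>The factor \<open>4 * B\<^sup>2\<close> comes from squaring a sum of three terms
    with factor \<open>B\<close>; three bounds with constant \<open>C\<^sup>2\<close> supply the
    remaining 3.\<close>
  define M where "M = 12 * B\<^sup>2 * C\<^sup>2"
  have CM: "C \<le> M"
  proof -
    have "1 \<le> B" unfolding B_def using s0 by (intro ge_one_powr_ge_zero) auto
    then have "1 \<le> B\<^sup>2" by (rule one_le_power)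
    moreover have "C \<le> C\<^sup>2" using C(4) by (simp add: power2_eq_square)
    ultimately have "1 * C \<le> B\<^sup>2 * C\<^sup>2" using C(1) by (intro mult_mono) auto
    then show ?thesis using C(1) by (simp add: M_def)
  qed
  show thesis
  proof (rule that)
    show "M > 0" using B C by (simp add: M_def)
    fix F G H :: "'a \<Rightarrow> ennreal"
    assume [measurable]: "F \<in> borel_measurable borel" "G \<in> borel_measurable borel" "H \<in> borel_measurable borel"
    let ?W = "\<lambda>x::'a. ennreal (japanese s x)"
    let ?P = "wnorm2 s F * wnorm2 s G * wnorm2 s H"
    let ?K1 = "hartree_kernel lam (\<lambda>x. ?W x * F x) G H"
    let ?K2 = "hartree_kernel lam F (\<lambda>x. ?W x * G x) H"
    let ?K3 = "hartree_kernel lam F G (\<lambda>x. ?W x * H x)"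
    have "(\<integral>\<^sup>+\<xi>. (?K1 \<xi>)\<^sup>2 \<partial>lborel) \<le> ennreal C * (wnorm2 s F * (\<integral>\<^sup>+a. npow lam a * (G a)\<^sup>2 \<partial>lborel)) * (ennreal C * (\<integral>\<^sup>+a. npow lam a * (H a)\<^sup>2 \<partial>lborel))"
      unfolding wnorm2_def by (rule hartree_kernel_est1[OF C(1)]; ((rule hardy bil; assumption) | measurable))
    also have "\<dots> \<le> ennreal C * (wnorm2 s F * wnorm2 s G) * (ennreal C * wnorm2 s H)"
      by (intro mult_mono mult_left_mono np) auto
    also have "\<dots> = ennreal (C\<^sup>2) * ?P" using C(1) by (simp add: ennreal_mult power2_eq_square mult_ac)
    finally have K1: "(\<integral>\<^sup>+\<xi>. (?K1 \<xi>)\<^sup>2 \<partial>lborel) \<le> ennreal (C\<^sup>2) * ?P" .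
    have "(\<integral>\<^sup>+\<xi>. (?K2 \<xi>)\<^sup>2 \<partial>lborel) \<le> ennreal C * (wnorm2 s G * (\<integral>\<^sup>+a. npow lam a * (F a)\<^sup>2 \<partial>lborel)) * (ennreal C * (\<integral>\<^sup>+a. npow lam a * (H a)\<^sup>2 \<partial>lborel))"
      unfolding wnorm2_def by (rule hartree_kernel_est2[OF C(1)]; ((rule hardy bil; assumption) | measurable))
    also have "\<dots> \<le> ennreal C * (wnorm2 s G * wnorm2 s F) * (ennreal C * wnorm2 s H)"
      by (intro mult_mono mult_left_mono np) auto
    also have "\<dots> = ennreal (C\<^sup>2) * ?P" using C(1) by (simp add: ennreal_mult power2_eq_square mult_ac)
    finally have K2: "(\<integral>\<^sup>+\<xi>. (?K2 \<xi>)\<^sup>2 \<partial>lborel) \<le> ennreal (C\<^sup>2) * ?P" .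
    have "(\<integral>\<^sup>+\<xi>. (?K3 \<xi>)\<^sup>2 \<partial>lborel) \<le> ennreal C * ((\<integral>\<^sup>+a. npow lam a * (F a)\<^sup>2 \<partial>lborel) * (\<integral>\<^sup>+a. npow lam a * (G a)\<^sup>2 \<partial>lborel)) * wnorm2 s H"
      unfolding wnorm2_def by (rule hartree_kernel_est3[OF C(1)]; ((rule hardy bil; assumption) | measurable))
    also have "\<dots> \<le> ennreal C * (wnorm2 s F * wnorm2 s G) * wnorm2 s H"
      by (intro mult_mono mult_left_mono np) auto
    also have "\<dots> \<le> ennreal (C\<^sup>2) * (wnorm2 s F * wnorm2 s G) * wnorm2 s H"
      using C by (intro mult_right_mono ennreal_leI) (auto simp: power2_eq_square)
    finally have K3: "(\<integral>\<^sup>+\<xi>. (?K3 \<xi>)\<^sup>2 \<partial>lborel) \<le> ennreal (C\<^sup>2) * ?P" by (simp only: mult.assoc)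
    have "wnorm2 s (hartree_kernel lam F G H) \<le> (\<integral>\<^sup>+\<xi>. ennreal (B\<^sup>2 * 4) * ((?K1 \<xi>)\<^sup>2 + (?K2 \<xi>)\<^sup>2 + (?K3 \<xi>)\<^sup>2) \<partial>lborel)"
      unfolding wnorm2_def
    proof (rule nn_integral_mono)
      fix \<xi> :: 'a
      have "(?W \<xi> * hartree_kernel lam F G H \<xi>)\<^sup>2 \<le> (ennreal B * (?K1 \<xi> + ?K2 \<xi> + ?K3 \<xi>))\<^sup>2"
        unfolding B_def by (intro power_mono weight_hartree_kernel_le s0) auto
      also have "\<dots> = ennreal (B\<^sup>2) * (?K1 \<xi> + ?K2 \<xi> + ?K3 \<xi>)\<^sup>2" using B by (simp add: power_mult_distrib ennreal_power)
      also have "\<dots> \<le> ennreal (B\<^sup>2) * (4 * ((?K1 \<xi>)\<^sup>2 + (?K2 \<xi>)\<^sup>2 + (?K3 \<xi>)\<^sup>2))" by (intro mult_left_mono ennreal_sum3_power2_le) simp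
      finally show "(?W \<xi> * hartree_kernel lam F G H \<xi>)\<^sup>2 \<le> ennreal (B\<^sup>2 * 4) * ((?K1 \<xi>)\<^sup>2 + (?K2 \<xi>)\<^sup>2 + (?K3 \<xi>)\<^sup>2)"
        using B by (simp add: ennreal_mult mult.assoc)
    qed
    also have "\<dots> = ennreal (B\<^sup>2 * 4) * ((\<integral>\<^sup>+\<xi>. (?K1 \<xi>)\<^sup>2 \<partial>lborel) + (\<integral>\<^sup>+\<xi>. (?K2 \<xi>)\<^sup>2 \<partial>lborel) + (\<integral>\<^sup>+\<xi>. (?K3 \<xi>)\<^sup>2 \<partial>lborel))"
      by (simp add: nn_integral_cmult nn_integral_add)
    also have "\<dots> \<le> ennreal (B\<^sup>2 * 4) * (ennreal (C\<^sup>2) * ?P + ennreal (C\<^sup>2) * ?P + ennreal (C\<^sup>2) * ?P)"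
      by (intro mult_left_mono add_mono K1 K2 K3) auto
    also have "\<dots> = ennreal (B\<^sup>2 * 4) * (ennreal (C\<^sup>2 + C\<^sup>2 + C\<^sup>2) * ?P)"
      by (simp only: ennreal_plus zero_le_power2 add_nonneg_nonneg distrib_right)
    also have "\<dots> = ennreal M * ?P"
    proof -
      have "ennreal (B\<^sup>2 * 4) * ennreal (C\<^sup>2 + C\<^sup>2 + C\<^sup>2) = ennreal M"
        by (subst ennreal_mult[symmetric]) (auto simp: M_def)
      then show ?thesis by (simp only: mult.assoc[symmetric])
    qed
    finally show "wnorm2 s (hartree_kernel lam F G H) \<le> ennreal M * ?P" .
  next
    fix F G :: "'a \<Rightarrow> ennreal"
    assume FG: "F \<in> borel_measurable borel" "G \<in> borel_measurable borel"
    have "ennreal C * ((\<integral>\<^sup>+b. npow lam b * (F b)\<^sup>2 \<partial>lborel) * (\<integral>\<^sup>+a. npow lam a * (G a)\<^sup>2 \<partial>lborel)) \<le> ennreal M * (wnorm2 s F * wnorm2 s G)"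
      using CM by (intro mult_mono np ennreal_leI) auto
    then show "(\<integral>\<^sup>+c. npow (lam - ?n) c * (\<integral>\<^sup>+a. F (a + c) * G a \<partial>lborel) \<partial>lborel)\<^sup>2 \<le> ennreal M * (wnorm2 s F * wnorm2 s G)"
      using hardy[OF FG] by (rule order_trans[rotated])
  qed
qed

section \<open>From moduli to the complex-valued nonlinearity\<close>

lemma japanese_nonneg [simp]: "0 \<le> japanese s \<xi>" and japanese_nonzero [simp]: "japanese s \<xi> \<noteq> 0"
  using japanese_pos[of s \<xi>] by linarith+

abbreviation enorm :: "('a \<Rightarrow> complex) \<Rightarrow> 'a \<Rightarrow> ennreal" where
  "enorm f \<equiv> (\<lambda>x. ennreal (norm (f x)))"

lemma integrable_autocorrelation:
  fixes f h :: "'a::euclidean_space \<Rightarrow> complex"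
  assumes "square_integrable f" "square_integrable h"
  shows "integrable lborel (\<lambda>\<zeta>. f (\<zeta> + \<eta>) * cnj (h \<zeta>))"
  by (intro integrable_mult_L2 square_integrable_translate square_integrable_cnj assms)

lemma norm_autocorrelation_le:
  "ennreal (norm (autocorrelation f \<eta>)) \<le> (\<integral>\<^sup>+\<zeta>. enorm f (\<zeta> + \<eta>) * enorm f \<zeta> \<partial>lborel)"
  unfolding autocorrelation_def
  using ennreal_norm_integral_le[of lborel "\<lambda>\<zeta>. f (\<zeta> + \<eta>) * cnj (f \<zeta>)"] by (simp add: norm_mult ennreal_mult)

text \<open>Telescoping of a sesquilinear expression, one factor changed at a time. Square
  integrability permits the two Bochner integrals to be subtracted.\<close>

lemma norm_autocorrelation_diff_le:
  fixes f h :: "'a::euclidean_space \<Rightarrow> complex"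
  assumes f: "square_integrable f" and h: "square_integrable h"
  defines "d \<equiv> \<lambda>x. f x - h x"
  shows "ennreal (norm (autocorrelation f \<eta> - autocorrelation h \<eta>))
    \<le> (\<integral>\<^sup>+\<zeta>. enorm d (\<zeta> + \<eta>) * enorm f \<zeta> \<partial>lborel) + (\<integral>\<^sup>+\<zeta>. enorm h (\<zeta> + \<eta>) * enorm d \<zeta> \<partial>lborel)"
proof -
  note [measurable] = square_integrable_measurable[OF f] square_integrable_measurable[OF h]
  have [measurable]: "d \<in> borel_measurable borel" unfolding d_def by measurable
  have "autocorrelation f \<eta> - autocorrelation h \<eta> = (\<integral>\<zeta>. f (\<zeta> + \<eta>) * cnj (f \<zeta>) - h (\<zeta> + \<eta>) * cnj (h \<zeta>) \<partial>lborel)"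
    unfolding autocorrelation_def by (intro Bochner_Integration.integral_diff[symmetric] integrable_autocorrelation f h)
  also have "\<dots> = (\<integral>\<zeta>. d (\<zeta> + \<eta>) * cnj (f \<zeta>) + h (\<zeta> + \<eta>) * cnj (d \<zeta>) \<partial>lborel)"
    by (simp add: d_def algebra_simps)
  also have "ennreal (norm \<dots>) \<le> (\<integral>\<^sup>+\<zeta>. ennreal (norm (d (\<zeta> + \<eta>) * cnj (f \<zeta>) + h (\<zeta> + \<eta>) * cnj (d \<zeta>))) \<partial>lborel)"
    by (rule ennreal_norm_integral_le)
  also have "\<dots> \<le> (\<integral>\<^sup>+\<zeta>. enorm d (\<zeta> + \<eta>) * enorm f \<zeta> + enorm h (\<zeta> + \<eta>) * enorm d \<zeta> \<partial>lborel)"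
  proof (rule nn_integral_mono)
    fix \<zeta>
    have "norm (d (\<zeta> + \<eta>) * cnj (f \<zeta>) + h (\<zeta> + \<eta>) * cnj (d \<zeta>)) \<le> norm (d (\<zeta> + \<eta>)) * norm (f \<zeta>) + norm (h (\<zeta> + \<eta>)) * norm (d \<zeta>)"
      by (rule order_trans[OF norm_triangle_ineq]) (simp add: norm_mult)
    from ennreal_leI[OF this]
    show "ennreal (norm (d (\<zeta> + \<eta>) * cnj (f \<zeta>) + h (\<zeta> + \<eta>) * cnj (d \<zeta>))) \<le> enorm d (\<zeta> + \<eta>) * enorm f \<zeta> + enorm h (\<zeta> + \<eta>) * enorm d \<zeta>"
      by (simp add: ennreal_mult)
  qed
  also have "\<dots> = (\<integral>\<^sup>+\<zeta>. enorm d (\<zeta> + \<eta>) * enorm f \<zeta> \<partial>lborel) + (\<integral>\<^sup>+\<zeta>. enorm h (\<zeta> + \<eta>) * enorm d \<zeta> \<partial>lborel)"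
    by (rule nn_integral_add) measurable
  finally show ?thesis .
qed

definition hartree_const :: "'a::euclidean_space itself \<Rightarrow> real \<Rightarrow> real" where
  "hartree_const _ lam = (2 * pi) powr (- real DIM('a) / 2) * riesz_const ((real DIM('a) - lam) / 2) / riesz_const (lam / 2)"

lemma hartree_const_nonneg: "0 \<le> hartree_const TYPE('a::euclidean_space) lam"
  unfolding hartree_const_def riesz_const_def by simp

lemma hartree_density_eq:
  "hartree_density lam (f :: 'a::euclidean_space \<Rightarrow> complex) \<eta> =
    of_real (hartree_const TYPE('a) lam) * (of_real (norm \<eta> powr (lam - real DIM('a))) * autocorrelation f \<eta>)"
  by (simp add: hartree_density_def hartree_const_def)

definition hartree_symbol :: "real \<Rightarrow> ('a::euclidean_space \<Rightarrow> complex) \<Rightarrow> 'a \<Rightarrow> complex" where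
  "hartree_symbol lam f \<xi> = (\<integral>\<eta>. hartree_density lam f \<eta> * f (\<xi> - \<eta>) \<partial>lborel)"

lemma measurable_hartree_density [measurable]:
  assumes [measurable]: "f \<in> borel_measurable borel"
  shows "hartree_density lam f \<in> borel_measurable borel"
  unfolding hartree_density_def by measurable

lemma measurable_hartree_symbol [measurable]:
  assumes [measurable]: "f \<in> borel_measurable borel"
  shows "hartree_symbol lam f \<in> borel_measurable borel"
  unfolding hartree_symbol_def by measurable

lemma enorm_hartree_density:
  "enorm (hartree_density lam f) \<eta> \<le> ennreal (hartree_const TYPE('a) lam) * (npow (lam - real DIM('a)) \<eta> * (\<integral>\<^sup>+\<zeta>. enorm f (\<zeta> + \<eta>) * enorm f \<zeta> \<partial>lborel))"
  for f :: "'a::euclidean_space \<Rightarrow> complex"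
proof -
  have "enorm (hartree_density lam f) \<eta> = ennreal (hartree_const TYPE('a) lam) * (npow (lam - real DIM('a)) \<eta> * ennreal (norm (autocorrelation f \<eta>)))"
    using hartree_const_nonneg[of lam, where 'a='a] by (simp add: hartree_density_eq norm_mult npow_def ennreal_mult)
  also have "\<dots> \<le> ennreal (hartree_const TYPE('a) lam) * (npow (lam - real DIM('a)) \<eta> * (\<integral>\<^sup>+\<zeta>. enorm f (\<zeta> + \<eta>) * enorm f \<zeta> \<partial>lborel))"
    by (intro mult_left_mono norm_autocorrelation_le) auto
  finally show ?thesis .
qed

lemma enorm_hartree_density_diff:
  fixes f h :: "'a::euclidean_space \<Rightarrow> complex"
  assumes f: "square_integrable f" and h: "square_integrable h"
  defines "d \<equiv> \<lambda>x. f x - h x"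
  shows "ennreal (norm (hartree_density lam f \<eta> - hartree_density lam h \<eta>))
    \<le> ennreal (hartree_const TYPE('a) lam) * (npow (lam - real DIM('a)) \<eta> *
      ((\<integral>\<^sup>+\<zeta>. enorm d (\<zeta> + \<eta>) * enorm f \<zeta> \<partial>lborel) + (\<integral>\<^sup>+\<zeta>. enorm h (\<zeta> + \<eta>) * enorm d \<zeta> \<partial>lborel)))"
proof -
  have "hartree_density lam f \<eta> - hartree_density lam h \<eta> = of_real (hartree_const TYPE('a) lam) * (of_real (norm \<eta> powr (lam - real DIM('a))) * (autocorrelation f \<eta> - autocorrelation h \<eta>))"
    by (simp add: hartree_density_eq algebra_simps)
  then have "ennreal (norm (hartree_density lam f \<eta> - hartree_density lam h \<eta>)) = ennreal (hartree_const TYPE('a) lam) * (npow (lam - real DIM('a)) \<eta> * ennreal (norm (autocorrelation f \<eta> - autocorrelation h \<eta>)))"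
    using hartree_const_nonneg[of lam, where 'a='a] by (simp add: norm_mult npow_def ennreal_mult)
  also have "\<dots> \<le> ennreal (hartree_const TYPE('a) lam) * (npow (lam - real DIM('a)) \<eta> *
      ((\<integral>\<^sup>+\<zeta>. enorm d (\<zeta> + \<eta>) * enorm f \<zeta> \<partial>lborel) + (\<integral>\<^sup>+\<zeta>. enorm h (\<zeta> + \<eta>) * enorm d \<zeta> \<partial>lborel)))"
    unfolding d_def by (intro mult_left_mono norm_autocorrelation_diff_le f h) auto
  finally show ?thesis .
qed

lemma enorm_hartree_symbol_le:
  fixes f :: "'a::euclidean_space \<Rightarrow> complex"
  assumes [measurable]: "f \<in> borel_measurable borel"
  shows "enorm (hartree_symbol lam f) \<xi> \<le> ennreal (hartree_const TYPE('a) lam) * hartree_kernel lam (enorm f) (enorm f) (enorm f) \<xi>"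
proof -
  have "enorm (hartree_symbol lam f) \<xi> \<le> (\<integral>\<^sup>+\<eta>. enorm (hartree_density lam f) \<eta> * enorm f (\<xi> - \<eta>) \<partial>lborel)"
    unfolding hartree_symbol_def using ennreal_norm_integral_le[of lborel "\<lambda>\<eta>. hartree_density lam f \<eta> * f (\<xi> - \<eta>)"]
    by (simp add: norm_mult ennreal_mult)
  also have "\<dots> \<le> (\<integral>\<^sup>+\<eta>. ennreal (hartree_const TYPE('a) lam) * ((npow (lam - real DIM('a)) \<eta> * (\<integral>\<^sup>+\<zeta>. enorm f (\<zeta> + \<eta>) * enorm f \<zeta> \<partial>lborel)) * enorm f (\<xi> - \<eta>)) \<partial>lborel)"
    by (intro nn_integral_mono, subst mult.assoc[symmetric], intro mult_right_mono enorm_hartree_density) auto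
  also have "\<dots> = ennreal (hartree_const TYPE('a) lam) * hartree_kernel lam (enorm f) (enorm f) (enorm f) \<xi>"
    unfolding hartree_kernel_def by (rule nn_integral_cmult) measurable
  finally show ?thesis .
qed

text \<open>Young's inequality makes the convolution of the moduli finite almost everywhere; at such
  frequencies the Bochner integrals are genuine and differences can be formed under the
  integral.\<close>

lemma AE_integrable_convolution:
  fixes \<phi> f :: "'a::euclidean_space \<Rightarrow> complex"
  assumes \<phi>: "integrable lborel \<phi>" and f: "square_integrable f"
  shows "AE \<xi> in lborel. integrable lborel (\<lambda>\<eta>. \<phi> \<eta> * f (\<xi> - \<eta>))"
proof -
  note [measurable] = borel_measurable_integrable[OF \<phi>] square_integrable_measurable[OF f]
  have "(\<integral>\<^sup>+\<xi>. (\<integral>\<^sup>+\<eta>. enorm \<phi> \<eta> * enorm f (\<xi> - \<eta>) \<partial>lborel)\<^sup>2 \<partial>lborel) \<le> (\<integral>\<^sup>+\<eta>. enorm \<phi> \<eta> \<partial>lborel)\<^sup>2 * (\<integral>\<^sup>+\<xi>. (enorm f \<xi>)\<^sup>2 \<partial>lborel)"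
    by (rule nn_young) measurable
  also have "\<dots> < \<infinity>"
    using \<phi> f by (simp add: ennreal_power square_integrable_iff_nn integrable_iff_bounded ennreal_mult_less_top power_less_top_ennreal)
  finally have "AE \<xi> in lborel. (\<integral>\<^sup>+\<eta>. enorm \<phi> \<eta> * enorm f (\<xi> - \<eta>) \<partial>lborel)\<^sup>2 \<noteq> \<infinity>"
    by (intro nn_integral_PInf_AE) auto
  then show ?thesis
  proof eventually_elim
    case (elim \<xi>)
    then have "(\<integral>\<^sup>+\<eta>. enorm \<phi> \<eta> * enorm f (\<xi> - \<eta>) \<partial>lborel)\<^sup>2 < top"
      by (simp add: less_top)
    then have "(\<integral>\<^sup>+\<eta>. enorm \<phi> \<eta> * enorm f (\<xi> - \<eta>) \<partial>lborel) < \<infinity>"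
      by (simp add: power_less_top_ennreal)
    then show ?case by (intro integrableI_bounded) (auto simp: norm_mult ennreal_mult)
  qed
qed

text \<open>Changing one factor at a time leaves three terms with the difference \<open>d\<close> in
  each slot in turn, so the trilinear bound covers all of them.\<close>

lemma AE_enorm_hartree_symbol_diff_le:
  fixes f h :: "'a::euclidean_space \<Rightarrow> complex"
  assumes f: "square_integrable f" "integrable lborel (hartree_density lam f)"
    and h: "square_integrable h" "integrable lborel (hartree_density lam h)"
  defines "d \<equiv> \<lambda>x. f x - h x"
  shows "AE \<xi> in lborel. ennreal (norm (hartree_symbol lam f \<xi> - hartree_symbol lam h \<xi>)) \<le> ennreal (hartree_const TYPE('a) lam) *
     (hartree_kernel lam (enorm d) (enorm f) (enorm f) \<xi> + hartree_kernel lam (enorm h) (enorm d) (enorm f) \<xi> + hartree_kernel lam (enorm h) (enorm h) (enorm d) \<xi>)"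
  using AE_integrable_convolution[OF f(2,1)] AE_integrable_convolution[OF h(2,1)]
proof eventually_elim
  case (elim \<xi>)
  note [measurable] = square_integrable_measurable[OF f(1)] square_integrable_measurable[OF h(1)]
  have [measurable]: "d \<in> borel_measurable borel" unfolding d_def by measurable
  let ?c = "ennreal (hartree_const TYPE('a) lam)" and ?n = "real DIM('a)"
  let ?A = "\<lambda>\<eta>. \<integral>\<^sup>+\<zeta>. enorm d (\<zeta> + \<eta>) * enorm f \<zeta> \<partial>lborel"
  let ?B = "\<lambda>\<eta>. \<integral>\<^sup>+\<zeta>. enorm h (\<zeta> + \<eta>) * enorm d \<zeta> \<partial>lborel"
  let ?D = "\<lambda>\<eta>. \<integral>\<^sup>+\<zeta>. enorm h (\<zeta> + \<eta>) * enorm h \<zeta> \<partial>lborel"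
  have sym: "hartree_symbol lam f \<xi> - hartree_symbol lam h \<xi> = (\<integral>\<eta>. (hartree_density lam f \<eta> - hartree_density lam h \<eta>) * f (\<xi> - \<eta>) + hartree_density lam h \<eta> * d (\<xi> - \<eta>) \<partial>lborel)"
  proof -
    have "hartree_symbol lam f \<xi> - hartree_symbol lam h \<xi> = (\<integral>\<eta>. hartree_density lam f \<eta> * f (\<xi> - \<eta>) - hartree_density lam h \<eta> * h (\<xi> - \<eta>) \<partial>lborel)"
    unfolding hartree_symbol_def by (rule Bochner_Integration.integral_diff[OF elim, symmetric])
    then show ?thesis by (simp add: d_def algebra_simps)
  qed
  have "ennreal (norm (hartree_symbol lam f \<xi> - hartree_symbol lam h \<xi>)) \<le> (\<integral>\<^sup>+\<eta>. ennreal (norm ((hartree_density lam f \<eta> - hartree_density lam h \<eta>) * f (\<xi> - \<eta>) + hartree_density lam h \<eta> * d (\<xi> - \<eta>))) \<partial>lborel)"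
    unfolding sym
    by (rule ennreal_norm_integral_le)
  also have "\<dots> \<le> (\<integral>\<^sup>+\<eta>. ?c * ((npow (lam - ?n) \<eta> * ?A \<eta>) * enorm f (\<xi> - \<eta>)
     + (npow (lam - ?n) \<eta> * ?B \<eta>) * enorm f (\<xi> - \<eta>) + (npow (lam - ?n) \<eta> * ?D \<eta>) * enorm d (\<xi> - \<eta>)) \<partial>lborel)"
  proof (rule nn_integral_mono)
    fix \<eta> :: 'a
    have "norm ((hartree_density lam f \<eta> - hartree_density lam h \<eta>) * f (\<xi> - \<eta>) + hartree_density lam h \<eta> * d (\<xi> - \<eta>))
      \<le> norm (hartree_density lam f \<eta> - hartree_density lam h \<eta>) * norm (f (\<xi> - \<eta>)) + norm (hartree_density lam h \<eta>) * norm (d (\<xi> - \<eta>))"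
      by (rule order_trans[OF norm_triangle_ineq]) (simp add: norm_mult)
    from ennreal_leI[OF this]
    have "ennreal (norm ((hartree_density lam f \<eta> - hartree_density lam h \<eta>) * f (\<xi> - \<eta>) + hartree_density lam h \<eta> * d (\<xi> - \<eta>)))
      \<le> ennreal (norm (hartree_density lam f \<eta> - hartree_density lam h \<eta>)) * enorm f (\<xi> - \<eta>) + enorm (hartree_density lam h) \<eta> * enorm d (\<xi> - \<eta>)"
      by (simp add: ennreal_mult)
    also have "\<dots> \<le> (?c * (npow (lam - ?n) \<eta> * (?A \<eta> + ?B \<eta>))) * enorm f (\<xi> - \<eta>) + (?c * (npow (lam - ?n) \<eta> * ?D \<eta>)) * enorm d (\<xi> - \<eta>)"
      using enorm_hartree_density_diff[OF f(1) h(1), of lam \<eta>] enorm_hartree_density[of lam h \<eta>] unfolding d_def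
      by (intro add_mono mult_right_mono) auto
    also have "\<dots> = ?c * ((npow (lam - ?n) \<eta> * ?A \<eta>) * enorm f (\<xi> - \<eta>)
     + (npow (lam - ?n) \<eta> * ?B \<eta>) * enorm f (\<xi> - \<eta>) + (npow (lam - ?n) \<eta> * ?D \<eta>) * enorm d (\<xi> - \<eta>))"
      by (simp only: distrib_left distrib_right mult.assoc)
    finally show "ennreal (norm ((hartree_density lam f \<eta> - hartree_density lam h \<eta>) * f (\<xi> - \<eta>) + hartree_density lam h \<eta> * d (\<xi> - \<eta>))) \<le> \<dots>" .
  qed
  also have "\<dots> = ?c * (hartree_kernel lam (enorm d) (enorm f) (enorm f) \<xi> + hartree_kernel lam (enorm h) (enorm d) (enorm f) \<xi> + hartree_kernel lam (enorm h) (enorm h) (enorm d) \<xi>)"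
    unfolding hartree_kernel_def by (simp add: nn_integral_cmult nn_integral_add)
  finally show ?case .
qed

section \<open>The nonlinearity in weighted frequency variables\<close>

definition deweight :: "real \<Rightarrow> 'a::euclidean_space L2 \<Rightarrow> 'a L2" where
  "deweight s g = mult_op (\<lambda>\<xi>. of_real (1 / japanese s \<xi>)) g"

lemma inverse_japanese_le_1: "0 \<le> s \<Longrightarrow> norm (complex_of_real (1 / japanese s \<xi>)) \<le> 1"
  using japanese_ge_1[of s \<xi>] by (simp add: norm_divide)

lemma rep_deweight:
  assumes "0 \<le> s"
  shows "AE \<xi> in lborel. rep_L2 (deweight s g) \<xi> = of_real (1 / japanese s \<xi>) * rep_L2 g \<xi>"
  unfolding deweight_def by (rule rep_mult_op[OF _ inverse_japanese_le_1[OF assms]]) measurable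

lemma bounded_linear_deweight: "0 \<le> s \<Longrightarrow> bounded_linear (deweight s)"
  unfolding deweight_def by (rule bounded_linear_mult_op[OF _ inverse_japanese_le_1]) measurable

lemma wnorm2_enorm:
  fixes f :: "'a::euclidean_space \<Rightarrow> complex"
  assumes "AE \<xi> in lborel. f \<xi> = of_real (1 / japanese s \<xi>) * rep_L2 g \<xi>"
  shows "wnorm2 s (enorm f) = ennreal ((norm g)\<^sup>2)"
proof -
  have "wnorm2 s (enorm f) = (\<integral>\<^sup>+x. ennreal ((norm (rep_L2 g x))\<^sup>2) \<partial>lborel)"
    unfolding wnorm2_def
  proof (rule nn_integral_cong_AE, use assms in eventually_elim)
    case (elim x)
    have "ennreal (japanese s x) * ennreal (norm (f x)) = ennreal (norm (rep_L2 g x))"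
      unfolding elim by (subst ennreal_mult[symmetric]) (auto simp: norm_mult norm_divide)
    then show ?case by (simp add: ennreal_power)
  qed
  then show ?thesis by (simp add: nn_norm_L2)
qed

lemma wnorm2_deweight: "0 \<le> s \<Longrightarrow> wnorm2 s (enorm (rep_L2 (deweight s g))) = ennreal ((norm g)\<^sup>2)"
  by (rule wnorm2_enorm) (rule rep_deweight)

lemma wnorm2_deweight_diff:
  assumes "0 \<le> s"
  shows "wnorm2 s (enorm (\<lambda>x. rep_L2 (deweight s g) x - rep_L2 (deweight s h) x)) = ennreal ((norm (g - h))\<^sup>2)"
proof (rule wnorm2_enorm)
  show "AE \<xi> in lborel. rep_L2 (deweight s g) \<xi> - rep_L2 (deweight s h) \<xi> = of_real (1 / japanese s \<xi>) * rep_L2 (g - h) \<xi>"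
    using rep_deweight[OF assms, of g] rep_deweight[OF assms, of h] rep_L2_diff[of g h]
    by eventually_elim (simp only: right_diff_distrib)
qed

text \<open>The Hartree nonlinearity conjugated by the isometry between H^s and L^2, so that its
  Sobolev estimates become statements about L^2 norms.\<close>

definition weighted_hartree :: "real \<Rightarrow> real \<Rightarrow> 'a::euclidean_space L2 \<Rightarrow> 'a L2" where
  "weighted_hartree lam s g = L2_class (\<lambda>\<xi>. of_real (japanese s \<xi>) * hartree_symbol lam (rep_L2 (deweight s g)) \<xi>)"

text \<open>The interface between the harmonic analysis and the evolution: from here on the
  nonlinearity is used through these facts alone.\<close>

lemma weighted_hartree_facts:
  assumes lam: "0 < lam" "lam < real DIM('a::euclidean_space)" and s: "lam / 2 \<le> s"
  obtains L where "L > 0"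
    and "\<And>g h :: 'a L2. norm (weighted_hartree lam s g - weighted_hartree lam s h) \<le> L * ((norm g)\<^sup>2 + (norm h)\<^sup>2) * norm (g - h)"
    and "weighted_hartree lam s (0 :: 'a L2) = 0"
    and "\<And>(u :: 'a L2) g. fourier u = deweight s g \<Longrightarrow> fourier (hartree lam u) = deweight s (weighted_hartree lam s g)"
proof -
  have s0: "0 \<le> s" using lam s by simp
  let ?n = "real DIM('a)"
  obtain M where M: "M > 0" "\<And>F G H :: 'a \<Rightarrow> ennreal. F \<in> borel_measurable borel \<Longrightarrow> G \<in> borel_measurable borel \<Longrightarrow> H \<in> borel_measurable borel \<Longrightarrow>
    wnorm2 s (hartree_kernel lam F G H) \<le> ennreal M * (wnorm2 s F * wnorm2 s G * wnorm2 s H)"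
   and hardy: "\<And>F G :: 'a \<Rightarrow> ennreal. F \<in> borel_measurable borel \<Longrightarrow> G \<in> borel_measurable borel \<Longrightarrow>
    (\<integral>\<^sup>+c. npow (lam - ?n) c * (\<integral>\<^sup>+a. F (a + c) * G a \<partial>lborel) \<partial>lborel)\<^sup>2 \<le> ennreal M * (wnorm2 s F * wnorm2 s G)"
    by (rule weighted_trilinear[OF lam s]) blast
  define K where "K = hartree_const TYPE('a) lam"
  have K: "K \<ge> 0" unfolding K_def by (rule hartree_const_nonneg)
  define f where "f g = rep_L2 (deweight s g)" for g :: "'a L2"
  have fm [measurable]: "f g \<in> borel_measurable borel" for g by (simp add: f_def)
  have em: "enorm (f g) \<in> borel_measurable borel" for g by measurable
  have fsq: "square_integrable (f g)" for g by (simp add: f_def)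
  have wf: "wnorm2 s (enorm (f g)) = ennreal ((norm g)\<^sup>2)" for g
    unfolding f_def by (rule wnorm2_deweight[OF s0])
  \<comment> \<open>Hardy's bound supplies the integrability condition under which the Hartree term
    has its frequency representation.\<close>
  have fin: "(\<integral>\<^sup>+\<eta>. ennreal (norm \<eta> powr (lam - ?n) * norm (autocorrelation (f g) \<eta>)) \<partial>lborel) < \<infinity>" for g
  proof -
    have "(\<integral>\<^sup>+\<eta>. ennreal (norm \<eta> powr (lam - ?n) * norm (autocorrelation (f g) \<eta>)) \<partial>lborel)
      \<le> (\<integral>\<^sup>+c. npow (lam - ?n) c * (\<integral>\<^sup>+a. enorm (f g) (a + c) * enorm (f g) a \<partial>lborel) \<partial>lborel)" (is "_ \<le> ?X")
    proof (rule nn_integral_mono)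
      fix \<eta> :: 'a
      have "npow (lam - ?n) \<eta> * ennreal (norm (autocorrelation (f g) \<eta>)) \<le> npow (lam - ?n) \<eta> * (\<integral>\<^sup>+a. enorm (f g) (a + \<eta>) * enorm (f g) a \<partial>lborel)"
        by (intro mult_left_mono norm_autocorrelation_le) simp
      then show "ennreal (norm \<eta> powr (lam - ?n) * norm (autocorrelation (f g) \<eta>)) \<le> npow (lam - ?n) \<eta> * (\<integral>\<^sup>+a. enorm (f g) (a + \<eta>) * enorm (f g) a \<partial>lborel)"
        by (simp add: npow_def ennreal_mult)
    qed
    also have "?X < \<infinity>"
    proof -
      have "?X\<^sup>2 \<le> ennreal M * (wnorm2 s (enorm (f g)) * wnorm2 s (enorm (f g)))" by (rule hardy) measurable
      also have "\<dots> < \<infinity>" by (simp add: wf ennreal_mult_less_top)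
      finally show ?thesis by (simp add: power_less_top_ennreal)
    qed
    finally show ?thesis .
  qed
  have dens: "integrable lborel (hartree_density lam (f g))" for g
    unfolding hartree_density_def
    by (intro integrable_mult_right integrableI_bounded) (use fin[of g] in \<open>auto simp: norm_mult\<close>)
  have sym_sq: "square_integrable (\<lambda>\<xi>. of_real (japanese s \<xi>) * hartree_symbol lam (f g) \<xi>)"
    and bound1: "norm (weighted_hartree lam s g) \<le> K * sqrt M * norm g ^ 3" for g
  proof -
    have *: "(\<integral>\<^sup>+\<xi>. ennreal ((norm (of_real (japanese s \<xi>) * hartree_symbol lam (f g) \<xi>))\<^sup>2) \<partial>lborel) \<le> ennreal ((K * sqrt M * norm g ^ 3)\<^sup>2)"
    proof -
      have "(\<integral>\<^sup>+\<xi>. ennreal ((norm (of_real (japanese s \<xi>) * hartree_symbol lam (f g) \<xi>))\<^sup>2) \<partial>lborel)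
        \<le> (\<integral>\<^sup>+\<xi>. ennreal (K\<^sup>2) * (ennreal (japanese s \<xi>) * hartree_kernel lam (enorm (f g)) (enorm (f g)) (enorm (f g)) \<xi>)\<^sup>2 \<partial>lborel)"
      proof (rule nn_integral_mono)
        fix \<xi> :: 'a
        have "ennreal (norm (of_real (japanese s \<xi>) * hartree_symbol lam (f g) \<xi>)) = ennreal (japanese s \<xi>) * enorm (hartree_symbol lam (f g)) \<xi>"
          by (simp add: norm_mult ennreal_mult less_imp_le)
        also have "\<dots> \<le> ennreal (japanese s \<xi>) * (ennreal K * hartree_kernel lam (enorm (f g)) (enorm (f g)) (enorm (f g)) \<xi>)"
          unfolding K_def by (intro mult_left_mono enorm_hartree_symbol_le) auto
        finally have "(ennreal (norm (of_real (japanese s \<xi>) * hartree_symbol lam (f g) \<xi>)))\<^sup>2 \<le> (ennreal (japanese s \<xi>) * (ennreal K * hartree_kernel lam (enorm (f g)) (enorm (f g)) (enorm (f g)) \<xi>))\<^sup>2"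
          by (rule power_mono) simp
        then show "ennreal ((norm (of_real (japanese s \<xi>) * hartree_symbol lam (f g) \<xi>))\<^sup>2) \<le> ennreal (K\<^sup>2) * (ennreal (japanese s \<xi>) * hartree_kernel lam (enorm (f g)) (enorm (f g)) (enorm (f g)) \<xi>)\<^sup>2"
          using K by (simp add: ennreal_power[symmetric] power_mult_distrib mult_ac)
      qed
      also have "\<dots> = ennreal (K\<^sup>2) * wnorm2 s (hartree_kernel lam (enorm (f g)) (enorm (f g)) (enorm (f g)))"
        unfolding wnorm2_def by (rule nn_integral_cmult) measurable
      also have "\<dots> \<le> ennreal (K\<^sup>2) * (ennreal M * (wnorm2 s (enorm (f g)) * wnorm2 s (enorm (f g)) * wnorm2 s (enorm (f g))))"
        by (intro mult_left_mono M(2) em) simp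
      also have "\<dots> = ennreal (K\<^sup>2 * (M * ((norm g)\<^sup>2 * (norm g)\<^sup>2 * (norm g)\<^sup>2)))"
        using M(1) by (simp add: wf ennreal_mult[symmetric])
      also have "K\<^sup>2 * (M * ((norm g)\<^sup>2 * (norm g)\<^sup>2 * (norm g)\<^sup>2)) = (K * sqrt M * norm g ^ 3)\<^sup>2"
        using M(1) by (simp add: power_mult_distrib power2_eq_square power3_eq_cube)
      finally show ?thesis .
    qed
    have m: "(\<lambda>\<xi>. of_real (japanese s \<xi>) * hartree_symbol lam (f g) \<xi>) \<in> borel_measurable borel" by measurable
    have p: "0 \<le> K * sqrt M * norm g ^ 3" using K M(1) by simp
    show "square_integrable (\<lambda>\<xi>. of_real (japanese s \<xi>) * hartree_symbol lam (f g) \<xi>)"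
      and "norm (weighted_hartree lam s g) \<le> K * sqrt M * norm g ^ 3"
      using norm_L2_class_le[OF m * p] by (simp_all add: weighted_hartree_def f_def)
  qed
  \<comment> \<open>With x and y the squared norms of g and h, the estimate to be reached is
    \<open>4 * M * K\<^sup>2 * (x\<^sup>2 + x * y + y\<^sup>2) \<le> L\<^sup>2 * (x +
    y)\<^sup>2\<close>. Adding 1 to \<open>K\<close> keeps \<open>L\<close> positive.\<close>
  define L where "L = 2 * (K + 1) * sqrt M"
  show thesis
  proof (rule that)
    show "L > 0" using K M(1) by (simp add: L_def)
    show "weighted_hartree lam s (0 :: 'a L2) = 0" using bound1[of 0] by simp
    show "fourier (hartree lam u) = deweight s (weighted_hartree lam s g)" if u: "fourier u = deweight s g" for u :: "'a L2" and g
    proof -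
      have fu: "rep_L2 (fourier u) = f g" by (simp add: u f_def)
      have "fourier (hartree lam u) = L2_class (\<lambda>\<xi>. \<integral>\<eta>. hartree_density lam (f g) \<eta> * f g (\<xi> - \<eta>) \<partial>lborel)"
        using fourier_hartree(2)[OF lam, of u] fin[of g] unfolding fu by simp
      also have "\<dots> = L2_class (\<lambda>\<xi>. of_real (1 / japanese s \<xi>) * (of_real (japanese s \<xi>) * hartree_symbol lam (f g) \<xi>))"
      proof -
        have "japanese s \<xi> \<noteq> 0" for \<xi> :: 'a using japanese_pos[of s \<xi>] by linarith
        then show ?thesis by (simp add: hartree_symbol_def)
      qed
      also have "\<dots> = deweight s (weighted_hartree lam s g)"
        unfolding weighted_hartree_def f_def[symmetric] unfolding deweight_def
        by (rule mult_op_L2_class[symmetric, OF _ sym_sq]) measurable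
      finally show ?thesis .
    qed
    fix g h :: "'a L2"
    define d where "d = (\<lambda>x. f g x - f h x)"
    have [measurable]: "d \<in> borel_measurable borel" unfolding d_def by measurable
    have emd: "enorm d \<in> borel_measurable borel" by measurable
    have wd: "wnorm2 s (enorm d) = ennreal ((norm (g - h))\<^sup>2)"
      unfolding d_def f_def by (rule wnorm2_deweight_diff[OF s0])
    let ?K1 = "hartree_kernel lam (enorm d) (enorm (f g)) (enorm (f g))"
    let ?K2 = "hartree_kernel lam (enorm (f h)) (enorm d) (enorm (f g))"
    let ?K3 = "hartree_kernel lam (enorm (f h)) (enorm (f h)) (enorm d)"
    let ?\<Delta> = "\<lambda>\<xi>. of_real (japanese s \<xi>) * hartree_symbol lam (f g) \<xi> - of_real (japanese s \<xi>) * hartree_symbol lam (f h) \<xi>"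
    have "(\<integral>\<^sup>+\<xi>. ennreal ((norm (?\<Delta> \<xi>))\<^sup>2) \<partial>lborel)
      \<le> (\<integral>\<^sup>+\<xi>. ennreal (K\<^sup>2 * 4) * ((ennreal (japanese s \<xi>) * ?K1 \<xi>)\<^sup>2 + (ennreal (japanese s \<xi>) * ?K2 \<xi>)\<^sup>2 + (ennreal (japanese s \<xi>) * ?K3 \<xi>)\<^sup>2) \<partial>lborel)"
    proof (rule nn_integral_mono_AE, use AE_enorm_hartree_symbol_diff_le[OF fsq[of g] dens[of g] fsq[of h] dens[of h]] in eventually_elim)
      case (elim \<xi>)
      then have le: "ennreal (norm (hartree_symbol lam (f g) \<xi> - hartree_symbol lam (f h) \<xi>)) \<le> ennreal K * (?K1 \<xi> + ?K2 \<xi> + ?K3 \<xi>)"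
        by (simp only: K_def d_def)
      have "ennreal (norm (?\<Delta> \<xi>)) = ennreal (japanese s \<xi>) * ennreal (norm (hartree_symbol lam (f g) \<xi> - hartree_symbol lam (f h) \<xi>))"
        by (simp add: right_diff_distrib[symmetric] norm_mult ennreal_mult less_imp_le)
      also have "\<dots> \<le> ennreal (japanese s \<xi>) * (ennreal K * (?K1 \<xi> + ?K2 \<xi> + ?K3 \<xi>))"
        by (intro mult_left_mono le) simp
      also have "\<dots> = ennreal K * (ennreal (japanese s \<xi>) * ?K1 \<xi> + ennreal (japanese s \<xi>) * ?K2 \<xi> + ennreal (japanese s \<xi>) * ?K3 \<xi>)"
        by (simp only: distrib_left mult_ac)
      finally have "(ennreal (norm (?\<Delta> \<xi>)))\<^sup>2 \<le> (ennreal K * (ennreal (japanese s \<xi>) * ?K1 \<xi> + ennreal (japanese s \<xi>) * ?K2 \<xi> + ennreal (japanese s \<xi>) * ?K3 \<xi>))\<^sup>2"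
        by (rule power_mono) simp
      also have "\<dots> = ennreal (K\<^sup>2) * (ennreal (japanese s \<xi>) * ?K1 \<xi> + ennreal (japanese s \<xi>) * ?K2 \<xi> + ennreal (japanese s \<xi>) * ?K3 \<xi>)\<^sup>2"
        using K by (simp add: power_mult_distrib ennreal_power)
      also have "\<dots> \<le> ennreal (K\<^sup>2) * (4 * ((ennreal (japanese s \<xi>) * ?K1 \<xi>)\<^sup>2 + (ennreal (japanese s \<xi>) * ?K2 \<xi>)\<^sup>2 + (ennreal (japanese s \<xi>) * ?K3 \<xi>)\<^sup>2))"
        by (intro mult_left_mono ennreal_sum3_power2_le) simp
      finally show ?case by (simp add: ennreal_power ennreal_mult mult.assoc)
    qed
    also have "\<dots> = ennreal (K\<^sup>2 * 4) * (wnorm2 s ?K1 + wnorm2 s ?K2 + wnorm2 s ?K3)"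
      unfolding wnorm2_def by (simp add: nn_integral_cmult nn_integral_add)
    also have "\<dots> \<le> ennreal (K\<^sup>2 * 4) * (ennreal M * (wnorm2 s (enorm d) * wnorm2 s (enorm (f g)) * wnorm2 s (enorm (f g)))
      + ennreal M * (wnorm2 s (enorm (f h)) * wnorm2 s (enorm d) * wnorm2 s (enorm (f g)))
      + ennreal M * (wnorm2 s (enorm (f h)) * wnorm2 s (enorm (f h)) * wnorm2 s (enorm d)))"
      by (intro mult_left_mono add_mono M(2) em emd) simp
    also have "\<dots> = ennreal (K\<^sup>2 * 4 * (M * ((norm (g - h))\<^sup>2 * (norm g)\<^sup>2 * (norm g)\<^sup>2) + M * ((norm h)\<^sup>2 * (norm (g - h))\<^sup>2 * (norm g)\<^sup>2) + M * ((norm h)\<^sup>2 * (norm h)\<^sup>2 * (norm (g - h))\<^sup>2)))"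
      using M(1) by (simp add: wf wd ennreal_mult[symmetric] ennreal_plus[symmetric] del: ennreal_plus)
    also have "\<dots> \<le> ennreal ((L * ((norm g)\<^sup>2 + (norm h)\<^sup>2) * norm (g - h))\<^sup>2)"
    proof (rule ennreal_leI)
      define x y z where "x = (norm g)\<^sup>2" "y = (norm h)\<^sup>2" "z = (norm (g - h))\<^sup>2"
      have xyz: "x \<ge> 0" "y \<ge> 0" "z \<ge> 0" by (auto simp: x_y_z_def)
      have "K\<^sup>2 * 4 * (M * (z * x * x) + M * (y * z * x) + M * (y * y * z)) = (4 * M) * z * (K\<^sup>2 * (x * x + y * x + y * y))"
        by (simp add: algebra_simps)
      also have "\<dots> \<le> (4 * M) * z * ((K + 1)\<^sup>2 * (x + y)\<^sup>2)"
        using K M(1) xyz by (intro mult_left_mono mult_mono power_mono) (auto simp: power2_eq_square algebra_simps)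
      also have "\<dots> = (L * (x + y) * norm (g - h))\<^sup>2"
      proof -
        have "L\<^sup>2 = 4 * (K + 1)\<^sup>2 * M" unfolding L_def power_mult_distrib using M(1) by simp
        then show ?thesis unfolding power_mult_distrib x_y_z_def(3) by (simp only: mult_ac)
      qed
      finally show "K\<^sup>2 * 4 * (M * ((norm (g - h))\<^sup>2 * (norm g)\<^sup>2 * (norm g)\<^sup>2) + M * ((norm h)\<^sup>2 * (norm (g - h))\<^sup>2 * (norm g)\<^sup>2) + M * ((norm h)\<^sup>2 * (norm h)\<^sup>2 * (norm (g - h))\<^sup>2))
        \<le> (L * ((norm g)\<^sup>2 + (norm h)\<^sup>2) * norm (g - h))\<^sup>2"
        unfolding x_y_z_def .
    qed
    finally have le: "(\<integral>\<^sup>+\<xi>. ennreal ((norm (?\<Delta> \<xi>))\<^sup>2) \<partial>lborel) \<le> ennreal ((L * ((norm g)\<^sup>2 + (norm h)\<^sup>2) * norm (g - h))\<^sup>2)" .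
    have "?\<Delta> \<in> borel_measurable borel" by measurable
    moreover have "0 \<le> L * ((norm g)\<^sup>2 + (norm h)\<^sup>2) * norm (g - h)" using \<open>L > 0\<close> by simp
    ultimately have "norm (L2_class ?\<Delta>) \<le> L * ((norm g)\<^sup>2 + (norm h)\<^sup>2) * norm (g - h)"
      using le by (intro norm_L2_class_le(2))
    then show "norm (weighted_hartree lam s g - weighted_hartree lam s h) \<le> L * ((norm g)\<^sup>2 + (norm h)\<^sup>2) * norm (g - h)"
      using L2_class_diff[OF sym_sq[of g] sym_sq[of h]] by (simp add: weighted_hartree_def f_def)
  qed
qed

subsection \<open>Integral equations with a locally Lipschitz field\<close>

text \<open>Damping by \<open>exp (- k * (t - a))\<close> turns the integral inequality into a
  contraction of the maximum: where \<open>E\<close> is maximal,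
  \<open>E m \<le> L / k * E m\<close>, and \<open>k = 2 * L + 1\<close> makes the factor smaller
  than 1/2.\<close>

lemma gronwall_zero_forward:
  fixes D :: "real \<Rightarrow> real"
  assumes cont: "continuous_on {a..b} D" and nn: "\<And>t. t \<in> {a..b} \<Longrightarrow> 0 \<le> D t"
    and le: "\<And>t. t \<in> {a..b} \<Longrightarrow> D t \<le> L * integral {a..t} D" and L: "L \<ge> 0" and t: "t \<in> {a..b}"
  shows "D t = 0"
proof -
  define k where "k = 2 * L + 1"
  have k: "k > 0" using L by (simp add: k_def)
  define E where "E t = exp (- k * (t - a)) * D t" for t
  have "continuous_on {a..b} E" unfolding E_def by (intro continuous_intros cont)
  then obtain m where m: "m \<in> {a..b}" "\<And>t. t \<in> {a..b} \<Longrightarrow> E t \<le> E m"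
    using continuous_attains_sup[OF compact_Icc, of a b E] t by fastforce
  have E0: "0 \<le> E t" if "t \<in> {a..b}" for t using nn[OF that] by (simp add: E_def)
  have DE: "D t = exp (k * (t - a)) * E t" for t by (simp add: E_def mult.assoc[symmetric] mult_exp_exp)
  have hi: "((\<lambda>t. exp (k * (t - a)) * E m) has_integral (exp (k * (m - a)) / k * E m - exp (k * (a - a)) / k * E m)) {a..m}"
    using m(1) k
    by (intro fundamental_theorem_of_calculus) (auto intro!: derivative_eq_intros simp: has_real_derivative_iff_has_vector_derivative[symmetric])
  have "D m \<le> L * integral {a..m} D" by (rule le[OF m(1)])
  also have "\<dots> \<le> L * integral {a..m} (\<lambda>t. exp (k * (t - a)) * E m)"
  proof (intro mult_left_mono integral_le L)
    show "D integrable_on {a..m}" by (rule integrable_continuous_interval) (use m(1) in \<open>auto intro: continuous_on_subset[OF cont]\<close>)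
    show "(\<lambda>t. exp (k * (t - a)) * E m) integrable_on {a..m}" using hi by blast
    show "D t \<le> exp (k * (t - a)) * E m" if "t \<in> {a..m}" for t
      unfolding DE[of t] using m that by (intro mult_left_mono) auto
  qed
  also have "\<dots> = L * ((exp (k * (m - a)) - 1) / k * E m)"
    using integral_unique[OF hi] by (simp add: diff_divide_distrib left_diff_distrib)
  also have "\<dots> \<le> L * (exp (k * (m - a)) / k * E m)"
    using E0[OF m(1)] k L by (intro mult_left_mono mult_right_mono divide_right_mono) auto
  finally have "exp (k * (m - a)) * E m \<le> exp (k * (m - a)) * (L / k * E m)" unfolding DE[of m] by (simp add: mult_ac)
  then have "E m \<le> L / k * E m" by (simp only: mult_le_cancel_left_pos exp_gt_zero)
  moreover have "L / k * E m \<le> 1 / 2 * E m" using E0[OF m(1)] k L by (intro mult_right_mono) (auto simp: k_def field_simps)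
  ultimately have "E m = 0" using E0[OF m(1)] by linarith
  then have "E t = 0" using m(2)[OF t] E0[OF t] by simp
  then show ?thesis by (simp add: DE)
qed

lemma gronwall_zero_backward:
  fixes D :: "real \<Rightarrow> real"
  assumes cont: "continuous_on {a..b} D" and nn: "\<And>t. t \<in> {a..b} \<Longrightarrow> 0 \<le> D t"
    and le: "\<And>t. t \<in> {a..b} \<Longrightarrow> D t \<le> L * integral {t..b} D" and L: "L \<ge> 0" and t: "t \<in> {a..b}"
  shows "D t = 0"
proof -
  have "(\<lambda>r. D (- r)) (- t) = 0"
  proof (rule gronwall_zero_forward[of "- b" "- a" "\<lambda>r. D (- r)" L "- t"])
    show "continuous_on {- b..- a} (\<lambda>r. D (- r))"
      by (rule continuous_on_compose2[OF cont]) (auto intro!: continuous_intros)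
    show "D (- r) \<le> L * integral {- b..r} (\<lambda>r. D (- r))" if "r \<in> {- b..- a}" for r
      using le[of "- r"] that Henstock_Kurzweil_Integration.integral_reflect_real[of b "- r" D] by simp
  qed (use nn L t in auto)
  then show ?thesis by simp
qed

text \<open>The abstract form of the equation in the interaction picture. Continuity is demanded
  along continuous curves, which is what strong continuity of the flow provides; the Lipschitz bound
  is that of a cubic field.\<close>

locale lipschitz_field =
  fixes \<Phi> :: "real \<Rightarrow> 'e::banach \<Rightarrow> 'e" and L :: real
  assumes L: "L > 0"
    and cont: "\<And>S h. continuous_on S h \<Longrightarrow> continuous_on S (\<lambda>t. \<Phi> t (h t))"
    and lip: "\<And>t x y. norm (\<Phi> t x - \<Phi> t y) \<le> L * ((norm x)\<^sup>2 + (norm y)\<^sup>2) * norm (x - y)"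
    and zero: "\<And>t. \<Phi> t 0 = 0"
begin

text \<open>Both solutions are continuous on a compact interval, hence bounded, and on bounded sets
  the field is Lipschitz with a constant \<open>K\<close> that may depend on the pair. Neither a
  small interval nor an a priori ball is involved, so uniqueness covers the whole class.\<close>

lemma integral_equation_unique:
  assumes h: "continuous_on {a..b} h" "\<And>t. t \<in> {a..b} \<Longrightarrow> has_oriented_integral (\<lambda>\<tau>. \<Phi> \<tau> (h \<tau>)) (h t - h0) t0 t"
    and k: "continuous_on {a..b} k" "\<And>t. t \<in> {a..b} \<Longrightarrow> has_oriented_integral (\<lambda>\<tau>. \<Phi> \<tau> (k \<tau>)) (k t - h0) t0 t"
    and t0: "t0 \<in> {a..b}" and t: "t \<in> {a..b}"
  shows "h t = k t"
proof -
  define D where "D t = norm (h t - k t)" for t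
  have Dc: "continuous_on {a..b} D" unfolding D_def by (intro continuous_intros h k)
  have "\<exists>R. \<forall>t\<in>{a..b}. norm (h t) \<le> R"
    using compact_imp_bounded[OF compact_continuous_image[OF h(1) compact_Icc]] by (auto simp: bounded_iff)
  then obtain R1 where R1: "\<And>t. t \<in> {a..b} \<Longrightarrow> norm (h t) \<le> R1" by blast
  have "\<exists>R. \<forall>t\<in>{a..b}. norm (k t) \<le> R"
    using compact_imp_bounded[OF compact_continuous_image[OF k(1) compact_Icc]] by (auto simp: bounded_iff)
  then obtain R2 where R2: "\<And>t. t \<in> {a..b} \<Longrightarrow> norm (k t) \<le> R2" by blast
  define K where "K = L * (R1\<^sup>2 + R2\<^sup>2)"
  have K: "K \<ge> 0" using L by (simp add: K_def)
  have lipD: "norm (\<Phi> t (h t) - \<Phi> t (k t)) \<le> K * D t" if "t \<in> {a..b}" for t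
  proof -
    have "L * ((norm (h t))\<^sup>2 + (norm (k t))\<^sup>2) \<le> K"
      unfolding K_def using L R1[OF that] R2[OF that] by (intro mult_left_mono add_mono power_mono) auto
    then have "L * ((norm (h t))\<^sup>2 + (norm (k t))\<^sup>2) * norm (h t - k t) \<le> K * D t" unfolding D_def by (rule mult_right_mono) simp
    then show ?thesis using lip[of t "h t" "k t"] by linarith
  qed
  have bound: "norm J \<le> K * integral {c..d} D"
    if J: "((\<lambda>\<tau>. \<Phi> \<tau> (h \<tau>) - \<Phi> \<tau> (k \<tau>)) has_integral J) {c..d}" and cd: "{c..d} \<subseteq> {a..b}" for J c d
  proof -
    have iD: "D integrable_on {c..d}" by (rule integrable_continuous_interval[OF continuous_on_subset[OF Dc cd]])
    have "norm J \<le> integral {c..d} (\<lambda>t. K * D t)"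
      unfolding integral_unique[OF J, symmetric]
      by (rule integral_norm_bound_integral) (use J iD lipD cd in \<open>auto intro!: integrable_on_mult_right\<close>)
    then show ?thesis by simp
  qed
  show ?thesis
  proof (cases "t0 \<le> t")
    case True
    have "D t = 0"
    proof (rule gronwall_zero_forward[of t0 b D K])
      show "continuous_on {t0..b} D" using t0 by (intro continuous_on_subset[OF Dc]) auto
      show "D r \<le> K * integral {t0..r} D" if r: "r \<in> {t0..b}" for r
      proof -
        have "((\<lambda>\<tau>. \<Phi> \<tau> (h \<tau>) - \<Phi> \<tau> (k \<tau>)) has_integral ((h r - h0) - (k r - h0))) {t0..r}"
          using h(2)[of r] k(2)[of r] r t0 by (intro has_integral_diff) (auto simp: has_oriented_integral_def)
        from bound[OF this] show ?thesis using r t0 by (auto simp: D_def)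
      qed
    qed (use True t K in \<open>auto simp: D_def\<close>)
    then show ?thesis by (simp add: D_def)
  next
    case False
    have "D t = 0"
    proof (rule gronwall_zero_backward[of a t0 D K])
      show "continuous_on {a..t0} D" using t0 by (intro continuous_on_subset[OF Dc]) auto
      show "D r \<le> K * integral {r..t0} D" if r: "r \<in> {a..t0}" for r
      proof (cases "r = t0")
        case True
        \<comment> \<open>At \<open>r = t0\<close> the oriented integral takes its first branch, an
          integral over a single point, so both curves start at \<open>h0\<close>.\<close>
        have "((\<lambda>\<tau>. \<Phi> \<tau> (h \<tau>)) has_integral (h t0 - h0)) {t0}" "((\<lambda>\<tau>. \<Phi> \<tau> (k \<tau>)) has_integral (k t0 - h0)) {t0}"
          using h(2)[OF t0] k(2)[OF t0] by (simp_all add: has_oriented_integral_def)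
        from this[THEN has_integral_unique, OF has_integral_refl(2)]
        have "h t0 - h0 = 0" "k t0 - h0 = 0" .
        then show ?thesis using True by (simp add: D_def)
      next
        case False
        have "((\<lambda>\<tau>. \<Phi> \<tau> (h \<tau>) - \<Phi> \<tau> (k \<tau>)) has_integral (- (h r - h0) - - (k r - h0))) {r..t0}"
          using h(2)[of r] k(2)[of r] r t0 False by (intro has_integral_diff) (auto simp: has_oriented_integral_def)
        from bound[OF this] show ?thesis using r t0 by (auto simp: D_def norm_minus_commute)
      qed
    qed (use False t K in \<open>auto simp: D_def\<close>)
    then show ?thesis by (simp add: D_def)
  qed
qed

text \<open>Contraction on the ball of radius \<open>2 * norm h0\<close>. There the Lipschitz
  constant is \<open>8 * L * (norm h0)\<^sup>2\<close>, and its product with \<delta> has to be at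
  most 1/2; hence the 16.\<close>

lemma integral_equation_exists:
  fixes h0 :: 'e and t0 \<delta> :: real
  assumes \<delta>: "\<delta> > 0" "16 * L * (norm h0)\<^sup>2 * \<delta> \<le> 1"
  obtains h where "continuous_on {t0 - \<delta>..t0 + \<delta>} h" "\<And>t. norm (h t) \<le> 2 * norm h0"
    "\<And>t. t \<in> {t0 - \<delta>..t0 + \<delta>} \<Longrightarrow> has_oriented_integral (\<lambda>\<tau>. \<Phi> \<tau> (h \<tau>)) (h t - h0) t0 t"
proof -
  let ?a = "t0 - \<delta>" and ?b = "t0 + \<delta>"
  let ?M = "norm h0"
  \<comment> \<open>Clamping the time to the interval extends the integral operator to curves on the
    whole line, where bounded continuous functions form a complete space.\<close>
  define cl where "cl t = max ?a (min t ?b)" for t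
  have cl: "cl t \<in> {?a..?b}" for t using \<delta>(1) by (auto simp: cl_def)
  have cl_id: "cl t = t" if "t \<in> {?a..?b}" for t using that by (auto simp: cl_def)
  have clc: "continuous_on UNIV cl" unfolding cl_def by (intro continuous_intros)
  \<comment> \<open>The oriented integral from \<open>t0\<close> as a difference of integrals from
    the left end, which gives continuity in t on both sides of \<open>t0\<close> at once.\<close>
  define P where "P f t = integral {?a..t} f - integral {?a..t0} f" for f :: "real \<Rightarrow> 'e" and t
  have Por: "has_oriented_integral f (P f t) t0 t" if f: "continuous_on {?a..?b} f" and t: "t \<in> {?a..?b}" for f t
  proof -
    have i: "f integrable_on {c..d}" if "?a \<le> c" "d \<le> ?b" for c d
      using that by (intro integrable_continuous_interval continuous_on_subset[OF f]) auto
    show ?thesis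
    proof (cases "t0 \<le> t")
      case True
      have "integral {?a..t0} f + integral {t0..t} f = integral {?a..t} f"
        by (rule Henstock_Kurzweil_Integration.integral_combine) (use True t \<delta> i in auto)
      then have "P f t = integral {t0..t} f" by (simp add: P_def algebra_simps)
      moreover have "(f has_integral integral {t0..t} f) {t0..t}" using i[of t0 t] t \<delta> by (intro integrable_integral) auto
      ultimately show ?thesis using True by (simp add: has_oriented_integral_def)
    next
      case False
      have "integral {?a..t} f + integral {t..t0} f = integral {?a..t0} f"
        by (rule Henstock_Kurzweil_Integration.integral_combine) (use False t \<delta> i in auto)
      then have "- P f t = integral {t..t0} f" by (simp add: P_def algebra_simps)
      moreover have "(f has_integral integral {t..t0} f) {t..t0}" using i[of t t0] t \<delta> by (intro integrable_integral) auto
      ultimately show ?thesis using False by (simp add: has_oriented_integral_def)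
    qed
  qed
  have Pc: "continuous_on {?a..?b} (P f)" if f: "continuous_on {?a..?b} f" for f
    unfolding P_def by (intro continuous_intros indefinite_integral_continuous_1 integrable_continuous_interval f)
  have oi_bound: "norm J \<le> B * \<delta>"
    if J: "has_oriented_integral f J t0 t" and t: "t \<in> {?a..?b}" and B: "B \<ge> 0" "\<And>\<tau>. \<tau> \<in> {?a..?b} \<Longrightarrow> norm (f \<tau>) \<le> B" for f J t B
  proof (cases "t0 \<le> t")
    case True
    then have "(f has_integral J) {t0..t}" using J by (simp add: has_oriented_integral_def)
    from has_integral_bound_real[OF B(1), of "{}", OF _ this] have "norm J \<le> B * (t - t0)"
      using True t \<delta> B(2) by (auto simp: measure_def)
    also have "\<dots> \<le> B * \<delta>" using t B by (intro mult_left_mono) auto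
    finally show ?thesis .
  next
    case False
    then have "(f has_integral - J) {t..t0}" using J by (simp add: has_oriented_integral_def)
    from has_integral_bound_real[OF B(1), of "{}", OF _ this] have "norm (- J) \<le> B * (t0 - t)"
      using False t \<delta> B(2) by (auto simp: measure_def)
    also have "\<dots> \<le> B * \<delta>" using t B by (intro mult_left_mono) auto
    finally show ?thesis by simp
  qed
  have oi_diff: "has_oriented_integral (\<lambda>\<tau>. f \<tau> - g \<tau>) (J - J') t0 t"
    if "has_oriented_integral f J t0 t" "has_oriented_integral g J' t0 t" for f g :: "real \<Rightarrow> 'e" and J J' t
  proof (cases "t0 \<le> t")
    case False
    then have "((\<lambda>\<tau>. f \<tau> - g \<tau>) has_integral (- J - - J')) {t..t0}"
      using that by (intro has_integral_diff) (auto simp: has_oriented_integral_def)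
    then show ?thesis using False by (simp add: has_oriented_integral_def)
  qed (use that in \<open>auto simp: has_oriented_integral_def intro: has_integral_diff\<close>)
  define T where "T h t = h0 + P (\<lambda>\<tau>. \<Phi> \<tau> (h \<tau>)) (cl t)" for h :: "real \<Rightarrow> 'e" and t
  have Tc: "continuous_on UNIV (T h)" if "continuous_on UNIV h" for h
    unfolding T_def
    by (intro continuous_intros continuous_on_compose2[OF Pc[OF cont[OF continuous_on_subset[OF that]]] clc]) (use cl in auto)
  have Tdiff: "norm (T h t - T k t) \<le> 1 / 2 * C"
    if h: "continuous_on UNIV h" "\<And>t. norm (h t) \<le> 2 * ?M" and k: "continuous_on UNIV k" "\<And>t. norm (k t) \<le> 2 * ?M"
      and C: "\<And>t. norm (h t - k t) \<le> C" for h k t C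
  proof -
    have C0: "0 \<le> C" using C[of 0] norm_ge_zero order_trans by blast
    have "norm (P (\<lambda>\<tau>. \<Phi> \<tau> (h \<tau>)) (cl t) - P (\<lambda>\<tau>. \<Phi> \<tau> (k \<tau>)) (cl t)) \<le> (8 * L * ?M\<^sup>2 * C) * \<delta>"
    proof (rule oi_bound[OF oi_diff[OF Por Por]])
      show "continuous_on {?a..?b} (\<lambda>\<tau>. \<Phi> \<tau> (h \<tau>))" "continuous_on {?a..?b} (\<lambda>\<tau>. \<Phi> \<tau> (k \<tau>))"
        using h(1) k(1) by (auto intro!: cont intro: continuous_on_subset)
      fix \<tau>
      have "norm (\<Phi> \<tau> (h \<tau>) - \<Phi> \<tau> (k \<tau>)) \<le> L * ((norm (h \<tau>))\<^sup>2 + (norm (k \<tau>))\<^sup>2) * norm (h \<tau> - k \<tau>)" by (rule lip)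
      also have "\<dots> \<le> L * ((2 * ?M)\<^sup>2 + (2 * ?M)\<^sup>2) * C"
        using L by (intro mult_mono mult_left_mono add_mono power_mono h k C) auto
      finally show "norm (\<Phi> \<tau> (h \<tau>) - \<Phi> \<tau> (k \<tau>)) \<le> 8 * L * ?M\<^sup>2 * C" by (simp add: power_mult_distrib)
    qed (use cl C0 L in auto)
    also have "\<dots> = 1 / 2 * (16 * L * ?M\<^sup>2 * \<delta>) * C" by simp
    also have "\<dots> \<le> 1 / 2 * 1 * C" using \<delta>(2) C0 by (intro mult_right_mono mult_left_mono) auto
    finally show ?thesis by (simp add: T_def)
  qed
  \<comment> \<open>The zero curve is mapped to the constant \<open>h0\<close>; comparing with it
    bounds the distance of \<open>T h\<close> from \<open>h0\<close> and keeps the ball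
    invariant.\<close>
  have T0: "T (\<lambda>_. 0) t = h0" for t by (simp add: T_def P_def zero)
  have Tb: "norm (T h t) \<le> 2 * ?M" if h: "continuous_on UNIV h" "\<And>t. norm (h t) \<le> 2 * ?M" for h t
  proof -
    have "norm (T h t - T (\<lambda>_. 0) t) \<le> 1 / 2 * (2 * ?M)" by (rule Tdiff) (use h in auto)
    then have "norm (T h t - h0) \<le> ?M" by (simp add: T0)
    then show ?thesis using norm_triangle_sub[of "T h t" h0] by simp
  qed
  \<comment> \<open>\<open>Bcontfun\<close> is meaningful only on bounded continuous functions, so
    \<open>F\<close> is evaluated on the invariant ball alone.\<close>
  define F where "F h = Bcontfun (T (apply_bcontfun h))" for h
  let ?S = "cball (0 :: real \<Rightarrow>\<^sub>C 'e) (2 * ?M)"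
  have Sb: "norm (apply_bcontfun h t) \<le> 2 * ?M" if "h \<in> ?S" for h t
    using that norm_bounded[of h t] by (simp add: dist_norm)
  have ac: "continuous_on UNIV (apply_bcontfun h)" for h :: "real \<Rightarrow>\<^sub>C 'e" by simp
  have Fa: "apply_bcontfun (F h) = T (apply_bcontfun h)" if "h \<in> ?S" for h
    unfolding F_def
  proof (rule Bcontfun_inverse)
    show "T (apply_bcontfun h) \<in> bcontfun"
      by (rule bcontfun_normI[where b = "2 * ?M"]) (use Tc[OF ac] Tb[OF ac Sb[OF that]] in auto)
  qed
  have "\<exists>!h\<in>?S. F h = h"
  proof (rule Banach_fix[OF complete_eq_closed[THEN iffD2, OF closed_cball], where c = "1/2"])
    show "?S \<noteq> {}" by (auto intro: exI[of _ 0])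
    show "F ` ?S \<subseteq> ?S"
    proof safe
      fix h assume h: "h \<in> ?S"
      have "norm (F h) \<le> 2 * ?M"
        by (rule norm_bound) (simp add: Fa[OF h] Tb[OF ac Sb[OF h]])
      then show "F h \<in> ?S" by (simp add: dist_norm)
    qed
    fix h k assume h: "h \<in> ?S" and k: "k \<in> ?S"
    have "norm (F h - F k) \<le> 1 / 2 * norm (h - k)"
    proof (rule norm_bound)
      fix t
      have "norm (T (apply_bcontfun h) t - T (apply_bcontfun k) t) \<le> 1 / 2 * norm (h - k)"
        by (rule Tdiff[OF ac Sb[OF h] ac Sb[OF k]]) (use norm_bounded[of "h - k"] in simp)
      then show "norm (apply_bcontfun (F h - F k) t) \<le> 1 / 2 * norm (h - k)" by (simp add: Fa[OF h] Fa[OF k])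
    qed
    then show "dist (F h) (F k) \<le> 1 / 2 * dist h k" by (simp add: dist_norm)
  qed auto
  then obtain hh where hh: "hh \<in> ?S" "F hh = hh" by blast
  define h where "h = apply_bcontfun hh"
  have fix_h: "h t = T h t" for t using Fa[OF hh(1)] hh(2) by (simp add: h_def)
  show thesis
  proof (rule that[of h])
    show hc: "continuous_on {?a..?b} h" unfolding h_def by (rule continuous_on_subset[OF ac]) simp
    show "norm (h t) \<le> 2 * ?M" for t unfolding h_def by (rule Sb[OF hh(1)])
    fix t assume t: "t \<in> {?a..?b}"
    have "h t - h0 = P (\<lambda>\<tau>. \<Phi> \<tau> (h \<tau>)) t" using fix_h[of t] by (simp add: T_def cl_id[OF t])
    then show "has_oriented_integral (\<lambda>\<tau>. \<Phi> \<tau> (h \<tau>)) (h t - h0) t0 t"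
      using Por[OF cont[OF hc] t] by simp
  qed
qed

end

subsection \<open>The free flow and Duhamel's formula\<close>

lemma has_oriented_integral_linear:
  "has_oriented_integral f J a b \<Longrightarrow> bounded_linear S \<Longrightarrow> has_oriented_integral (\<lambda>t. S (f t)) (S J) a b"
  using has_integral_linear[of f J "{a..b}" S] has_integral_linear[of f "- J" "{b..a}" S]
  by (auto simp: has_oriented_integral_def o_def linear_neg bounded_linear.linear)

lemma has_oriented_integral_unique:
  "has_oriented_integral f J a b \<Longrightarrow> has_oriented_integral f J' a b \<Longrightarrow> J = J'"
  by (auto simp: has_oriented_integral_def dest: has_integral_unique split: if_splits)

lemma has_oriented_integral_cong:
  assumes "\<And>t. t \<in> {c..d} \<Longrightarrow> f t = g t" "a \<in> {c..d}" "b \<in> {c..d}"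
  shows "has_oriented_integral f J a b \<longleftrightarrow> has_oriented_integral g J a b"
  unfolding has_oriented_integral_def using assms
  by (auto intro!: has_integral_cong[THEN arg_cong] has_integral_cong)

lemma has_oriented_integral_exists:
  fixes f :: "real \<Rightarrow> 'b::banach"
  assumes "continuous_on {c..d} f" "a \<in> {c..d}" "b \<in> {c..d}"
  obtains J where "has_oriented_integral f J a b"
proof (cases "a \<le> b")
  case True
  have "f integrable_on {a..b}" by (rule integrable_continuous_interval) (use assms in \<open>auto intro: continuous_on_subset\<close>)
  then show thesis using that True by (auto simp: has_oriented_integral_def integrable_on_def)
next
  case False
  have "f integrable_on {b..a}" by (rule integrable_continuous_interval) (use assms in \<open>auto intro: continuous_on_subset\<close>)
  then obtain K where "(f has_integral - (- K)) {b..a}" by (auto simp: integrable_on_def)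
  then show thesis using that[of "- K"] False by (simp add: has_oriented_integral_def)
qed

text \<open>The value at t depends on whether some translate of t by a multiple of \<open>T\<close>
  lies in the interval (0, tp], a countable union of intervals. Measurability and the bound are all
  that the evolution retains of the coefficients.\<close>

lemma periodic_step_function:
  fixes f :: "real \<Rightarrow> real"
  assumes T: "T > 0" and tp: "0 < tp" "tp < T"
    and pos: "\<And>t. 0 < t \<Longrightarrow> t \<le> tp \<Longrightarrow> f t = p" and neg: "\<And>t. tp - T < t \<Longrightarrow> t \<le> 0 \<Longrightarrow> f t = - q"
    and per: "\<And>t. f (t + T) = f t"
  shows "f \<in> borel_measurable borel" "\<bar>f t\<bar> \<le> \<bar>p\<bar> + \<bar>q\<bar>"
proof -
  have pern: "f (t + real n * T) = f t" for t n
  proof (induction n)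
    case (Suc n)
    have "f (t + real (Suc n) * T) = f ((t + real n * T) + T)" by (simp add: algebra_simps)
    then show ?case using per Suc by simp
  qed simp
  have peri: "f (t - of_int k * T) = f t" for t and k :: int
  proof (cases "k \<ge> 0")
    case True
    then show ?thesis using pern[of "t - of_int k * T" "nat k"] by simp
  next
    case False
    then show ?thesis using pern[of t "nat (- k)"] by simp
  qed
  have eq: "f t = (if \<exists>k::int. 0 < t - of_int k * T \<and> t - of_int k * T \<le> tp then p else - q)" for t
  proof (cases "\<exists>k::int. 0 < t - of_int k * T \<and> t - of_int k * T \<le> tp")
    case True
    then obtain k :: int where "0 < t - of_int k * T" "t - of_int k * T \<le> tp" by blast
    then show ?thesis using pos[of "t - of_int k * T"] peri[of t k] True by auto
  next
    case False
    \<comment> \<open>This k moves t into the period from \<open>tp - T\<close> (excluded) to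
      \<open>tp\<close> (included).\<close>
    define k where "k = \<lceil>(t - tp) / T\<rceil>"
    have "(t - tp) / T \<le> of_int k" "of_int k < (t - tp) / T + 1" unfolding k_def by linarith+
    then have "t - of_int k * T \<le> tp" "tp - T < t - of_int k * T" using T by (simp_all add: field_simps)
    moreover from this False have "t - of_int k * T \<le> 0" by force
    ultimately show ?thesis using neg[of "t - of_int k * T"] peri[of t k] False by auto
  qed
  show "f \<in> borel_measurable borel" by (subst eq[abs_def]) measurable
  show "\<bar>f t\<bar> \<le> \<bar>p\<bar> + \<bar>q\<bar>" by (subst eq) auto
qed

lemma interval_integral_bounded:
  fixes f :: "real \<Rightarrow> real"
  assumes [measurable]: "f \<in> borel_measurable borel" and B: "\<And>t. \<bar>f t\<bar> \<le> B"
  shows "(LBINT \<tau>=ereal a..ereal b. f \<tau>) + (LBINT \<tau>=ereal b..ereal c. f \<tau>) = (LBINT \<tau>=ereal a..ereal c. f \<tau>)"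
    and "\<bar>LBINT \<tau>=ereal a..ereal b. f \<tau>\<bar> \<le> B * \<bar>b - a\<bar>"
proof -
  have int: "set_integrable lborel S f" if S: "S \<in> sets borel" "S \<subseteq> {x..y}" for S x y
    unfolding set_integrable_def
  proof (rule Bochner_Integration.integrable_bound)
    show "integrable lborel (\<lambda>t. B * indicator {x..y} t)"
      by (intro integrable_mult_right integrable_real_indicator) (auto simp: emeasure_lborel_Icc_eq)
    show "AE t in lborel. norm (indicator S t *\<^sub>R f t) \<le> norm (B * indicator {x..y} t)"
      using B S(2) by (intro AE_I2) (auto simp: indicator_def intro: order_trans[OF B abs_ge_self])
  qed (use S in measurable)
  have ii: "interval_lebesgue_integrable lborel (ereal x) (ereal y) f" for x y
    unfolding interval_lebesgue_integrable_def by (auto intro!: int[of _ "min x y" "max x y"])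
  have mm: "min (ereal a) (min (ereal b) (ereal c)) = ereal (min a (min b c))" "max (ereal a) (max (ereal b) (ereal c)) = ereal (max a (max b c))"
    by (simp_all add: min_def max_def)
  show "(LBINT \<tau>=ereal a..ereal b. f \<tau>) + (LBINT \<tau>=ereal b..ereal c. f \<tau>) = (LBINT \<tau>=ereal a..ereal c. f \<tau>)"
    by (rule interval_integral_sum) (unfold mm, rule ii)
  have le: "\<bar>LBINT \<tau>=ereal x..ereal y. f \<tau>\<bar> \<le> B * \<bar>y - x\<bar>" if xy: "x \<le> y" for x y
  proof -
    have i: "set_integrable lborel {x..y} f" by (rule int[of _ x y]) auto
    have "(f has_integral integral {x..y} f) {x..y}"
      using set_borel_integral_eq_integral(1)[OF i] by (rule integrable_integral)
    from has_integral_bound_real[of B "{}", OF _ _ this] have "norm (integral {x..y} f) \<le> B * measure lborel {x..y}"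
      using B order_trans[OF abs_ge_zero B] by auto
    then show ?thesis using interval_integral_eq_integral[OF xy i] xy by simp
  qed
  show "\<bar>LBINT \<tau>=ereal a..ereal b. f \<tau>\<bar> \<le> B * \<bar>b - a\<bar>"
  proof (cases "a \<le> b")
    case True then show ?thesis by (rule le)
  next
    case False
    then show ?thesis using le[of b a] by (subst interval_integral_endpoints_reverse) (simp add: abs_minus_commute)
  qed
qed

text \<open>Symbols that converge only pointwise give no convergence in operator norm. The change of
  \<open>g\<close> is absorbed by unimodularity, and on the fixed function \<open>g a\<close>
  dominated convergence applies with majorant \<open>4 * (norm (r \<xi>))\<^sup>2\<close>.\<close>

lemma mult_op_strongly_continuous:
  fixes m :: "real \<Rightarrow> 'a::euclidean_space \<Rightarrow> complex"
  assumes meas [measurable]: "\<And>t. m t \<in> borel_measurable borel" and uni: "\<And>t \<xi>. norm (m t \<xi>) = 1"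
    and cont: "\<And>\<xi>. continuous_on UNIV (\<lambda>t. m t \<xi>)" and g: "continuous_on S g"
  shows "continuous_on S (\<lambda>t. mult_op (m t) (g t))"
  unfolding continuous_on_sequentially
proof (intro allI ballI impI)
  fix x :: "nat \<Rightarrow> real" and a assume a: "a \<in> S" and x: "(\<forall>n. x n \<in> S) \<and> x \<longlonglongrightarrow> a"
  have gx: "(\<lambda>n. g (x n)) \<longlonglongrightarrow> g a"
    using g a x unfolding continuous_on_sequentially by (auto simp: o_def)
  define r where "r = rep_L2 (g a)"
  have [measurable]: "r \<in> borel_measurable borel" by (simp add: r_def)
  have sqr: "square_integrable r" by (simp add: r_def)
  have "(\<lambda>n. \<integral>\<xi>. (norm (m (x n) \<xi> * r \<xi> - m a \<xi> * r \<xi>))\<^sup>2 \<partial>lborel) \<longlonglongrightarrow> (\<integral>\<xi>. 0 \<partial>(lborel :: 'a measure))"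
  proof (rule integral_dominated_convergence)
    show "integrable lborel (\<lambda>\<xi>. 4 * (norm (r \<xi>))\<^sup>2)" using sqr by (simp add: square_integrable_def)
    show "AE \<xi> in lborel. norm ((norm (m (x n) \<xi> * r \<xi> - m a \<xi> * r \<xi>))\<^sup>2) \<le> 4 * (norm (r \<xi>))\<^sup>2" for n
    proof (rule AE_I2)
      fix \<xi>
      have "norm (m (x n) \<xi> * r \<xi> - m a \<xi> * r \<xi>) \<le> 2 * norm (r \<xi>)"
        using norm_triangle_ineq4[of "m (x n) \<xi> * r \<xi>" "m a \<xi> * r \<xi>"] by (simp add: norm_mult uni)
      then have "(norm (m (x n) \<xi> * r \<xi> - m a \<xi> * r \<xi>))\<^sup>2 \<le> (2 * norm (r \<xi>))\<^sup>2" by (rule power_mono) simp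
      then show "norm ((norm (m (x n) \<xi> * r \<xi> - m a \<xi> * r \<xi>))\<^sup>2) \<le> 4 * (norm (r \<xi>))\<^sup>2" by (simp add: power_mult_distrib)
    qed
    show "AE \<xi> in lborel. (\<lambda>n. (norm (m (x n) \<xi> * r \<xi> - m a \<xi> * r \<xi>))\<^sup>2) \<longlonglongrightarrow> 0"
    proof (rule AE_I2)
      fix \<xi>
      have "(\<lambda>n. m (x n) \<xi>) \<longlonglongrightarrow> m a \<xi>"
        using cont[of \<xi>] x unfolding continuous_on_sequentially by (auto simp: o_def)
      then have "(\<lambda>n. (norm (m (x n) \<xi> * r \<xi> - m a \<xi> * r \<xi>))\<^sup>2) \<longlonglongrightarrow> (norm (m a \<xi> * r \<xi> - m a \<xi> * r \<xi>))\<^sup>2"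
        by (intro tendsto_intros)
      then show "(\<lambda>n. (norm (m (x n) \<xi> * r \<xi> - m a \<xi> * r \<xi>))\<^sup>2) \<longlonglongrightarrow> 0" by simp
    qed
  qed measurable
  then have "(\<lambda>n. sqrt (\<integral>\<xi>. (norm (m (x n) \<xi> * r \<xi> - m a \<xi> * r \<xi>))\<^sup>2 \<partial>lborel)) \<longlonglongrightarrow> sqrt 0"
    by (intro tendsto_real_sqrt) simp
  moreover have "norm (mult_op (m (x n)) (g a) - mult_op (m a) (g a)) = sqrt (\<integral>\<xi>. (norm (m (x n) \<xi> * r \<xi> - m a \<xi> * r \<xi>))\<^sup>2 \<partial>lborel)" for n
  proof -
    have s: "square_integrable (\<lambda>\<xi>. m t \<xi> * r \<xi>)" for t by (rule square_integrable_mult[OF meas, of _ 1]) (simp_all add: uni sqr)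
    show ?thesis unfolding mult_op_def r_def[symmetric] L2_class_diff[OF s s]
      by (rule norm_L2_class) (rule square_integrable_diff[OF s s])
  qed
  ultimately have 2: "(\<lambda>n. norm (mult_op (m (x n)) (g a) - mult_op (m a) (g a))) \<longlonglongrightarrow> 0" by simp
  have 1: "(\<lambda>n. norm (g (x n) - g a)) \<longlonglongrightarrow> 0" using gx by (simp add: tendsto_norm_zero_iff LIM_zero_iff)
  have bl: "bounded_linear (mult_op (m t))" for t by (rule bounded_linear_mult_op[of _ 1]) (simp_all add: uni)
  have "norm (mult_op (m (x n)) (g (x n)) - mult_op (m a) (g a)) \<le> norm (g (x n) - g a) + norm (mult_op (m (x n)) (g a) - mult_op (m a) (g a))" for n
  proof -
    have decomp: "mult_op (m (x n)) (g (x n)) - mult_op (m a) (g a) = mult_op (m (x n)) (g (x n) - g a) + (mult_op (m (x n)) (g a) - mult_op (m a) (g a))"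
      by (simp add: linear_diff[OF bounded_linear.linear[OF bl]])
    show ?thesis
      unfolding decomp
      using norm_triangle_ineq[of "mult_op (m (x n)) (g (x n) - g a)" "mult_op (m (x n)) (g a) - mult_op (m a) (g a)"]
      by (simp only: norm_mult_op_unimodular[OF meas uni])
  qed
  note le = this
  have lim0: "(\<lambda>n. norm (g (x n) - g a) + norm (mult_op (m (x n)) (g a) - mult_op (m a) (g a))) \<longlonglongrightarrow> 0"
    using tendsto_add[OF 1 2] by (simp only: add_0_left)
  have "(\<lambda>n. mult_op (m (x n)) (g (x n)) - mult_op (m a) (g a)) \<longlonglongrightarrow> 0"
    by (rule Lim_null_comparison[OF always_eventually lim0]) (rule allI, rule le)
  then show "((\<lambda>t. mult_op (m t) (g t)) \<circ> x) \<longlonglongrightarrow> mult_op (m a) (g a)"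
    by (simp add: o_def LIM_zero_iff)
qed

section \<open>Isometric identification of H^s with L^2\<close>

definition sobolev_lift :: "real \<Rightarrow> 'a::euclidean_space L2 \<Rightarrow> 'a L2" where
  "sobolev_lift s g = inv_fourier (deweight s g)"

lemma fourier_sobolev_lift: "fourier (sobolev_lift s g) = deweight s g"
  by (simp add: sobolev_lift_def)

lemma bounded_linear_sobolev_lift: "0 \<le> s \<Longrightarrow> bounded_linear (sobolev_lift s)"
  unfolding sobolev_lift_def[abs_def] inv_fourier_eq
  by (rule bounded_linear_compose[OF bounded_linear_fourier_L2 bounded_linear_deweight]) simp_all

lemma bessel_weight_eq: "bessel_weight s u \<xi> = of_real (japanese s \<xi>) * rep_L2 (fourier u) \<xi>"
  by (simp add: bessel_weight_def japanese_def)

lemma bessel_weight_sobolev_lift: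
  assumes "0 \<le> s"
  shows "square_integrable (bessel_weight s (sobolev_lift s g))" "L2_class (bessel_weight s (sobolev_lift s g)) = g"
proof -
  have [measurable]: "bessel_weight s (sobolev_lift s g) \<in> borel_measurable borel"
    unfolding bessel_weight_eq by measurable
  have ae: "AE \<xi> in lborel. bessel_weight s (sobolev_lift s g) \<xi> = rep_L2 g \<xi>"
    using rep_deweight[OF assms, of g]
    by eventually_elim (simp add: bessel_weight_eq fourier_sobolev_lift)
  show "square_integrable (bessel_weight s (sobolev_lift s g))"
    by (rule square_integrable_bound[of "rep_L2 g" _ 1]) (use ae in \<open>auto elim!: eventually_mono\<close>)
  show "L2_class (bessel_weight s (sobolev_lift s g)) = g"
    using L2_class_cong_AE[OF _ _ ae] by simp
qed

lemma sobolev_lift_surj: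
  assumes "0 \<le> s" "u \<in> sobolev_space s"
  shows "sobolev_lift s (L2_class (bessel_weight s u)) = u"
proof -
  have sq: "square_integrable (bessel_weight s u)" using assms by (simp add: sobolev_space_def)
  have "deweight s (L2_class (bessel_weight s u)) = L2_class (\<lambda>\<xi>. of_real (1 / japanese s \<xi>) * bessel_weight s u \<xi>)"
    unfolding deweight_def by (rule mult_op_L2_class[OF _ sq]) measurable
  also have "\<dots> = fourier u" by (simp add: bessel_weight_eq)
  finally show ?thesis by (simp add: sobolev_lift_def)
qed

lemma sobolev_lift_facts:
  assumes "0 \<le> s"
  shows "sobolev_lift s g \<in> sobolev_space s" "sobolev_norm s (sobolev_lift s g) = norm g" "inj (sobolev_lift s)"
    "sobolev_norm s (sobolev_lift s g - sobolev_lift s h) = norm (g - h)"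
proof -
  show "sobolev_lift s g \<in> sobolev_space s" and n: "sobolev_norm s (sobolev_lift s g) = norm g" for g
    using bessel_weight_sobolev_lift[OF assms, of g] by (simp_all add: sobolev_space_def sobolev_norm_def)
  show "inj (sobolev_lift s)" by (rule injI) (metis bessel_weight_sobolev_lift(2)[OF assms])
  show "sobolev_norm s (sobolev_lift s g - sobolev_lift s h) = norm (g - h)"
    using n[of "g - h"] linear_diff[OF bounded_linear.linear[OF bounded_linear_sobolev_lift[OF assms]], of g h] by simp
qed

text \<open>The lift is isometric, so convergence in the Sobolev norm is convergence of the
  preimages in L^2.\<close>

lemma C_sobolev_lift_iff:
  assumes s: "0 \<le> s" and u: "\<And>t. t \<in> I \<Longrightarrow> u t = sobolev_lift s (g t)"
  shows "u \<in> C_sobolev I s \<longleftrightarrow> continuous_on I g"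
proof -
  have "((\<lambda>r. sobolev_norm s (u r - u t)) \<longlongrightarrow> 0) (at t within I) \<longleftrightarrow> (g \<longlongrightarrow> g t) (at t within I)" if t: "t \<in> I" for t
  proof -
    have "((\<lambda>r. sobolev_norm s (u r - u t)) \<longlongrightarrow> 0) (at t within I) \<longleftrightarrow> ((\<lambda>r. norm (g r - g t)) \<longlongrightarrow> 0) (at t within I)"
      by (rule tendsto_cong) (auto simp: eventually_at_filter u t sobolev_lift_facts(4)[OF s])
    then show ?thesis by (simp add: tendsto_norm_zero_iff LIM_zero_iff)
  qed
  then show ?thesis
    using u by (auto simp: C_sobolev_def continuous_on_def sobolev_lift_facts(1)[OF s])
qed

text \<open>Multiplication operators commute, so a Fourier multiplier passes through the Sobolev
  weight.\<close>

lemma multiplier_sobolev_lift: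
  assumes "0 \<le> s" and [measurable]: "m \<in> borel_measurable borel" and m: "\<And>\<xi>. norm (m \<xi>) \<le> 1"
  shows "multiplier m (sobolev_lift s g) = sobolev_lift s (mult_op m g)"
proof -
  have "mult_op m (deweight s g) = deweight s (mult_op m g)"
    unfolding deweight_def
    by (subst (1 2) mult_op_mult_op[where B = 1]) (auto simp: m inverse_japanese_le_1[OF assms(1), simplified] mult.commute norm_divide japanese_ge_1[OF assms(1)])
  then show ?thesis
    by (simp add: multiplier_def mult_op_def[symmetric] fourier_sobolev_lift) (simp add: sobolev_lift_def)
qed

section \<open>The interaction picture and the Cauchy problem\<close>

locale hartree_flow =
  fixes \<alpha> \<beta> :: "real \<Rightarrow> real" and B :: real and lam s L \<theta> t0 :: real and ty :: "'a::euclidean_space itself"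
  assumes meas_\<alpha>: "\<alpha> \<in> borel_measurable borel" and meas_\<beta>: "\<beta> \<in> borel_measurable borel"
    and bound_\<alpha>: "\<And>t. \<bar>\<alpha> t\<bar> \<le> B" and bound_\<beta>: "\<And>t. \<bar>\<beta> t\<bar> \<le> B"
    and s: "0 \<le> s" and \<theta>: "\<theta> \<noteq> 0" and L: "L > 0"
    and lip: "\<And>g h :: 'a L2. norm (weighted_hartree lam s g - weighted_hartree lam s h) \<le> L * ((norm g)\<^sup>2 + (norm h)\<^sup>2) * norm (g - h)"
    and zero: "weighted_hartree lam s (0 :: 'a L2) = 0"
    and link: "\<And>(u :: 'a L2) g. fourier u = deweight s g \<Longrightarrow> fourier (hartree lam u) = deweight s (weighted_hartree lam s g)"
begin

abbreviation J :: "'a L2 \<Rightarrow> 'a L2" where "J \<equiv> sobolev_lift s"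

text \<open>The phase of the propagator from \<open>t0\<close> to t. Measuring from
  \<open>t0\<close> makes the flow the identity there, and the propagator between two arbitrary
  times becomes a difference of phases.\<close>

definition phase :: "real \<Rightarrow> 'a \<Rightarrow> real" where
  "phase t \<xi> = (norm \<xi>) ^ 4 * (LBINT \<tau>=ereal t0..ereal t. \<beta> \<tau>) - (norm \<xi>)\<^sup>2 * (LBINT \<tau>=ereal t0..ereal t. \<alpha> \<tau>)"

definition flow :: "real \<Rightarrow> 'a L2 \<Rightarrow> 'a L2" where "flow t = mult_op (\<lambda>\<xi>. cis (phase t \<xi>))"

definition backflow :: "real \<Rightarrow> 'a L2 \<Rightarrow> 'a L2" where "backflow t = mult_op (\<lambda>\<xi>. cis (- phase t \<xi>))"

text \<open>Interaction picture: pulled back along the free flow, Duhamel's formula becomes an integral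
  equation without propagator, whose right-hand side is \<open>force\<close> up to the factor \<open>\<i>\<theta>\<close>.\<close>

definition force :: "real \<Rightarrow> 'a L2 \<Rightarrow> 'a L2" where
  "force t x = backflow t (weighted_hartree lam s (flow t x))"

lemma measurable_phase [measurable]: "phase t \<in> borel_measurable borel"
  unfolding phase_def by measurable

text \<open>The integral of a bounded function is Lipschitz in its end point, so jumps of the
  coefficients leave no trace in the phase.\<close>

lemma continuous_phase: "continuous_on UNIV (\<lambda>t. phase t \<xi>)"
proof -
  have "continuous_on UNIV (\<lambda>t. LBINT \<tau>=ereal t0..ereal t. f \<tau>)"
    if f: "f \<in> borel_measurable borel" "\<And>t. \<bar>f t\<bar> \<le> B" for f :: "real \<Rightarrow> real"
  proof (rule continuous_onI)
    fix t e :: real assume e: "e > 0"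
    have B: "B \<ge> 0" using f(2)[of 0] by linarith
    show "\<exists>d>0. \<forall>t'\<in>UNIV. dist t' t < d \<longrightarrow> dist (LBINT \<tau>=ereal t0..ereal t'. f \<tau>) (LBINT \<tau>=ereal t0..ereal t. f \<tau>) \<le> e"
    proof (intro exI conjI ballI impI)
      show "e / (B + 1) > 0" using e B by simp
      fix t' assume d: "dist t' t < e / (B + 1)"
      have "dist (LBINT \<tau>=ereal t0..ereal t'. f \<tau>) (LBINT \<tau>=ereal t0..ereal t. f \<tau>) = \<bar>LBINT \<tau>=ereal t..ereal t'. f \<tau>\<bar>"
        unfolding dist_real_def interval_integral_bounded(1)[OF f, of t0 t t', symmetric] by simp
      also have "\<dots> \<le> B * \<bar>t' - t\<bar>" by (rule interval_integral_bounded(2)[OF f])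
      also have "\<dots> \<le> (B + 1) * (e / (B + 1))" using d B by (intro mult_mono) (auto simp: dist_real_def)
      finally show "dist (LBINT \<tau>=ereal t0..ereal t'. f \<tau>) (LBINT \<tau>=ereal t0..ereal t. f \<tau>) \<le> e" using B by simp
    qed
  qed
  from this[OF meas_\<alpha> bound_\<alpha>] this[OF meas_\<beta> bound_\<beta>] show ?thesis
    unfolding phase_def by (intro continuous_intros)
qed

lemma bounded_linear_flow: "bounded_linear (flow t)"
  unfolding flow_def by (rule bounded_linear_mult_op[of _ 1]) auto

lemma norm_flow [simp]: "norm (flow t x) = norm x" and norm_backflow [simp]: "norm (backflow t x) = norm x"
  unfolding flow_def backflow_def by (auto intro!: norm_mult_op_unimodular)

lemma flow_backflow [simp]: "flow t (backflow t x) = x" and backflow_flow [simp]: "backflow t (flow t x) = x"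
  unfolding flow_def backflow_def by (subst mult_op_mult_op[where B = 1]; simp add: cis_mult)+

lemma flow_t0 [simp]: "flow t0 x = x" and backflow_t0 [simp]: "backflow t0 x = x"
  unfolding flow_def backflow_def phase_def by simp_all

lemma continuous_flow: "continuous_on S g \<Longrightarrow> continuous_on S (\<lambda>t. flow t (g t))"
  and continuous_backflow: "continuous_on S g \<Longrightarrow> continuous_on S (\<lambda>t. backflow t (g t))"
  unfolding flow_def backflow_def
  by (rule mult_op_strongly_continuous; auto intro!: continuous_on_compose2[of UNIV cis] continuous_intros continuous_phase)+

lemma continuous_weighted_hartree:
  fixes g :: "'t::topological_space \<Rightarrow> 'a L2"
  assumes "continuous_on S g"
  shows "continuous_on S (\<lambda>t. weighted_hartree lam s (g t))"
proof -
  have "continuous_on UNIV (weighted_hartree lam s :: 'a L2 \<Rightarrow> 'a L2)"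
    unfolding continuous_on_def
  proof (intro ballI)
    fix x :: "'a L2"
    have "((\<lambda>y. L * ((norm y)\<^sup>2 + (norm x)\<^sup>2) * norm (y - x)) \<longlongrightarrow> L * ((norm x)\<^sup>2 + (norm x)\<^sup>2) * norm (x - x)) (at x)"
      by (intro tendsto_intros)
    then have lim0: "((\<lambda>y. L * ((norm y)\<^sup>2 + (norm x)\<^sup>2) * norm (y - x)) \<longlongrightarrow> 0) (at x)" by simp
    have "((\<lambda>y. weighted_hartree lam s y - weighted_hartree lam s x) \<longlongrightarrow> 0) (at x)"
      by (rule Lim_null_comparison[OF always_eventually lim0]) (rule allI, rule lip)
    then show "(weighted_hartree lam s \<longlongrightarrow> weighted_hartree lam s x) (at x within UNIV)" by (simp add: LIM_zero_iff)
  qed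
  from continuous_on_compose2[OF this assms] show ?thesis by simp
qed

lemma continuous_force: "continuous_on S h \<Longrightarrow> continuous_on S (\<lambda>t. force t (h t))"
  unfolding force_def by (intro continuous_backflow continuous_weighted_hartree continuous_flow)

abbreviation c :: complex where "c \<equiv> \<i> * of_real \<theta>"

lemma norm_scaleC_le: "norm (k *\<^sub>C x) \<le> norm k * norm (x :: 'a L2)"
  unfolding scaleC_eq_mult_op by (rule norm_mult_op_le) auto

text \<open>The flow is linear and isometric, so conjugation by it preserves the Lipschitz constant
  of the nonlinearity; the coupling contributes the factor |\<theta>|.\<close>

sublocale lipschitz_field "\<lambda>t x. c *\<^sub>C force t x" "L * \<bar>\<theta>\<bar>"
proof
  show "L * \<bar>\<theta>\<bar> > 0" using L \<theta> by simp
  show "continuous_on S (\<lambda>t. c *\<^sub>C force t (h t))" if "continuous_on S h" for S h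
    by (rule bounded_linear.continuous_on[OF bounded_linear_scaleC continuous_force[OF that]])
  have bd: "linear (backflow t)" for t
    unfolding backflow_def by (rule bounded_linear.linear, rule bounded_linear_mult_op[of _ 1]) auto
  show "norm (c *\<^sub>C force t x - c *\<^sub>C force t y) \<le> L * \<bar>\<theta>\<bar> * ((norm x)\<^sup>2 + (norm y)\<^sup>2) * norm (x - y)" for t x y
  proof -
    have "c *\<^sub>C force t x - c *\<^sub>C force t y = c *\<^sub>C backflow t (weighted_hartree lam s (flow t x) - weighted_hartree lam s (flow t y))"
      by (simp add: force_def linear_diff[OF bd] linear_diff[OF bounded_linear.linear[OF bounded_linear_scaleC]])
    then have "norm (c *\<^sub>C force t x - c *\<^sub>C force t y) \<le> \<bar>\<theta>\<bar> * norm (weighted_hartree lam s (flow t x) - weighted_hartree lam s (flow t y))"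
      using norm_scaleC_le[of c "backflow t (weighted_hartree lam s (flow t x) - weighted_hartree lam s (flow t y))"] by (simp add: norm_mult)
    also have "\<dots> \<le> \<bar>\<theta>\<bar> * (L * ((norm (flow t x))\<^sup>2 + (norm (flow t y))\<^sup>2) * norm (flow t x - flow t y))"
      by (intro mult_left_mono lip) simp
    also have "flow t x - flow t y = flow t (x - y)" by (simp add: linear_diff[OF bounded_linear.linear[OF bounded_linear_flow]])
    finally show ?thesis by (simp add: mult_ac)
  qed
  show "c *\<^sub>C force t 0 = 0" for t
    by (simp add: force_def zero linear_0[OF bd] linear_0[OF bounded_linear.linear[OF bounded_linear_flow]] linear_0[OF bounded_linear.linear[OF bounded_linear_scaleC]])
qed

text \<open>Cocycle property: the propagator from r to t is the backward flow from r followed by the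
  flow to t, because the integrals of the coefficients from r to t are differences of integrals from
  \<open>t0\<close>.\<close>

lemma propagator_lift: "propagator \<alpha> \<beta> t r (J g) = J (flow t (backflow r g))"
proof -
  let ?A = "LBINT \<tau>=ereal r..ereal t. \<alpha> \<tau>" and ?B = "LBINT \<tau>=ereal r..ereal t. \<beta> \<tau>"
  have A: "?A = (LBINT \<tau>=ereal t0..ereal t. \<alpha> \<tau>) - (LBINT \<tau>=ereal t0..ereal r. \<alpha> \<tau>)"
    using interval_integral_bounded(1)[OF meas_\<alpha> bound_\<alpha>, of t0 r t] by linarith
  have B: "?B = (LBINT \<tau>=ereal t0..ereal t. \<beta> \<tau>) - (LBINT \<tau>=ereal t0..ereal r. \<beta> \<tau>)"
    using interval_integral_bounded(1)[OF meas_\<beta> bound_\<beta>, of t0 r t] by linarith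
  have p: "phase t \<xi> - phase r \<xi> = (norm \<xi>) ^ 4 * ?B - (norm \<xi>)\<^sup>2 * ?A" for \<xi> :: 'a
    unfolding phase_def A B by (simp add: right_diff_distrib)
  have e: "exp (- \<i> * of_real ((norm \<xi>)\<^sup>2 * ?A) + \<i> * of_real ((norm \<xi>) ^ 4 * ?B)) = cis (phase t \<xi> - phase r \<xi>)" for \<xi> :: 'a
  proof -
    have "- \<i> * of_real x + \<i> * of_real y = \<i> * of_real (y - x)" for x y by (simp add: right_diff_distrib)
    then show ?thesis unfolding cis_conv_exp p by (rule arg_cong)
  qed
  have "propagator \<alpha> \<beta> t r (J g) = multiplier (\<lambda>\<xi>. cis (phase t \<xi> - phase r \<xi>)) (J g)"
    unfolding propagator_def Let_def e ..
  also have "\<dots> = J (mult_op (\<lambda>\<xi>. cis (phase t \<xi> - phase r \<xi>)) g)"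
    by (rule multiplier_sobolev_lift[OF s]) auto
  also have "mult_op (\<lambda>\<xi>. cis (phase t \<xi> - phase r \<xi>)) g = flow t (backflow r g)"
    unfolding flow_def backflow_def by (subst mult_op_mult_op[where B = 1]) (auto simp: cis_mult)
  finally show ?thesis .
qed

lemma hartree_lift: "hartree lam (J g) = J (weighted_hartree lam s g)"
  using link[OF fourier_sobolev_lift[of s g]] by (metis sobolev_lift_def inv_fourier_fourier)

lemma scaleC_flow: "k *\<^sub>C flow t x = flow t (k *\<^sub>C x)" and scaleC_lift: "k *\<^sub>C J x = J (k *\<^sub>C x)"
proof -
  show "k *\<^sub>C flow t x = flow t (k *\<^sub>C x)"
    unfolding flow_def scaleC_eq_mult_op
    by (subst mult_op_mult_op[where B = 1], simp_all, subst mult_op_mult_op[where B = "norm k"]) (simp_all add: mult.commute)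
  have "k *\<^sub>C deweight s x = deweight s (k *\<^sub>C x)"
    unfolding deweight_def scaleC_eq_mult_op
    by (subst mult_op_mult_op[where B = 1], simp, simp, rule inverse_japanese_le_1[OF s], subst mult_op_mult_op[where B = "norm k"]) (simp_all add: mult.commute)
  then show "k *\<^sub>C J x = J (k *\<^sub>C x)"
    unfolding sobolev_lift_def inv_fourier_eq by (metis fourier_L2_scaleC mult_1)
qed

text \<open>The composition of \<open>J\<close> with \<open>flow t\<close> is bounded, linear and
  injective, so it leaves the integral and can be cancelled. Both directions are used: the fixed
  point has to be a mild solution, and an arbitrary mild solution has to be brought into the form
  that Gronwall covers.\<close>

lemma duhamel_iff:
  assumes I: "t0 \<in> {a..b}" and u: "\<And>t. t \<in> {a..b} \<Longrightarrow> u t = J (g t)" and g: "continuous_on {a..b} g"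
  shows "mild_solution \<alpha> \<beta> lam \<theta> t0 (J g0) {a..b} u \<longleftrightarrow>
    (\<forall>t\<in>{a..b}. has_oriented_integral (\<lambda>\<tau>. c *\<^sub>C force \<tau> (backflow \<tau> (g \<tau>))) (backflow t (g t) - g0) t0 t)"
proof -
  define X where "X \<tau> = force \<tau> (backflow \<tau> (g \<tau>))" for \<tau>
  have Xc: "continuous_on {a..b} X" unfolding X_def by (intro continuous_force continuous_backflow g)
  have bl: "bounded_linear (\<lambda>x. J (flow t x))" for t
    by (rule bounded_linear_compose[OF bounded_linear_sobolev_lift[OF s] bounded_linear_flow])
  have lin: "J (flow t x) + J (flow t y) = J (flow t (x + y))" for t x y
    using linear_add[OF bounded_linear.linear[OF bl]] by metis
  have integrand: "propagator \<alpha> \<beta> t \<tau> (hartree lam (u \<tau>)) = J (flow t (X \<tau>))" if "\<tau> \<in> {a..b}" for t \<tau>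
    by (simp add: u[OF that] hartree_lift propagator_lift X_def force_def)
  have inj: "J (flow t x) = J (flow t y) \<longleftrightarrow> x = y" for t x y
    using injD[OF sobolev_lift_facts(3)[OF s]] backflow_flow by metis
  have "(\<exists>Y. has_oriented_integral (\<lambda>\<tau>. propagator \<alpha> \<beta> t \<tau> (hartree lam (u \<tau>))) Y t0 t \<and> u t = propagator \<alpha> \<beta> t t0 (J g0) + c *\<^sub>C Y)
    \<longleftrightarrow> has_oriented_integral (\<lambda>\<tau>. c *\<^sub>C X \<tau>) (backflow t (g t) - g0) t0 t" if t: "t \<in> {a..b}" for t
  proof -
    \<comment> \<open>Continuity makes the integral exist; uniqueness of its value then replaces the
      quantified \<open>Y\<close> by the explicit \<open>J (flow t K)\<close>.\<close>
    obtain K where K: "has_oriented_integral X K t0 t" using has_oriented_integral_exists[OF Xc I t] .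
    have "has_oriented_integral (\<lambda>\<tau>. propagator \<alpha> \<beta> t \<tau> (hartree lam (u \<tau>))) Y t0 t \<longleftrightarrow> has_oriented_integral (\<lambda>\<tau>. J (flow t (X \<tau>))) Y t0 t" for Y
      by (rule has_oriented_integral_cong[OF _ I t]) (rule integrand)
    then have int: "has_oriented_integral (\<lambda>\<tau>. propagator \<alpha> \<beta> t \<tau> (hartree lam (u \<tau>))) Y t0 t \<longleftrightarrow> Y = J (flow t K)" for Y
      using has_oriented_integral_linear[OF K bl, of t] has_oriented_integral_unique by blast
    have "u t = propagator \<alpha> \<beta> t t0 (J g0) + c *\<^sub>C J (flow t K) \<longleftrightarrow> J (flow t (backflow t (g t))) = J (flow t (g0 + c *\<^sub>C K))"
      by (simp add: u[OF t] propagator_lift scaleC_lift scaleC_flow lin)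
    also have "\<dots> \<longleftrightarrow> backflow t (g t) - g0 = c *\<^sub>C K" unfolding inj by (auto simp: algebra_simps)
    also have "\<dots> \<longleftrightarrow> has_oriented_integral (\<lambda>\<tau>. c *\<^sub>C X \<tau>) (backflow t (g t) - g0) t0 t"
      using has_oriented_integral_linear[OF K bounded_linear_scaleC, of c] has_oriented_integral_unique by metis
    finally show ?thesis unfolding int by simp
  qed
  then show ?thesis unfolding mild_solution_def X_def by blast
qed

lemma local_well_posedness:
  fixes u0 :: "'a L2"
  assumes u0: "u0 \<in> sobolev_space s" and \<delta>: "\<delta> > 0" "16 * (L * \<bar>\<theta>\<bar>) * (sobolev_norm s u0)\<^sup>2 * \<delta> \<le> 1"
  defines "I \<equiv> {- \<delta> + t0 .. \<delta> + t0}"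
  shows "\<exists>u. u \<in> C_sobolev I s \<and> mild_solution \<alpha> \<beta> lam \<theta> t0 u0 I u \<and>
    Linf_sobolev_norm I s u \<le> ereal (2 * sobolev_norm s u0) \<and>
    (\<forall>v. v \<in> C_sobolev I s \<and> mild_solution \<alpha> \<beta> lam \<theta> t0 u0 I v \<longrightarrow> (\<forall>t\<in>I. v t = u t))"
proof -
  define g0 where "g0 = L2_class (bessel_weight s u0)"
  have u0_eq: "u0 = J g0" unfolding g0_def using sobolev_lift_surj[OF s u0] by simp
  have norm_u0: "sobolev_norm s u0 = norm g0" by (simp add: g0_def sobolev_norm_def)
  have I: "{t0 - \<delta>..t0 + \<delta>} = I" by (simp add: I_def add.commute)
  have t0: "t0 \<in> {- \<delta> + t0..\<delta> + t0}" using \<delta>(1) by simp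
  obtain h where h: "continuous_on I h" "\<And>t. norm (h t) \<le> 2 * norm g0"
    "\<And>t. t \<in> I \<Longrightarrow> has_oriented_integral (\<lambda>\<tau>. c *\<^sub>C force \<tau> (h \<tau>)) (h t - g0) t0 t"
    using integral_equation_exists[of \<delta> g0 t0] \<delta> unfolding norm_u0 I by blast
  \<comment> \<open>The return from the interaction picture: flow and lift are isometric, so the
    ball of radius \<open>2 * norm g0\<close> becomes the bound on the Sobolev norm.\<close>
  define u where "u t = J (flow t (h t))" for t
  have fc: "continuous_on I (\<lambda>t. flow t (h t))" by (rule continuous_flow[OF h(1)])
  have norm_u: "sobolev_norm s (u t) = norm (h t)" for t by (simp add: u_def sobolev_lift_facts(2)[OF s])
  show ?thesis
  proof (intro exI conjI allI impI ballI)
    show "u \<in> C_sobolev I s" using C_sobolev_lift_iff[OF s, of I u "\<lambda>t. flow t (h t)"] fc by (simp add: u_def)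
    show "mild_solution \<alpha> \<beta> lam \<theta> t0 u0 I u"
      using duhamel_iff[OF t0, of u "\<lambda>t. flow t (h t)" g0] fc h(3) unfolding I_def u0_eq u_def by simp
    show "Linf_sobolev_norm I s u \<le> ereal (2 * sobolev_norm s u0)"
      unfolding Linf_sobolev_norm_def
    proof (rule esssup_I)
      have "continuous_on I (\<lambda>t. norm (h t))" by (intro continuous_intros h(1))
      moreover have "I \<in> sets lebesgue" by (simp add: I_def)
      ultimately have "(\<lambda>t. norm (h t)) \<in> borel_measurable (lebesgue_on I)"
        by (rule continuous_imp_measurable_on_sets_lebesgue)
      then show "(\<lambda>t. ereal (sobolev_norm s (u t))) \<in> borel_measurable (lebesgue_on I)"
        unfolding norm_u by measurable
      show "AE t in lebesgue_on I. ereal (sobolev_norm s (u t)) \<le> ereal (2 * sobolev_norm s u0)"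
        by (rule AE_I2) (simp add: norm_u norm_u0 h(2))
    qed
    fix v t assume v: "v \<in> C_sobolev I s \<and> mild_solution \<alpha> \<beta> lam \<theta> t0 u0 I v" and t: "t \<in> I"
    \<comment> \<open>No bound on \<open>v\<close> is known beforehand; membership in the class
      supplies preimages in L^2 and their continuity, which is all that uniqueness asks for.\<close>
    define g where "g t = L2_class (bessel_weight s (v t))" for t
    have vg: "v t = J (g t)" if "t \<in> I" for t
      unfolding g_def using v that by (intro sobolev_lift_surj[OF s, symmetric]) (auto simp: C_sobolev_def)
    have "v \<in> C_sobolev I s \<longleftrightarrow> continuous_on I g" by (rule C_sobolev_lift_iff[OF s]) (rule vg)
    then have gc: "continuous_on I g" using v by (rule iffD1[OF _ conjunct1])
    have "h t = backflow t (g t)"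
    proof (rule integral_equation_unique[OF h(1)[unfolded I_def] _ continuous_backflow[OF gc[unfolded I_def]]])
      show "has_oriented_integral (\<lambda>\<tau>. c *\<^sub>C force \<tau> (h \<tau>)) (h r - g0) t0 r" if "r \<in> {- \<delta> + t0..\<delta> + t0}" for r
        using h(3) that by (simp add: I_def)
      show "has_oriented_integral (\<lambda>\<tau>. c *\<^sub>C force \<tau> (backflow \<tau> (g \<tau>))) (backflow r (g r) - g0) t0 r" if "r \<in> {- \<delta> + t0..\<delta> + t0}" for r
        using iffD1[OF duhamel_iff[OF t0 vg gc[unfolded I_def], of g0]] v that unfolding I_def u0_eq by blast
    qed (use t0 t in \<open>simp_all add: I_def\<close>)
    then show "v t = u t" by (simp add: u_def vg[OF t])
  qed
qed

end

theorem theorem3p3: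
  fixes lam s t0 T \<theta> :: real
    and \<alpha> \<beta> :: "real \<Rightarrow> real"
    and \<alpha>p \<alpha>m \<beta>p \<beta>m T1 T2 tp \<tau>p :: real
  assumes "0 < lam" and "lam < real CARD('n::finite)" and "s \<ge> lam / 2"
    and "T > 0" and "\<theta> \<noteq> 0"
    and "\<alpha>p > 0" and "\<alpha>m > 0" and "\<beta>p > 0" and "\<beta>m > 0"
    and "T1 > 0" and "T2 > 0"
    and "0 < tp" and "tp < T1" and "0 < \<tau>p" and "\<tau>p < T2"
    and "\<And>t. 0 < t \<Longrightarrow> t \<le> tp \<Longrightarrow> \<alpha> t = \<alpha>p"
    and "\<And>t. tp - T1 < t \<Longrightarrow> t \<le> 0 \<Longrightarrow> \<alpha> t = - \<alpha>m"
    and "\<And>t. \<alpha> (t + T1) = \<alpha> t"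
    and "\<And>t. 0 < t \<Longrightarrow> t \<le> \<tau>p \<Longrightarrow> \<beta> t = \<beta>p"
    and "\<And>t. \<tau>p - T2 < t \<Longrightarrow> t \<le> 0 \<Longrightarrow> \<beta> t = - \<beta>m"
    and "\<And>t. \<beta> (t + T2) = \<beta> t"
  shows "\<exists>(C::real) (T0 :: real \<Rightarrow> real). C > 0 \<and>
    (\<forall>u0 :: (real ^ 'n) L2. u0 \<in> sobolev_space s \<longrightarrow>
      (let \<delta> = T0 (sobolev_norm s u0); I = {- \<delta> + t0 .. \<delta> + t0} in
        0 < \<delta> \<and> \<delta> \<le> T \<and>
        (\<exists>u. u \<in> C_sobolev I s \<and> mild_solution \<alpha> \<beta> lam \<theta> t0 u0 I u \<and>
             Linf_sobolev_norm I s u \<le> ereal (C * sobolev_norm s u0) \<and>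
             (\<forall>v. v \<in> C_sobolev I s \<and> mild_solution \<alpha> \<beta> lam \<theta> t0 u0 I v \<longrightarrow>
                  (\<forall>t\<in>I. v t = u t)))))"
  proof -
  have s: "0 \<le> s" using assms(1,3) by simp
  have lam: "lam < real DIM(real ^ 'n)" using assms(2) by simp
  obtain L where L: "L > 0"
    "\<And>g h :: (real ^ 'n) L2. norm (weighted_hartree lam s g - weighted_hartree lam s h) \<le> L * ((norm g)\<^sup>2 + (norm h)\<^sup>2) * norm (g - h)"
    "weighted_hartree lam s (0 :: (real ^ 'n) L2) = 0"
    "\<And>(u :: (real ^ 'n) L2) g. fourier u = deweight s g \<Longrightarrow> fourier (hartree lam u) = deweight s (weighted_hartree lam s g)"
    by (rule weighted_hartree_facts[OF assms(1) lam assms(3)]) blast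
  note \<alpha> = periodic_step_function[where f = \<alpha>, OF assms(10,12,13,16,17,18)]
  note \<beta> = periodic_step_function[where f = \<beta>, OF assms(11,14,15,19,20,21)]
  define B where "B = \<bar>\<alpha>p\<bar> + \<bar>\<alpha>m\<bar> + (\<bar>\<beta>p\<bar> + \<bar>\<beta>m\<bar>)"
  have bounds: "\<bar>\<alpha> t\<bar> \<le> B" "\<bar>\<beta> t\<bar> \<le> B" for t using \<alpha>(2)[of t] \<beta>(2)[of t] unfolding B_def by linarith+
  interpret hartree_flow \<alpha> \<beta> B lam s L \<theta> t0 "TYPE(real ^ 'n)"
    by (rule hartree_flow.intro[OF \<alpha>(1) \<beta>(1) bounds s assms(5) L])
  define K where "K = 16 * (L * \<bar>\<theta>\<bar>)"
  \<comment> \<open>A function of the norm alone, as required. The 1 in the denominator keeps the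
    quotient meaningful for vanishing data and still gives
    \<open>K * M\<^sup>2 * T0 M \<le> 1\<close>.\<close>
  define T0 where "T0 M = min T (1 / (K * M\<^sup>2 + 1))" for M :: real
  have K: "K \<ge> 0" using L(1) by (simp add: K_def)
  have T0: "0 < T0 M" "T0 M \<le> T" "K * M\<^sup>2 * T0 M \<le> 1" for M
  proof -
    have pos: "0 < K * M\<^sup>2 + 1" using K by (intro add_nonneg_pos mult_nonneg_nonneg) auto
    show "0 < T0 M" "T0 M \<le> T" using assms(4) pos by (simp_all add: T0_def)
    have "K * M\<^sup>2 * T0 M \<le> K * M\<^sup>2 * (1 / (K * M\<^sup>2 + 1))"
      using K by (intro mult_left_mono) (auto simp: T0_def)
    also have "\<dots> \<le> 1" using pos by simp
    finally show "K * M\<^sup>2 * T0 M \<le> 1" .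
  qed
  show ?thesis
  \<comment> \<open>The constant 2 is the radius of the invariant ball relative to the size of the
    data.\<close>
  proof (intro exI[of _ "2::real"] exI[of _ T0] conjI allI impI)
    fix u0 :: "(real ^ 'n) L2" assume u0: "u0 \<in> sobolev_space s"
    from local_well_posedness[OF u0 T0(1) T0(3)[unfolded K_def]] T0(1,2)
    show "let \<delta> = T0 (sobolev_norm s u0); I = {- \<delta> + t0 .. \<delta> + t0} in
        0 < \<delta> \<and> \<delta> \<le> T \<and>
        (\<exists>u. u \<in> C_sobolev I s \<and> mild_solution \<alpha> \<beta> lam \<theta> t0 u0 I u \<and>
             Linf_sobolev_norm I s u \<le> ereal (2 * sobolev_norm s u0) \<and>
             (\<forall>v. v \<in> C_sobolev I s \<and> mild_solution \<alpha> \<beta> lam \<theta> t0 u0 I v \<longrightarrow>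
                  (\<forall>t\<in>I. v t = u t)))"
      unfolding Let_def by blast
  qed simp
qed

end
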